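(* Let $M$ be a strongly pseudoconvex almost CR manifold of real dimension $2n+1$. Suppose that $M$ admits a contracting CR automorphism $\varphi$, contracting at a point $o\in M$, and let $\mathcal W\subset M$ be the stable manifold of $\varphi$ (with respect to $o$). Then $\mathcal W$ is CR equivalent to the generalized Heisenberg group $\mathcal H_P$ for some complex skew-symmetric $n\times n$ matrix $P$.
   Context: All structures are $C^\infty$-smooth. An almost CR manifold is a real $(2n+1)$-dimensional manifold $M$ with a rank-$2n$ subbundle $H\subset TM$ and an almost complex structure $J$ on $H$ ($J^2=-\mathrm{Id}$). Put $H_{1,0}=\{X-iJX: X\in H\}\subset \mathbb C\otimes H$. It is strongly pseudoconvex if $H$ is a contact distribution and there is a contact form $\theta$ (a nowhere-vanishing real 1-form with kernel $H$) with $d\theta(X,JX)>0$ for all nonzero $X\in H$; "contact form" always means one with this positivity, so any two differ by a factor $e^{2f}$ with $f$ real-valued and smooth. A CR equivalence between almost CR manifolds is a diffeomorphism $f$ with $f_*H_{1,0}=H_{1,0}$; a CR automorphism of $M$ is a CR equivalence $M\to M$. Open subsets of $M$ carry the restricted almost CR structure. A CR automorphism $\varphi$ of $M$ is contracting at a point $o\in M$ (with $\varphi(o)=o$) if $\varphi^*\theta|_o=\mu\,\theta|_o$ for some real $0<\mu<1$, where $\theta$ is a contact form (the condition and $\mu$ do not depend on the choice of $\theta$). The stable manifold $\mathcal W$ of $\varphi$ with respect to $o$ is the set of $x\in M$ having a neighborhood $V$ such that $\varphi^k\to o$ uniformly on $V$ as $k\to\infty$; it is a nonempty open subset of $M$.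 For a constant complex skew-symmetric $n\times n$ matrix $P=(P_{\alpha\beta})$, the generalized Heisenberg group $\mathcal H_P$ is the almost CR manifold $\mathbb C^n\times\mathbb R$ with coordinates $(z^1,\dots,z^n,t)$ whose bundle $H_{1,0}$ is spanned by $$Z_\alpha=\frac{\partial}{\partial z^\alpha}+\Big(i\,\overline{z^{\alpha}}+\sum_\beta P_{\alpha\beta}z^\beta\Big)\frac{\partial}{\partial t},\qquad \alpha=1,\dots,n.$$ *)

theory Defs
  imports "HOL-Analysis.Analysis"
begin

section \<open>Smooth functions and smooth manifolds\<close>

text \<open>On an open set \<open>S\<close>, \<open>Ck_on k f S\<close> says that \<open>f\<close> is \<open>k\<close> times continuously differentiable.\<close>

primrec Ck_on ::
  "nat \<Rightarrow> ('e::euclidean_space \<Rightarrow> 'b::real_normed_vector) \<Rightarrow> 'e set \<Rightarrow> bool" where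
  "Ck_on 0 f S \<longleftrightarrow> continuous_on S f"
| "Ck_on (Suc k) f S \<longleftrightarrow>
     (\<forall>x\<in>S. f differentiable (at x)) \<and>
     (\<forall>v. Ck_on k (\<lambda>x. frechet_derivative f (at x) v) S)"

definition smooth_on ::
  "'e set \<Rightarrow> ('e::euclidean_space \<Rightarrow> 'b::real_normed_vector) \<Rightarrow> bool" where
  "smooth_on S f \<longleftrightarrow> (\<forall>k. Ck_on k f S)"

text \<open>A chart is a pair \<open>(U, c)\<close> of its domain and its coordinate map. An atlas need not be
  maximal; none of the notions below changes when compatible charts are added.\<close>

record ('a, 'e) mfd =
  mtop :: "'a topology"
  charts :: "('a set \<times> ('a \<Rightarrow> 'e)) set"

definition smooth_manifold :: "('a, 'e::euclidean_space, 'm) mfd_scheme \<Rightarrow> bool" where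
  "smooth_manifold M \<longleftrightarrow>
     Hausdorff_space (mtop M) \<and> second_countable (mtop M) \<and>
     (\<Union>(U, c)\<in>charts M. U) = topspace (mtop M) \<and>
     (\<forall>(U, c)\<in>charts M. openin (mtop M) U \<and> open (c ` U) \<and>
        homeomorphic_map (subtopology (mtop M) U) (top_of_set (c ` U)) c) \<and>
     (\<forall>(U, c)\<in>charts M. \<forall>(V, d)\<in>charts M. smooth_on (c ` (U \<inter> V)) (d \<circ> inv_into U c))"

definition smooth_fun_on ::
  "('a, 'e::euclidean_space, 'm) mfd_scheme \<Rightarrow> 'a set \<Rightarrow> ('a \<Rightarrow> 'b::real_normed_vector) \<Rightarrow> bool" where
  "smooth_fun_on M W g \<longleftrightarrow> openin (mtop M) W \<and>
     (\<forall>(U, c)\<in>charts M. smooth_on (c ` (U \<inter> W)) (g \<circ> inv_into U c))"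

definition smooth_near ::
  "('a, 'e::euclidean_space, 'm) mfd_scheme \<Rightarrow> 'a \<Rightarrow> ('a \<Rightarrow> 'b::real_normed_vector) \<Rightarrow> bool" where
  "smooth_near M p g \<longleftrightarrow> (\<exists>W. p \<in> W \<and> smooth_fun_on M W g)"

definition smooth_map ::
  "('a, 'e::euclidean_space, 'm) mfd_scheme \<Rightarrow> ('b, 'f::euclidean_space, 'n) mfd_scheme \<Rightarrow>
     ('a \<Rightarrow> 'b) \<Rightarrow> bool" where
  "smooth_map M N f \<longleftrightarrow> continuous_map (mtop M) (mtop N) f \<and>
     (\<forall>(U, c)\<in>charts M. \<forall>(V, d)\<in>charts N. smooth_on (c ` (U \<inter> f -` V)) (d \<circ> f \<circ> inv_into U c))"

definition diffeomorphism ::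
  "('a, 'e::euclidean_space, 'm) mfd_scheme \<Rightarrow> ('b, 'f::euclidean_space, 'n) mfd_scheme \<Rightarrow>
     ('a \<Rightarrow> 'b) \<Rightarrow> bool" where
  "diffeomorphism M N f \<longleftrightarrow>
     bij_betw f (topspace (mtop M)) (topspace (mtop N)) \<and>
     smooth_map M N f \<and> smooth_map N M (inv_into (topspace (mtop M)) f)"


section \<open>Tangent vectors, vector fields and 1-forms\<close>

text \<open>A (possibly complex) tangent vector at \<open>p\<close> is the first-order differential operator that it
  induces on complex-valued functions smooth near \<open>p\<close>; it is set to \<open>0\<close> on all other functions, so
  that equality of tangent vectors is equality of functions. The real tangent vectors at \<open>p\<close> are the
  directional derivatives along vectors \<open>w\<close> of the (real) model space in a chart around \<open>p\<close>. With
  this convention the tangent spaces of an open submanifold are literally those of the manifold.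
  The linear structure is pointwise, and elements of the complexified tangent space are complex
  linear combinations of real tangent vectors.\<close>

type_synonym 'a tvec = "('a \<Rightarrow> complex) \<Rightarrow> complex"

definition dir_deriv ::
  "('a, 'e::euclidean_space, 'm) mfd_scheme \<Rightarrow> 'a set \<Rightarrow> ('a \<Rightarrow> 'e) \<Rightarrow> 'a \<Rightarrow> 'e \<Rightarrow> 'a tvec" where
  "dir_deriv M U c p w =
     (\<lambda>g. if smooth_near M p g then frechet_derivative (g \<circ> inv_into U c) (at (c p)) w else 0)"

definition tangent_space :: "('a, 'e::euclidean_space, 'm) mfd_scheme \<Rightarrow> 'a \<Rightarrow> 'a tvec set" where
  "tangent_space M p = {dir_deriv M U c p w | U c w. (U, c) \<in> charts M \<and> p \<in> U}"

definition pushforward ::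
  "('b, 'f::euclidean_space, 'n) mfd_scheme \<Rightarrow> ('a \<Rightarrow> 'b) \<Rightarrow> 'a \<Rightarrow> 'a tvec \<Rightarrow> 'b tvec" where
  "pushforward N f p X = (\<lambda>g. if smooth_near N (f p) g then X (g \<circ> f) else 0)"

definition smooth_vector_field ::
  "('a, 'e::euclidean_space, 'm) mfd_scheme \<Rightarrow> 'a set \<Rightarrow> ('a \<Rightarrow> 'a tvec) \<Rightarrow> bool" where
  "smooth_vector_field M W X \<longleftrightarrow> openin (mtop M) W \<and>
     (\<forall>p\<in>W. X p \<in> tangent_space M p) \<and>
     (\<forall>V g. V \<subseteq> W \<and> smooth_fun_on M V g \<longrightarrow> smooth_fun_on M V (\<lambda>p. X p g))"

definition lie_bracket ::
  "('a, 'e::euclidean_space, 'm) mfd_scheme \<Rightarrow> ('a \<Rightarrow> 'a tvec) \<Rightarrow> ('a \<Rightarrow> 'a tvec) \<Rightarrow> 'a \<Rightarrow> 'a tvec"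
  where
  "lie_bracket M X Y p =
     (\<lambda>g. if smooth_near M p g then X p (\<lambda>q. Y q g) - Y p (\<lambda>q. X q g) else 0)"

definition one_form_on ::
  "('a, 'e::euclidean_space, 'm) mfd_scheme \<Rightarrow> 'a set \<Rightarrow> ('a \<Rightarrow> 'a tvec \<Rightarrow> real) \<Rightarrow> bool" where
  "one_form_on M W \<theta> \<longleftrightarrow> openin (mtop M) W \<and>
     (\<forall>p\<in>W. \<forall>X\<in>tangent_space M p. \<forall>Y\<in>tangent_space M p. \<forall>a b :: real.
        \<theta> p (\<lambda>g. of_real a * X g + of_real b * Y g) = a * \<theta> p X + b * \<theta> p Y) \<and>
     (\<forall>V X. V \<subseteq> W \<and> smooth_vector_field M V X \<longrightarrow> smooth_fun_on M V (\<lambda>p. \<theta> p (X p)))"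

text \<open>The value of \<open>d\<theta>\<close> at \<open>p\<close> on real tangent vectors \<open>u\<close>, \<open>v\<close> is
  \<open>X(\<theta>(Y)) - Y(\<theta>(X)) - \<theta>([X, Y])\<close> at \<open>p\<close>, for any smooth vector fields \<open>X\<close>, \<open>Y\<close> near \<open>p\<close> that
  extend \<open>u\<close> and \<open>v\<close>; it does not depend on the extensions.\<close>

definition ext_deriv ::
  "('a, 'e::euclidean_space, 'm) mfd_scheme \<Rightarrow> ('a \<Rightarrow> 'a tvec \<Rightarrow> real) \<Rightarrow>
     'a \<Rightarrow> 'a tvec \<Rightarrow> 'a tvec \<Rightarrow> real" where
  "ext_deriv M \<theta> p u v = (THE r. \<exists>W X Y. p \<in> W \<and>
     smooth_vector_field M W X \<and> smooth_vector_field M W Y \<and> X p = u \<and> Y p = v \<and>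
     r = Re (X p (\<lambda>q. of_real (\<theta> q (Y q)))) - Re (Y p (\<lambda>q. of_real (\<theta> q (X q))))
         - \<theta> p (lie_bracket M X Y p))"


section \<open>Almost CR manifolds\<close>

record ('a, 'e) cr_mfd = "('a, 'e) mfd" +
  cr_H :: "'a \<Rightarrow> 'a tvec set"
  cr_J :: "'a \<Rightarrow> 'a tvec \<Rightarrow> 'a tvec"

text \<open>Smooth subbundle of rank \<open>m\<close> of the tangent bundle, via local frames.\<close>

definition smooth_distribution ::
  "nat \<Rightarrow> ('a, 'e::euclidean_space, 'm) mfd_scheme \<Rightarrow> ('a \<Rightarrow> 'a tvec set) \<Rightarrow> bool" where
  "smooth_distribution m M D \<longleftrightarrow>
     (\<forall>p\<in>topspace (mtop M). \<exists>W X. p \<in> W \<and>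
        (\<forall>i<m. smooth_vector_field M W (X i)) \<and> openin (mtop M) W \<and>
        (\<forall>q\<in>W.
           D q = {\<lambda>g. \<Sum>i<m. of_real (a i) * X i q g | a :: nat \<Rightarrow> real. True} \<and>
           (\<forall>a :: nat \<Rightarrow> real.
              (\<lambda>g. \<Sum>i<m. of_real (a i) * X i q g) = (\<lambda>g. 0) \<longrightarrow> (\<forall>i<m. a i = 0))))"

definition almost_cr_manifold :: "nat \<Rightarrow> ('a, 'e::euclidean_space) cr_mfd \<Rightarrow> bool" where
  "almost_cr_manifold n M \<longleftrightarrow>
     smooth_manifold M \<and> DIM('e) = 2 * n + 1 \<and>
     smooth_distribution (2 * n) M (cr_H M) \<and>
     (\<forall>p\<in>topspace (mtop M). \<forall>X\<in>cr_H M p.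
        cr_J M p X \<in> cr_H M p \<and> cr_J M p (cr_J M p X) = (\<lambda>g. - X g) \<and>
        (\<forall>Y\<in>cr_H M p. \<forall>a b :: real.
           cr_J M p (\<lambda>g. of_real a * X g + of_real b * Y g) =
             (\<lambda>g. of_real a * cr_J M p X g + of_real b * cr_J M p Y g))) \<and>
     (\<forall>W X. smooth_vector_field M W X \<and> (\<forall>p\<in>W. X p \<in> cr_H M p) \<longrightarrow>
        smooth_vector_field M W (\<lambda>p. cr_J M p (X p)))"

definition H10 :: "('a, 'e::euclidean_space) cr_mfd \<Rightarrow> 'a \<Rightarrow> 'a tvec set" where
  "H10 M p = {\<lambda>g. X g - \<i> * cr_J M p X g | X. X \<in> cr_H M p}"

text \<open>Nowhere-vanishing real 1-forms on the open set \<open>W\<close> with kernel \<open>H\<close>.\<close>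

definition defining_form_on ::
  "('a, 'e::euclidean_space) cr_mfd \<Rightarrow> 'a set \<Rightarrow> ('a \<Rightarrow> 'a tvec \<Rightarrow> real) \<Rightarrow> bool" where
  "defining_form_on M W \<theta> \<longleftrightarrow> one_form_on M W \<theta> \<and>
     (\<forall>p\<in>W. (\<exists>X\<in>tangent_space M p. \<theta> p X \<noteq> 0) \<and>
             {X \<in> tangent_space M p. \<theta> p X = 0} = cr_H M p)"

definition contact_distribution :: "('a, 'e::euclidean_space) cr_mfd \<Rightarrow> bool" where
  "contact_distribution M \<longleftrightarrow>
     (\<forall>p\<in>topspace (mtop M). \<exists>W \<theta>. p \<in> W \<and> defining_form_on M W \<theta> \<and>
        (\<forall>q\<in>W. \<forall>X\<in>cr_H M q. X \<noteq> (\<lambda>g. 0) \<longrightarrow> (\<exists>Y\<in>cr_H M q. ext_deriv M \<theta> q X Y \<noteq> 0)))"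

definition contact_form ::
  "('a, 'e::euclidean_space) cr_mfd \<Rightarrow> ('a \<Rightarrow> 'a tvec \<Rightarrow> real) \<Rightarrow> bool" where
  "contact_form M \<theta> \<longleftrightarrow> defining_form_on M (topspace (mtop M)) \<theta> \<and>
     (\<forall>p\<in>topspace (mtop M). \<forall>X\<in>cr_H M p. X \<noteq> (\<lambda>g. 0) \<longrightarrow>
        ext_deriv M \<theta> p X (cr_J M p X) > 0)"

definition strongly_pseudoconvex :: "('a, 'e::euclidean_space) cr_mfd \<Rightarrow> bool" where
  "strongly_pseudoconvex M \<longleftrightarrow> contact_distribution M \<and> (\<exists>\<theta>. contact_form M \<theta>)"

definition cr_equivalence ::
  "('a, 'e::euclidean_space) cr_mfd \<Rightarrow> ('b, 'f::euclidean_space) cr_mfd \<Rightarrow> ('a \<Rightarrow> 'b) \<Rightarrow> bool" where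
  "cr_equivalence M N f \<longleftrightarrow> diffeomorphism M N f \<and>
     (\<forall>p\<in>topspace (mtop M). pushforward N f p ` H10 M p = H10 N (f p))"

definition cr_equivalent ::
  "('a, 'e::euclidean_space) cr_mfd \<Rightarrow> ('b, 'f::euclidean_space) cr_mfd \<Rightarrow> bool" where
  "cr_equivalent M N \<longleftrightarrow> (\<exists>f. cr_equivalence M N f)"

abbreviation cr_automorphism :: "('a, 'e::euclidean_space) cr_mfd \<Rightarrow> ('a \<Rightarrow> 'a) \<Rightarrow> bool" where
  "cr_automorphism M \<phi> \<equiv> cr_equivalence M M \<phi>"

definition cr_restrict :: "('a, 'e::euclidean_space) cr_mfd \<Rightarrow> 'a set \<Rightarrow> ('a, 'e) cr_mfd" where
  "cr_restrict M W = M\<lparr>mtop := subtopology (mtop M) W, charts := {(U \<inter> W, c) | U c. (U, c) \<in> charts M}\<rparr>"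

definition contracting_at ::
  "('a, 'e::euclidean_space) cr_mfd \<Rightarrow> ('a \<Rightarrow> 'a) \<Rightarrow> 'a \<Rightarrow> bool" where
  "contracting_at M \<phi> pt \<longleftrightarrow> pt \<in> topspace (mtop M) \<and> \<phi> pt = pt \<and>
     (\<exists>\<theta> \<mu>. contact_form M \<theta> \<and> 0 < \<mu> \<and> \<mu> < 1 \<and>
        (\<forall>X\<in>tangent_space M pt. \<theta> (\<phi> pt) (pushforward M \<phi> pt X) = \<mu> * \<theta> pt X))"

text \<open>Uniform convergence to the constant \<open>pt\<close>: every neighbourhood \<open>N\<close> of \<open>pt\<close> eventually
  contains the whole image \<open>\<phi>\<^sup>k(V)\<close>.\<close>

definition stable_manifold ::
  "('a, 'e::euclidean_space) cr_mfd \<Rightarrow> ('a \<Rightarrow> 'a) \<Rightarrow> 'a \<Rightarrow> 'a set" where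
  "stable_manifold M \<phi> pt = {x. \<exists>V. x \<in> V \<and> openin (mtop M) V \<and>
     (\<forall>N. openin (mtop M) N \<and> pt \<in> N \<longrightarrow> (\<forall>\<^sub>F k in sequentially. (\<phi> ^^ k) ` V \<subseteq> N))}"


section \<open>The generalized Heisenberg group\<close>

definition euclidean_mfd :: "('e::euclidean_space, 'e) mfd" where
  "euclidean_mfd = \<lparr>mtop = euclidean, charts = {(UNIV, id)}\<rparr>"

text \<open>The operator \<open>\<partial>/\<partial>z\<^sup>\<alpha> = (\<partial>/\<partial>x\<^sup>\<alpha> - \<i> \<partial>/\<partial>y\<^sup>\<alpha>) / 2\<close>, where \<open>z\<^sup>\<alpha> = x\<^sup>\<alpha> + \<i> y\<^sup>\<alpha>\<close>, and \<open>\<partial>/\<partial>t\<close>, at \<open>p\<close>.\<close>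

definition d_dz :: "'n::finite \<Rightarrow> (complex^'n) \<times> real \<Rightarrow> ((complex^'n) \<times> real) tvec" where
  "d_dz \<alpha> p = (\<lambda>g. (dir_deriv euclidean_mfd UNIV id p (axis \<alpha> 1, 0) g
                   - \<i> * dir_deriv euclidean_mfd UNIV id p (axis \<alpha> \<i>, 0) g) / 2)"

definition d_dt :: "(complex^'n::finite) \<times> real \<Rightarrow> ((complex^'n) \<times> real) tvec" where
  "d_dt p = dir_deriv euclidean_mfd UNIV id p (0, 1)"

definition heis_Z ::
  "complex^'n^'n \<Rightarrow> 'n::finite \<Rightarrow> (complex^'n) \<times> real \<Rightarrow> ((complex^'n) \<times> real) tvec" where
  "heis_Z P \<alpha> p =
     (\<lambda>g. d_dz \<alpha> p g + (\<i> * cnj (fst p $ \<alpha>) + (\<Sum>\<beta>\<in>UNIV. P $ \<alpha> $ \<beta> * fst p $ \<beta>)) * d_dt p g)"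

definition heis_H10 ::
  "complex^'n^'n \<Rightarrow> (complex^'n::finite) \<times> real \<Rightarrow> ((complex^'n) \<times> real) tvec set" where
  "heis_H10 P p = {\<lambda>g. \<Sum>\<alpha>\<in>UNIV. a \<alpha> * heis_Z P \<alpha> p g | a :: 'n \<Rightarrow> complex. True}"

text \<open>The pair \<open>(H, J)\<close> is the one determined by \<open>H\<^sub>1\<^sub>,\<^sub>0 = {X - \<i> J X}\<close>: a real vector \<open>X\<close>
  is in \<open>H\<close> iff \<open>X - \<i> Y\<close> is in \<open>H\<^sub>1\<^sub>,\<^sub>0\<close> for some real vector \<open>Y\<close>, which is unique and equal to \<open>J X\<close>.\<close>

definition heisenberg ::
  "complex^'n^'n \<Rightarrow> ((complex^'n::finite) \<times> real, (complex^'n) \<times> real) cr_mfd" where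
  "heisenberg P =
     \<lparr>mtop = euclidean, charts = {(UNIV, id)},
      cr_H = (\<lambda>p. {X \<in> tangent_space euclidean_mfd p.
                   \<exists>Y\<in>tangent_space euclidean_mfd p. (\<lambda>g. X g - \<i> * Y g) \<in> heis_H10 P p}),
      cr_J = (\<lambda>p X. THE Y. Y \<in> tangent_space euclidean_mfd p \<and>
                   (\<lambda>g. X g - \<i> * Y g) \<in> heis_H10 P p)\<rparr>"

end

theory Submission
  imports Defs
begin

text \<open>Near the fixed point one looks for coordinates \<open>(z, t)\<close> in which the automorphism is its own
differential, a dilation \<open>\<Lambda>(z, t) = (A z, \<mu> t)\<close> with \<open>A\<close> equal to \<open>\<surd>\<mu>\<close> times a unitary map. A contact
form and a complex structure that are invariant under such a dilation have no choice but to be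
those of a model group, and iterating the automorphism spreads the coordinates over the whole stable
manifold.

\<^bold>\<open>The differential.\<close> An automorphism multiplies the contact form by a function whose value at the fixed
point is \<open>\<mu>\<close>. Differentiating this relation there shows that the Levi form is multiplied by \<open>\<mu>\<close> too, so
that the differential is \<open>\<surd>\<mu>\<close> times a unitary map on the contact hyperplane; a complementary eigenvector
with eigenvalue \<open>\<mu>\<close> exists because all lengths in the hyperplane are scaled by \<open>\<surd>\<mu> \<noteq> \<mu>\<close>
(\<open>form_pullback_derivative\<close>, \<open>normal_frame\<close>).

\<^bold>\<open>Linearisation.\<close> Conjugating the automorphism to its differential amounts to solving equations
\<open>\<sigma> = K (\<sigma> \<circ> f) + R\<close>, where \<open>K\<close> inverts a part of the differential. Iteration converges if \<open>R\<close> vanishes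
at \<open>0\<close> to such an order that composition with the contraction \<open>f\<close> beats the norm of \<open>K\<close>, and the
solution is smooth because its derivatives solve a system of the same form (\<open>fe_smooth_solution\<close>).
Constants that depend on the dimension are harmless: a high power of the automorphism contracts as strongly
as desired and has the same stable manifold (\<open>stable_manifold_iterate\<close>). The one true obstruction is
the resonance \<open>\<mu> = \<surd>\<mu> \<surd>\<mu>\<close>, that is, terms quadratic in \<open>z\<close> in the last component. It is here that
the geometry enters a second time: the symmetric part of the differentiated relation for the contact form
says precisely that these terms can be removed (\<open>linearisation\<close>, \<open>linearised_coordinates\<close>).

\<^bold>\<open>Rigidity.\<close> In such coordinates a suitable multiple of the contact form is \<open>dt + \<alpha>\<close>, where \<open>\<alpha>\<close> has weight
\<open>\<mu>\<close> under \<open>\<Lambda>\<close> and therefore is \<open>\<beta>(z, dz)\<close> for a bilinear \<open>\<beta>\<close>. The complex structure on the contact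
hyperplanes, projected to the \<open>z\<close>-space, has weight \<open>0\<close> and therefore is the constant \<open>\<i>\<close>
(\<open>invariant_form_linear\<close>, \<open>invariant_structure_constant\<close>). A quadratic change of \<open>t\<close> makes \<open>\<beta>\<close>
alternating (\<open>heis_coordinates\<close>). The part of \<open>\<beta>\<close> invariant under \<open>\<i>\<close> is prescribed by the
normalisation of the Levi form; its remaining part is the real part of a complex bilinear
alternating form, which gives the matrix \<open>P\<close> (\<open>coefficient\<close>, \<open>H10_heisenberg\<close>).

\<^bold>\<open>Globalisation.\<close> Since \<open>\<Lambda>\<close> is an automorphism of the model, \<open>\<Lambda>\<^sup>-\<^sup>k \<circ> c \<circ> \<phi>\<^sup>k\<close> is again a system
of model coordinates, on the set of points that \<open>\<phi>\<^sup>k\<close> maps into the first domain. These systems extend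
each other, their domains exhaust the stable manifold, and their images exhaust the model because
\<open>\<Lambda>\<^sup>k\<close> contracts every point into the image of \<open>c\<close> (\<open>stable_manifold_equivalent\<close>).\<close>

section \<open>Calculus of functions of class \<open>C\<^sup>k\<close>\<close>

lemma has_frechet: "f differentiable at x \<Longrightarrow> (f has_derivative frechet_derivative f (at x)) (at x)"
  by (rule frechet_derivative_works[THEN iffD1])

lemma frechetI: "(f has_derivative f') (at x) \<Longrightarrow> frechet_derivative f (at x) = f'"
  using frechet_derivative_at by metis

lemma frechet_linear: "f differentiable at x \<Longrightarrow> linear (frechet_derivative f (at x))"
  using has_derivative_linear has_frechet by blast

text \<open>The class \<open>C\<^sup>k\<close> is defined by derivatives in constant directions; this expansion reduces to them a
  derivative in a direction that varies with the point.\<close>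

lemma frechet_basis_sum:
  fixes f :: "'e::euclidean_space \<Rightarrow> 'b::real_normed_vector"
  assumes "f differentiable at x"
  shows "frechet_derivative f (at x) v = (\<Sum>b\<in>Basis. (v \<bullet> b) *\<^sub>R frechet_derivative f (at x) b)"
proof -
  interpret linear "frechet_derivative f (at x)" by (rule frechet_linear[OF assms])
  have "frechet_derivative f (at x) (\<Sum>b\<in>Basis. (v \<bullet> b) *\<^sub>R b) = (\<Sum>b\<in>Basis. (v \<bullet> b) *\<^sub>R frechet_derivative f (at x) b)"
    by (simp add: sum scaleR)
  then show ?thesis by (simp add: euclidean_representation)
qed

lemma Ck_on_subset: "Ck_on k f S \<Longrightarrow> T \<subseteq> S \<Longrightarrow> Ck_on k f T"
  by (induction k arbitrary: f) (auto intro: continuous_on_subset)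

lemma Ck_on_Suc_imp: "Ck_on (Suc k) f S \<Longrightarrow> Ck_on k f S"
proof (induction k arbitrary: f)
  case 0
  then show ?case
    by (auto intro!: continuous_at_imp_continuous_on differentiable_imp_continuous_within)
next
  case (Suc k)
  then show ?case by (metis Ck_on.simps(2))
qed

lemma Ck_on_mono: "Ck_on k f S \<Longrightarrow> j \<le> k \<Longrightarrow> Ck_on j f S"
proof (induction k)
  case (Suc k)
  then show ?case using Ck_on_Suc_imp[of k f S] le_Suc_eq by auto
qed auto

lemma Ck_on_cong:
  assumes "open S" "\<And>x. x \<in> S \<Longrightarrow> f x = g x" "Ck_on k f S"
  shows "Ck_on k g S"
  using assms(2,3)
proof (induction k arbitrary: f g)
  case 0
  then show ?case by (metis Ck_on.simps(1) continuous_on_cong)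
next
  case (Suc k)
  have d: "(g has_derivative frechet_derivative f (at x)) (at x)" if "x \<in> S" for x
    using Suc.prems that assms(1) has_frechet[of f x]
    by (auto intro!: has_derivative_transform_within_open[of f _ x UNIV S g])
  have "Ck_on k (\<lambda>x. frechet_derivative g (at x) v) S" for v
  proof (rule Suc.IH)
    show "Ck_on k (\<lambda>x. frechet_derivative f (at x) v) S" using Suc.prems by simp
    show "frechet_derivative f (at x) v = frechet_derivative g (at x) v" if "x \<in> S" for x
      using frechetI[OF d[OF that]] by simp
  qed
  then show ?case using d by (auto simp: differentiable_def)
qed

lemma Ck_on_local:
  assumes "\<And>x. x \<in> S \<Longrightarrow> \<exists>T. open T \<and> x \<in> T \<and> Ck_on k f T"
  shows "Ck_on k f S"
  using assms
proof (induction k arbitrary: f)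
  case 0
  have "continuous_on S f"
  proof (rule continuous_at_imp_continuous_on, rule)
    fix x assume "x \<in> S"
    then obtain T where "open T" "x \<in> T" "continuous_on T f" using 0 by auto
    then show "isCont f x" by (simp add: continuous_on_eq_continuous_at)
  qed
  then show ?case by simp
next
  case (Suc k)
  have "\<exists>T. open T \<and> x \<in> T \<and> Ck_on k (\<lambda>x. frechet_derivative f (at x) v) T" if "x \<in> S" for x v
    using Suc.prems[OF that] by auto
  with Suc.IH have "Ck_on k (\<lambda>x. frechet_derivative f (at x) v) S" for v by blast
  moreover have "f differentiable (at x)" if "x \<in> S" for x using Suc.prems[OF that] by auto
  ultimately show ?case by simp
qed

lemma Ck_on_SucI:
  assumes "open S" "\<And>x. x \<in> S \<Longrightarrow> (f has_derivative f' x) (at x)"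
    "\<And>v. Ck_on k (\<lambda>x. f' x v) S"
  shows "Ck_on (Suc k) f S"
proof -
  have "Ck_on k (\<lambda>x. frechet_derivative f (at x) v) S" for v
    by (rule Ck_on_cong[OF assms(1) _ assms(3)[of v]]) (simp add: frechetI[OF assms(2)])
  then show ?thesis using assms(2) by (auto simp: differentiable_def)
qed

lemma Ck_on_const: "open S \<Longrightarrow> Ck_on k (\<lambda>x. a) S"
proof (induction k arbitrary: a)
  case (Suc k)
  show ?case by (rule Ck_on_SucI[where f'="\<lambda>x v. 0"]) (use Suc in auto)
qed auto

lemma Ck_on_linear_comp:
  assumes "open S" "bounded_linear h" "Ck_on k f S"
  shows "Ck_on k (\<lambda>x. h (f x)) S"
  using assms(3)
proof (induction k arbitrary: f)
  case 0
  then have "continuous_on S (\<lambda>x. h (f x))"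
    by (intro bounded_linear.continuous_on[OF assms(2)]) simp
  then show ?case by simp
next
  case (Suc k)
  show ?case
  proof (rule Ck_on_SucI[OF assms(1), where f'="\<lambda>x v. h (frechet_derivative f (at x) v)"])
    show "((\<lambda>x. h (f x)) has_derivative (\<lambda>v. h (frechet_derivative f (at x) v))) (at x)" if "x \<in> S" for x
      by (rule bounded_linear.has_derivative[OF assms(2)]) (use Suc.prems that in \<open>simp add: has_frechet\<close>)
    show "Ck_on k (\<lambda>x. h (frechet_derivative f (at x) v)) S" for v
      using Suc by simp
  qed
qed

lemma Ck_on_linear: "open S \<Longrightarrow> bounded_linear h \<Longrightarrow> Ck_on k h S"
proof (induction k)
  case 0 then show ?case by (auto intro: linear_continuous_on)
next
  case (Suc k)
  show ?case
    by (rule Ck_on_SucI[where f'="\<lambda>x v. h v"])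
       (use Suc in \<open>auto intro: bounded_linear_imp_has_derivative Ck_on_const\<close>)
qed

lemma Ck_on_add:
  assumes "open S" "Ck_on k f S" "Ck_on k g S"
  shows "Ck_on k (\<lambda>x. f x + g x) S"
  using assms(2,3)
proof (induction k arbitrary: f g)
  case 0 then show ?case by (auto intro: continuous_on_add)
next
  case (Suc k)
  show ?case
    by (rule Ck_on_SucI[OF assms(1), where f'="\<lambda>x v. frechet_derivative f (at x) v + frechet_derivative g (at x) v"])
       (use Suc in \<open>auto intro!: has_derivative_add has_frechet\<close>)
qed

lemma Ck_on_sum:
  assumes "open S" "\<And>i. i \<in> I \<Longrightarrow> Ck_on k (f i) S"
  shows "Ck_on k (\<lambda>x. \<Sum>i\<in>I. f i x) S"
  using assms(2)
proof (induction I rule: infinite_finite_induct)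
  case (insert i I)
  then have "Ck_on k (\<lambda>x. f i x + (\<Sum>i\<in>I. f i x)) S" by (intro Ck_on_add assms(1)) auto
  then show ?case using insert by simp
qed (auto intro: Ck_on_const assms(1))

lemma Ck_on_bilinear:
  assumes "open S" "bounded_bilinear mul" "Ck_on k f S" "Ck_on k g S"
  shows "Ck_on k (\<lambda>x. mul (f x) (g x)) S"
  using assms(3,4)
proof (induction k arbitrary: f g)
  case 0
  then have "continuous_on S (\<lambda>x. mul (f x) (g x))"
    by (intro bounded_bilinear.continuous_on[OF assms(2)]) simp_all
  then show ?case by simp
next
  case (Suc k)
  show ?case
  proof (rule Ck_on_SucI[OF assms(1), where f'="\<lambda>x v. mul (f x) (frechet_derivative g (at x) v) + mul (frechet_derivative f (at x) v) (g x)"])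
    show "((\<lambda>x. mul (f x) (g x)) has_derivative
        (\<lambda>v. mul (f x) (frechet_derivative g (at x) v) + mul (frechet_derivative f (at x) v) (g x))) (at x)" if "x \<in> S" for x
      by (rule bounded_bilinear.FDERIV[OF assms(2)]) (use Suc.prems that in \<open>simp_all add: has_frechet\<close>)
    show "Ck_on k (\<lambda>x. mul (f x) (frechet_derivative g (at x) v) + mul (frechet_derivative f (at x) v) (g x)) S" for v
    proof -
      have "Ck_on k f S" "Ck_on k g S" using Suc.prems Ck_on_Suc_imp by blast+
      then show ?thesis using Suc.prems by (intro Ck_on_add assms(1) Suc.IH) auto
    qed
  qed
qed

text \<open>In the chain rule the outer derivative is taken in a direction depending on the point, so it is
  expanded in a basis before the induction hypothesis is applied to the individual factors.\<close>

lemma Ck_on_compose: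
  fixes f :: "'e::euclidean_space \<Rightarrow> 'f::euclidean_space"
  assumes "open S" "open T" "f ` S \<subseteq> T" "Ck_on k g T" "Ck_on k f S"
  shows "Ck_on k (\<lambda>x. g (f x)) S"
  using assms(4,5)
proof (induction k arbitrary: g)
  case 0
  then have "continuous_on S (\<lambda>x. g (f x))"
    using continuous_on_compose2[OF _ _ assms(3), of g] by simp
  then show ?case by simp
next
  case (Suc k)
  have gd: "g differentiable at (f x)" if "x \<in> S" for x using Suc.prems(1) assms(3) that by auto
  have fd: "f differentiable at x" if "x \<in> S" for x using Suc.prems(2) that by auto
  show ?case
  proof (rule Ck_on_SucI[OF assms(1), where f'="\<lambda>x v. \<Sum>b\<in>Basis. (frechet_derivative f (at x) v \<bullet> b) *\<^sub>R frechet_derivative g (at (f x)) b"])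
    fix x assume x: "x \<in> S"
    have "((\<lambda>x. g (f x)) has_derivative (\<lambda>v. frechet_derivative g (at (f x)) (frechet_derivative f (at x) v))) (at x)"
      using diff_chain_at[OF has_frechet[OF fd[OF x]] has_frechet[OF gd[OF x]]] by (simp add: o_def)
    then show "((\<lambda>x. g (f x)) has_derivative (\<lambda>v. \<Sum>b\<in>Basis. (frechet_derivative f (at x) v \<bullet> b) *\<^sub>R frechet_derivative g (at (f x)) b)) (at x)"
      by (subst frechet_basis_sum[OF gd[OF x], symmetric])
  next
    fix v
    have 1: "Ck_on k (\<lambda>x. frechet_derivative g (at (f x)) b) S" for b
    proof (rule Suc.IH)
      show "Ck_on k f S" using Suc.prems Ck_on_Suc_imp by blast
      show "Ck_on k (\<lambda>x. frechet_derivative g (at x) b) T" using Suc.prems by simp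
    qed
    have 2: "Ck_on k (\<lambda>x. frechet_derivative f (at x) v \<bullet> b) S" for b
      by (rule Ck_on_linear_comp[OF assms(1) bounded_linear_inner_left]) (use Suc.prems in auto)
    show "Ck_on k (\<lambda>x. \<Sum>b\<in>Basis. (frechet_derivative f (at x) v \<bullet> b) *\<^sub>R frechet_derivative g (at (f x)) b) S"
      by (rule Ck_on_sum[OF assms(1)]) (rule Ck_on_bilinear[OF assms(1) bounded_bilinear_scaleR 2 1])
  qed
qed

lemma Ck_on_componentwise:
  fixes f :: "'e::euclidean_space \<Rightarrow> 'f::euclidean_space"
  assumes "open S" "\<And>b. b \<in> Basis \<Longrightarrow> Ck_on k (\<lambda>x. f x \<bullet> b) S"
  shows "Ck_on k f S"
proof -
  have "Ck_on k (\<lambda>x. \<Sum>b\<in>Basis. (f x \<bullet> b) *\<^sub>R b) S"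
    by (rule Ck_on_sum[OF assms(1)], rule Ck_on_linear_comp[OF assms(1) bounded_linear_scaleR_left]) (use assms in auto)
  then show ?thesis by (simp add: euclidean_representation)
qed

lemma Ck_on_inverse_real:
  fixes f :: "'e::euclidean_space \<Rightarrow> real"
  assumes "open S" "\<And>x. x \<in> S \<Longrightarrow> f x \<noteq> 0" "Ck_on k f S"
  shows "Ck_on k (\<lambda>x. inverse (f x)) S"
  using assms(3)
proof (induction k)
  case 0 then show ?case using assms(2) by (auto intro: continuous_on_inverse)
next
  case (Suc k)
  have ih: "Ck_on k (\<lambda>x. inverse (f x)) S" using Suc Ck_on_Suc_imp by blast
  show ?case
  proof (rule Ck_on_SucI[OF assms(1), where f'="\<lambda>x v. - ((inverse (f x) * frechet_derivative f (at x) v) * inverse (f x))"])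
    show "((\<lambda>x. inverse (f x)) has_derivative (\<lambda>v. - ((inverse (f x) * frechet_derivative f (at x) v) * inverse (f x)))) (at x)" if "x \<in> S" for x
      by (rule Deriv.has_derivative_inverse) (use Suc.prems that assms(2) in \<open>auto simp: has_frechet\<close>)
    have "Ck_on k (\<lambda>x. (-1) * ((inverse (f x) * frechet_derivative f (at x) v) * inverse (f x))) S" for v
      by (intro Ck_on_bilinear[OF assms(1) bounded_bilinear_mult] ih Ck_on_const assms(1)) (use Suc.prems in auto)
    then show "Ck_on k (\<lambda>x. - ((inverse (f x) * frechet_derivative f (at x) v) * inverse (f x))) S" for v
      by simp
  qed
qed

subsection \<open>Smooth functions\<close>

lemma smooth_onI: "(\<And>k. Ck_on k f S) \<Longrightarrow> smooth_on S f"
  by (simp add: smooth_on_def)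
lemma smooth_on_subset: "smooth_on S f \<Longrightarrow> T \<subseteq> S \<Longrightarrow> smooth_on T f"
  by (auto simp: smooth_on_def intro: Ck_on_subset)
lemma smooth_on_cong: "open S \<Longrightarrow> (\<And>x. x \<in> S \<Longrightarrow> f x = g x) \<Longrightarrow> smooth_on S f \<Longrightarrow> smooth_on S g"
  by (rule smooth_onI, rule Ck_on_cong[where f=f]; simp add: smooth_on_def)
lemma smooth_on_local: "(\<And>x. x \<in> S \<Longrightarrow> \<exists>T. open T \<and> x \<in> T \<and> smooth_on T f) \<Longrightarrow> smooth_on S f"
  by (rule smooth_onI, rule Ck_on_local, simp add: smooth_on_def) blast
lemma smooth_on_const: "open S \<Longrightarrow> smooth_on S (\<lambda>x. a)"
  by (rule smooth_onI, rule Ck_on_const; simp add: smooth_on_def)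
lemma smooth_on_linear: "open S \<Longrightarrow> bounded_linear h \<Longrightarrow> smooth_on S h"
  by (rule smooth_onI, rule Ck_on_linear; simp add: smooth_on_def)
lemma smooth_on_linear_comp: "open S \<Longrightarrow> bounded_linear h \<Longrightarrow> smooth_on S f \<Longrightarrow> smooth_on S (\<lambda>x. h (f x))"
  by (rule smooth_onI, rule Ck_on_linear_comp[where h=h and f=f]; simp add: smooth_on_def)
lemma smooth_on_add: "open S \<Longrightarrow> smooth_on S f \<Longrightarrow> smooth_on S g \<Longrightarrow> smooth_on S (\<lambda>x. f x + g x)"
  by (rule smooth_onI, rule Ck_on_add[where f=f and g=g]; simp add: smooth_on_def)
lemma smooth_on_sum: "open S \<Longrightarrow> (\<And>i. i \<in> I \<Longrightarrow> smooth_on S (f i)) \<Longrightarrow> smooth_on S (\<lambda>x. \<Sum>i\<in>I. f i x)"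
  by (rule smooth_onI, rule Ck_on_sum[where f=f]; simp add: smooth_on_def)
lemma smooth_on_bilinear: "open S \<Longrightarrow> bounded_bilinear mul \<Longrightarrow> smooth_on S f \<Longrightarrow> smooth_on S g \<Longrightarrow> smooth_on S (\<lambda>x. mul (f x) (g x))"
  by (rule smooth_onI, rule Ck_on_bilinear[where mul=mul and f=f and g=g]; simp add: smooth_on_def)
lemma smooth_on_minus: "open S \<Longrightarrow> smooth_on S f \<Longrightarrow> smooth_on S (\<lambda>x. - f x)"
  by (rule smooth_on_linear_comp[OF _ bounded_linear_minus[OF bounded_linear_ident]])
lemma smooth_on_diff: "open S \<Longrightarrow> smooth_on S f \<Longrightarrow> smooth_on S g \<Longrightarrow> smooth_on S (\<lambda>x. f x - g x)"
  using smooth_on_add[of S f "\<lambda>x. - g x"] smooth_on_minus[of S g] by simp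
lemma smooth_on_compose:
  fixes f :: "'e::euclidean_space \<Rightarrow> 'f::euclidean_space"
  shows "open S \<Longrightarrow> open T \<Longrightarrow> f ` S \<subseteq> T \<Longrightarrow> smooth_on T g \<Longrightarrow> smooth_on S f \<Longrightarrow> smooth_on S (\<lambda>x. g (f x))"
  by (rule smooth_onI, rule Ck_on_compose[where f=f and T=T]; simp add: smooth_on_def)
lemma smooth_on_componentwise:
  fixes f :: "'e::euclidean_space \<Rightarrow> 'f::euclidean_space"
  shows "open S \<Longrightarrow> (\<And>b. b \<in> Basis \<Longrightarrow> smooth_on S (\<lambda>x. f x \<bullet> b)) \<Longrightarrow> smooth_on S f"
  by (rule smooth_onI, rule Ck_on_componentwise; simp add: smooth_on_def)
lemma smooth_on_inverse_real:
  fixes f :: "'e::euclidean_space \<Rightarrow> real"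
  shows "open S \<Longrightarrow> (\<And>x. x \<in> S \<Longrightarrow> f x \<noteq> 0) \<Longrightarrow> smooth_on S f \<Longrightarrow> smooth_on S (\<lambda>x. inverse (f x))"
  by (rule smooth_onI, rule Ck_on_inverse_real; simp add: smooth_on_def)
lemma smooth_on_frechet:
  assumes "smooth_on S f" shows "smooth_on S (\<lambda>x. frechet_derivative f (at x) v)"
  unfolding smooth_on_def
proof
  fix k
  have "Ck_on (Suc k) f S" using assms by (simp add: smooth_on_def del: Ck_on.simps)
  then show "Ck_on k (\<lambda>x. frechet_derivative f (at x) v) S" by simp
qed
lemma smooth_on_differentiable:
  assumes "smooth_on S f" "x \<in> S" shows "f differentiable at x"
proof -
  have "Ck_on (Suc 0) f S" using assms by (simp add: smooth_on_def del: Ck_on.simps)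
  then show ?thesis using assms by simp
qed
lemma smooth_on_has_derivative:
  "smooth_on S f \<Longrightarrow> x \<in> S \<Longrightarrow> (f has_derivative frechet_derivative f (at x)) (at x)"
  by (rule has_frechet[OF smooth_on_differentiable])
lemma smooth_on_continuous_on:
  assumes "smooth_on S f" shows "continuous_on S f"
proof -
  have "Ck_on 0 f S" using assms by (simp add: smooth_on_def del: Ck_on.simps)
  then show ?thesis by simp
qed

lemma smooth_on_frechet_field:
  fixes f :: "'e::euclidean_space \<Rightarrow> 'b::real_normed_vector"
  assumes "open S" "smooth_on S f" "smooth_on S Y"
  shows "smooth_on S (\<lambda>x. frechet_derivative f (at x) (Y x))"
proof -
  have "smooth_on S (\<lambda>x. (Y x \<bullet> b) *\<^sub>R frechet_derivative f (at x) b)" for b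
  proof (rule smooth_on_bilinear[where mul="(*\<^sub>R)" and f="\<lambda>x. Y x \<bullet> b" and g="\<lambda>x. frechet_derivative f (at x) b", OF assms(1)])
    show "bounded_bilinear ((*\<^sub>R) :: real \<Rightarrow> 'b \<Rightarrow> 'b)" by (rule bounded_bilinear_scaleR)
    show "smooth_on S (\<lambda>x. Y x \<bullet> b)"
      by (rule smooth_on_linear_comp[where f=Y and h="\<lambda>x. x \<bullet> b", OF assms(1) bounded_linear_inner_left assms(3)])
    show "smooth_on S (\<lambda>x. frechet_derivative f (at x) b)" by (rule smooth_on_frechet[OF assms(2)])
  qed
  then have "smooth_on S (\<lambda>x. \<Sum>b\<in>Basis. (Y x \<bullet> b) *\<^sub>R frechet_derivative f (at x) b)"
    by (rule smooth_on_sum[OF assms(1), of Basis "\<lambda>b x. (Y x \<bullet> b) *\<^sub>R frechet_derivative f (at x) b"])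
  moreover have "(\<Sum>b\<in>Basis. (Y x \<bullet> b) *\<^sub>R frechet_derivative f (at x) b) = frechet_derivative f (at x) (Y x)" if "x \<in> S" for x
    by (rule frechet_basis_sum[OF smooth_on_differentiable[OF assms(2) that], symmetric])
  ultimately show ?thesis
    using smooth_on_cong[OF assms(1), where f="\<lambda>x. \<Sum>b\<in>Basis. (Y x \<bullet> b) *\<^sub>R frechet_derivative f (at x) b" and g="\<lambda>x. frechet_derivative f (at x) (Y x)"]
    by simp
qed

section \<open>Symmetry of second derivatives and the smooth inverse function theorem\<close>

text \<open>The left-hand side of the equation is symmetric in \<open>u\<close> and \<open>v\<close>, the right-hand side is a mixed
  derivative in a prescribed order at an intermediate point. It is found by applying the mean value theorem first in
  the direction \<open>u\<close>, to the difference of \<open>f\<close> in the direction \<open>v\<close>, and then in the direction \<open>v\<close>.\<close>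

lemma second_difference_mvt:
  fixes f :: "'e::euclidean_space \<Rightarrow> real"
  assumes S: "open S" and f: "Ck_on 2 f S" and h: "0 < h"
    and box: "\<And>s t. 0 \<le> s \<Longrightarrow> s \<le> h \<Longrightarrow> 0 \<le> t \<Longrightarrow> t \<le> h \<Longrightarrow> x + s *\<^sub>R u + t *\<^sub>R v \<in> S"
  shows "\<exists>s t. 0 < s \<and> s < h \<and> 0 < t \<and> t < h \<and>
    f (x + h *\<^sub>R u + h *\<^sub>R v) - f (x + h *\<^sub>R u) - f (x + h *\<^sub>R v) + f x
      = h * h * frechet_derivative (\<lambda>y. frechet_derivative f (at y) u) (at (x + s *\<^sub>R u + t *\<^sub>R v)) v"
proof -
  have f2: "\<And>y. y \<in> S \<Longrightarrow> f differentiable at y"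
    "\<And>y w. y \<in> S \<Longrightarrow> (\<lambda>y. frechet_derivative f (at y) w) differentiable at y"
    using f by (auto simp: numeral_2_eq_2)
  define g where "g s = f (x + s *\<^sub>R u + h *\<^sub>R v) - f (x + s *\<^sub>R u)" for s
  have dline: "((\<lambda>s. G (p + s *\<^sub>R w)) has_derivative (\<lambda>d. d * frechet_derivative G (at (p + s *\<^sub>R w)) w)) (at s)"
    if "G differentiable at (p + s *\<^sub>R w)" for G :: "'e \<Rightarrow> real" and p w s
  proof -
    have "((\<lambda>s. p + s *\<^sub>R w) has_derivative (\<lambda>d. d *\<^sub>R w)) (at s)" by (auto intro!: derivative_eq_intros)
    from diff_chain_at[OF this has_frechet[OF that]]
    show ?thesis using frechet_linear[OF that] by (simp add: o_def linear_scale)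
  qed
  have dg: "(g has_derivative (\<lambda>d. d * (frechet_derivative f (at (x + s *\<^sub>R u + h *\<^sub>R v)) u - frechet_derivative f (at (x + s *\<^sub>R u)) u))) (at s)"
    if "0 \<le> s" "s \<le> h" for s
  proof -
    have m1: "x + h *\<^sub>R v + s *\<^sub>R u \<in> S" "x + s *\<^sub>R u \<in> S"
      using box[of s h] box[of s 0] that h by (auto simp: algebra_simps)
    have "((\<lambda>s. f (x + h *\<^sub>R v + s *\<^sub>R u) - f (x + s *\<^sub>R u)) has_derivative
      (\<lambda>d. d * frechet_derivative f (at (x + h *\<^sub>R v + s *\<^sub>R u)) u - d * frechet_derivative f (at (x + s *\<^sub>R u)) u)) (at s)"
      by (intro has_derivative_diff dline f2 m1)
    then show ?thesis by (simp add: g_def[abs_def] algebra_simps)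
  qed
  obtain s where s: "0 < s" "s < h" and gs: "g h - g 0 = h * (frechet_derivative f (at (x + s *\<^sub>R u + h *\<^sub>R v)) u - frechet_derivative f (at (x + s *\<^sub>R u)) u)"
  proof -
    have "\<exists>s\<in>{0<..<h}. g h - g 0 = (\<lambda>d. d * (frechet_derivative f (at (x + s *\<^sub>R u + h *\<^sub>R v)) u - frechet_derivative f (at (x + s *\<^sub>R u)) u)) (h - 0)"
      by (rule mvt_simple[OF h]) (use dg in \<open>auto intro: has_derivative_at_withinI\<close>)
    then show thesis using that by auto
  qed
  define k where "k t = frechet_derivative f (at (x + s *\<^sub>R u + t *\<^sub>R v)) u" for t
  have dk: "(k has_derivative (\<lambda>d. d * frechet_derivative (\<lambda>y. frechet_derivative f (at y) u) (at (x + s *\<^sub>R u + t *\<^sub>R v)) v)) (at t)"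
    if "0 \<le> t" "t \<le> h" for t
    unfolding k_def by (rule dline[where p="x + s *\<^sub>R u"]) (use f2 box[of s t] that s in auto)
  have "\<exists>t\<in>{0<..<h}. k h - k 0 = (\<lambda>d. d * frechet_derivative (\<lambda>y. frechet_derivative f (at y) u) (at (x + s *\<^sub>R u + t *\<^sub>R v)) v) (h - 0)"
    by (rule mvt_simple[OF h]) (use dk in \<open>auto intro: has_derivative_at_withinI\<close>)
  then obtain t where t: "0 < t" "t < h" "k h - k 0 = h * frechet_derivative (\<lambda>y. frechet_derivative f (at y) u) (at (x + s *\<^sub>R u + t *\<^sub>R v)) v"
    by auto
  have "f (x + h *\<^sub>R u + h *\<^sub>R v) - f (x + h *\<^sub>R u) - f (x + h *\<^sub>R v) + f x = g h - g 0"
    by (simp add: g_def)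
  also have "\<dots> = h * (k h - k 0)" using gs by (simp add: k_def)
  finally show ?thesis using s t by (intro exI[of _ s] exI[of _ t]) (simp add: mult.assoc)
qed

text \<open>The two mixed derivatives, each taken at a suitable point of a small parallelogram, both equal the second
  difference and hence each other. By continuity they cannot differ at the corner.\<close>

lemma second_derivative_symmetric_real:
  fixes f :: "'e::euclidean_space \<Rightarrow> real"
  assumes S: "open S" "x \<in> S" and f: "Ck_on 2 f S"
  shows "frechet_derivative (\<lambda>y. frechet_derivative f (at y) u) (at x) v =
         frechet_derivative (\<lambda>y. frechet_derivative f (at y) v) (at x) u"
proof (rule ccontr)
  define A where "A y = frechet_derivative (\<lambda>y. frechet_derivative f (at y) u) (at y) v" for y
  define B where "B y = frechet_derivative (\<lambda>y. frechet_derivative f (at y) v) (at y) u" for y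
  have cont: "continuous_on S A" "continuous_on S B"
    using f by (auto simp: numeral_2_eq_2 A_def[abs_def] B_def[abs_def])
  assume "\<not> ?thesis"
  then have e: "dist (A x) (B x) / 2 > 0" by (simp add: A_def B_def)
  define e where "e = dist (A x) (B x) / 2"
  have "isCont A x" "isCont B x" using cont S by (auto simp: continuous_on_eq_continuous_at)
  moreover have "e > 0" using e by (simp add: e_def)
  ultimately obtain d1 d2 where d: "d1 > 0" "d2 > 0" "\<And>y. dist y x < d1 \<Longrightarrow> dist (A y) (A x) < e" "\<And>y. dist y x < d2 \<Longrightarrow> dist (B y) (B x) < e"
    unfolding continuous_at_eps_delta by metis
  obtain d0 where d0: "d0 > 0" "ball x d0 \<subseteq> S" using S open_contains_ball by blast
  define r where "r = min d0 (min d1 d2)"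
  have r: "r > 0" using d d0 by (simp add: r_def)
  define P where "P = norm u + norm v + 1"
  define h where "h = r / (2 * P)"
  have pos: "P > 0" by (simp add: P_def add_nonneg_pos)
  have h: "h > 0" using r pos by (simp add: h_def)
  have near: "dist (x + s *\<^sub>R u + t *\<^sub>R v) x < r" if "0 \<le> s" "s \<le> h" "0 \<le> t" "t \<le> h" for s t
  proof -
    have "norm (s *\<^sub>R u + t *\<^sub>R v) \<le> s * norm u + t * norm v" using that norm_triangle_ineq[of "s *\<^sub>R u" "t *\<^sub>R v"] by simp
    also have "\<dots> \<le> h * norm u + h * norm v" using that by (intro add_mono mult_right_mono) auto
    also have "\<dots> \<le> h * P" using h by (simp add: algebra_simps P_def)
    also have "\<dots> = r / 2" using pos by (simp add: h_def)
    also have "\<dots> < r" using r by simp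
    finally show ?thesis by (simp add: dist_norm add.assoc)
  qed
  have inS: "x + s *\<^sub>R u + t *\<^sub>R v \<in> S" "x + t *\<^sub>R v + s *\<^sub>R u \<in> S" if "0 \<le> s" "s \<le> h" "0 \<le> t" "t \<le> h" for s t
    using near[OF that] d0 by (auto simp: r_def dist_commute algebra_simps subset_eq)
  obtain s t where 1: "0 < s" "s < h" "0 < t" "t < h" "f (x + h *\<^sub>R u + h *\<^sub>R v) - f (x + h *\<^sub>R u) - f (x + h *\<^sub>R v) + f x = h * h * A (x + s *\<^sub>R u + t *\<^sub>R v)"
    unfolding A_def using second_difference_mvt[OF S(1) f h, of x u v] inS by blast
  obtain s' t' where 2: "0 < s'" "s' < h" "0 < t'" "t' < h" "f (x + h *\<^sub>R v + h *\<^sub>R u) - f (x + h *\<^sub>R v) - f (x + h *\<^sub>R u) + f x = h * h * B (x + s' *\<^sub>R v + t' *\<^sub>R u)"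
    unfolding B_def using second_difference_mvt[OF S(1) f h, of x v u] inS by blast
  have "h * h * A (x + s *\<^sub>R u + t *\<^sub>R v) = h * h * B (x + s' *\<^sub>R v + t' *\<^sub>R u)"
    using 1(5) 2(5) by (simp add: algebra_simps)
  then have eq: "A (x + s *\<^sub>R u + t *\<^sub>R v) = B (x + s' *\<^sub>R v + t' *\<^sub>R u)" using h by simp
  have "dist (A (x + s *\<^sub>R u + t *\<^sub>R v)) (A x) < e" using near[of s t] 1 d by (auto simp: r_def)
  moreover have "dist (B (x + s' *\<^sub>R v + t' *\<^sub>R u)) (B x) < e" using near[of t' s'] 2 d by (auto simp: r_def algebra_simps)
  ultimately have "dist (A x) (B x) < 2 * e" using eq dist_triangle2[of "A x" "B x" "A (x + s *\<^sub>R u + t *\<^sub>R v)"]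
    by (simp add: dist_commute)
  then show False by (simp add: e_def)
qed

lemma second_derivative_symmetric:
  fixes f :: "'e::euclidean_space \<Rightarrow> 'f::euclidean_space"
  assumes S: "open S" "x \<in> S" and f: "smooth_on S f"
  shows "frechet_derivative (\<lambda>y. frechet_derivative f (at y) u) (at x) v =
         frechet_derivative (\<lambda>y. frechet_derivative f (at y) v) (at x) u"
proof (rule euclidean_eqI)
  fix b :: 'f assume b: "b \<in> Basis"
  have inner: "frechet_derivative (\<lambda>y. g y \<bullet> b) (at y) = (\<lambda>w. frechet_derivative g (at y) w \<bullet> b)"
    if "g differentiable at y" for g :: "'e \<Rightarrow> 'f" and y
    by (rule frechetI) (rule bounded_linear.has_derivative[OF bounded_linear_inner_left has_frechet[OF that]])
  have fb: "smooth_on S (\<lambda>y. f y \<bullet> b)"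
    by (rule smooth_on_linear_comp[where h="\<lambda>y. y \<bullet> b" and f=f, OF S(1) bounded_linear_inner_left f])
  have *: "frechet_derivative (\<lambda>y. frechet_derivative f (at y) u) (at x) v \<bullet> b
      = frechet_derivative (\<lambda>y. frechet_derivative (\<lambda>y. f y \<bullet> b) (at y) u) (at x) v" for u v
  proof -
    have "frechet_derivative (\<lambda>y. frechet_derivative f (at y) u \<bullet> b) (at x) = (\<lambda>v. frechet_derivative (\<lambda>y. frechet_derivative f (at y) u) (at x) v \<bullet> b)"
      by (rule inner[OF smooth_on_differentiable[OF smooth_on_frechet[OF f] S(2)]])
    moreover have "frechet_derivative (\<lambda>y. frechet_derivative f (at y) u \<bullet> b) (at x)
       = frechet_derivative (\<lambda>y. frechet_derivative (\<lambda>y. f y \<bullet> b) (at y) u) (at x)"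
    proof (rule frechet_derivative_transform_within_open[OF _ S])
      show "(\<lambda>y. frechet_derivative f (at y) u \<bullet> b) differentiable at x"
        using bounded_linear.has_derivative[OF bounded_linear_inner_left has_frechet[OF smooth_on_differentiable[OF smooth_on_frechet[OF f] S(2)]]]
        unfolding differentiable_def by blast
      show "frechet_derivative f (at y) u \<bullet> b = frechet_derivative (\<lambda>y. f y \<bullet> b) (at y) u" if "y \<in> S" for y
        using inner[OF smooth_on_differentiable[OF f that]] by simp
    qed
    ultimately show ?thesis by simp
  qed
  have "Ck_on 2 (\<lambda>y. f y \<bullet> b) S" using fb by (simp add: smooth_on_def)
  then show "frechet_derivative (\<lambda>y. frechet_derivative f (at y) u) (at x) v \<bullet> b =
     frechet_derivative (\<lambda>y. frechet_derivative f (at y) v) (at x) u \<bullet> b"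
    unfolding * by (rule second_derivative_symmetric_real[OF S])
qed

text \<open>The product rule at a zero of the scalar factor, where the derivative of the other factor drops out. That
  factor will be the conformal factor by which an automorphism multiplies the contact form.\<close>

lemma has_derivative_scaleR_vanishing:
  fixes u :: "'e::euclidean_space \<Rightarrow> real" and w :: "'e \<Rightarrow> 'b::real_normed_vector"
  assumes u: "(u has_derivative u') (at y)" "u y = 0" and w: "isCont w y"
  shows "((\<lambda>z. u z *\<^sub>R w z) has_derivative (\<lambda>h. u' h *\<^sub>R w y)) (at y)"
proof -
  have 1: "((\<lambda>z. u z *\<^sub>R w y) has_derivative (\<lambda>h. u' h *\<^sub>R w y)) (at y)"
    by (rule has_derivative_scaleR_left[OF u(1)])
  obtain K where K: "\<And>h. \<bar>u' h\<bar> \<le> norm h * K" 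
    using has_derivative_bounded_linear[OF u(1)] bounded_linear.bounded by (metis real_norm_def)
  have 2: "((\<lambda>z. u z *\<^sub>R (w z - w y)) has_derivative (\<lambda>h. 0)) (at y)"
    unfolding has_derivative_at2
  proof (intro conjI)
    have l1: "((\<lambda>z. (u z - u y - u' (z - y)) / norm (z - y)) \<longlongrightarrow> 0) (at y)"
      using u(1) unfolding has_derivative_at2 by (simp add: divide_inverse mult.commute diff_diff_eq)
    have l2: "((\<lambda>z. w z - w y) \<longlongrightarrow> 0) (at y)" using w by (simp add: isCont_def LIM_zero)
    have b: "norm ((u z / norm (z - y)) *\<^sub>R (w z - w y)) \<le> (\<bar>(u z - u y - u' (z - y)) / norm (z - y)\<bar> + K) * norm (w z - w y)" for z
    proof (cases "z = y")
      case False
      then have n: "norm (z - y) > 0" by simp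
      have "\<bar>u z\<bar> \<le> \<bar>u z - u y - u' (z - y)\<bar> + norm (z - y) * K" using K[of "z - y"] u(2) by linarith
      then have "\<bar>u z\<bar> / norm (z - y) \<le> \<bar>u z - u y - u' (z - y)\<bar> / norm (z - y) + K"
        using n by (simp add: field_simps)
      then have "\<bar>u z\<bar> / norm (z - y) * norm (w z - w y) \<le> (\<bar>u z - u y - u' (z - y)\<bar> / norm (z - y) + K) * norm (w z - w y)"
        by (rule mult_right_mono) simp
      then show ?thesis by simp
    qed (simp add: u(2))
    have "((\<lambda>z. (\<bar>(u z - u y - u' (z - y)) / norm (z - y)\<bar> + K) * norm (w z - w y)) \<longlongrightarrow> (\<bar>0\<bar> + K) * norm (0::'b)) (at y)"
      by (intro tendsto_mult tendsto_add tendsto_rabs tendsto_norm l1 l2 tendsto_const)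
    then have "((\<lambda>z. (\<bar>(u z - u y - u' (z - y)) / norm (z - y)\<bar> + K) * norm (w z - w y)) \<longlongrightarrow> 0) (at y)" by simp
    then have "((\<lambda>z. (u z / norm (z - y)) *\<^sub>R (w z - w y)) \<longlongrightarrow> 0) (at y)"
      by (rule tendsto_0_le[where K=1]) (use b in \<open>auto intro!: always_eventually order_trans[OF b] simp del: norm_scaleR\<close>)
    then show "((\<lambda>z. (1 / norm (z - y)) *\<^sub>R (u z *\<^sub>R (w z - w y) - (u y *\<^sub>R (w y - w y) + 0))) \<longlongrightarrow> 0) (at y)"
      by simp
  qed simp
  have "((\<lambda>z. u z *\<^sub>R w y + u z *\<^sub>R (w z - w y)) has_derivative (\<lambda>h. u' h *\<^sub>R w y + 0)) (at y)"
    by (rule has_derivative_add[OF 1 2])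
  then show ?thesis by (simp add: algebra_simps)
qed

text \<open>The entries of the inverse of a matrix that depends smoothly on a parameter are smooth: once
  the inverse is known to be continuous, its derivative is \<open>- M\<^sup>-\<^sup>1 (D M) M\<^sup>-\<^sup>1\<close>, which has the same
  regularity as the inverse itself.\<close>

lemma Ck_on_inverse_family:
  fixes M N :: "'e::euclidean_space \<Rightarrow> 'f::euclidean_space \<Rightarrow> 'f"
  assumes S: "open S" and lin: "\<And>y. y \<in> S \<Longrightarrow> linear (N y)" "\<And>y. y \<in> S \<Longrightarrow> linear (M y)"
    and NM: "\<And>y v. y \<in> S \<Longrightarrow> N y (M y v) = v" and MN: "\<And>y v. y \<in> S \<Longrightarrow> M y (N y v) = v"
    and K: "\<And>y v. y \<in> S \<Longrightarrow> norm (N y v) \<le> K * norm v"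
    and M: "\<And>v. Ck_on k (\<lambda>y. M y v) S"
  shows "Ck_on k (\<lambda>y. N y v) S"
proof -
  have expand: "L w = (\<Sum>b\<in>Basis. (w \<bullet> b) *\<^sub>R L b)" if "linear L" for L :: "'f \<Rightarrow> 'f" and w
  proof -
    have "L (\<Sum>b\<in>Basis. (w \<bullet> b) *\<^sub>R b) = (\<Sum>b\<in>Basis. (w \<bullet> b) *\<^sub>R L b)"
      by (simp add: linear_sum[OF that] linear_scale[OF that])
    then show ?thesis by (simp add: euclidean_representation)
  qed
  have diff: "N y v - N y0 v = - N y (M y (N y0 v) - M y0 (N y0 v))" if "y \<in> S" "y0 \<in> S" for y y0 v
    using that lin NM MN by (simp add: linear_diff)
  have cont: "isCont (\<lambda>y. N y v) y0" if y0: "y0 \<in> S" and M: "continuous_on S (\<lambda>y. M y (N y0 v))" for y0 v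
  proof -
    have "isCont (\<lambda>y. M y (N y0 v)) y0" using M S y0 by (simp add: continuous_on_eq_continuous_at)
    then have "((\<lambda>y. M y (N y0 v) - M y0 (N y0 v)) \<longlongrightarrow> 0) (at y0)" by (simp add: isCont_def LIM_zero)
    moreover have "\<forall>\<^sub>F y in at y0. norm (N y v - N y0 v) \<le> norm (M y (N y0 v) - M y0 (N y0 v)) * K"
      using eventually_at_topological[of "\<lambda>y. y \<in> S"] S y0 K diff
      by (auto simp: eventually_at_topological intro!: exI[of _ S]) (metis mult.commute norm_minus_cancel)
    ultimately have "((\<lambda>y. N y v - N y0 v) \<longlongrightarrow> 0) (at y0)" by (rule tendsto_0_le)
    then show ?thesis by (simp add: isCont_def LIM_zero_iff)
  qed
  show ?thesis using M
  proof (induction k arbitrary: v)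
    case 0
    have "continuous_on S (\<lambda>y. N y v)"
      by (rule continuous_at_imp_continuous_on, rule, rule cont) (use 0 in simp_all)
    then show ?case by simp
  next
    case (Suc k)
    have Mk: "Ck_on k (\<lambda>y. M y v) S" for v using Suc.prems Ck_on_Suc_imp by blast
    have Nk: "Ck_on k (\<lambda>y. N y v) S" for v by (rule Suc.IH[OF Mk])
    have Mc: "continuous_on S (\<lambda>y. M y v)" for v
      using Ck_on_mono[OF Mk[of v], of 0] by simp
    define D where "D y w h = frechet_derivative (\<lambda>y. M y w) (at y) h" for y w h
    have Md: "((\<lambda>y. M y w) has_derivative D y w) (at y)" if "y \<in> S" for y w
      unfolding D_def using Suc.prems[of w] that by (auto intro: has_frechet)
    have Nd: "((\<lambda>y. N y v) has_derivative (\<lambda>h. - N y0 (D y0 (N y0 v) h))) (at y0)" if y0: "y0 \<in> S" for y0 v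
    proof -
      define u where "u y = M y (N y0 v) - M y0 (N y0 v)" for y
      have du: "(u has_derivative D y0 (N y0 v)) (at y0)"
        unfolding u_def using has_derivative_diff[OF Md[OF y0] has_derivative_const] by simp
      have "((\<lambda>y. - (\<Sum>b\<in>Basis. (u y \<bullet> b) *\<^sub>R N y b) + N y0 v) has_derivative (\<lambda>h. - (\<Sum>b\<in>Basis. (D y0 (N y0 v) h \<bullet> b) *\<^sub>R N y0 b) + 0)) (at y0)"
        by (intro has_derivative_add has_derivative_minus has_derivative_sum has_derivative_scaleR_vanishing
            has_derivative_const bounded_linear.has_derivative[OF bounded_linear_inner_left du] cont y0 Mc) (simp add: u_def)
      then have "((\<lambda>y. - (\<Sum>b\<in>Basis. (u y \<bullet> b) *\<^sub>R N y b) + N y0 v) has_derivative (\<lambda>h. - N y0 (D y0 (N y0 v) h))) (at y0)"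
        by (subst expand[OF lin(1)[OF y0]]) simp
      then show ?thesis
      proof (rule has_derivative_transform_within_open[OF _ S y0])
        fix y assume y: "y \<in> S"
        show "- (\<Sum>b\<in>Basis. (u y \<bullet> b) *\<^sub>R N y b) + N y0 v = N y v"
          unfolding expand[OF lin(1)[OF y], of "u y", symmetric] using diff[OF y y0, of v] by (simp add: u_def algebra_simps)
      qed
    qed
    have "Ck_on k (\<lambda>y. - N y (D y (N y v) h)) S" for h
    proof -
      have Dk: "Ck_on k (\<lambda>y. D y b h) S" for b using Suc.prems[of b] by (simp add: D_def)
      have Dexp: "D y (N y v) h = (\<Sum>b\<in>Basis. (N y v \<bullet> b) *\<^sub>R D y b h)" if y: "y \<in> S" for y
      proof -
        have "((\<lambda>z. \<Sum>b\<in>Basis. (N y v \<bullet> b) *\<^sub>R M z b) has_derivative (\<lambda>h. \<Sum>b\<in>Basis. (N y v \<bullet> b) *\<^sub>R D y b h)) (at y)"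
          by (intro has_derivative_sum has_derivative_scaleR_right Md y)
        then have "((\<lambda>z. M z (N y v)) has_derivative (\<lambda>h. \<Sum>b\<in>Basis. (N y v \<bullet> b) *\<^sub>R D y b h)) (at y)"
          by (rule has_derivative_transform_within_open[OF _ S y]) (use expand[OF lin(2)] in metis)
        then show ?thesis unfolding D_def by (simp add: frechetI)
      qed
      have in1: "Ck_on k (\<lambda>y. N y v \<bullet> b) S" for b
        by (rule Ck_on_linear_comp[where h="\<lambda>z. z \<bullet> b" and f="\<lambda>y. N y v", OF S bounded_linear_inner_left Nk])
      have "Ck_on k (\<lambda>y. (N y v \<bullet> b) *\<^sub>R D y b h) S" for b
        by (rule Ck_on_bilinear[where mul="(*\<^sub>R)" and f="\<lambda>y. N y v \<bullet> b" and g="\<lambda>y. D y b h", OF S bounded_bilinear_scaleR in1 Dk])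
      then have "Ck_on k (\<lambda>y. \<Sum>b\<in>Basis. (N y v \<bullet> b) *\<^sub>R D y b h) S"
        by (rule Ck_on_sum[OF S, of Basis])
      then have D1: "Ck_on k (\<lambda>y. D y (N y v) h) S"
        by (rule Ck_on_cong[OF S, rotated]) (simp add: Dexp)
      have in2: "Ck_on k (\<lambda>y. D y (N y v) h \<bullet> b) S" for b
        by (rule Ck_on_linear_comp[where h="\<lambda>z. z \<bullet> b" and f="\<lambda>y. D y (N y v) h", OF S bounded_linear_inner_left D1])
      have "Ck_on k (\<lambda>y. (D y (N y v) h \<bullet> b) *\<^sub>R N y b) S" for b
        by (rule Ck_on_bilinear[where mul="(*\<^sub>R)" and f="\<lambda>y. D y (N y v) h \<bullet> b" and g="\<lambda>y. N y b", OF S bounded_bilinear_scaleR in2 Nk])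
      then have "Ck_on k (\<lambda>y. \<Sum>b\<in>Basis. (D y (N y v) h \<bullet> b) *\<^sub>R N y b) S"
        by (rule Ck_on_sum[OF S, of Basis])
      then have "Ck_on k (\<lambda>y. - (\<Sum>b\<in>Basis. (D y (N y v) h \<bullet> b) *\<^sub>R N y b)) S"
        by (rule Ck_on_linear_comp[where h=uminus, OF S bounded_linear_minus[OF bounded_linear_ident]])
      then show ?thesis
        by (rule Ck_on_cong[OF S, rotated]) (use expand[OF lin(1)] in metis)
    qed
    then show ?case using Ck_on_SucI[OF S Nd] by blast
  qed
qed

text \<open>The inverse function theorem provides an inverse of class \<open>C\<^sup>1\<close> whose derivative is the pointwise
  inverse of the derivative of \<open>f\<close>; \<open>Ck_on_inverse_family\<close> then raises its regularity step by step. Restricting to derivatives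
  close to the identity gives the uniform bound on the inverses that this requires.\<close>

lemma smooth_local_inverse:
  fixes f :: "'e::euclidean_space \<Rightarrow> 'e"
  assumes U: "open U" "a \<in> U" and f: "smooth_on U f"
    and df: "(f has_derivative id) (at a)"
  obtains U' V g where "open U'" "U' \<subseteq> U" "a \<in> U'" "open V" "V = f ` U'" "inj_on f U'"
    "\<And>x. x \<in> U' \<Longrightarrow> g (f x) = x" "g ` V \<subseteq> U'" "\<And>y. y \<in> V \<Longrightarrow> f (g y) = y" "smooth_on V g"
proof -
  define f' where "f' x = Blinfun (frechet_derivative f (at x))" for x
  have bl: "bounded_linear (frechet_derivative f (at x))" if "x \<in> U" for x
    using smooth_on_has_derivative[OF f that] has_derivative_bounded_linear by blast
  have f'_apply: "blinfun_apply (f' x) = frechet_derivative f (at x)" if "x \<in> U" for x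
    unfolding f'_def by (rule bounded_linear_Blinfun_apply[OF bl[OF that]])
  have der: "(f has_derivative blinfun_apply (f' x)) (at x)" if "x \<in> U" for x
    using smooth_on_has_derivative[OF f that] f'_apply[OF that] by simp
  have contf': "continuous_on U f'"
  proof (rule continuous_on_blinfun_componentwise)
    fix i :: 'e
    have "continuous_on U (\<lambda>x. frechet_derivative f (at x) i)"
      by (rule smooth_on_continuous_on[OF smooth_on_frechet[OF f]])
    then show "continuous_on U (\<lambda>x. blinfun_apply (f' x) i)"
      by (rule continuous_on_cong[THEN iffD1, rotated -1]) (auto simp: f'_apply)
  qed
  have fa: "f' a = id_blinfun"
    by (rule blinfun_eqI) (simp add: f'_apply[OF U(2)] frechetI[OF df])
  obtain U1 V1 g g' where inv: "open U1" "U1 \<subseteq> U" "a \<in> U1" "open V1" "f a \<in> V1" "homeomorphism U1 V1 f g"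
    and g1: "\<And>y. y \<in> V1 \<Longrightarrow> (g has_derivative (g' y)) (at y)"
    and g2: "\<And>y. y \<in> V1 \<Longrightarrow> g' y = inv (blinfun_apply (f'(g y)))"
    and g3: "\<And>y. y \<in> V1 \<Longrightarrow> bij (blinfun_apply (f'(g y)))"
    by (rule inverse_function_theorem[OF U(1) der contf' U(2), of id_blinfun])
       (simp_all add: fa blinfun_eqI)
  have "isCont f' a" using contf' U by (simp add: continuous_on_eq_continuous_at)
  then obtain d where d: "d > 0" "\<And>x. dist x a < d \<Longrightarrow> dist (f' x) (f' a) < 1/2"
    unfolding continuous_at_eps_delta by (metis half_gt_zero zero_less_one)
  define U' where "U' = U1 \<inter> ball a d"
  have hom: "g (f x) = x" "f x \<in> V1" if "x \<in> U1" for x using inv(6) that by (auto simp: homeomorphism_def)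
  have hom': "f (g y) = y" "g y \<in> U1" if "y \<in> V1" for y using inv(6) that by (auto simp: homeomorphism_def)
  define V where "V = f ` U'"
  have "V = V1 \<inter> g -` ball a d"
    unfolding V_def U'_def using hom hom' by (auto simp: image_iff) (metis IntI hom'(1) hom'(2) mem_ball)
  moreover have "open (V1 \<inter> g -` ball a d)"
    using inv(4,6) by (auto simp: homeomorphism_def intro: continuous_open_preimage)
  ultimately have V: "open V" "V \<subseteq> V1" by auto
  have gV: "g y \<in> U'" if "y \<in> V" for y using that hom unfolding V_def U'_def by auto
  have low: "norm v \<le> 2 * norm (f' x v)" if "x \<in> U'" for x v
  proof -
    have "norm (f' x - f' a) \<le> 1/2" using d(2)[of x] that by (simp add: U'_def dist_commute dist_norm[symmetric])
    then have "norm ((f' x - f' a) v) \<le> 1/2 * norm v"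
      using norm_blinfun[of "f' x - f' a" v] by (meson mult_right_mono norm_ge_zero order_trans)
    then have "norm (f' x v - v) \<le> 1/2 * norm v" by (simp add: fa blinfun.diff_left)
    then show ?thesis using norm_triangle_ineq2[of v "f' x v"] by (simp add: norm_minus_commute)
  qed
  have gCk: "Ck_on k g V" for k
  proof (induction k)
    case 0
    have "continuous_on V g" using inv(6) V(2) by (auto simp: homeomorphism_def intro: continuous_on_subset)
    then show ?case by simp
  next
    case (Suc k)
    have bij: "bij (blinfun_apply (f'(g y)))" if "y \<in> V" for y using g3 V that by auto
    have "Ck_on k (\<lambda>y. g' y v) V" for v
    proof (rule Ck_on_inverse_family[OF V(1), of g' "\<lambda>y. blinfun_apply (f' (g y))" 2])
      fix y assume y: "y \<in> V"
      then have y1: "y \<in> V1" using V by auto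
      show "linear (g' y)" using g1[OF y1] has_derivative_linear by blast
      show "linear (blinfun_apply (f' (g y)))" by (simp add: linear_conv_bounded_linear blinfun.bounded_linear_right)
      show "g' y (f' (g y) v) = v" for v using bij[OF y] g2[OF y1] by (simp add: bij_is_inj)
      show mn: "f' (g y) (g' y v) = v" for v using bij[OF y] g2[OF y1] by (simp add: bij_is_surj surj_f_inv_f)
      show "norm (g' y v) \<le> 2 * norm v" for v using low[OF gV[OF y], of "g' y v"] mn by simp
    next
      fix v
      have "Ck_on k (\<lambda>x. frechet_derivative f (at x) v) U" using smooth_on_frechet[OF f] by (simp add: smooth_on_def)
      then have "Ck_on k (\<lambda>y. frechet_derivative f (at (g y)) v) V"
        by (rule Ck_on_compose[OF V(1) U(1) _ _ Suc.IH, rotated]) (use gV inv(2) in \<open>auto simp: U'_def\<close>)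
      then show "Ck_on k (\<lambda>y. blinfun_apply (f' (g y)) v) V"
        by (rule Ck_on_cong[OF V(1), rotated]) (use gV inv(2) in \<open>auto simp: U'_def f'_apply subset_eq\<close>)
    qed
    then show ?case using g1 V by (intro Ck_on_SucI[OF V(1), where f'=g']) auto
  qed
  show thesis
  proof (rule that[of U' V g])
    show "open U'" "U' \<subseteq> U" "a \<in> U'" using inv d by (auto simp: U'_def)
    show "open V" "V = f ` U'" using V V_def by auto
    show "inj_on f U'" by (rule inj_on_inverseI[where g=g]) (auto simp: U'_def hom)
    show "g (f x) = x" if "x \<in> U'" for x using that hom by (auto simp: U'_def)
    show "g ` V \<subseteq> U'" using gV by auto
    show "f (g y) = y" if "y \<in> V" for y using that V hom' by auto
    show "smooth_on V g" using gCk by (simp add: smooth_on_def)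
  qed
qed

section \<open>Regularity for linear functional equations over a contraction\<close>

text \<open>Functions of class \<open>C\<^sup>k\<close> whose derivatives of order \<open>j \<le> k\<close> are bounded by a multiple of
  \<open>|x|\<^sup>p\<^sup>-\<^sup>j\<close> (of \<open>1\<close> if \<open>j \<ge> p\<close>). The weight \<open>p\<close> is what makes composition with a map that
  shrinks by the factor \<open>c\<close> shrink functions by \<open>c\<^sup>p\<close>.\<close>

primrec Cw :: "'e::euclidean_space set \<Rightarrow> nat \<Rightarrow> nat \<Rightarrow> ('e \<Rightarrow> real) \<Rightarrow> bool" where
  "Cw U 0 p f \<longleftrightarrow> continuous_on U f \<and> (\<exists>C. \<forall>x\<in>U. \<bar>f x\<bar> \<le> C * norm x ^ p)"
| "Cw U (Suc k) p f \<longleftrightarrow> (\<exists>C. \<forall>x\<in>U. \<bar>f x\<bar> \<le> C * norm x ^ p) \<and> (\<forall>x\<in>U. f differentiable at x) \<and>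
     (\<forall>v. Cw U k (p - 1) (\<lambda>x. frechet_derivative f (at x) v))"

lemma bound_nonneg:
  assumes "\<exists>C. \<forall>x\<in>U. \<bar>f x\<bar> \<le> C * norm x ^ p"
  shows "\<exists>C\<ge>0. \<forall>x\<in>U. \<bar>f x :: real\<bar> \<le> C * norm (x::'e::real_normed_vector) ^ p"
proof -
  obtain C where C: "\<And>x. x \<in> U \<Longrightarrow> \<bar>f x\<bar> \<le> C * norm x ^ p" using assms by auto
  have "\<bar>f x\<bar> \<le> \<bar>C\<bar> * norm x ^ p" if "x \<in> U" for x
    by (rule order_trans[OF C[OF that]]) (simp add: mult_right_mono)
  then show ?thesis by (intro exI[of _ "\<bar>C\<bar>"]) auto
qed

lemma Cw_bound: "Cw U k p f \<Longrightarrow> \<exists>C\<ge>0. \<forall>x\<in>U. \<bar>f x\<bar> \<le> C * norm x ^ p"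
  by (rule bound_nonneg) (cases k; simp)

lemma Cw_imp_Ck_on: "Cw U k p f \<Longrightarrow> Ck_on k f U"
proof (induction k arbitrary: p f)
  case (Suc k)
  then have "Ck_on k (\<lambda>x. frechet_derivative f (at x) v) U" for v by (intro Suc.IH[of "p - 1"]) simp
  then show ?case using Suc.prems by simp
qed auto

lemma Cw_cong:
  assumes "open U" "\<And>x. x \<in> U \<Longrightarrow> f x = g x" "Cw U k p f"
  shows "Cw U k p g"
  using assms(2,3)
proof (induction k arbitrary: p f g)
  case 0
  then show ?case using continuous_on_cong[of U U f g] by auto
next
  case (Suc k)
  have d: "(g has_derivative frechet_derivative f (at x)) (at x)" if "x \<in> U" for x
    by (rule has_derivative_transform_within_open[OF has_frechet assms(1) that Suc.prems(1)]) (use Suc.prems that in auto)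
  have "Cw U k (p - 1) (\<lambda>x. frechet_derivative g (at x) v)" for v
  proof (rule Suc.IH)
    show "Cw U k (p - 1) (\<lambda>x. frechet_derivative f (at x) v)" using Suc.prems by simp
    show "frechet_derivative f (at x) v = frechet_derivative g (at x) v" if "x \<in> U" for x
      using frechetI[OF d[OF that]] by simp
  qed
  then show ?case using d Suc.prems by (auto simp: differentiable_def)
qed

lemma Cw_SucI:
  assumes "open U" "\<exists>C. \<forall>x\<in>U. \<bar>f x\<bar> \<le> C * norm x ^ p" "\<And>x. x \<in> U \<Longrightarrow> (f has_derivative f' x) (at x)"
    "\<And>v. Cw U k (p - 1) (\<lambda>x. f' x v)"
  shows "Cw U (Suc k) p f"
proof -
  have "Cw U k (p - 1) (\<lambda>x. frechet_derivative f (at x) v)" for v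
    by (rule Cw_cong[OF assms(1) _ assms(4)[of v]]) (simp add: frechetI[OF assms(3)])
  then show ?thesis using assms by (auto simp: differentiable_def)
qed

lemma Cw_Suc_imp: "Cw U (Suc k) p f \<Longrightarrow> Cw U k p f"
proof (induction k arbitrary: p f)
  case 0
  then show ?case by (auto intro!: continuous_at_imp_continuous_on differentiable_imp_continuous_within)
next
  case (Suc k)
  then show ?case by (metis Cw.simps(2))
qed

lemma Cw_weaken:
  assumes "U \<subseteq> ball 0 1" "Cw U k p f" "q \<le> p"
  shows "Cw U k q f"
  using assms(2,3)
proof (induction k arbitrary: p q f)
  case b: 0
  obtain C where C: "C \<ge> 0" "\<And>x. x \<in> U \<Longrightarrow> \<bar>f x\<bar> \<le> C * norm x ^ p" using Cw_bound[OF b(1)] by auto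
  have "\<bar>f x\<bar> \<le> C * norm x ^ q" if "x \<in> U" for x
    by (rule order_trans[OF C(2)[OF that]], rule mult_left_mono, rule power_decreasing)
       (use b C assms(1) that in auto)
  then show ?case using b by auto
next
  case (Suc k)
  obtain C where C: "C \<ge> 0" "\<And>x. x \<in> U \<Longrightarrow> \<bar>f x\<bar> \<le> C * norm x ^ p" using Cw_bound[OF Suc.prems(1)] by auto
  have "\<bar>f x\<bar> \<le> C * norm x ^ q" if "x \<in> U" for x
    by (rule order_trans[OF C(2)[OF that]], rule mult_left_mono, rule power_decreasing)
       (use Suc.prems C assms(1) that in auto)
  moreover have "Cw U k (q - 1) (\<lambda>x. frechet_derivative f (at x) v)" for v
    by (rule Suc.IH[of "p - 1"]) (use Suc.prems in auto)
  ultimately show ?case using Suc.prems by auto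
qed

lemma Cw_zero: "open U \<Longrightarrow> Cw U k p (\<lambda>x. 0)"
proof (induction k arbitrary: p)
  case (Suc k)
  show ?case by (rule Cw_SucI[where f'="\<lambda>x v. 0"]) (use Suc in \<open>auto intro: exI[of _ 0]\<close>)
qed (auto intro: exI[of _ 0])

lemma Cw_const: "open U \<Longrightarrow> Cw U k 0 (\<lambda>x. a)"
proof (cases k)
  case (Suc j)
  assume "open U"
  then show ?thesis unfolding Suc
    by (intro Cw_SucI[where f'="\<lambda>x v. 0"]) (auto intro: exI[of _ "\<bar>a\<bar>"] Cw_zero)
qed (auto intro: exI[of _ "\<bar>a\<bar>"])

lemma Cw_add:
  assumes "open U" "Cw U k p f" "Cw U k p g"
  shows "Cw U k p (\<lambda>x. f x + g x)"
  using assms(2,3)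
proof (induction k arbitrary: p f g)
  case c0: 0
  obtain C D where "\<And>x. x \<in> U \<Longrightarrow> \<bar>f x\<bar> \<le> C * norm x ^ p" "\<And>x. x \<in> U \<Longrightarrow> \<bar>g x\<bar> \<le> D * norm x ^ p"
    using c0 by auto
  then have "\<forall>x\<in>U. \<bar>f x + g x\<bar> \<le> (C + D) * norm x ^ p"
    by (auto simp: algebra_simps intro!: order_trans[OF abs_triangle_ineq] add_mono)
  then show ?case using c0 by (auto intro: continuous_on_add)
next
  case (Suc k)
  obtain C D where "\<And>x. x \<in> U \<Longrightarrow> \<bar>f x\<bar> \<le> C * norm x ^ p" "\<And>x. x \<in> U \<Longrightarrow> \<bar>g x\<bar> \<le> D * norm x ^ p"
    using Suc.prems by auto
  then have "\<forall>x\<in>U. \<bar>f x + g x\<bar> \<le> (C + D) * norm x ^ p"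
    by (auto simp: algebra_simps intro!: order_trans[OF abs_triangle_ineq] add_mono)
  then show ?case
    by (intro Cw_SucI[OF assms(1), where f'="\<lambda>x v. frechet_derivative f (at x) v + frechet_derivative g (at x) v"])
       (use Suc in \<open>auto intro!: has_derivative_add has_frechet\<close>)
qed

lemma Cw_sum:
  assumes "open U" "\<And>i. i \<in> I \<Longrightarrow> Cw U k p (f i)"
  shows "Cw U k p (\<lambda>x. \<Sum>i\<in>I. f i x)"
  using assms(2)
proof (induction I rule: infinite_finite_induct)
  case (insert i I)
  then have "Cw U k p (\<lambda>x. f i x + (\<Sum>i\<in>I. f i x))" by (intro Cw_add assms(1)) auto
  then show ?case using insert by simp
qed (auto intro: Cw_zero assms(1))

lemma Cw_mult:
  assumes "open U" "U \<subseteq> ball 0 1" "Cw U k 0 f" "Cw U k p g"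
  shows "Cw U k p (\<lambda>x. f x * g x)"
  using assms(3,4)
proof (induction k arbitrary: p f g)
  case c0: 0
  obtain C D where C: "C \<ge> 0" "\<And>x. x \<in> U \<Longrightarrow> \<bar>f x\<bar> \<le> C" "\<And>x. x \<in> U \<Longrightarrow> \<bar>g x\<bar> \<le> D * norm x ^ p"
    using Cw_bound[OF c0(1)] Cw_bound[OF c0(2)] by auto
  then have "\<forall>x\<in>U. \<bar>f x * g x\<bar> \<le> (C * D) * norm x ^ p"
    by (auto simp: abs_mult mult.assoc intro!: mult_mono)
  then show ?case using c0 by (auto intro: continuous_on_mult)
next
  case (Suc k)
  obtain C D where C: "C \<ge> 0" "\<And>x. x \<in> U \<Longrightarrow> \<bar>f x\<bar> \<le> C" "\<And>x. x \<in> U \<Longrightarrow> \<bar>g x\<bar> \<le> D * norm x ^ p"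
    using Cw_bound[OF Suc.prems(1)] Cw_bound[OF Suc.prems(2)] by auto
  have b: "\<forall>x\<in>U. \<bar>f x * g x\<bar> \<le> (C * D) * norm x ^ p"
    using C by (auto simp: abs_mult mult.assoc intro!: mult_mono)
  show ?case
  proof (rule Cw_SucI[OF assms(1), where f'="\<lambda>x v. f x * frechet_derivative g (at x) v + frechet_derivative f (at x) v * g x"])
    show "\<exists>C. \<forall>x\<in>U. \<bar>f x * g x\<bar> \<le> C * norm x ^ p" using b by blast
    show "((\<lambda>x. f x * g x) has_derivative (\<lambda>v. f x * frechet_derivative g (at x) v + frechet_derivative f (at x) v * g x)) (at x)" if "x \<in> U" for x
      by (rule has_derivative_mult[OF has_frechet has_frechet]) (use Suc.prems that in auto)
    fix v
    have 1: "Cw U k (p - 1) (\<lambda>x. f x * frechet_derivative g (at x) v)"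
      by (rule Suc.IH[OF Cw_Suc_imp[OF Suc.prems(1)]]) (use Suc.prems in auto)
    have "Cw U k p g" by (rule Cw_Suc_imp[OF Suc.prems(2)])
    then have "Cw U k (p - 1) g" by (rule Cw_weaken[OF assms(2)]) simp
    moreover have "Cw U k 0 (\<lambda>x. frechet_derivative f (at x) v)" using Suc.prems(1) by simp
    ultimately have 2: "Cw U k (p - 1) (\<lambda>x. frechet_derivative f (at x) v * g x)" by (intro Suc.IH)
    show "Cw U k (p - 1) (\<lambda>x. f x * frechet_derivative g (at x) v + frechet_derivative f (at x) v * g x)"
      by (rule Cw_add[OF assms(1) 1 2])
  qed
qed

lemma Cw_compose:
  fixes \<phi> :: "'e::euclidean_space \<Rightarrow> 'e"
  assumes U: "open U" "U \<subseteq> ball 0 1"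
    and \<phi>: "\<And>x. x \<in> U \<Longrightarrow> \<phi> x \<in> U" "\<And>x. x \<in> U \<Longrightarrow> norm (\<phi> x) \<le> norm x" "smooth_on U \<phi>"
      "\<And>k b. b \<in> Basis \<Longrightarrow> Cw U k 0 (\<lambda>x. \<phi> x \<bullet> b)"
    and f: "Cw U k p f"
  shows "Cw U k p (\<lambda>x. f (\<phi> x))"
  using f
proof (induction k arbitrary: p f)
  case c0: 0
  obtain C where C: "C \<ge> 0" "\<And>x. x \<in> U \<Longrightarrow> \<bar>f x\<bar> \<le> C * norm x ^ p" using Cw_bound[OF c0] by auto
  have "\<bar>f (\<phi> x)\<bar> \<le> C * norm x ^ p" if "x \<in> U" for x
    by (rule order_trans[OF C(2)[OF \<phi>(1)[OF that]]], intro mult_left_mono power_mono) (use C \<phi> that in auto)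
  moreover have "continuous_on U (\<lambda>x. f (\<phi> x))"
    using continuous_on_compose2[of U f U \<phi>] c0 \<phi>(1) smooth_on_continuous_on[OF \<phi>(3)] by auto
  ultimately show ?case by auto
next
  case (Suc k)
  obtain C where C: "C \<ge> 0" "\<And>x. x \<in> U \<Longrightarrow> \<bar>f x\<bar> \<le> C * norm x ^ p" using Cw_bound[OF Suc.prems] by auto
  have b: "\<bar>f (\<phi> x)\<bar> \<le> C * norm x ^ p" if "x \<in> U" for x
    by (rule order_trans[OF C(2)[OF \<phi>(1)[OF that]]], intro mult_left_mono power_mono) (use C \<phi> that in auto)
  have fd: "f differentiable at x" if "x \<in> U" for x using Suc.prems that by auto
  show ?case
  proof (rule Cw_SucI[OF U(1), where f'="\<lambda>x v. \<Sum>b\<in>Basis. (frechet_derivative \<phi> (at x) v \<bullet> b) * frechet_derivative f (at (\<phi> x)) b"])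
    show "\<exists>C. \<forall>x\<in>U. \<bar>f (\<phi> x)\<bar> \<le> C * norm x ^ p" using b by blast
    fix x assume x: "x \<in> U"
    have "((\<lambda>x. f (\<phi> x)) has_derivative (\<lambda>v. frechet_derivative f (at (\<phi> x)) (frechet_derivative \<phi> (at x) v))) (at x)"
      using diff_chain_at[OF smooth_on_has_derivative[OF \<phi>(3) x] has_frechet[OF fd[OF \<phi>(1)[OF x]]]] by (simp add: o_def)
    moreover have "(\<lambda>v. frechet_derivative f (at (\<phi> x)) (frechet_derivative \<phi> (at x) v)) =
        (\<lambda>v. \<Sum>b\<in>Basis. (frechet_derivative \<phi> (at x) v \<bullet> b) * frechet_derivative f (at (\<phi> x)) b)"
      by (rule ext) (rule frechet_basis_sum[OF fd[OF \<phi>(1)[OF x]], unfolded real_scaleR_def])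
    ultimately show "((\<lambda>x. f (\<phi> x)) has_derivative (\<lambda>v. \<Sum>b\<in>Basis. (frechet_derivative \<phi> (at x) v \<bullet> b) * frechet_derivative f (at (\<phi> x)) b)) (at x)"
      by (simp only:)
  next
    fix v
    show "Cw U k (p - 1) (\<lambda>x. \<Sum>b\<in>Basis. (frechet_derivative \<phi> (at x) v \<bullet> b) * frechet_derivative f (at (\<phi> x)) b)"
    proof (rule Cw_sum[OF U(1)], rule Cw_mult[OF U])
      fix b :: 'e assume b: "b \<in> Basis"
      show "Cw U k (p - 1) (\<lambda>x. frechet_derivative f (at (\<phi> x)) b)"
        by (rule Suc.IH) (use Suc.prems in simp)
      have "Cw U (Suc k) 0 (\<lambda>x. \<phi> x \<bullet> b)" by (rule \<phi>(4)[OF b])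
      then have "Cw U k 0 (\<lambda>x. frechet_derivative (\<lambda>x. \<phi> x \<bullet> b) (at x) v)" by simp
      then show "Cw U k 0 (\<lambda>x. frechet_derivative \<phi> (at x) v \<bullet> b)"
      proof (rule Cw_cong[OF U(1), rotated])
        fix x assume "x \<in> U"
        then show "frechet_derivative (\<lambda>x. \<phi> x \<bullet> b) (at x) v = frechet_derivative \<phi> (at x) v \<bullet> b"
          using frechetI[OF bounded_linear.has_derivative[OF bounded_linear_inner_left smooth_on_has_derivative[OF \<phi>(3)]]] by metis
      qed
    qed
  qed
qed

subsection \<open>Smooth functions vanishing to finite order\<close>

primrec vanish :: "nat \<Rightarrow> ('e::euclidean_space \<Rightarrow> real) \<Rightarrow> bool" where
  "vanish 0 f \<longleftrightarrow> True"
| "vanish (Suc p) f \<longleftrightarrow> f 0 = 0 \<and> (\<forall>v. vanish p (\<lambda>x. frechet_derivative f (at x) v))"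

text \<open>The derivatives vanish to one order less, so a bound for them can be integrated along segments
  starting at the origin.\<close>

lemma vanish_bound:
  fixes f :: "'e::euclidean_space \<Rightarrow> real"
  assumes S: "cball 0 r \<subseteq> S" and f: "smooth_on S f" "vanish p f"
  shows "\<exists>C. \<forall>x\<in>cball 0 r. \<bar>f x\<bar> \<le> C * norm x ^ p"
  using f
proof (induction p arbitrary: f)
  case 0
  have "compact (f ` cball 0 r)"
    by (rule compact_continuous_image) (use smooth_on_continuous_on[OF 0(1)] S in \<open>auto intro: continuous_on_subset\<close>)
  then obtain C where "\<forall>y\<in>f ` cball 0 r. norm y \<le> C" using compact_imp_bounded bounded_iff by metis
  then show ?case by auto
next
  case (Suc p)
  have "\<exists>C\<ge>0. \<forall>x\<in>cball 0 r. \<bar>frechet_derivative f (at x) b\<bar> \<le> C * norm x ^ p" for b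
    by (rule bound_nonneg, rule Suc.IH[OF smooth_on_frechet[OF Suc.prems(1)]]) (use Suc.prems in simp)
  then obtain C where C: "\<And>b. C b \<ge> 0" "\<And>b x. x \<in> cball 0 r \<Longrightarrow> \<bar>frechet_derivative f (at x) b\<bar> \<le> C b * norm x ^ p"
    by metis
  have "\<bar>f x\<bar> \<le> (\<Sum>b\<in>Basis. C b) * norm x ^ Suc p" if x: "x \<in> cball 0 r" for x
  proof -
    have tx: "t *\<^sub>R x \<in> cball 0 r" if "0 \<le> t" "t \<le> 1" for t
      using x that mult_left_le_one_le[of "norm x" t] by (auto intro: order_trans)
    have d: "((\<lambda>t. f (t *\<^sub>R x)) has_derivative (\<lambda>h. frechet_derivative f (at (t *\<^sub>R x)) (h *\<^sub>R x))) (at t)" if "0 \<le> t" "t \<le> 1" for t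
    proof -
      have "((\<lambda>t. t *\<^sub>R x) has_derivative (\<lambda>h. h *\<^sub>R x)) (at t)" by (auto intro!: derivative_eq_intros)
      moreover have "t *\<^sub>R x \<in> S" using tx[OF that] S by blast
      ultimately show ?thesis
        using diff_chain_at[OF _ smooth_on_has_derivative[OF Suc.prems(1)]] by (fastforce simp: o_def)
    qed
    have "\<exists>t\<in>{0<..<1}. (\<lambda>t. f (t *\<^sub>R x)) 1 - (\<lambda>t. f (t *\<^sub>R x)) 0 = (\<lambda>h. frechet_derivative f (at (t *\<^sub>R x)) (h *\<^sub>R x)) (1 - 0)"
      by (rule mvt_simple) (use d in \<open>auto intro: has_derivative_at_withinI\<close>)
    then obtain t where t: "0 < t" "t < 1" "f x = frechet_derivative f (at (t *\<^sub>R x)) x"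
      using Suc.prems by auto
    have txS: "t *\<^sub>R x \<in> cball 0 r" using tx t by simp
    have "f x = (\<Sum>b\<in>Basis. (x \<bullet> b) *\<^sub>R frechet_derivative f (at (t *\<^sub>R x)) b)"
      unfolding t(3) by (rule frechet_basis_sum, rule smooth_on_differentiable[OF Suc.prems(1)]) (use txS S in auto)
    then have "\<bar>f x\<bar> \<le> (\<Sum>b\<in>Basis. \<bar>(x \<bullet> b) * frechet_derivative f (at (t *\<^sub>R x)) b\<bar>)"
      using sum_abs by (simp add: sum_abs)
    also have "\<dots> \<le> (\<Sum>b\<in>Basis. norm x * (C b * norm x ^ p))"
    proof (rule sum_mono)
      fix b :: 'e assume b: "b \<in> Basis"
      have "\<bar>frechet_derivative f (at (t *\<^sub>R x)) b\<bar> \<le> C b * norm (t *\<^sub>R x) ^ p" by (rule C(2)[OF txS])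
      also have "\<dots> \<le> C b * norm x ^ p"
        by (intro mult_left_mono power_mono C(1)) (use t mult_left_le_one_le[of "norm x" t] in auto)
      finally show "\<bar>(x \<bullet> b) * frechet_derivative f (at (t *\<^sub>R x)) b\<bar> \<le> norm x * (C b * norm x ^ p)"
        unfolding abs_mult using Basis_le_norm[OF b, of x] by (intro mult_mono) auto
    qed
    also have "\<dots> = (\<Sum>b\<in>Basis. C b) * norm x ^ Suc p" unfolding sum_distrib_right by (rule sum.cong) simp_all
    finally show ?thesis .
  qed
  then show ?case by blast
qed

lemma smooth_vanish_Cw:
  fixes f :: "'e::euclidean_space \<Rightarrow> real"
  assumes S: "cball 0 r \<subseteq> S" and f: "smooth_on S f" "vanish p f"
  shows "Cw (ball 0 r) k p f"
  using f
proof (induction k arbitrary: p f)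
  case 0
  have "continuous_on (ball 0 r) f"
    by (rule continuous_on_subset[OF smooth_on_continuous_on[OF 0(1)]]) (use S in auto)
  moreover obtain C where "\<forall>x\<in>cball 0 r. \<bar>f x\<bar> \<le> C * norm x ^ p" using vanish_bound[OF S 0] by blast
  moreover have "ball 0 r \<subseteq> cball (0::'e) r" by auto
  ultimately show ?case unfolding Cw.simps by blast
next
  case (Suc k)
  obtain C where C: "\<forall>x\<in>cball 0 r. \<bar>f x\<bar> \<le> C * norm x ^ p" using vanish_bound[OF S Suc.prems] by blast
  have sub: "ball 0 r \<subseteq> cball (0::'e) r" by auto
  have "vanish (p - 1) (\<lambda>x. frechet_derivative f (at x) v)" for v using Suc.prems by (cases p) auto
  then have "Cw (ball 0 r) k (p - 1) (\<lambda>x. frechet_derivative f (at x) v)" for v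
    by (rule Suc.IH[OF smooth_on_frechet[OF Suc.prems(1)]])
  moreover have "f differentiable at x" if "x \<in> ball 0 r" for x
    by (rule smooth_on_differentiable[OF Suc.prems(1)]) (use S that in auto)
  ultimately show ?case using C sub unfolding Cw.simps by blast
qed

subsection \<open>The functional equation\<close>

text \<open>The Picard iterates, starting from \<open>0\<close>, of the linear system \<open>F\<^sub>i = (\<Sum>j. A\<^sub>i\<^sub>j (F\<^sub>j \<circ> \<phi>)) + B\<^sub>i\<close>.
  Systems with variable coefficients are considered, although in the end a single constant matrix is
  of interest, because differentiating an equation leads to a larger system whose
  coefficients involve the derivative of \<open>\<phi>\<close>.\<close>

primrec fe_iter :: "('i \<Rightarrow> 'i \<Rightarrow> 'e \<Rightarrow> real) \<Rightarrow> 'i set \<Rightarrow> ('i \<Rightarrow> 'e \<Rightarrow> real) \<Rightarrow> ('e \<Rightarrow> 'e) \<Rightarrow> nat \<Rightarrow> 'i \<Rightarrow> 'e \<Rightarrow> real" where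
  "fe_iter A I B \<phi> 0 = (\<lambda>i x. 0)"
| "fe_iter A I B \<phi> (Suc m) = (\<lambda>i x. (\<Sum>j\<in>I. A i j x * fe_iter A I B \<phi> m j (\<phi> x)) + B i x)"

text \<open>An unknown is indexed by \<open>(l, j)\<close>, where the list \<open>l\<close> records the directions in which the original
  unknown \<open>j\<close> has been differentiated. The first derivatives of a system are thus indexed by the same type
  as the system itself, as the induction on the order of differentiability requires.\<close>

definition ext_index :: "('e::euclidean_space list \<times> 'j) set \<Rightarrow> ('e list \<times> 'j) set" where
  "ext_index I = (\<lambda>(b, l, j). (b # l, j)) ` (Basis \<times> I)"

definition pre :: "'e \<Rightarrow> 'e list \<times> 'j \<Rightarrow> 'e list \<times> 'j" where "pre b i = (b # fst i, snd i)"
definition hdi :: "'e list \<times> 'j \<Rightarrow> 'e" where "hdi u = hd (fst u)"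
definition tli :: "'e list \<times> 'j \<Rightarrow> 'e list \<times> 'j" where "tli u = (tl (fst u), snd u)"

lemma pre_simps [simp]: "hdi (pre b i) = b" "tli (pre b i) = i"
  by (auto simp: pre_def hdi_def tli_def)

lemma ext_index_pre: "b \<in> Basis \<Longrightarrow> i \<in> I \<Longrightarrow> pre b i \<in> ext_index I"
  by (cases i) (force simp: ext_index_def pre_def image_iff)

lemma ext_indexE:
  assumes "u \<in> ext_index I"
  obtains b i where "b \<in> Basis" "i \<in> I" "u = pre b i"
  using assms by (force simp: ext_index_def pre_def)

lemma finite_ext_index: "finite I \<Longrightarrow> finite (ext_index I)"
  by (simp add: ext_index_def)

lemma sum_ext_index: "(\<Sum>u\<in>ext_index I. h u) = (\<Sum>b\<in>Basis. \<Sum>i\<in>I. h (pre b i))"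
proof -
  have "inj_on (\<lambda>(b, l, j). (b # l, j)) (Basis \<times> I)" by (auto simp: inj_on_def)
  then have "(\<Sum>u\<in>ext_index I. h u) = (\<Sum>(b,i)\<in>Basis \<times> I. h (pre b i))"
    unfolding ext_index_def by (subst sum.reindex) (auto simp: pre_def case_prod_unfold intro!: sum.cong)
  then show ?thesis by (simp add: sum.cartesian_product)
qed

text \<open>The bound on the absolute row sums of the derivative of \<open>\<phi>\<close>, rather than on its operator norm, is the
  one that passes to the differentiated system.\<close>

locale contraction_domain =
  fixes r c :: real and \<phi> :: "'e::euclidean_space \<Rightarrow> 'e"
  assumes r: "0 < r" "r \<le> 1" and c: "0 \<le> c" "c \<le> 1"
    and \<phi>_le: "\<And>x. x \<in> ball 0 r \<Longrightarrow> norm (\<phi> x) \<le> c * norm x"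
    and \<phi>_Cw: "\<And>k b. b \<in> Basis \<Longrightarrow> Cw (ball 0 r) k 0 (\<lambda>x. \<phi> x \<bullet> b)"
    and \<phi>_smooth: "smooth_on (ball 0 r) \<phi>"
    and \<phi>_deriv: "\<And>x a. x \<in> ball 0 r \<Longrightarrow> a \<in> Basis \<Longrightarrow>
      (\<Sum>b\<in>Basis. \<bar>frechet_derivative \<phi> (at x) a \<bullet> b\<bar>) \<le> c"
begin

abbreviation "U \<equiv> ball (0::'e) r"

lemma U: "open U" "U \<subseteq> ball 0 1" using r by auto

lemma \<phi>_le1: "x \<in> U \<Longrightarrow> norm (\<phi> x) \<le> norm x"
  using \<phi>_le[of x] c by (meson mult_left_le_one_le norm_ge_zero order_trans)

lemma \<phi>_U: "x \<in> U \<Longrightarrow> \<phi> x \<in> U"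
  using \<phi>_le1[of x] by auto

lemma Cw_phi: "Cw U k p f \<Longrightarrow> Cw U k p (\<lambda>x. f (\<phi> x))"
  by (rule Cw_compose[OF U \<phi>_U \<phi>_le1 \<phi>_smooth \<phi>_Cw])

lemma Cw_phi_deriv:
  assumes "b \<in> Basis" shows "Cw U k 0 (\<lambda>x. frechet_derivative \<phi> (at x) v \<bullet> b)"
proof -
  have "Cw U (Suc k) 0 (\<lambda>x. \<phi> x \<bullet> b)" by (rule \<phi>_Cw[OF assms])
  then have "Cw U k 0 (\<lambda>x. frechet_derivative (\<lambda>x. \<phi> x \<bullet> b) (at x) v)" by simp
  then show ?thesis
  proof (rule Cw_cong[OF U(1), rotated])
    fix x assume "x \<in> U"
    then show "frechet_derivative (\<lambda>x. \<phi> x \<bullet> b) (at x) v = frechet_derivative \<phi> (at x) v \<bullet> b"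
      using frechetI[OF bounded_linear.has_derivative[OF bounded_linear_inner_left smooth_on_has_derivative[OF \<phi>_smooth]]] by metis
  qed
qed

text \<open>One step of the iteration multiplies the weighted bound by \<open>q < 1\<close>: the row sums of the coefficients may exceed
  \<open>1\<close> as long as the factor \<open>c\<^sup>p\<close> gained from the weight compensates for it.\<close>

lemma weighted_step:
  assumes A: "(\<Sum>j\<in>I. \<bar>A j\<bar>) * c ^ p \<le> q" and C: "0 \<le> C" and x: "x \<in> U"
    and F: "\<And>j. j \<in> I \<Longrightarrow> \<bar>F j\<bar> \<le> C * norm (\<phi> x) ^ p"
  shows "\<bar>\<Sum>j\<in>I. A j * F j\<bar> \<le> q * (C * norm x ^ p)"
proof -
  have "\<bar>\<Sum>j\<in>I. A j * F j\<bar> \<le> (\<Sum>j\<in>I. \<bar>A j\<bar> * \<bar>F j\<bar>)" using sum_abs[of "\<lambda>j. A j * F j" I] by (simp add: abs_mult)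
  also have "\<dots> \<le> (\<Sum>j\<in>I. \<bar>A j\<bar> * (C * (c * norm x) ^ p))"
  proof (rule sum_mono, rule mult_left_mono)
    fix j assume "j \<in> I"
    then have "\<bar>F j\<bar> \<le> C * norm (\<phi> x) ^ p" by (rule F)
    also have "\<dots> \<le> C * (c * norm x) ^ p" by (intro mult_left_mono power_mono \<phi>_le x C) simp
    finally show "\<bar>F j\<bar> \<le> C * (c * norm x) ^ p" .
  qed simp
  also have "\<dots> = ((\<Sum>j\<in>I. \<bar>A j\<bar>) * c ^ p) * (C * norm x ^ p)"
    by (simp add: sum_distrib_right[symmetric] power_mult_distrib)
  also have "\<dots> \<le> q * (C * norm x ^ p)" by (intro mult_right_mono A) (use C in auto)
  finally show ?thesis .
qed

lemma fe_iter_converges: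
  assumes I: "finite I" and q: "0 \<le> q"
    and A: "\<And>x i. x \<in> U \<Longrightarrow> i \<in> I \<Longrightarrow> (\<Sum>j\<in>I. \<bar>A i j x\<bar>) * c ^ p \<le> q"
    and C: "0 \<le> C" "\<And>x i. x \<in> U \<Longrightarrow> i \<in> I \<Longrightarrow> \<bar>F i x\<bar> \<le> C * norm x ^ p"
    and F: "\<And>x i. x \<in> U \<Longrightarrow> i \<in> I \<Longrightarrow> F i x = (\<Sum>j\<in>I. A i j x * F j (\<phi> x)) + B i x"
  shows "x \<in> U \<Longrightarrow> i \<in> I \<Longrightarrow> \<bar>F i x - fe_iter A I B \<phi> m i x\<bar> \<le> C * q ^ m * norm x ^ p"
proof (induction m arbitrary: i x)
  case 0 then show ?case using C by simp
next
  case (Suc m)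
  have "F i x - fe_iter A I B \<phi> (Suc m) i x = (\<Sum>j\<in>I. A i j x * (F j (\<phi> x) - fe_iter A I B \<phi> m j (\<phi> x)))"
    using F[OF Suc.prems] by (simp add: algebra_simps sum_subtractf)
  also have "\<bar>\<dots>\<bar> \<le> q * (C * q ^ m * norm x ^ p)"
    by (rule weighted_step[OF A[OF Suc.prems] _ Suc.prems(1) Suc.IH[OF \<phi>_U[OF Suc.prems(1)]]])
       (use C q in auto)
  finally show ?case by (simp add: mult_ac)
qed

text \<open>Successive iterates differ by a geometric sequence times \<open>|x|\<^sup>p\<close>, so they converge to a solution.\<close>

lemma fe_solution_exists:
  assumes I: "finite I" and q: "0 \<le> q" "q < 1"
    and A: "\<And>x i. x \<in> U \<Longrightarrow> i \<in> I \<Longrightarrow> (\<Sum>j\<in>I. \<bar>A i j x\<bar>) * c ^ p \<le> q"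
    and B: "\<And>i. i \<in> I \<Longrightarrow> \<exists>C. \<forall>x\<in>U. \<bar>B i x\<bar> \<le> C * norm x ^ p"
  shows "\<exists>F. \<exists>C\<ge>0. (\<forall>x\<in>U. \<forall>i\<in>I. \<bar>F i x\<bar> \<le> C * norm x ^ p) \<and>
    (\<forall>x\<in>U. \<forall>i\<in>I. F i x = (\<Sum>j\<in>I. A i j x * F j (\<phi> x)) + B i x)"
proof -
  have "\<forall>i\<in>I. \<exists>C\<ge>0. \<forall>x\<in>U. \<bar>B i x\<bar> \<le> C * norm x ^ p" using B bound_nonneg by blast
  then obtain C0 where C0: "\<And>i. i \<in> I \<Longrightarrow> C0 i \<ge> 0" "\<And>i x. i \<in> I \<Longrightarrow> x \<in> U \<Longrightarrow> \<bar>B i x\<bar> \<le> C0 i * norm x ^ p"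
    by metis
  define C where "C = (\<Sum>i\<in>I. C0 i)"
  have C: "C \<ge> 0" "\<And>i x. i \<in> I \<Longrightarrow> x \<in> U \<Longrightarrow> \<bar>B i x\<bar> \<le> C * norm x ^ p"
  proof -
    show "C \<ge> 0" unfolding C_def using C0 by (simp add: sum_nonneg)
    fix i x assume i: "i \<in> I" "x \<in> U"
    have "C0 i \<le> C" unfolding C_def by (rule member_le_sum) (use i I C0 in auto)
    then show "\<bar>B i x\<bar> \<le> C * norm x ^ p" using C0(2)[OF i] by (meson mult_right_mono norm_ge_zero order_trans zero_le_power)
  qed
  let ?F = "fe_iter A I B \<phi>"
  have step: "\<bar>?F (Suc m) i x - ?F m i x\<bar> \<le> C * q ^ m * norm x ^ p" if "x \<in> U" "i \<in> I" for m i x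
    using that
  proof (induction m arbitrary: i x)
    case 0 then show ?case using C by simp
  next
    case (Suc m)
    have "?F (Suc (Suc m)) i x - ?F (Suc m) i x = (\<Sum>j\<in>I. A i j x * (?F (Suc m) j (\<phi> x) - ?F m j (\<phi> x)))"
      by (simp add: algebra_simps sum_subtractf)
    also have "\<bar>\<dots>\<bar> \<le> q * (C * q ^ m * norm x ^ p)"
      by (rule weighted_step[OF A[OF Suc.prems] _ Suc.prems(1) Suc.IH[OF \<phi>_U[OF Suc.prems(1)]]])
         (use C q in auto)
    finally show ?case by (simp add: mult_ac)
  qed
  define F where "F i x = (\<Sum>m. ?F (Suc m) i x - ?F m i x)" for i x
  have geo: "summable (\<lambda>m. C * q ^ m * norm x ^ p)" for x :: 'e
    by (intro summable_mult summable_mult2 summable_geometric) (use q in auto)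
  have summ: "summable (\<lambda>m. \<bar>?F (Suc m) i x - ?F m i x\<bar>)" if "x \<in> U" "i \<in> I" for i x
    by (rule summable_comparison_test[OF _ geo[of x]]) (use step that in auto)
  have lim: "(\<lambda>m. ?F m i x) \<longlonglongrightarrow> F i x" if "x \<in> U" "i \<in> I" for i x
  proof -
    have "(\<lambda>m. \<Sum>k<m. ?F (Suc k) i x - ?F k i x) \<longlonglongrightarrow> F i x"
      unfolding F_def by (rule summable_LIMSEQ[OF summable_rabs_cancel[OF summ[OF that]]])
    moreover have "(\<Sum>k<m. ?F (Suc k) i x - ?F k i x) = ?F m i x" for m
      using sum_lessThan_telescope[of "\<lambda>k. ?F k i x" m] by (simp del: fe_iter.simps(2))
    ultimately show ?thesis by (simp only:)
  qed
  have "\<bar>F i x\<bar> \<le> C / (1 - q) * norm x ^ p" if "x \<in> U" "i \<in> I" for i x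
  proof -
    have "\<bar>F i x\<bar> \<le> (\<Sum>m. \<bar>?F (Suc m) i x - ?F m i x\<bar>)" unfolding F_def by (rule summable_rabs[OF summ[OF that]])
    also have "\<dots> \<le> (\<Sum>m. C * q ^ m * norm x ^ p)" by (rule suminf_le[OF step[OF that] summ[OF that] geo])
    also have "\<dots> = C * (1 / (1 - q)) * norm x ^ p"
      using q by (simp add: suminf_mult suminf_mult2[symmetric] suminf_geometric summable_geometric summable_mult)
    finally show ?thesis by simp
  qed
  moreover have "F i x = (\<Sum>j\<in>I. A i j x * F j (\<phi> x)) + B i x" if "x \<in> U" "i \<in> I" for i x
  proof (rule LIMSEQ_unique)
    show "(\<lambda>m. ?F (Suc m) i x) \<longlonglongrightarrow> F i x" by (rule LIMSEQ_Suc[OF lim[OF that]])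
    show "(\<lambda>m. ?F (Suc m) i x) \<longlonglongrightarrow> (\<Sum>j\<in>I. A i j x * F j (\<phi> x)) + B i x"
      unfolding fe_iter.simps by (intro tendsto_add tendsto_sum tendsto_mult tendsto_const lim \<phi>_U that)
  qed
  ultimately show ?thesis using C q by (intro exI[of _ F] exI[of _ "C / (1 - q)"]) auto
qed

lemma fe_iter_Cw:
  assumes "finite I" "\<And>i j. i \<in> I \<Longrightarrow> j \<in> I \<Longrightarrow> Cw U k 0 (A i j)" "\<And>i. i \<in> I \<Longrightarrow> Cw U k p (B i)"
  shows "i \<in> I \<Longrightarrow> Cw U k p (fe_iter A I B \<phi> m i)"
proof (induction m arbitrary: i)
  case 0 then show ?case using Cw_zero[OF U(1)] by simp
next
  case (Suc m)
  show ?case unfolding fe_iter.simps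
    by (rule Cw_add[OF U(1)], rule Cw_sum[OF U(1)], rule Cw_mult[OF U], rule assms, rule Suc, assumption, rule Cw_phi, rule Suc.IH)
       (use assms Suc in auto)
qed

text \<open>The coefficients and the right-hand side of the system that the first derivatives of a solution
  \<open>F\<close> satisfy: the coefficients are multiplied by those of the derivative of \<open>\<phi>\<close>, while the derivatives of
  the coefficients join the right-hand side.\<close>

definition "fe_A' A = (\<lambda>u v x. A (tli u) (tli v) x * (frechet_derivative \<phi> (at x) (hdi u) \<bullet> hdi v))"
definition "fe_B' A I B F = (\<lambda>u x. (\<Sum>j\<in>I. frechet_derivative (A (tli u) j) (at x) (hdi u) * F j (\<phi> x)) +
    frechet_derivative (B (tli u)) (at x) (hdi u))"

text \<open>Differentiation lowers the weight by one, but the factor \<open>c\<close> lost in this way is returned by the derivative of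
  \<open>\<phi>\<close>. Hence the same \<open>q\<close> works for the differentiated system.\<close>

lemma fe_A'_bound:
  assumes I: "finite I" and A: "\<And>i. i \<in> I \<Longrightarrow> (\<Sum>j\<in>I. \<bar>A i j x\<bar>) * c ^ p \<le> q" and x: "x \<in> U" and u: "u \<in> ext_index I"
  shows "(\<Sum>v\<in>ext_index I. \<bar>fe_A' A u v x\<bar>) * c ^ (p - 1) \<le> q"
proof -
  obtain b i where bi: "b \<in> Basis" "i \<in> I" "u = pre b i" using u by (rule ext_indexE)
  have "(\<Sum>v\<in>ext_index I. \<bar>fe_A' A u v x\<bar>) = (\<Sum>b'\<in>Basis. \<bar>frechet_derivative \<phi> (at x) b \<bullet> b'\<bar>) * (\<Sum>j\<in>I. \<bar>A i j x\<bar>)"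
    unfolding sum_ext_index fe_A'_def bi sum_product by (simp add: abs_mult mult.commute)
  also have "\<dots> \<le> c * (\<Sum>j\<in>I. \<bar>A i j x\<bar>)" by (intro mult_right_mono \<phi>_deriv x bi sum_nonneg) simp
  finally have "(\<Sum>v\<in>ext_index I. \<bar>fe_A' A u v x\<bar>) * c ^ (p - 1) \<le> c * (\<Sum>j\<in>I. \<bar>A i j x\<bar>) * c ^ (p - 1)"
    by (intro mult_right_mono) (use c in auto)
  also have "\<dots> = (\<Sum>j\<in>I. \<bar>A i j x\<bar>) * (c * c ^ (p - 1))" by simp
  also have "\<dots> \<le> (\<Sum>j\<in>I. \<bar>A i j x\<bar>) * c ^ p"
  proof (rule mult_left_mono)
    show "c * c ^ (p - 1) \<le> c ^ p" using c by (cases p) auto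
  qed (simp add: sum_nonneg)
  also have "\<dots> \<le> q" by (rule A[OF bi(2)])
  finally show ?thesis .
qed

lemma fe_A'_Cw:
  assumes "\<And>i j. i \<in> I \<Longrightarrow> j \<in> I \<Longrightarrow> Cw U k 0 (A i j)" "u \<in> ext_index I" "v \<in> ext_index I"
  shows "Cw U k 0 (fe_A' A u v)"
proof -
  obtain b i where bi: "b \<in> Basis" "i \<in> I" "u = pre b i" using assms(2) by (rule ext_indexE)
  obtain b' j where bj: "b' \<in> Basis" "j \<in> I" "v = pre b' j" using assms(3) by (rule ext_indexE)
  show ?thesis unfolding fe_A'_def
    by (rule Cw_mult[OF U]) (use bi bj assms(1) Cw_phi_deriv in auto)
qed

lemma fe_B'_Cw:
  assumes "finite I" "\<And>i j. i \<in> I \<Longrightarrow> j \<in> I \<Longrightarrow> Cw U (Suc k) 0 (A i j)" "\<And>i. i \<in> I \<Longrightarrow> Cw U (Suc k) p (B i)"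
    "\<And>i. i \<in> I \<Longrightarrow> Cw U k p (F i)" "u \<in> ext_index I"
  shows "Cw U k (p - 1) (fe_B' A I B F u)"
proof -
  obtain b i where bi: "b \<in> Basis" "i \<in> I" "u = pre b i" using assms(5) by (rule ext_indexE)
  show ?thesis unfolding fe_B'_def
  proof (rule Cw_add[OF U(1)], rule Cw_sum[OF U(1)], rule Cw_mult[OF U])
    fix j assume j: "j \<in> I"
    show "Cw U k 0 (\<lambda>x. frechet_derivative (A (tli u) j) (at x) (hdi u))" using assms(2)[OF bi(2) j] bi by simp
    show "Cw U k (p - 1) (\<lambda>x. F j (\<phi> x))" by (rule Cw_weaken[OF U(2) Cw_phi[OF assms(4)[OF j]]]) simp
  next
    show "Cw U k (p - 1) (\<lambda>x. frechet_derivative (B (tli u)) (at x) (hdi u))" using assms(3)[OF bi(2)] bi by simp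
  qed
qed

lemma fe_iter_deriv_Suc:
  assumes I: "finite I" and A: "\<And>i j. i \<in> I \<Longrightarrow> j \<in> I \<Longrightarrow> Cw U 1 0 (A i j)" and B: "\<And>i. i \<in> I \<Longrightarrow> Cw U 1 p (B i)"
    and x: "x \<in> U" and i: "i \<in> I" and b: "b \<in> Basis"
  shows "frechet_derivative (fe_iter A I B \<phi> (Suc m) i) (at x) b =
    (\<Sum>v\<in>ext_index I. fe_A' A (pre b i) v x * frechet_derivative (fe_iter A I B \<phi> m (tli v)) (at (\<phi> x)) (hdi v)) +
    fe_B' A I B (fe_iter A I B \<phi> m) (pre b i) x"
proof -
  let ?F = "fe_iter A I B \<phi> m"
  have FD: "?F j differentiable at y" if "j \<in> I" "y \<in> U" for j y
    using fe_iter_Cw[OF I A B that(1), where m=m] that(2) by simp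
  have AD: "A i j differentiable at x" if "j \<in> I" for j using A[OF i that] x by simp
  have BD: "B i differentiable at x" using B[OF i] x by simp
  have comp: "((\<lambda>x. ?F j (\<phi> x)) has_derivative (\<lambda>v. frechet_derivative (?F j) (at (\<phi> x)) (frechet_derivative \<phi> (at x) v))) (at x)" if "j \<in> I" for j
    using diff_chain_at[OF smooth_on_has_derivative[OF \<phi>_smooth x] has_frechet[OF FD[OF that \<phi>_U[OF x]]]] by (simp add: o_def)
  have "(fe_iter A I B \<phi> (Suc m) i has_derivative
     (\<lambda>v. (\<Sum>j\<in>I. A i j x * frechet_derivative (?F j) (at (\<phi> x)) (frechet_derivative \<phi> (at x) v) + frechet_derivative (A i j) (at x) v * ?F j (\<phi> x))
       + frechet_derivative (B i) (at x) v)) (at x)"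
    unfolding fe_iter.simps
    by (intro has_derivative_add has_derivative_sum has_derivative_mult has_frechet AD BD comp)
  then have "frechet_derivative (fe_iter A I B \<phi> (Suc m) i) (at x) b =
     (\<Sum>j\<in>I. A i j x * frechet_derivative (?F j) (at (\<phi> x)) (frechet_derivative \<phi> (at x) b) + frechet_derivative (A i j) (at x) b * ?F j (\<phi> x))
       + frechet_derivative (B i) (at x) b"
    by (simp only: frechetI)
  also have "\<dots> = (\<Sum>j\<in>I. A i j x * frechet_derivative (?F j) (at (\<phi> x)) (frechet_derivative \<phi> (at x) b)) + fe_B' A I B ?F (pre b i) x"
    by (simp add: sum.distrib fe_B'_def)
  also have "(\<Sum>j\<in>I. A i j x * frechet_derivative (?F j) (at (\<phi> x)) (frechet_derivative \<phi> (at x) b)) =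
      (\<Sum>j\<in>I. \<Sum>b'\<in>Basis. A i j x * ((frechet_derivative \<phi> (at x) b \<bullet> b') * frechet_derivative (?F j) (at (\<phi> x)) b'))"
  proof (rule sum.cong[OF refl])
    fix j assume j: "j \<in> I"
    show "A i j x * frechet_derivative (?F j) (at (\<phi> x)) (frechet_derivative \<phi> (at x) b) =
      (\<Sum>b'\<in>Basis. A i j x * ((frechet_derivative \<phi> (at x) b \<bullet> b') * frechet_derivative (?F j) (at (\<phi> x)) b'))"
      by (subst frechet_basis_sum[OF FD[OF j \<phi>_U[OF x]], of "frechet_derivative \<phi> (at x) b"]) (simp add: sum_distrib_left)
  qed
  also have "\<dots> = (\<Sum>v\<in>ext_index I. fe_A' A (pre b i) v x * frechet_derivative (?F (tli v)) (at (\<phi> x)) (hdi v))"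
    unfolding sum_ext_index by (subst sum.swap) (simp add: fe_A'_def mult.assoc)
  finally show ?thesis .
qed

text \<open>The derivatives of the iterates nearly satisfy the recursion for the differentiated system, with an error
  that decays geometrically because the iterates themselves converge. So they converge uniformly to the solution
  \<open>G\<close> of that system, and a limit of functions whose derivatives converge uniformly may be differentiated termwise.\<close>

lemma fe_solution_differentiable:
  assumes I: "finite I" and q: "0 \<le> q" "q < 1"
    and Ab: "\<And>x i. x \<in> U \<Longrightarrow> i \<in> I \<Longrightarrow> (\<Sum>j\<in>I. \<bar>A i j x\<bar>) * c ^ p \<le> q"
    and A: "\<And>i j. i \<in> I \<Longrightarrow> j \<in> I \<Longrightarrow> Cw U 1 0 (A i j)" and B: "\<And>i. i \<in> I \<Longrightarrow> Cw U 1 p (B i)"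
    and C: "0 \<le> C" "\<And>x i. x \<in> U \<Longrightarrow> i \<in> I \<Longrightarrow> \<bar>F i x\<bar> \<le> C * norm x ^ p"
    and F: "\<And>x i. x \<in> U \<Longrightarrow> i \<in> I \<Longrightarrow> F i x = (\<Sum>j\<in>I. A i j x * F j (\<phi> x)) + B i x"
    and D: "0 \<le> D" "\<And>x u. x \<in> U \<Longrightarrow> u \<in> ext_index I \<Longrightarrow> \<bar>G u x\<bar> \<le> D * norm x ^ (p - 1)"
    and G: "\<And>x u. x \<in> U \<Longrightarrow> u \<in> ext_index I \<Longrightarrow>
      G u x = (\<Sum>v\<in>ext_index I. fe_A' A u v x * G v (\<phi> x)) + fe_B' A I B F u x"
    and i: "i \<in> I" and x: "x \<in> U"
  shows "(F i has_derivative (\<lambda>h. \<Sum>b\<in>Basis. (h \<bullet> b) * G (pre b i) x)) (at x)"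
proof -
  let ?F = "fe_iter A I B \<phi>"
  define dF where "dF m u x = frechet_derivative (?F m (tli u)) (at x) (hdi u)" for m u x
  have FD: "?F m j differentiable at y" if "j \<in> I" "y \<in> U" for m j y
    using fe_iter_Cw[OF I A B that(1), where m=m] that(2) by simp
  obtain K where K: "K \<ge> 0" "\<And>i j b x. i \<in> I \<Longrightarrow> j \<in> I \<Longrightarrow> b \<in> Basis \<Longrightarrow> x \<in> U \<Longrightarrow> \<bar>frechet_derivative (A i j) (at x) b\<bar> \<le> K"
  proof -
    have "\<exists>C\<ge>0. \<forall>x\<in>U. \<bar>frechet_derivative (A i j) (at x) b\<bar> \<le> C * norm x ^ 0" if "i \<in> I" "j \<in> I" for i j b
      by (rule Cw_bound[of _ 0]) (use A[OF that] in simp)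
    then have "\<forall>t\<in>I\<times>I\<times>Basis. \<exists>C\<ge>0. \<forall>x\<in>U. \<bar>frechet_derivative (A (fst t) (fst (snd t))) (at x) (snd (snd t))\<bar> \<le> C"
      by auto
    then obtain k where k: "\<And>t. t\<in>I\<times>I\<times>Basis \<Longrightarrow> k t \<ge> 0 \<and> (\<forall>x\<in>U. \<bar>frechet_derivative (A (fst t) (fst (snd t))) (at x) (snd (snd t))\<bar> \<le> k t)"
      by metis
    have fin: "finite (I \<times> I \<times> (Basis::'e set))" using I by simp
    show thesis
    proof (rule that[of "\<Sum>t\<in>I\<times>I\<times>(Basis::'e set). k t"])
      show "0 \<le> (\<Sum>t\<in>I\<times>I\<times>Basis. k t)" by (intro sum_nonneg) (use k in auto)
      fix i j b x assume *: "i \<in> I" "j \<in> I" "b \<in> (Basis::'e set)" "x \<in> U"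
      have "k (i,j,b) \<le> (\<Sum>t\<in>I\<times>I\<times>Basis. k t)" by (rule member_le_sum) (use * k fin in auto)
      then show "\<bar>frechet_derivative (A i j) (at x) b\<bar> \<le> (\<Sum>t\<in>I\<times>I\<times>Basis. k t)" using k[of "(i,j,b)"] * by fastforce
    qed
  qed
  \<comment> \<open>the error made in each step is of size \<open>q\<^sup>m\<close>, so a rate slightly worse than \<open>q\<close> absorbs its accumulation\<close>
  define q' where "q' = (q + 1) / 2"
  have q': "q < q'" "0 < q'" "q' < 1" using q by (auto simp: q'_def)
  define K' where "K' = card I * (K * C)"
  have K': "K' \<ge> 0" using K C by (simp add: K'_def)
  define D' where "D' = max D (K' / (q' - q))"
  have D': "D' \<ge> 0" "D \<le> D'" "q * D' + K' \<le> D' * q'"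
  proof -
    show "D' \<ge> 0" "D \<le> D'" using D by (auto simp: D'_def)
    have "K' / (q' - q) \<le> D'" by (simp add: D'_def)
    then have "K' \<le> D' * (q' - q)" using q' by (simp add: field_simps)
    then show "q * D' + K' \<le> D' * q'" by (simp add: algebra_simps)
  qed
  have err: "\<bar>dF m u x - G u x\<bar> \<le> D' * q' ^ m * norm x ^ (p - 1)" if "x \<in> U" "u \<in> ext_index I" for m u x
    using that
  proof (induction m arbitrary: u x)
    case 0
    have "\<bar>G u x\<bar> \<le> D' * norm x ^ (p - 1)" using D(2)[OF 0] D'(2) by (meson mult_right_mono norm_ge_zero order_trans zero_le_power)
    moreover have "dF 0 u x = 0" by (simp add: dF_def)
    ultimately show ?case by simp
  next
    case (Suc m)
    obtain b i where bi: "b \<in> Basis" "i \<in> I" "u = pre b i" using Suc.prems(2) by (rule ext_indexE)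
    have "dF (Suc m) u x = (\<Sum>v\<in>ext_index I. fe_A' A u v x * dF m v (\<phi> x)) + fe_B' A I B (?F m) u x"
      unfolding dF_def bi pre_simps by (rule fe_iter_deriv_Suc[OF I A B Suc.prems(1) bi(2,1)])
    then have "dF (Suc m) u x - G u x = (\<Sum>v\<in>ext_index I. fe_A' A u v x * (dF m v (\<phi> x) - G v (\<phi> x)))
       + (\<Sum>j\<in>I. frechet_derivative (A i j) (at x) b * (?F m j (\<phi> x) - F j (\<phi> x)))"
      unfolding G[OF Suc.prems] by (simp add: fe_B'_def bi algebra_simps sum_subtractf)
    moreover have "\<bar>\<Sum>v\<in>ext_index I. fe_A' A u v x * (dF m v (\<phi> x) - G v (\<phi> x))\<bar> \<le> q * ((D' * q' ^ m) * norm x ^ (p - 1))"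
      by (rule weighted_step[OF fe_A'_bound[where A=A, OF I Ab[OF Suc.prems(1)] Suc.prems] _ Suc.prems(1) Suc.IH[OF \<phi>_U[OF Suc.prems(1)]]])
         (use D' q' in auto)
    moreover have "\<bar>\<Sum>j\<in>I. frechet_derivative (A i j) (at x) b * (?F m j (\<phi> x) - F j (\<phi> x))\<bar> \<le> K' * q ^ m * norm x ^ (p - 1)"
    proof -
      have "\<bar>\<Sum>j\<in>I. frechet_derivative (A i j) (at x) b * (?F m j (\<phi> x) - F j (\<phi> x))\<bar>
         \<le> (\<Sum>j\<in>I. \<bar>frechet_derivative (A i j) (at x) b\<bar> * \<bar>F j (\<phi> x) - ?F m j (\<phi> x)\<bar>)"
        using sum_abs[of "\<lambda>j. frechet_derivative (A i j) (at x) b * (?F m j (\<phi> x) - F j (\<phi> x))" I] by (simp add: abs_mult abs_minus_commute)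
      also have "\<dots> \<le> (\<Sum>j\<in>I. K * (C * q ^ m * norm x ^ (p - 1)))"
      proof (rule sum_mono, rule mult_mono)
        fix j assume j: "j \<in> I"
        show "\<bar>frechet_derivative (A i j) (at x) b\<bar> \<le> K" by (rule K(2)[OF bi(2) j bi(1) Suc.prems(1)])
        have "\<bar>F j (\<phi> x) - ?F m j (\<phi> x)\<bar> \<le> C * q ^ m * norm (\<phi> x) ^ p"
          by (rule fe_iter_converges[OF I q(1) Ab C F \<phi>_U[OF Suc.prems(1)] j])
        also have "norm (\<phi> x) ^ p \<le> norm x ^ p" by (rule power_mono[OF \<phi>_le1[OF Suc.prems(1)]]) simp
        also have "norm x ^ p \<le> norm x ^ (p - 1)" using Suc.prems(1) r by (intro power_decreasing) auto
        finally show "\<bar>F j (\<phi> x) - ?F m j (\<phi> x)\<bar> \<le> C * q ^ m * norm x ^ (p - 1)"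
          using C q by (simp add: mult_left_mono)
      qed (use K in auto)
      also have "\<dots> = K' * q ^ m * norm x ^ (p - 1)" by (simp add: K'_def)
      finally show ?thesis .
    qed
    ultimately have "\<bar>dF (Suc m) u x - G u x\<bar> \<le> q * ((D' * q' ^ m) * norm x ^ (p - 1)) + K' * q ^ m * norm x ^ (p - 1)"
      by linarith
    also have "\<dots> \<le> q * ((D' * q' ^ m) * norm x ^ (p - 1)) + K' * q' ^ m * norm x ^ (p - 1)"
      by (intro add_left_mono mult_right_mono mult_left_mono power_mono) (use q' q K' in auto)
    also have "\<dots> = (q * D' + K') * (q' ^ m * norm x ^ (p - 1))" by (simp add: algebra_simps)
    also have "\<dots> \<le> (D' * q') * (q' ^ m * norm x ^ (p - 1))" by (rule mult_right_mono[OF D'(3)]) (use q' in auto)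
    finally show ?case by (simp add: mult_ac)
  qed
  define N where "N = real DIM('e)"
  have "\<exists>g. \<forall>x\<in>U. (\<lambda>m. ?F m i x) \<longlonglongrightarrow> g x \<and> (g has_derivative (\<lambda>h. \<Sum>b\<in>Basis. (h \<bullet> b) * G (pre b i) x)) (at x within U)"
  proof (rule has_derivative_sequence[where f'="\<lambda>m x. frechet_derivative (?F m i) (at x)"])
    show "(?F m i has_derivative frechet_derivative (?F m i) (at x)) (at x within U)" if "x \<in> U" for m x
      by (rule has_derivative_at_withinI[OF has_frechet[OF FD[OF i that]]])
    show "(0::'e) \<in> U" using r by simp
    have "\<bar>F i 0 - ?F m i 0\<bar> \<le> C * q ^ m" for m
    proof -
      have "\<bar>F i 0 - ?F m i 0\<bar> \<le> C * q ^ m * norm (0::'e) ^ p"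
        by (rule fe_iter_converges[OF I q(1) Ab C F _ i]) (use r in auto)
      also have "\<dots> \<le> C * q ^ m" using C q by (cases p) auto
      finally show ?thesis .
    qed
    moreover have "(\<lambda>m. C * q ^ m) \<longlonglongrightarrow> 0" using q by (intro tendsto_mult_right_zero LIMSEQ_realpow_zero) auto
    ultimately have "(\<lambda>m. F i 0 - ?F m i 0) \<longlonglongrightarrow> 0" by (intro Lim_null_comparison[of "\<lambda>m. F i 0 - ?F m i 0" "\<lambda>m. C * q ^ m"]) auto
    then have "(\<lambda>m. F i 0 - (F i 0 - ?F m i 0)) \<longlonglongrightarrow> F i 0 - 0" by (intro tendsto_diff tendsto_const)
    then show "(\<lambda>m. ?F m i 0) \<longlonglongrightarrow> F i 0" by simp
    fix e :: real assume e: "e > 0"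
    have "(\<lambda>m. N * (D' * q' ^ m)) \<longlonglongrightarrow> 0" using q' by (intro tendsto_mult_right_zero LIMSEQ_realpow_zero) auto
    then have "\<forall>\<^sub>F m in sequentially. N * (D' * q' ^ m) < e" using e order_tendstoD(2) by blast
    then show "\<forall>\<^sub>F m in sequentially. \<forall>x\<in>U. \<forall>h. norm (frechet_derivative (?F m i) (at x) h - (\<Sum>b\<in>Basis. (h \<bullet> b) * G (pre b i) x)) \<le> e * norm h"
    proof eventually_elim
      case (elim m)
      show ?case
      proof (intro ballI allI)
        fix x h assume x: "x \<in> U"
        have "frechet_derivative (?F m i) (at x) h = (\<Sum>b\<in>Basis. (h \<bullet> b) * dF m (pre b i) x)"
          unfolding dF_def pre_simps by (rule frechet_basis_sum[OF FD[OF i x], unfolded real_scaleR_def])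
        then have "norm (frechet_derivative (?F m i) (at x) h - (\<Sum>b\<in>Basis. (h \<bullet> b) * G (pre b i) x))
            = \<bar>\<Sum>b\<in>Basis. (h \<bullet> b) * (dF m (pre b i) x - G (pre b i) x)\<bar>"
          by (simp add: algebra_simps sum_subtractf)
        also have "\<dots> \<le> (\<Sum>b\<in>Basis. \<bar>(h \<bullet> b) * (dF m (pre b i) x - G (pre b i) x)\<bar>)" by (rule sum_abs)
        also have "\<dots> \<le> (\<Sum>b\<in>(Basis::'e set). norm h * (D' * q' ^ m))"
        proof (rule sum_mono)
          fix b :: 'e assume b: "b \<in> Basis"
          have "\<bar>dF m (pre b i) x - G (pre b i) x\<bar> \<le> D' * q' ^ m * norm x ^ (p - 1)" by (rule err[OF x ext_index_pre[OF b i]])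
          also have "\<dots> \<le> D' * q' ^ m * 1" by (intro mult_left_mono power_le_one) (use x r D' q' in auto)
          finally show "\<bar>(h \<bullet> b) * (dF m (pre b i) x - G (pre b i) x)\<bar> \<le> norm h * (D' * q' ^ m)"
            unfolding abs_mult using Basis_le_norm[OF b, of h] by (intro mult_mono) auto
        qed
        also have "\<dots> = N * (D' * q' ^ m) * norm h" by (simp add: N_def)
        also have "\<dots> \<le> e * norm h" using elim by (intro mult_right_mono) auto
        finally show "norm (frechet_derivative (?F m i) (at x) h - (\<Sum>b\<in>Basis. (h \<bullet> b) * G (pre b i) x)) \<le> e * norm h" .
      qed
    qed
  qed simp
  then obtain g where g: "\<And>x. x \<in> U \<Longrightarrow> (\<lambda>m. ?F m i x) \<longlonglongrightarrow> g x"
    "\<And>x. x \<in> U \<Longrightarrow> (g has_derivative (\<lambda>h. \<Sum>b\<in>Basis. (h \<bullet> b) * G (pre b i) x)) (at x within U)" by blast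
  have gF: "g y = F i y" if y: "y \<in> U" for y
  proof (rule LIMSEQ_unique[OF g(1)[OF y]])
    have "\<bar>F i y - ?F m i y\<bar> \<le> C * q ^ m * norm y ^ p" for m
      by (rule fe_iter_converges[OF I q(1) Ab C F y i])
    moreover have "(\<lambda>m. C * q ^ m * norm y ^ p) \<longlonglongrightarrow> 0"
      using q by (intro tendsto_mult_left_zero tendsto_mult_right_zero LIMSEQ_realpow_zero) auto
    ultimately have "(\<lambda>m. F i y - ?F m i y) \<longlonglongrightarrow> 0" by (intro Lim_null_comparison[of "\<lambda>m. F i y - ?F m i y" "\<lambda>m. C * q ^ m * norm y ^ p"]) auto
    then have "(\<lambda>m. F i y - (F i y - ?F m i y)) \<longlonglongrightarrow> F i y - 0" by (intro tendsto_diff tendsto_const)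
    then show "(\<lambda>m. ?F m i y) \<longlonglongrightarrow> F i y" by simp
  qed
  have "(g has_derivative (\<lambda>h. \<Sum>b\<in>Basis. (h \<bullet> b) * G (pre b i) x)) (at x)"
    using g(2)[OF x] x by (simp add: at_within_open[OF x U(1)])
  then show ?thesis by (rule has_derivative_transform_within_open[OF _ U(1) x]) (rule gF)
qed

text \<open>A solution of weight \<open>p\<close> inherits the regularity of the right-hand side: by the preceding lemma its derivatives
  solve a system of the same kind, to which the induction hypothesis applies.\<close>

lemma fe_solution_regular:
  fixes I :: "('e list \<times> 'j) set"
  assumes "finite I" and q: "0 \<le> q" "q < 1"
    and "\<And>x i. x \<in> U \<Longrightarrow> i \<in> I \<Longrightarrow> (\<Sum>j\<in>I. \<bar>A i j x\<bar>) * c ^ p \<le> q"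
    and "\<And>k i j. i \<in> I \<Longrightarrow> j \<in> I \<Longrightarrow> Cw U k 0 (A i j)" and "\<And>i. i \<in> I \<Longrightarrow> Cw U k p (B i)"
    and "0 \<le> C" "\<And>x i. x \<in> U \<Longrightarrow> i \<in> I \<Longrightarrow> \<bar>F i x\<bar> \<le> C * norm x ^ p"
    and "\<And>x i. x \<in> U \<Longrightarrow> i \<in> I \<Longrightarrow> F i x = (\<Sum>j\<in>I. A i j x * F j (\<phi> x)) + B i x"
    and "i \<in> I"
  shows "Cw U k p (F i)"
  using assms(1,4-)
proof (induction k arbitrary: I A B F C p i)
  case (0 I A B F C p i)
  have "continuous_on U (F i)"
  proof (rule uniform_limit_theorem[OF always_eventually])
    show "\<forall>m. continuous_on U (fe_iter A I B \<phi> m i)"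
    proof
      fix m
      have "Cw U 0 p (fe_iter A I B \<phi> m i)"
        by (rule fe_iter_Cw[OF 0(1,3,4,8)])
      then show "continuous_on U (fe_iter A I B \<phi> m i)" by simp
    qed
    show "uniform_limit U (\<lambda>m. fe_iter A I B \<phi> m i) (F i) sequentially"
      unfolding uniform_limit_iff
    proof (intro allI impI)
      fix e :: real assume "e > 0"
      have "(\<lambda>m. C * q ^ m) \<longlonglongrightarrow> 0" using q by (intro tendsto_mult_right_zero LIMSEQ_realpow_zero) auto
      then have "\<forall>\<^sub>F m in sequentially. C * q ^ m < e" using \<open>e > 0\<close> order_tendstoD(2) by blast
      then show "\<forall>\<^sub>F m in sequentially. \<forall>x\<in>U. dist (fe_iter A I B \<phi> m i x) (F i x) < e"
      proof eventually_elim
        case (elim m)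
        show ?case
        proof
          fix x assume x: "x \<in> U"
          have "\<bar>F i x - fe_iter A I B \<phi> m i x\<bar> \<le> C * q ^ m * norm x ^ p"
            by (rule fe_iter_converges[OF 0(1) q(1) 0(2) 0(5,6,7) x 0(8)])
          also have "\<dots> \<le> C * q ^ m * 1" by (intro mult_left_mono power_le_one) (use x r 0(5) q in auto)
          finally show "dist (fe_iter A I B \<phi> m i x) (F i x) < e" using elim by (simp add: dist_real_def abs_minus_commute)
        qed
      qed
    qed
  qed simp
  then show ?case using 0(6,8) unfolding Cw.simps by blast
next
  case (Suc k I A B F C p i)
  note I = Suc.prems(1) and Ab = Suc.prems(2) and A = Suc.prems(3) and B = Suc.prems(4) and C = Suc.prems(5,6) and F = Suc.prems(7) and i = Suc.prems(8)
  have Bk: "Cw U k p (B j)" if "j \<in> I" for j by (rule Cw_Suc_imp[OF B[OF that]])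
  have Fk: "Cw U k p (F j)" if "j \<in> I" for j
    by (rule Suc.IH[OF I Ab A Bk C F that])
  have B1: "Cw U 1 p (B j)" if "j \<in> I" for j
  proof -
    have "Cw U (Suc k) p f \<Longrightarrow> Cw U 1 p f" for f
      by (induction k) (auto dest: Cw_Suc_imp simp del: Cw.simps)
    then show ?thesis using B[OF that] .
  qed
  have B'k: "Cw U k (p - 1) (fe_B' A I B F u)" if "u \<in> ext_index I" for u
    by (rule fe_B'_Cw[OF I A B Fk that])
  have B'b: "\<exists>C. \<forall>x\<in>U. \<bar>fe_B' A I B F u x\<bar> \<le> C * norm x ^ (p - 1)" if "u \<in> ext_index I" for u
    using Cw_bound[OF B'k[OF that]] by blast
  have A'b: "(\<Sum>v\<in>ext_index I. \<bar>fe_A' A u v x\<bar>) * c ^ (p - 1) \<le> q" if "x \<in> U" "u \<in> ext_index I" for x u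
    by (rule fe_A'_bound[where A=A, OF I Ab[OF that(1)] that])
  from fe_solution_exists[where I="ext_index I" and A="fe_A' A" and B="fe_B' A I B F" and p="p - 1" and q=q,
      OF finite_ext_index[OF I] q A'b B'b]
  obtain G D where G: "D \<ge> 0" "\<And>x u. x \<in> U \<Longrightarrow> u \<in> ext_index I \<Longrightarrow> \<bar>G u x\<bar> \<le> D * norm x ^ (p - 1)"
    "\<And>x u. x \<in> U \<Longrightarrow> u \<in> ext_index I \<Longrightarrow> G u x = (\<Sum>v\<in>ext_index I. fe_A' A u v x * G v (\<phi> x)) + fe_B' A I B F u x"
    by blast
  have Gk: "Cw U k (p - 1) (G u)" if "u \<in> ext_index I" for u
    by (rule Suc.IH[OF finite_ext_index[OF I] A'b fe_A'_Cw[where A=A, OF A] B'k G that])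
  have deriv: "(F i has_derivative (\<lambda>h. \<Sum>b\<in>Basis. (h \<bullet> b) * G (pre b i) x)) (at x)" if "x \<in> U" for x
    by (rule fe_solution_differentiable[OF I q Ab A B1 C F G i that])
  show ?case
  proof (rule Cw_SucI[OF U(1) _ deriv])
    show "\<exists>C. \<forall>x\<in>U. \<bar>F i x\<bar> \<le> C * norm x ^ p" using C i by blast
    show "Cw U k (p - 1) (\<lambda>x. \<Sum>b\<in>Basis. (v \<bullet> b) * G (pre b i) x)" for v
      by (rule Cw_sum[OF U(1)], rule Cw_mult[OF U Cw_const[OF U(1)]], rule Gk, rule ext_index_pre[OF _ i])
  qed
qed

theorem fe_smooth_solution:
  fixes I :: "('e list \<times> 'j) set"
  assumes I: "finite I" and q: "0 \<le> q" "q < 1"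
    and A: "\<And>x i. x \<in> U \<Longrightarrow> i \<in> I \<Longrightarrow> (\<Sum>j\<in>I. \<bar>A i j x\<bar>) * c ^ p \<le> q"
    and AC: "\<And>k i j. i \<in> I \<Longrightarrow> j \<in> I \<Longrightarrow> Cw U k 0 (A i j)" and B: "\<And>k i. i \<in> I \<Longrightarrow> Cw U k p (B i)"
  obtains F where "\<And>k i. i \<in> I \<Longrightarrow> Cw U k p (F i)"
    "\<And>x i. x \<in> U \<Longrightarrow> i \<in> I \<Longrightarrow> F i x = (\<Sum>j\<in>I. A i j x * F j (\<phi> x)) + B i x"
proof -
  have Bb: "\<exists>C. \<forall>x\<in>U. \<bar>B i x\<bar> \<le> C * norm x ^ p" if "i \<in> I" for i
    using Cw_bound[OF B[OF that, of 0]] by blast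
  obtain F C where F: "C \<ge> 0" "\<And>x i. x \<in> U \<Longrightarrow> i \<in> I \<Longrightarrow> \<bar>F i x\<bar> \<le> C * norm x ^ p"
    "\<And>x i. x \<in> U \<Longrightarrow> i \<in> I \<Longrightarrow> F i x = (\<Sum>j\<in>I. A i j x * F j (\<phi> x)) + B i x"
    using fe_solution_exists[where I=I and A=A and B=B and p=p and q=q, OF I q A Bb] by blast
  show thesis by (rule that[OF fe_solution_regular[OF I q A AC B F] F(3)])
qed

end

section \<open>Linearisation of a contraction\<close>

lemma small_has_derivative_zero:
  fixes s :: "'e::euclidean_space \<Rightarrow> 'v::real_normed_vector"
  assumes "0 < \<rho>" "\<And>x. x \<in> ball 0 \<rho> \<Longrightarrow> norm (s x) \<le> C * norm x ^ 2"
  shows "s 0 = 0" "(s has_derivative (\<lambda>h. 0)) (at 0)"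
proof -
  show s0: "s 0 = 0" using assms(2)[of 0] assms(1) by simp
  show "(s has_derivative (\<lambda>h. 0)) (at 0)"
    unfolding has_derivative_at_alt
  proof (intro conjI allI impI)
    fix e :: real assume e: "e > 0"
    define d where "d = min \<rho> (e / (\<bar>C\<bar> + 1))"
    have d: "d > 0" using e assms(1) by (simp add: d_def)
    have "norm (s y - s 0 - 0) \<le> e * norm (y - 0)" if "norm (y - 0) < d" for y
    proof -
      have y: "norm y < \<rho>" "norm y < e / (\<bar>C\<bar> + 1)" using that by (auto simp: d_def)
      then have "norm y * (\<bar>C\<bar> + 1) < e" by (simp add: pos_less_divide_eq)
      moreover have "C * norm y \<le> norm y * (\<bar>C\<bar> + 1)" using mult_right_mono[of C "\<bar>C\<bar> + 1" "norm y"] by (simp add: mult.commute)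
      ultimately have "C * norm y \<le> e" by linarith
      then have "C * norm y * norm y \<le> e * norm y" by (rule mult_right_mono) simp
      moreover have "norm (s y) \<le> C * norm y * norm y" using assms(2)[of y] y by (simp add: power2_eq_square mult.assoc)
      ultimately show ?thesis using s0 by simp
    qed
    then show "\<exists>d>0. \<forall>y. norm (y - 0) < d \<longrightarrow> norm (s y - s 0 - 0) \<le> e * norm (y - 0)" using d by blast
  qed simp
qed

text \<open>The factor \<open>DIM('e)\<close> passes from the operator norm of the differential at \<open>0\<close> to the sum of the absolute values of
  its entries; the strict inequality leaves room for the higher-order terms of \<open>f\<close> on a small ball.\<close>

lemma contraction_domain_exists:
  fixes f :: "'e::euclidean_space \<Rightarrow> 'e"
  assumes S: "open S" "0 \<in> S" and f: "smooth_on S f" "f 0 = 0"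
    and s: "0 \<le> s" "\<And>v. norm (frechet_derivative f (at 0) v) \<le> s * norm v"
    and c: "real DIM('e) * s < c" "c \<le> 1"
  obtains r where "contraction_domain r c f" "cball 0 r \<subseteq> S"
proof -
  have sc: "s < c"
  proof -
    have "1 * s \<le> real DIM('e) * s" using s(1) DIM_positive[where 'a='e] by (intro mult_right_mono) auto
    then show ?thesis using c by simp
  qed
  have d0: "(f has_derivative frechet_derivative f (at 0)) (at 0)" by (rule smooth_on_has_derivative[OF f(1) S(2)])
  have "c - s > 0" using sc by simp
  then have "\<exists>d>0. \<forall>y. norm (y - 0) < d \<longrightarrow> norm (f y - f 0 - frechet_derivative f (at 0) (y - 0)) \<le> (c - s) * norm (y - 0)"
    using d0 unfolding has_derivative_at_alt by blast
  then obtain r1 where r1: "r1 > 0" "\<And>y. norm y < r1 \<Longrightarrow> norm (f y - frechet_derivative f (at 0) y) \<le> (c - s) * norm y"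
    using f(2) by auto
  have bound0: "(\<Sum>b\<in>Basis. \<bar>frechet_derivative f (at 0) a \<bullet> b\<bar>) < c" if a: "a \<in> Basis" for a
  proof -
    have "(\<Sum>b\<in>Basis. \<bar>frechet_derivative f (at 0) a \<bullet> b\<bar>) \<le> (\<Sum>b\<in>(Basis::'e set). s)"
    proof (rule sum_mono)
      fix b :: 'e assume "b \<in> Basis"
      then show "\<bar>frechet_derivative f (at 0) a \<bullet> b\<bar> \<le> s" using Basis_le_norm[of b "frechet_derivative f (at 0) a"] s(2)[of a] a by simp
    qed
    then show ?thesis using c by simp
  qed
  have "\<forall>\<^sub>F x in nhds 0. \<forall>a\<in>Basis. (\<Sum>b\<in>Basis. \<bar>frechet_derivative f (at x) a \<bullet> b\<bar>) < c"
    unfolding eventually_ball_finite_distrib[OF finite_Basis]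
  proof
    fix a :: 'e assume a: "a \<in> Basis"
    have "isCont (\<lambda>x. frechet_derivative f (at x) a) 0"
      using smooth_on_continuous_on[OF smooth_on_frechet[OF f(1)]] S by (simp add: continuous_on_eq_continuous_at)
    define g where "g x = (\<Sum>b\<in>Basis. \<bar>frechet_derivative f (at x) a \<bullet> b\<bar>)" for x
    have "isCont g 0" unfolding g_def using \<open>isCont (\<lambda>x. frechet_derivative f (at x) a) 0\<close>
      by (intro continuous_intros)
    then have "(g \<longlongrightarrow> g 0) (nhds 0)"
      unfolding isCont_def tendsto_at_iff_tendsto_nhds .
    then show "\<forall>\<^sub>F x in nhds 0. (\<Sum>b\<in>Basis. \<bar>frechet_derivative f (at x) a \<bullet> b\<bar>) < c"
      using bound0[OF a] order_tendstoD(2)[of g "g 0" "nhds 0" c] by (simp add: g_def)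
  qed
  then obtain r2 where r2: "r2 > 0" "\<And>x a. norm x < r2 \<Longrightarrow> a \<in> Basis \<Longrightarrow> (\<Sum>b\<in>Basis. \<bar>frechet_derivative f (at x) a \<bullet> b\<bar>) < c"
    unfolding eventually_nhds_metric by auto
  obtain r3 where r3: "r3 > 0" "cball 0 r3 \<subseteq> S" using S open_contains_cball by blast
  define r where "r = min 1 (min r1 (min r2 r3))"
  have cb: "cball 0 r \<subseteq> S" using r3 by (auto simp: r_def)
  have bS: "ball 0 r \<subseteq> S" using cb by (auto simp: subset_eq)
  have "contraction_domain r c f"
  proof
    show "0 < r" "r \<le> 1" using r1 r2 r3 by (auto simp: r_def)
    show "0 \<le> c" "c \<le> 1" using sc s c by auto
    show "norm (f x) \<le> c * norm x" if "x \<in> ball 0 r" for x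
    proof -
      have "norm (f x) \<le> norm (f x - frechet_derivative f (at 0) x) + norm (frechet_derivative f (at 0) x)"
        using norm_triangle_ineq[of "f x - frechet_derivative f (at 0) x" "frechet_derivative f (at 0) x"] by simp
      also have "\<dots> \<le> (c - s) * norm x + s * norm x" using that r1(2)[of x] s(2)[of x] by (intro add_mono) (auto simp: r_def)
      finally show ?thesis by (simp add: algebra_simps)
    qed
    show "Cw (ball 0 r) k 0 (\<lambda>x. f x \<bullet> b)" for k b
      by (rule smooth_vanish_Cw[OF cb smooth_on_linear_comp[where h="\<lambda>y. y \<bullet> b" and f=f, OF S(1) bounded_linear_inner_left f(1)]]) simp
    show "smooth_on (ball 0 r) f" by (rule smooth_on_subset[OF f(1) bS])
    show "(\<Sum>b\<in>Basis. \<bar>frechet_derivative f (at x) a \<bullet> b\<bar>) \<le> c" if "x \<in> ball 0 r" "a \<in> Basis" for x a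
      using r2(2)[of x a] that by (auto simp: r_def)
  qed
  then show thesis using that cb by blast
qed

text \<open>Written in components this is a system with constant coefficients, whose absolute row sums are at most
  \<open>DIM('v) \<kappa>\<close>.\<close>

lemma vector_functional_equation:
  fixes f :: "'e::euclidean_space \<Rightarrow> 'e" and K :: "'v::euclidean_space \<Rightarrow> 'v" and R :: "'e \<Rightarrow> 'v"
  assumes S: "open S" "0 \<in> S" and f: "smooth_on S f" "f 0 = 0"
    and s: "0 \<le> s" "\<And>v. norm (frechet_derivative f (at 0) v) \<le> s * norm v"
    and c: "real DIM('e) * s < c" "c \<le> 1"
    and R: "smooth_on S R" "\<And>b. b \<in> Basis \<Longrightarrow> vanish p (\<lambda>x. R x \<bullet> b)"
    and K: "linear K" "0 \<le> \<kappa>" "\<And>v. norm (K v) \<le> \<kappa> * norm v" "real DIM('v) * \<kappa> * c ^ p < 1"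
  obtains \<rho> \<sigma> C where "0 < \<rho>" "ball 0 \<rho> \<subseteq> S" "smooth_on (ball 0 \<rho>) \<sigma>" "\<And>x. x \<in> ball 0 \<rho> \<Longrightarrow> norm (f x) \<le> norm x"
    "\<And>x. x \<in> ball 0 \<rho> \<Longrightarrow> \<sigma> x = K (\<sigma> (f x)) + R x" "\<And>x. x \<in> ball 0 \<rho> \<Longrightarrow> norm (\<sigma> x) \<le> C * norm x ^ p"
proof -
  obtain r where "contraction_domain r c f" and cb: "cball 0 r \<subseteq> S"
    by (rule contraction_domain_exists[OF S f s c])
  then interpret contraction_domain r c f by simp
  define I where "I = {([]::'e list, b) | b::'v. b \<in> Basis}"
  have Ieq: "I = Pair [] ` Basis" by (auto simp: I_def)
  have I: "finite I" unfolding Ieq by simp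
  have sumI: "(\<Sum>j\<in>I. h j) = (\<Sum>b\<in>Basis. h ([], b))" for h :: "'e list \<times> 'v \<Rightarrow> real"
    unfolding Ieq by (subst sum.reindex) (auto simp: inj_on_def)
  define A where "A i j x = K (snd j) \<bullet> snd i" for i j :: "'e list \<times> 'v" and x :: 'e
  define B where "B i x = R x \<bullet> snd i" for i :: "'e list \<times> 'v" and x :: 'e
  define q where "q = real DIM('v) * \<kappa> * c ^ p"
  have q: "0 \<le> q" "q < 1" using K local.c by (auto simp: q_def)
  have A1: "(\<Sum>j\<in>I. \<bar>A i j x\<bar>) * c ^ p \<le> q" if "i \<in> I" for i x
  proof -
    have "(\<Sum>j\<in>I. \<bar>A i j x\<bar>) \<le> (\<Sum>b\<in>(Basis::'v set). \<kappa>)" unfolding sumI A_def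
    proof (rule sum_mono)
      fix b :: 'v assume b: "b \<in> Basis"
      obtain b' where b': "i = ([], b')" "b' \<in> Basis" using \<open>i \<in> I\<close> by (auto simp: I_def)
      show "\<bar>K (snd ([]::'e list, b)) \<bullet> snd i\<bar> \<le> \<kappa>" using Basis_le_norm[OF b'(2), of "K b"] K(3)[of b] b b' by simp
    qed
    then have "(\<Sum>j\<in>I. \<bar>A i j x\<bar>) \<le> real DIM('v) * \<kappa>" by simp
    then show ?thesis unfolding q_def by (rule mult_right_mono) (use local.c in simp)
  qed
  have A2: "Cw U k 0 (A i j)" for k i j unfolding A_def by (rule Cw_const[OF U(1)])
  have B: "Cw U k p (B i)" if i: "i \<in> I" for k i
  proof -
    obtain b where b: "i = ([], b)" "b \<in> Basis" using i by (auto simp: I_def)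
    show ?thesis unfolding B_def
      by (rule smooth_vanish_Cw[OF cb smooth_on_linear_comp[where h="\<lambda>y. y \<bullet> snd i" and f=R, OF S(1) bounded_linear_inner_left R(1)]])
         (use R(2) b in simp)
  qed
  obtain F where F: "\<And>k i. i \<in> I \<Longrightarrow> Cw U k p (F i)"
    "\<And>x i. x \<in> U \<Longrightarrow> i \<in> I \<Longrightarrow> F i x = (\<Sum>j\<in>I. A i j x * F j (f x)) + B i x"
    by (rule fe_smooth_solution[where I=I and A=A and B=B and p=p and q=q, OF I q A1 A2 B]) (assumption | rule that)+
  define \<sigma> where "\<sigma> x = (\<Sum>b\<in>Basis. F ([], b) x *\<^sub>R b)" for x
  have \<sigma>b: "\<sigma> x \<bullet> b = F ([], b) x" if "b \<in> Basis" for x b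
    unfolding \<sigma>_def using that by (simp add: inner_sum_left inner_Basis if_distrib[of "(*) _"] sum.delta cong: if_cong)
  have \<sigma>s: "smooth_on U \<sigma>"
  proof (rule smooth_on_componentwise[OF U(1)], rule smooth_onI)
    fix b :: 'v and k assume b: "b \<in> Basis"
    have "Cw U k p (F ([], b))" by (rule F(1)) (use b in \<open>simp add: I_def\<close>)
    then show "Ck_on k (\<lambda>x. \<sigma> x \<bullet> b) U" using \<sigma>b[OF b] by (simp add: Cw_imp_Ck_on)
  qed
  have eq: "\<sigma> x = K (\<sigma> (f x)) + R x" if x: "x \<in> U" for x
  proof (rule euclidean_eqI)
    fix b :: 'v assume b: "b \<in> Basis"
    have "K (\<sigma> (f x)) \<bullet> b = (\<Sum>b'\<in>Basis. (K b' \<bullet> b) * F ([], b') (f x))"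
      unfolding \<sigma>_def by (simp add: linear_sum[OF K(1)] linear_scale[OF K(1)] inner_sum_left mult.commute)
    then show "\<sigma> x \<bullet> b = (K (\<sigma> (f x)) + R x) \<bullet> b"
      using F(2)[OF x, of "([], b)"] b unfolding sumI by (simp add: \<sigma>b I_def A_def B_def inner_add_left)
  qed
  have "\<forall>b\<in>(Basis::'v set). \<exists>C\<ge>0. \<forall>x\<in>U. \<bar>F ([], b) x\<bar> \<le> C * norm x ^ p"
  proof
    fix b :: 'v assume "b \<in> Basis"
    then have "Cw U 0 p (F ([], b))" by (intro F(1)) (simp add: I_def)
    then show "\<exists>C\<ge>0. \<forall>x\<in>U. \<bar>F ([], b) x\<bar> \<le> C * norm x ^ p" by (rule Cw_bound)
  qed
  then obtain Cb where Cb: "\<And>b::'v. b \<in> Basis \<Longrightarrow> \<forall>x\<in>U. \<bar>F ([], b) x\<bar> \<le> Cb b * norm x ^ p" by metis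
  have "norm (\<sigma> x) \<le> (\<Sum>b\<in>Basis. Cb b) * norm x ^ p" if x: "x \<in> U" for x
  proof -
    have "norm (\<sigma> x) \<le> (\<Sum>b\<in>Basis. \<bar>\<sigma> x \<bullet> b\<bar>)" by (rule norm_le_l1)
    also have "\<dots> \<le> (\<Sum>b\<in>Basis. Cb b * norm x ^ p)" by (rule sum_mono) (use Cb \<sigma>b x in auto)
    finally show ?thesis by (simp add: sum_distrib_right)
  qed
  then show thesis using that[of r \<sigma>] local.r cb \<sigma>s eq \<phi>_le1 ball_subset_cball[of 0 r] by blast
qed

subsection \<open>Removing the resonance\<close>

type_synonym 'n heis = "(complex^'n) \<times> real"

lemma second_order_vanish:
  fixes r :: "'e::euclidean_space \<Rightarrow> real"
  assumes S: "open S" "0 \<in> S" and r: "r 0 = 0"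
    and d1: "\<And>x. x \<in> S \<Longrightarrow> (r has_derivative r' x) (at x)" "\<And>v. r' 0 v = 0"
    and d2: "\<And>v. ((\<lambda>x. r' x v) has_derivative (\<lambda>u. 0)) (at 0)"
  shows "vanish 3 r"
proof -
  have e1: "frechet_derivative r (at x) v = r' x v" if "x \<in> S" for x v using frechetI[OF d1(1)[OF that]] by simp
  have "frechet_derivative (\<lambda>x. frechet_derivative r (at x) v) (at 0) u = 0" for u v
  proof -
    have "((\<lambda>x. frechet_derivative r (at x) v) has_derivative (\<lambda>u. 0)) (at 0)"
      by (rule has_derivative_transform_within_open[OF d2 S]) (simp add: e1)
    then show ?thesis by (simp add: frechetI)
  qed
  then show ?thesis using r d1(2) e1 S by (simp add: numeral_3_eq_3)
qed

lemma first_order_vanish: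
  fixes r :: "'e::euclidean_space \<Rightarrow> real"
  assumes "r 0 = 0" "(r has_derivative (\<lambda>v. 0)) (at 0)"
  shows "vanish 2 r"
  using assms by (simp add: numeral_2_eq_2 frechetI)

text \<open>The differential \<open>\<Lambda>\<close> of \<open>f\<close> scales the first factor by \<open>\<surd>\<mu>\<close> and the second by \<open>\<mu>\<close>. The only
  resonant terms of order at most two are quadratic terms in the first factor occurring in the last
  component; the hypothesis \<open>res\<close> says that they are a coboundary, so that a quadratic change of the
  last coordinate removes them. All remaining second-order terms of that component are non-resonant
  and are removed explicitly, and the rest of order three is absorbed by a functional equation that
  is contracting on functions vanishing to that order. With a contraction rate \<open>c = 2 N \<surd>\<mu>\<close>, where \<open>N\<close> is
  the dimension, both functional equations ask for \<open>8 N\<^sup>3 \<surd>\<mu> < 1\<close>.\<close>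

theorem linearisation:
  fixes f :: "'n::finite heis \<Rightarrow> 'n heis" and A :: "complex^'n \<Rightarrow> complex^'n" and S\<^sub>H :: "complex^'n \<Rightarrow> complex^'n \<Rightarrow> real"
  assumes S: "open S" "0 \<in> S" and f: "smooth_on S f" "f 0 = 0"
    and Df: "\<And>z t. frechet_derivative f (at 0) (z, t) = (A z, \<mu> * t)"
    and A: "linear A" "\<And>z. norm (A z) = sqrt \<mu> * norm z"
    and \<mu>: "0 < \<mu>" "\<mu> < 1" "8 * real DIM('n heis) ^ 3 * sqrt \<mu> < 1"
    and SH: "bilinear S\<^sub>H" "\<And>u v. S\<^sub>H u v = S\<^sub>H v u"
    and res: "\<And>u v. snd (frechet_derivative (\<lambda>x. frechet_derivative f (at x) (v, 0)) (at 0) (u, 0)) = \<mu> * S\<^sub>H u v - S\<^sub>H (A u) (A v)"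
  obtains F \<rho> where "0 < \<rho>" "ball 0 \<rho> \<subseteq> S" "smooth_on (ball 0 \<rho>) F" "F 0 = 0" "(F has_derivative id) (at 0)"
    "\<And>x. x \<in> ball 0 \<rho> \<Longrightarrow> f x \<in> ball 0 \<rho> \<and> F (f x) = (A (fst (F x)), \<mu> * snd (F x))"
proof -
  define N where "N = real DIM('n heis)"
  define s where "s = sqrt \<mu>"
  have s: "0 < s" "s < 1" "s * s = \<mu>" using \<mu> by (auto simp: s_def)
  have N1: "N \<ge> 1" unfolding N_def using DIM_positive[where 'a="'n heis"] by linarith
  have small: "8 * N ^ 3 * s < 1" using \<mu>(3) by (simp add: N_def s_def)
  define c where "c = 2 * N * s"
  have c: "N * s < c" "c \<le> 1"
  proof -
    show "N * s < c" using N1 s by (simp add: c_def)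
    have "N ^ 1 \<le> N ^ 3" using N1 by (intro power_increasing) auto
    then have "c \<le> 8 * N ^ 3 * s" unfolding c_def using s N1 by (intro mult_right_mono) auto
    then show "c \<le> 1" using small by linarith
  qed
  have \<Lambda>: "norm (frechet_derivative f (at 0) v) \<le> s * norm v" for v :: "'n heis"
  proof -
    obtain z t where v: "v = (z, t)" by (cases v)
    have "norm (A z, \<mu> * t) = sqrt ((s * norm z)\<^sup>2 + (\<mu> * t)\<^sup>2)" by (simp add: norm_Pair A(2) s_def)
    also have "\<dots> \<le> sqrt ((s * norm z)\<^sup>2 + (s * t)\<^sup>2)"
    proof (rule real_sqrt_le_mono, rule add_left_mono)
      have "\<mu>\<^sup>2 \<le> s\<^sup>2" using \<mu> s mult_left_le[of \<mu> \<mu>] by (simp add: power2_eq_square)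
      then have "\<mu>\<^sup>2 * t\<^sup>2 \<le> s\<^sup>2 * t\<^sup>2" by (rule mult_right_mono) simp
      then show "(\<mu> * t)\<^sup>2 \<le> (s * t)\<^sup>2" by (simp only: power_mult_distrib)
    qed
    also have "\<dots> = s * norm v" using s by (simp add: v norm_Pair power_mult_distrib real_sqrt_mult distrib_left[symmetric])
    finally show ?thesis by (simp add: v Df)
  qed
  have d0: "(f has_derivative (\<lambda>v. (A (fst v), \<mu> * snd v))) (at 0)"
    using smooth_on_has_derivative[OF f(1) S(2)] Df by (metis (no_types, lifting) ext prod.collapse)
  \<comment> \<open>the inverse of \<open>A\<close> has norm \<open>1/s\<close>, which the factor \<open>c\<^sup>2\<close> of the second-order remainder compensates\<close>
  have "inj A"
  proof (rule linear_injective_0[OF A(1), THEN iffD2], intro allI impI)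
    fix z assume "A z = 0" then show "z = 0" using A(2)[of z] \<mu> by simp
  qed
  then obtain A' where A': "linear A'" "\<And>z. A' (A z) = z" "\<And>z. A (A' z) = z"
    using linear_injective_isomorphism[OF A(1)] by auto
  have A'n: "norm (A' z) \<le> (1 / s) * norm z" for z using A(2)[of "A' z"] A'(3) s by (simp add: s_def field_simps)
  define R1 where "R1 x = A' (fst (f x) - A (fst x))" for x
  have blA: "bounded_linear A" "bounded_linear A'" using A A' by (simp_all add: linear_conv_bounded_linear)
  have R1s: "smooth_on S R1" unfolding R1_def
    by (rule smooth_on_linear_comp[where h=A', OF S(1) blA(2)], rule smooth_on_diff[OF S(1)],
        rule smooth_on_linear_comp[where h=fst, OF S(1) bounded_linear_fst f(1)],
        rule smooth_on_linear[where h="\<lambda>x. A (fst x)", OF S(1) bounded_linear_compose[OF blA(1) bounded_linear_fst]])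
  have R1d: "(R1 has_derivative (\<lambda>v. 0)) (at 0)"
  proof -
    have "(R1 has_derivative (\<lambda>v. A' (fst (A (fst v), \<mu> * snd v) - A (fst v)))) (at 0)"
      unfolding R1_def
      by (intro bounded_linear.has_derivative[OF blA(2)] has_derivative_diff bounded_linear.has_derivative[OF bounded_linear_fst] d0
           bounded_linear.has_derivative[OF blA(1)] has_derivative_ident)
    then show ?thesis by (simp add: linear_0[OF A'(1)])
  qed
  have R1v: "vanish 2 (\<lambda>x. R1 x \<bullet> b)" for b
  proof (rule first_order_vanish)
    show "R1 0 \<bullet> b = 0" by (simp add: R1_def f(2) linear_0[OF A(1)] linear_0[OF A'(1)])
    show "((\<lambda>x. R1 x \<bullet> b) has_derivative (\<lambda>v. 0)) (at 0)"
      using bounded_linear.has_derivative[OF bounded_linear_inner_left R1d, of b] by simp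
  qed
  have K1: "real DIM(complex^'n) * (1 / s) * c ^ 2 < 1"
  proof -
    have "real DIM(complex^'n) \<le> N" by (simp add: N_def)
    then have "real DIM(complex^'n) * (1 / s) * c ^ 2 \<le> N * (1 / s) * c ^ 2" using s by (intro mult_right_mono) auto
    also have "\<dots> = 4 * N ^ 3 * s" using s by (simp add: c_def power2_eq_square power3_eq_cube)
    also have "\<dots> \<le> 8 * N ^ 3 * s" using s N1 by (intro mult_right_mono) auto
    finally show ?thesis using small by simp
  qed
  obtain \<rho>1 \<sigma>1 C1 where 1: "0 < \<rho>1" "ball 0 \<rho>1 \<subseteq> S" "smooth_on (ball 0 \<rho>1) \<sigma>1" "\<And>x. x \<in> ball 0 \<rho>1 \<Longrightarrow> norm (f x) \<le> norm x"
    "\<And>x. x \<in> ball 0 \<rho>1 \<Longrightarrow> \<sigma>1 x = A' (\<sigma>1 (f x)) + R1 x" "\<And>x. x \<in> ball 0 \<rho>1 \<Longrightarrow> norm (\<sigma>1 x) \<le> C1 * norm x ^ 2"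
  proof (rule vector_functional_equation[OF S f less_imp_le[OF s(1)] \<Lambda> c[unfolded N_def] R1s R1v A'(1) _ A'n K1])
    show "0 \<le> 1 / s" using s by simp
  qed (rule that)
  \<comment> \<open>the inverse of \<open>\<mu>\<close> is too large for \<open>c\<^sup>2\<close> but not for \<open>c\<^sup>3\<close>, so the quadratic part \<open>Q\<close> has to be removed beforehand\<close>
  define Q where "Q u v = snd (frechet_derivative (\<lambda>x. frechet_derivative f (at x) v) (at 0) u)" for u v
  have Qlin: "linear (\<lambda>u. Q u v)" for v
    unfolding Q_def
    by (rule linear_compose[OF frechet_linear[OF smooth_on_differentiable[OF smooth_on_frechet[OF f(1)] S(2)]], of snd, unfolded o_def])
       (simp add: linear_snd)
  have Qsym: "Q u v = Q v u" for u v unfolding Q_def using second_derivative_symmetric[OF S f(1)] by metis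
  have Qlin2: "linear (Q u)" for u using Qlin[of u] Qsym by (metis (no_types, lifting) ext)
  define \<xi> :: "'n heis" where "\<xi> = (0, 1)"
  have split: "(z, t) = (z, 0) + t *\<^sub>R \<xi>" for z :: "complex^'n" and t by (simp add: \<xi>_def)
  have Qexp: "Q (z, t) (w, u) = Q (z, 0) (w, 0) + t * Q \<xi> (w, 0) + u * Q \<xi> (z, 0) + t * u * Q \<xi> \<xi>" for z t w u
  proof -
    have "Q (z, t) (w, u) = Q (z, 0) (w, u) + t * Q \<xi> (w, u)"
      using split[of z t] linear_add[OF Qlin] linear_scale[OF Qlin] by simp
    also have "Q (z, 0) (w, u) = Q (z, 0) (w, 0) + u * Q (z, 0) \<xi>" using split[of w u] linear_add[OF Qlin2] linear_scale[OF Qlin2] by simp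
    also have "Q \<xi> (w, u) = Q \<xi> (w, 0) + u * Q \<xi> \<xi>" using split[of w u] linear_add[OF Qlin2] linear_scale[OF Qlin2] by simp
    finally show ?thesis by (simp add: Qsym[of "(z, 0)" \<xi>] algebra_simps)
  qed
  have "linear (\<lambda>z. z - A z)" using A(1) by (intro linear_compose_sub linear_ident)
  moreover have "inj (\<lambda>z. z - A z)"
  proof (rule linear_injective_0[OF calculation, THEN iffD2], intro allI impI)
    fix z assume "z - A z = 0"
    then have "norm z = s * norm z" using A(2)[of z] by (simp add: s_def)
    then show "z = 0" using s by simp
  qed
  ultimately obtain B where B: "linear B" "\<And>z. B (z - A z) = z"
    using linear_injective_isomorphism[of "\<lambda>z. z - A z"] by auto
  define \<tau> where "\<tau> z = Q \<xi> (B z, 0) / \<mu>" for z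
  have \<tau>lin: "linear \<tau>"
  proof -
    have "linear (\<lambda>z. (B z, 0::real))" by (rule linearI) (simp_all add: linear_add[OF B(1)] linear_scale[OF B(1)])
    from linear_compose[OF this Qlin2[of \<xi>]] have "linear (\<lambda>z. Q \<xi> (B z, 0))" by (simp add: o_def)
    from linear_compose_scale_right[OF this, of "1/\<mu>"] show ?thesis by (simp add: \<tau>_def[abs_def])
  qed
  have \<tau>A: "\<mu> * \<tau> (A z) - \<mu> * \<tau> z + Q \<xi> (z, 0) = 0" for z
  proof -
    have "\<tau> (z - A z) = Q \<xi> (z, 0) / \<mu>" by (simp add: \<tau>_def B(2))
    then show ?thesis using \<mu> by (simp add: linear_diff[OF \<tau>lin] field_simps)
  qed
  define \<kappa> where "\<kappa> = Q \<xi> \<xi> / (\<mu> - \<mu> * \<mu>)"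
  have \<mu>2: "\<mu> - \<mu> * \<mu> > 0" using \<mu> mult_strict_left_mono[of \<mu> 1 \<mu>] by simp
  \<comment> \<open>mixed terms and squares of the last coordinate have the weights \<open>\<mu>\<surd>\<mu>\<close> and \<open>\<mu>\<^sup>2\<close>, different from \<open>\<mu>\<close>, and \<open>\<tau>\<close> and \<open>\<kappa>\<close> solve the equations for them\<close>
  define S2 where "S2 x y = S\<^sub>H (fst x) (fst y) + snd x * \<tau> (fst y) + snd y * \<tau> (fst x) + \<kappa> * snd x * snd y" for x y :: "'n heis"
  have S2sym: "S2 x y = S2 y x" for x y by (simp add: S2_def SH(2)[of "fst x"])
  have SHl: "linear (S\<^sub>H u)" for u using SH(1) by (simp add: bilinear_def)
  have S2lin: "linear (S2 x)" for x
    by (rule linearI) (simp_all add: S2_def linear_add[OF SHl] linear_scale[OF SHl] linear_add[OF \<tau>lin] linear_scale[OF \<tau>lin] algebra_simps)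
  have "bilinear S2" unfolding bilinear_def using S2lin S2sym by (metis (no_types, lifting) ext)
  then have bbS2: "bounded_bilinear S2" by (simp add: bilinear_conv_bounded_bilinear)
  have S2\<Lambda>: "S2 (A (fst u), \<mu> * snd u) (A (fst v), \<mu> * snd v) + Q u v = \<mu> * S2 u v" for u v
  proof -
    obtain z t w p where uv: "u = (z, t)" "v = (w, p)" by (cases u, cases v)
    have e1: "Q (z, 0) (w, 0) = \<mu> * S\<^sub>H z w - S\<^sub>H (A z) (A w)" using res[of w z] by (simp add: Q_def)
    have "\<mu> - \<mu> * \<mu> \<noteq> 0" using \<mu>2 by linarith
    then have e2: "Q \<xi> \<xi> = \<kappa> * (\<mu> - \<mu> * \<mu>)" using nonzero_eq_divide_eq[of "\<mu> - \<mu> * \<mu>" \<kappa> "Q \<xi> \<xi>"] \<kappa>_def by metis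
    have e3: "Q \<xi> (z, 0) = \<mu> * \<tau> z - \<mu> * \<tau> (A z)" "Q \<xi> (w, 0) = \<mu> * \<tau> w - \<mu> * \<tau> (A w)"
      using \<tau>A[of z] \<tau>A[of w] by linarith+
    show ?thesis unfolding uv S2_def Qexp[of z t w p] e1 e2 e3 by (simp add: algebra_simps)
  qed
  define T0 where "T0 x = snd x + (1/2) * S2 x x" for x
  define r2 where "r2 x = T0 (f x) - \<mu> * T0 x" for x
  have T0s: "smooth_on UNIV T0" unfolding T0_def
    by (rule smooth_on_add[OF open_UNIV smooth_on_linear[where h=snd, OF open_UNIV bounded_linear_snd]],
        rule smooth_on_bilinear[where mul="(*)", OF open_UNIV bounded_bilinear_mult smooth_on_const[OF open_UNIV]],
        rule smooth_on_bilinear[where mul=S2, OF open_UNIV bbS2]; rule smooth_on_linear[OF open_UNIV bounded_linear_ident])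
  have r2s: "smooth_on S r2" unfolding r2_def
    by (rule smooth_on_diff[OF S(1)], rule smooth_on_compose[where g=T0, OF S(1) open_UNIV subset_UNIV T0s f(1)],
        rule smooth_on_linear_comp[where h="\<lambda>t. \<mu> * t" and f=T0, OF S(1) bounded_linear_mult_right smooth_on_subset[OF T0s subset_UNIV]])
  have T0d: "(T0 has_derivative (\<lambda>v. snd v + S2 x v)) (at x)" for x
  proof -
    have "(T0 has_derivative (\<lambda>v. snd v + (1/2) * (S2 x v + S2 v x))) (at x)" unfolding T0_def
      by (intro has_derivative_add bounded_linear.has_derivative[OF bounded_linear_snd] has_derivative_ident
          has_derivative_mult_right bounded_bilinear.FDERIV[OF bbS2])
    then show ?thesis by (simp add: S2sym[of _ x])
  qed
  have fd: "(f has_derivative frechet_derivative f (at x)) (at x)" if "x \<in> S" for x by (rule smooth_on_has_derivative[OF f(1) that])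
  have r2d: "(r2 has_derivative (\<lambda>v. (snd (frechet_derivative f (at x) v) + S2 (f x) (frechet_derivative f (at x) v)) - \<mu> * (snd v + S2 x v))) (at x)" if x: "x \<in> S" for x
    unfolding r2_def
    by (intro has_derivative_diff has_derivative_mult_right T0d diff_chain_at[OF fd[OF x] T0d, unfolded o_def])
  have S20: "S2 0 v = 0" for v using linear_0[OF S2lin[of v]] S2sym by metis
  have "vanish 3 r2"
  proof (rule second_order_vanish[OF S _ r2d])
    show "r2 0 = 0" by (simp add: r2_def T0_def f(2) S20)
    show "snd (frechet_derivative f (at 0) v) + S2 (f 0) (frechet_derivative f (at 0) v) - \<mu> * (snd v + S2 0 v) = 0" for v
      by (cases v) (simp add: Df f(2) S20)
    fix v
    have "((\<lambda>x. snd (frechet_derivative f (at x) v) + S2 (f x) (frechet_derivative f (at x) v) - \<mu> * (snd v + S2 x v)) has_derivative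
      (\<lambda>u. snd (frechet_derivative (\<lambda>x. frechet_derivative f (at x) v) (at 0) u) +
         (S2 (f 0) (frechet_derivative (\<lambda>x. frechet_derivative f (at x) v) (at 0) u) + S2 (frechet_derivative f (at 0) u) (frechet_derivative f (at 0) v))
         - \<mu> * (0 + (S2 0 0 + S2 u v)))) (at 0)"
      by (intro has_derivative_diff has_derivative_add has_derivative_mult_right has_derivative_const
          bounded_linear.has_derivative[OF bounded_linear_snd] bounded_bilinear.FDERIV[OF bbS2] fd[OF S(2)] has_derivative_ident
          smooth_on_has_derivative[OF smooth_on_frechet[OF f(1)] S(2)])
    moreover have "snd (frechet_derivative (\<lambda>x. frechet_derivative f (at x) v) (at 0) u) +
         (S2 (f 0) (frechet_derivative (\<lambda>x. frechet_derivative f (at x) v) (at 0) u) + S2 (frechet_derivative f (at 0) u) (frechet_derivative f (at 0) v))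
         - \<mu> * (0 + (S2 0 0 + S2 u v)) = 0" for u
      using S2\<Lambda>[of u v] Df[of "fst u" "snd u"] Df[of "fst v" "snd v"] by (simp add: f(2) S20 Q_def)
    ultimately show "((\<lambda>x. snd (frechet_derivative f (at x) v) + S2 (f x) (frechet_derivative f (at x) v) - \<mu> * (snd v + S2 x v)) has_derivative (\<lambda>u. 0)) (at 0)"
      by simp
  qed
  then have r20: "r2 0 = 0" "frechet_derivative r2 (at 0) v = 0"
    "frechet_derivative (\<lambda>x. frechet_derivative r2 (at x) v) (at 0) u = 0" for u v
    unfolding numeral_3_eq_3 vanish.simps by blast+
  define R2 where "R2 x = r2 x / \<mu>" for x
  have R2s: "smooth_on S R2" unfolding R2_def
    by (rule smooth_on_linear_comp[where h="\<lambda>t. t / \<mu>" and f=r2, OF S(1) bounded_linear_divide r2s])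
  have R2v: "vanish 3 (\<lambda>x. R2 x \<bullet> b)" for b :: real
  proof (rule second_order_vanish[OF S])
    show "R2 0 \<bullet> b = 0" by (simp add: R2_def r20)
    show "((\<lambda>x. R2 x \<bullet> b) has_derivative (\<lambda>v. frechet_derivative r2 (at x) v / \<mu> * b)) (at x)" if "x \<in> S" for x
      unfolding R2_def inner_real_def
      by (rule bounded_linear.has_derivative[OF bounded_linear_compose[OF bounded_linear_mult_left bounded_linear_divide] smooth_on_has_derivative[OF r2s that]])
    show "frechet_derivative r2 (at 0) v / \<mu> * b = 0" for v by (simp add: r20)
    fix v
    have "((\<lambda>x. frechet_derivative r2 (at x) v / \<mu> * b) has_derivative (\<lambda>u. frechet_derivative (\<lambda>x. frechet_derivative r2 (at x) v) (at 0) u / \<mu> * b)) (at 0)"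
      by (rule bounded_linear.has_derivative[OF bounded_linear_compose[OF bounded_linear_mult_left bounded_linear_divide] smooth_on_has_derivative[OF smooth_on_frechet[OF r2s] S(2)]])
    then show "((\<lambda>x. frechet_derivative r2 (at x) v / \<mu> * b) has_derivative (\<lambda>u. 0)) (at 0)"
      by (simp add: r20)
  qed
  have K2: "real DIM(real) * (1 / \<mu>) * c ^ 3 < 1"
  proof -
    have "c ^ 3 = 8 * N ^ 3 * s * \<mu>" using s by (simp add: c_def power3_eq_cube)
    then show ?thesis using small \<mu> by simp
  qed
  obtain \<rho>2 \<sigma>2 C2 where 2: "0 < \<rho>2" "ball 0 \<rho>2 \<subseteq> S" "smooth_on (ball 0 \<rho>2) \<sigma>2" "\<And>x. x \<in> ball 0 \<rho>2 \<Longrightarrow> norm (f x) \<le> norm x"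
    "\<And>x. x \<in> ball 0 \<rho>2 \<Longrightarrow> \<sigma>2 x = \<sigma>2 (f x) / \<mu> + R2 x" "\<And>x. x \<in> ball 0 \<rho>2 \<Longrightarrow> norm (\<sigma>2 x) \<le> C2 * norm x ^ 3"
  proof (rule vector_functional_equation[where K="\<lambda>t. t / \<mu>", OF S f less_imp_le[OF s(1)] \<Lambda> c[unfolded N_def] R2s R2v _ _ _ K2])
    show "linear (\<lambda>t. t / \<mu>)" using bounded_linear_divide linear_conv_bounded_linear by blast
    show "0 \<le> 1 / \<mu>" "norm (v / \<mu>) \<le> 1 / \<mu> * norm v" for v :: real using \<mu> by auto
  qed (rule that)
  define \<rho> where "\<rho> = min 1 (min \<rho>1 \<rho>2)"
  have \<rho>: "0 < \<rho>" "ball 0 \<rho> \<subseteq> (ball 0 \<rho>1 :: 'n heis set)" "ball 0 \<rho> \<subseteq> (ball 0 \<rho>2 :: 'n heis set)" using 1 2 by (auto simp: \<rho>_def)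
  define F where "F x = (fst x + \<sigma>1 x, T0 x + \<sigma>2 x)" for x
  show thesis
  proof (rule that[of \<rho> F])
    show "0 < \<rho>" "ball 0 \<rho> \<subseteq> S" using \<rho> 1 by auto
    show "smooth_on (ball 0 \<rho>) F"
    proof (rule smooth_on_componentwise)
      fix b :: "'n heis" assume "b \<in> Basis"
      have "smooth_on (ball 0 \<rho>) (\<lambda>x. fst x + \<sigma>1 x)"
        by (rule smooth_on_add[OF open_ball smooth_on_linear[where h=fst, OF open_ball bounded_linear_fst] smooth_on_subset[OF 1(3) \<rho>(2)]])
      then have a: "smooth_on (ball 0 \<rho>) (\<lambda>x. (fst x + \<sigma>1 x) \<bullet> fst b)"
        by (rule smooth_on_linear_comp[where h="\<lambda>y. y \<bullet> fst b", OF open_ball bounded_linear_inner_left])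
      have "smooth_on (ball 0 \<rho>) (\<lambda>x. T0 x + \<sigma>2 x)"
        by (rule smooth_on_add[OF open_ball smooth_on_subset[OF T0s subset_UNIV] smooth_on_subset[OF 2(3) \<rho>(3)]])
      then have "smooth_on (ball 0 \<rho>) (\<lambda>x. (T0 x + \<sigma>2 x) \<bullet> snd b)"
        by (rule smooth_on_linear_comp[where h="\<lambda>y. y \<bullet> snd b", OF open_ball bounded_linear_inner_left])
      from smooth_on_add[OF open_ball a this]
      show "smooth_on (ball 0 \<rho>) (\<lambda>x. F x \<bullet> b)" by (simp add: F_def inner_prod_def)
    qed simp
    have z1: "\<sigma>1 0 = 0" "(\<sigma>1 has_derivative (\<lambda>h. 0)) (at 0)" using small_has_derivative_zero[OF 1(1,6)] by auto
    have "norm (\<sigma>2 x) \<le> \<bar>C2\<bar> * norm x ^ 2" if "x \<in> ball 0 \<rho>" for x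
    proof -
      have "norm (\<sigma>2 x) \<le> C2 * norm x ^ 3" using 2(6) that \<rho>(3) by blast
      also have "\<dots> \<le> \<bar>C2\<bar> * norm x ^ 3" by (simp add: mult_right_mono)
      also have "\<dots> \<le> \<bar>C2\<bar> * norm x ^ 2" using that by (intro mult_left_mono power_decreasing) (auto simp: \<rho>_def)
      finally show ?thesis .
    qed
    from small_has_derivative_zero[OF \<rho>(1) this] have z2: "\<sigma>2 0 = 0" "(\<sigma>2 has_derivative (\<lambda>h. 0)) (at 0)" by auto
    show "F 0 = 0" by (simp only: F_def z1 z2 T0_def S20) (simp add: zero_prod_def)
    have "(F has_derivative (\<lambda>v. (fst v + 0, (snd v + S2 0 v) + 0))) (at 0)" unfolding F_def
      by (intro has_derivative_Pair has_derivative_add z1 z2 T0d bounded_linear.has_derivative[OF bounded_linear_fst] has_derivative_ident)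
    then show "(F has_derivative id) (at 0)" by (simp add: S20 id_def)
    fix x :: "'n heis" assume x: "x \<in> ball 0 \<rho>"
    have x1: "x \<in> ball 0 \<rho>1" and x2: "x \<in> ball 0 \<rho>2" using x \<rho> by auto
    have "norm (f x) \<le> norm x" by (rule 1(4)[OF x1])
    then have fx: "f x \<in> ball 0 \<rho>" using x by auto
    have "A (\<sigma>1 x) = \<sigma>1 (f x) + (fst (f x) - A (fst x))"
      using arg_cong[OF 1(5)[OF x1], of A] by (simp add: linear_add[OF A(1)] A' R1_def)
    then have e1: "fst (f x) + \<sigma>1 (f x) = A (fst x + \<sigma>1 x)" by (simp add: linear_add[OF A(1)])
    have "\<mu> * \<sigma>2 x = \<sigma>2 (f x) + r2 x" using 2(5)[OF x2] \<mu> by (simp add: R2_def field_simps)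
    then have "T0 (f x) + \<sigma>2 (f x) = \<mu> * (T0 x + \<sigma>2 x)" by (simp add: r2_def algebra_simps)
    then show "f x \<in> ball 0 \<rho> \<and> F (f x) = (A (fst (F x)), \<mu> * snd (F x))" using fx e1 by (simp add: F_def)
  qed
qed

section \<open>Coordinate systems with an arbitrary model space\<close>

text \<open>A chart compatible with the atlas that may take values in a Euclidean space other than the model
  space of the manifold: normal coordinates naturally take values in \<open>\<complex>\<^sup>n \<times> \<real>\<close>.\<close>

definition coord :: "('a, 'e::euclidean_space, 'm) mfd_scheme \<Rightarrow> 'a set \<Rightarrow> ('a \<Rightarrow> 'f::euclidean_space) \<Rightarrow> bool" where
  "coord M U c \<longleftrightarrow> openin (mtop M) U \<and> inj_on c U \<and> open (c ` U) \<and> smooth_fun_on M U c \<and>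
     (\<forall>(V, d)\<in>charts M. open (c ` (U \<inter> V)) \<and> smooth_on (c ` (U \<inter> V)) (d \<circ> inv_into U c))"

definition tv :: "('a, 'e::euclidean_space, 'm) mfd_scheme \<Rightarrow> 'a set \<Rightarrow> ('a \<Rightarrow> 'f::euclidean_space) \<Rightarrow> 'a \<Rightarrow> 'f \<Rightarrow> 'a tvec" where
  "tv M U c p w =
     (\<lambda>g. if smooth_near M p g then frechet_derivative (g \<circ> inv_into U c) (at (c p)) w else 0)"

lemma dir_deriv_eq_tv: "dir_deriv M U c = tv M U c"
  by (intro ext) (simp add: dir_deriv_def tv_def)

locale manifold =
  fixes M :: "('a, 'e::euclidean_space, 'm) mfd_scheme"
  assumes M: "smooth_manifold M"
begin

lemma chart:
  assumes "(U, c) \<in> charts M"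
  shows "openin (mtop M) U" "open (c ` U)" "inj_on c U"
    "\<And>V. openin (mtop M) V \<Longrightarrow> V \<subseteq> U \<Longrightarrow> open (c ` V)"
    "\<And>T. open T \<Longrightarrow> openin (mtop M) {p \<in> U. c p \<in> T}"
proof -
  have *: "openin (mtop M) U" "open (c ` U)" and hom: "homeomorphic_map (subtopology (mtop M) U) (top_of_set (c ` U)) c"
  proof -
    have "\<forall>(U, c)\<in>charts M. openin (mtop M) U \<and> open (c ` U) \<and>
        homeomorphic_map (subtopology (mtop M) U) (top_of_set (c ` U)) c"
      using M unfolding smooth_manifold_def by (elim conjE)
    from bspec[OF this assms] show "openin (mtop M) U" "open (c ` U)" "homeomorphic_map (subtopology (mtop M) U) (top_of_set (c ` U)) c"
      by simp_all
  qed
  show "openin (mtop M) U" "open (c ` U)" by fact+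
  have ts: "topspace (subtopology (mtop M) U) = U" using openin_subset[OF *(1)] by auto
  show "inj_on c U" using homeomorphic_imp_injective_map[OF hom] ts by simp
  show "open (c ` V)" if "openin (mtop M) V" "V \<subseteq> U" for V
  proof -
    have "openin (subtopology (mtop M) U) V" using that by (simp add: openin_open_subtopology *)
    then have "openin (top_of_set (c ` U)) (c ` V)" using homeomorphic_imp_open_map[OF hom] by (simp add: open_map_def)
    then show ?thesis using *(2) by (simp add: openin_open_eq)
  qed
  show "openin (mtop M) {p \<in> U. c p \<in> T}" if "open T" for T
  proof -
    have "openin (top_of_set (c ` U)) (c ` U \<inter> T)" using that by (simp add: openin_open_Int)
    then have "openin (subtopology (mtop M) U) {p \<in> topspace (subtopology (mtop M) U). c p \<in> c ` U \<inter> T}"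
      using homeomorphic_imp_continuous_map[OF hom] by (simp only: continuous_map_def)
    moreover have "{p \<in> topspace (subtopology (mtop M) U). c p \<in> c ` U \<inter> T} = {p \<in> U. c p \<in> T}" using ts by auto
    ultimately show ?thesis using *(1) by (simp add: openin_open_subtopology)
  qed
qed

lemma charts_compatible:
  "(U, c) \<in> charts M \<Longrightarrow> (V, d) \<in> charts M \<Longrightarrow> smooth_on (c ` (U \<inter> V)) (d \<circ> inv_into U c)"
  using M unfolding smooth_manifold_def by fast

lemma chart_at:
  assumes "p \<in> topspace (mtop M)" obtains U c where "(U, c) \<in> charts M" "p \<in> U"
  using assms M unfolding smooth_manifold_def by blast

lemma smooth_fun_onD: "smooth_fun_on M W g \<Longrightarrow> (U, c) \<in> charts M \<Longrightarrow> smooth_on (c ` (U \<inter> W)) (g \<circ> inv_into U c)"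
  unfolding smooth_fun_on_def by fast

lemma smooth_fun_on_openin: "smooth_fun_on M W g \<Longrightarrow> openin (mtop M) W"
  unfolding smooth_fun_on_def by fast

lemma smooth_fun_on_subset: "smooth_fun_on M W g \<Longrightarrow> openin (mtop M) V \<Longrightarrow> V \<subseteq> W \<Longrightarrow> smooth_fun_on M V g"
  unfolding smooth_fun_on_def by (fast intro: smooth_on_subset)

lemma coordD:
  assumes "coord M U c"
  shows "openin (mtop M) U" "inj_on c U" "open (c ` U)" "smooth_fun_on M U c"
    "\<And>V d. (V, d) \<in> charts M \<Longrightarrow> open (c ` (U \<inter> V))"
    "\<And>V d. (V, d) \<in> charts M \<Longrightarrow> smooth_on (c ` (U \<inter> V)) (d \<circ> inv_into U c)"
  using assms unfolding coord_def by auto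

lemma chart_coord: 
  assumes c: "(U, c) \<in> charts M" shows "coord M U c"
proof -
  have a: "smooth_fun_on M U c" unfolding smooth_fun_on_def
    using chart(1)[OF c] charts_compatible[OF _ c] by blast
  have "open (c ` (U \<inter> V))" if "(V, d) \<in> charts M" for V d
    by (rule chart(4)[OF c]) (use chart(1)[OF c] chart(1)[OF that] in auto)
  then show ?thesis unfolding coord_def using a chart(1-3)[OF c] charts_compatible[OF c] by blast
qed

lemma coord_topspace: "coord M U c \<Longrightarrow> U \<subseteq> topspace (mtop M)"
  using coordD(1) openin_subset by blast

lemma coord_inv: "coord M U c \<Longrightarrow> p \<in> U \<Longrightarrow> inv_into U c (c p) = p"
  by (simp add: coordD(2))

lemma coord_openin:
  assumes c: "coord M U c" and T: "open T"
  shows "openin (mtop M) {p \<in> U. c p \<in> T}"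
proof (subst openin_subopen, intro ballI)
  fix p assume p: "p \<in> {p \<in> U. c p \<in> T}"
  then obtain V d where d: "(V, d) \<in> charts M" "p \<in> V" using chart_at coord_topspace[OF c] by blast
  have o: "open (d ` (V \<inter> U))" by (rule chart(4)[OF d(1)]) (use chart(1)[OF d(1)] coordD(1)[OF c] in auto)
  have "continuous_on (d ` (V \<inter> U)) (c \<circ> inv_into V d)"
    by (rule smooth_on_continuous_on[OF smooth_fun_onD[OF coordD(4)[OF c] d(1)]])
  then have "open (d ` (V \<inter> U) \<inter> (c \<circ> inv_into V d) -` T)" using o T by (rule continuous_open_preimage)
  from chart(5)[OF d(1) this]
  have "openin (mtop M) {q \<in> V. d q \<in> d ` (V \<inter> U) \<inter> (c \<circ> inv_into V d) -` T}" .
  moreover have "{q \<in> V. d q \<in> d ` (V \<inter> U) \<inter> (c \<circ> inv_into V d) -` T} = {q \<in> V. q \<in> U \<and> c q \<in> T}"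
    by (auto simp: inj_on_eq_iff[OF chart(3)[OF d(1)]] inv_into_f_f[OF chart(3)[OF d(1)]])
  ultimately show "\<exists>T'. openin (mtop M) T' \<and> p \<in> T' \<and> T' \<subseteq> {p \<in> U. c p \<in> T}" using p d by auto
qed

lemma coord_open_image:
  assumes c: "coord M U c" and V: "openin (mtop M) V" "V \<subseteq> U"
  shows "open (c ` V)"
proof (subst open_subopen, intro ballI)
  fix y assume "y \<in> c ` V"
  then obtain p where p: "p \<in> V" "y = c p" by auto
  then obtain W d where d: "(W, d) \<in> charts M" "p \<in> W" using chart_at openin_subset[OF V(1)] by blast
  have o: "open (d ` (W \<inter> V))" by (rule chart(4)[OF d(1)]) (use chart(1)[OF d(1)] V in auto)
  have "open (c ` (U \<inter> W) \<inter> (d \<circ> inv_into U c) -` (d ` (W \<inter> V)))"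
    by (rule continuous_open_preimage[OF smooth_on_continuous_on[OF coordD(6)[OF c d(1)]] coordD(5)[OF c d(1)] o])
  moreover have "c ` (U \<inter> W) \<inter> (d \<circ> inv_into U c) -` (d ` (W \<inter> V)) \<subseteq> c ` V"
  proof
    fix z assume "z \<in> c ` (U \<inter> W) \<inter> (d \<circ> inv_into U c) -` (d ` (W \<inter> V))"
    then obtain q where q: "q \<in> U" "q \<in> W" "z = c q" "d (inv_into U c z) \<in> d ` (W \<inter> V)" by auto
    then have "d q \<in> d ` (W \<inter> V)" using coord_inv[OF c q(1)] by simp
    then have "q \<in> W \<inter> V" using inj_on_image_mem_iff[OF chart(3)[OF d(1)] q(2)] by blast
    then show "z \<in> c ` V" unfolding q(3) by blast
  qed
  moreover have "y \<in> c ` (U \<inter> W) \<inter> (d \<circ> inv_into U c) -` (d ` (W \<inter> V))"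
    using p d V coord_inv[OF c] by auto
  ultimately show "\<exists>T. open T \<and> y \<in> T \<and> T \<subseteq> c ` V" by blast
qed

lemma smooth_fun_on_pull:
  assumes c: "coord M U c" and V: "V \<subseteq> U" and g: "smooth_fun_on M V g"
  shows "smooth_on (c ` V) (g \<circ> inv_into U c)"
proof (rule smooth_on_local)
  fix y assume "y \<in> c ` V"
  then obtain p where p: "p \<in> V" "y = c p" by auto
  have oV: "openin (mtop M) V" by (rule smooth_fun_on_openin[OF g])
  then obtain W d where d: "(W, d) \<in> charts M" "p \<in> W" using chart_at p openin_subset by blast
  have oVW: "openin (mtop M) (W \<inter> V)" using oV chart(1)[OF d(1)] by auto
  define T where "T = c ` (W \<inter> V)"
  have T: "open T" unfolding T_def by (rule coord_open_image[OF c oVW]) (use V in auto)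
  have inv: "inv_into U c (c q) = q" "inv_into W d (d q) = q" if "q \<in> W \<inter> V" for q
    using that V coord_inv[OF c] chart(3)[OF d(1)] by auto
  have "smooth_on T (\<lambda>y. (g \<circ> inv_into W d) ((d \<circ> inv_into U c) y))"
  proof (rule smooth_on_compose[where T="d ` (W \<inter> V)", OF T])
    show "open (d ` (W \<inter> V))" by (rule chart(4)[OF d(1) oVW]) auto
    show "(d \<circ> inv_into U c) ` T \<subseteq> d ` (W \<inter> V)" unfolding T_def using inv by auto
    show "smooth_on (d ` (W \<inter> V)) (g \<circ> inv_into W d)" by (rule smooth_fun_onD[OF g d(1)])
    show "smooth_on T (d \<circ> inv_into U c)"
      by (rule smooth_on_subset[OF coordD(6)[OF c d(1)]]) (use V in \<open>auto simp: T_def\<close>)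
  qed
  then have "smooth_on T (g \<circ> inv_into U c)"
    by (rule smooth_on_cong[OF T, rotated]) (auto simp: T_def inv)
  then show "\<exists>T. open T \<and> y \<in> T \<and> smooth_on T (g \<circ> inv_into U c)" using T p d by (auto simp: T_def)
qed

lemma smooth_fun_on_push:
  fixes c :: "'a \<Rightarrow> 'f::euclidean_space"
  assumes c: "coord M U c" and V: "openin (mtop M) V" "V \<subseteq> U" and g: "smooth_on (c ` V) (g \<circ> inv_into U c)"
  shows "smooth_fun_on M V g"
  unfolding smooth_fun_on_def
proof (intro conjI V(1) ballI, clarify)
  fix W d assume d: "(W, d) \<in> charts M"
  have oVW: "openin (mtop M) (W \<inter> V)" using V chart(1)[OF d(1)] by auto
  have o: "open (d ` (W \<inter> V))" by (rule chart(4)[OF d oVW]) auto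
  have inv: "inv_into U c (c q) = q" "inv_into W d (d q) = q" if "q \<in> W \<inter> V" for q
    using that V coord_inv[OF c] chart(3)[OF d(1)] by auto
  have "smooth_on (d ` (W \<inter> V)) (\<lambda>y. (g \<circ> inv_into U c) ((c \<circ> inv_into W d) y))"
  proof (rule smooth_on_compose[where T="c ` V", OF o])
    show "open (c ` V)" by (rule coord_open_image[OF c V])
    show "(c \<circ> inv_into W d) ` d ` (W \<inter> V) \<subseteq> c ` V" using inv by auto
    show "smooth_on (d ` (W \<inter> V)) (c \<circ> inv_into W d)"
      by (rule smooth_on_subset[OF smooth_fun_onD[OF coordD(4)[OF c] d]]) (use V in auto)
  qed (rule g)
  then show "smooth_on (d ` (W \<inter> V)) (g \<circ> inv_into W d)"
    by (rule smooth_on_cong[OF o, rotated]) (auto simp: inv)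
qed

lemma smooth_near_iff:
  assumes c: "coord M U c" and p: "p \<in> U"
  shows "smooth_near M p g \<longleftrightarrow> (\<exists>S. open S \<and> c p \<in> S \<and> S \<subseteq> c ` U \<and> smooth_on S (g \<circ> inv_into U c))"
proof
  assume "smooth_near M p g"
  then obtain W where W: "p \<in> W" "smooth_fun_on M W g" by (auto simp: smooth_near_def)
  have o: "openin (mtop M) (W \<inter> U)" using smooth_fun_on_openin[OF W(2)] coordD(1)[OF c] by auto
  have "smooth_on (c ` (W \<inter> U)) (g \<circ> inv_into U c)"
    by (rule smooth_fun_on_pull[OF c _ smooth_fun_on_subset[OF W(2) o]]) auto
  moreover have "open (c ` (W \<inter> U))" by (rule coord_open_image[OF c o]) auto
  ultimately show "\<exists>S. open S \<and> c p \<in> S \<and> S \<subseteq> c ` U \<and> smooth_on S (g \<circ> inv_into U c)" using W p by blast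
next
  assume "\<exists>S. open S \<and> c p \<in> S \<and> S \<subseteq> c ` U \<and> smooth_on S (g \<circ> inv_into U c)"
  then obtain S where S: "open S" "c p \<in> S" "S \<subseteq> c ` U" "smooth_on S (g \<circ> inv_into U c)" by blast
  have im: "c ` {q \<in> U. c q \<in> S} = S" using S(3) by auto
  have "smooth_fun_on M {q \<in> U. c q \<in> S} g"
  proof (rule smooth_fun_on_push[OF c coord_openin[OF c S(1)]])
    show "smooth_on (c ` {q \<in> U. c q \<in> S}) (g \<circ> inv_into U c)" unfolding im by (rule S(4))
  qed blast
  moreover have "p \<in> {q \<in> U. c q \<in> S}" using p S(2) by simp
  ultimately show "smooth_near M p g" unfolding smooth_near_def
    by (intro exI[of _ "{q \<in> U. c q \<in> S}"] conjI)
qed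

lemma smooth_near_coord:
  assumes c: "coord M U c" and p: "p \<in> U" and h: "smooth_on (c ` U) h"
  shows "smooth_near M p (\<lambda>q. h (c q))"
proof -
  have "smooth_on (c ` U) ((\<lambda>q. h (c q)) \<circ> inv_into U c)"
    by (rule smooth_on_cong[OF coordD(3)[OF c] _ h]) (auto simp: coord_inv[OF c])
  then show ?thesis using smooth_near_iff[OF c p] coordD(3)[OF c] p by blast
qed

lemma tv_eval:
  assumes c: "coord M U c" and p: "p \<in> U" and h: "smooth_on (c ` U) h"
  shows "tv M U c p w (\<lambda>q. h (c q)) = frechet_derivative h (at (c p)) w"
proof -
  have "frechet_derivative h (at (c p)) = frechet_derivative ((\<lambda>q. h (c q)) \<circ> inv_into U c) (at (c p))"
    by (rule frechet_derivative_transform_within_open[OF smooth_on_differentiable[OF h] coordD(3)[OF c]])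
       (use p in \<open>auto simp: coord_inv[OF c]\<close>)
  then show ?thesis unfolding tv_def using smooth_near_coord[OF c p h] by simp
qed

lemma tv_component:
  assumes c: "coord M U c" and p: "p \<in> U"
  shows "tv M U c p w (\<lambda>q. complex_of_real (c q \<bullet> b)) = complex_of_real (w \<bullet> b)"
proof -
  have bl: "bounded_linear (\<lambda>y. complex_of_real (y \<bullet> b))"
    by (rule bounded_linear_compose[OF bounded_linear_of_real bounded_linear_inner_left])
  have "tv M U c p w (\<lambda>q. complex_of_real (c q \<bullet> b)) = frechet_derivative (\<lambda>y. complex_of_real (y \<bullet> b)) (at (c p)) w"
    by (rule tv_eval[OF c p smooth_on_linear[OF coordD(3)[OF c] bl]])
  then show ?thesis using frechetI[OF bounded_linear_imp_has_derivative[OF bl]] by metis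
qed

lemma tv_inj:
  fixes c :: "'a \<Rightarrow> 'f::euclidean_space"
  assumes c: "coord M U c" and p: "p \<in> U" and eq: "tv M U c p w = tv M U c p w'"
  shows "w = w'"
proof (rule euclidean_eqI)
  fix b :: 'f assume "b \<in> Basis"
  show "w \<bullet> b = w' \<bullet> b" using tv_component[OF c p, of w b] tv_component[OF c p, of w' b] eq by (metis of_real_eq_iff)
qed

lemma tv_near_differentiable:
  assumes c: "coord M U c" and p: "p \<in> U" and g: "smooth_near M p g"
  shows "(g \<circ> inv_into U c) differentiable at (c p)"
  using g smooth_near_iff[OF c p] smooth_on_differentiable by blast

lemma tv_linear:
  assumes c: "coord M U c" and p: "p \<in> U"
  shows "(\<lambda>g. of_real a * tv M U c p w g + of_real b * tv M U c p w' g) = tv M U c p (a *\<^sub>R w + b *\<^sub>R w')"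
proof
  fix g
  show "of_real a * tv M U c p w g + of_real b * tv M U c p w' g = tv M U c p (a *\<^sub>R w + b *\<^sub>R w') g"
  proof (cases "smooth_near M p g")
    case True
    from frechet_linear[OF tv_near_differentiable[OF c p True]] show ?thesis
      unfolding tv_def using True by (simp add: linear_add linear_scale scaleR_conv_of_real)
  qed (simp add: tv_def)
qed

lemma tv_change:
  fixes c :: "'a \<Rightarrow> 'f::euclidean_space" and d :: "'a \<Rightarrow> 'g::euclidean_space"
  assumes c: "coord M U c" and d: "coord M V d" and p: "p \<in> U" "p \<in> V"
  shows "tv M V d p w = tv M U c p (frechet_derivative (c \<circ> inv_into V d) (at (d p)) w)"
proof
  fix g
  show "tv M V d p w g = tv M U c p (frechet_derivative (c \<circ> inv_into V d) (at (d p)) w) g"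
  proof (cases "smooth_near M p g")
    case True
    have oUV: "openin (mtop M) (U \<inter> V)" using coordD(1)[OF c] coordD(1)[OF d] by auto
    have s: "smooth_on (d ` (U \<inter> V)) (c \<circ> inv_into V d)"
      by (rule smooth_fun_on_pull[OF d _ smooth_fun_on_subset[OF coordD(4)[OF c] oUV]]) auto
    have o: "open (d ` (U \<inter> V))" by (rule coord_open_image[OF d oUV]) auto
    have d1: "((c \<circ> inv_into V d) has_derivative frechet_derivative (c \<circ> inv_into V d) (at (d p))) (at (d p))"
      by (rule smooth_on_has_derivative[OF s]) (use p in auto)
    have cp: "(c \<circ> inv_into V d) (d p) = c p" using coord_inv[OF d p(2)] by simp
    have "((g \<circ> inv_into U c) has_derivative frechet_derivative (g \<circ> inv_into U c) (at (c p))) (at ((c \<circ> inv_into V d) (d p)))"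
      unfolding cp by (rule has_frechet[OF tv_near_differentiable[OF c p(1) True]])
    from diff_chain_at[OF d1 this]
    have "((g \<circ> inv_into V d) has_derivative (\<lambda>w. frechet_derivative (g \<circ> inv_into U c) (at (c p)) (frechet_derivative (c \<circ> inv_into V d) (at (d p)) w))) (at (d p))"
      unfolding o_def
    proof (rule has_derivative_transform_within_open[OF _ o])
      show "d p \<in> d ` (U \<inter> V)" using p by auto
      fix y assume "y \<in> d ` (U \<inter> V)"
      then show "g (inv_into U c (c (inv_into V d y))) = g (inv_into V d y)"
        using coord_inv[OF c] coord_inv[OF d] by auto
    qed
    then show ?thesis unfolding tv_def using True by (simp add: frechetI)
  qed (simp add: tv_def)
qed

lemma tangent_space_coord:
  assumes c: "coord M U c" and p: "p \<in> U"
  shows "tangent_space M p = range (tv M U c p)"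
proof
  show "tangent_space M p \<subseteq> range (tv M U c p)"
  proof
    fix X assume "X \<in> tangent_space M p"
    then obtain V d w where "X = tv M V d p w" "(V, d) \<in> charts M" "p \<in> V"
      by (auto simp: tangent_space_def dir_deriv_eq_tv)
    then have "X = tv M U c p (frechet_derivative (c \<circ> inv_into V d) (at (d p)) w)"
      using tv_change[OF c chart_coord p] by simp
    then show "X \<in> range (tv M U c p)" by (rule range_eqI)
  qed
  obtain V d where d: "(V, d) \<in> charts M" "p \<in> V" using chart_at p coord_topspace[OF c] by blast
  show "range (tv M U c p) \<subseteq> tangent_space M p"
  proof
    fix X assume "X \<in> range (tv M U c p)"
    then obtain w where "X = tv M U c p w" by blast
    then have "X = tv M V d p (frechet_derivative (d \<circ> inv_into U c) (at (c p)) w)"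
      using tv_change[OF chart_coord[OF d(1)] c d(2) p] by simp
    then show "X \<in> tangent_space M p" unfolding tangent_space_def dir_deriv_eq_tv using d by blast
  qed
qed

subsection \<open>Making new coordinate systems\<close>

lemma coord_subset:
  assumes c: "coord M U c" and V: "openin (mtop M) V" "V \<subseteq> U"
  shows "coord M V c"
  unfolding coord_def
proof (intro conjI ballI, goal_cases)
  case 1 show ?case by (rule V)
  case 2 show ?case using coordD(2)[OF c] V inj_on_subset by blast
  case 3 show ?case by (rule coord_open_image[OF c V])
  case 4 show ?case by (rule smooth_fun_on_subset[OF coordD(4)[OF c] V])
  case (5 x)
  obtain W d where x: "x = (W, d)" and d: "(W, d) \<in> charts M" using 5 by (cases x) auto
  have o: "open (c ` (V \<inter> W))" by (rule coord_open_image[OF c]) (use V chart(1)[OF d] in auto)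
  have inj: "inj_on c V" using coordD(2)[OF c] V inj_on_subset by blast
  have "smooth_on (c ` (V \<inter> W)) (d \<circ> inv_into U c)"
    by (rule smooth_on_subset[OF coordD(6)[OF c d]]) (use V in auto)
  then have "smooth_on (c ` (V \<inter> W)) (d \<circ> inv_into V c)"
    by (rule smooth_on_cong[OF o, rotated]) (use inj V coord_inv[OF c] in auto)
  then show ?case using o x by simp
qed

lemma tv_subset:
  assumes c: "coord M U c" and V: "openin (mtop M) V" "V \<subseteq> U" and p: "p \<in> V"
  shows "tv M V c p w = tv M U c p w"
proof -
  have pU: "p \<in> U" using p V by auto
  have "tv M V c p w = tv M U c p (frechet_derivative (c \<circ> inv_into V c) (at (c p)) w)"
    by (rule tv_change[OF c coord_subset[OF c V] pU p])
  also have "frechet_derivative (c \<circ> inv_into V c) (at (c p)) = id"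
  proof (rule frechetI, rule has_derivative_transform_within_open[OF has_derivative_id])
    show "open (c ` V)" by (rule coord_open_image[OF c V])
  qed (use p in \<open>auto simp: f_inv_into_f\<close>)
  finally show ?thesis by simp
qed

lemma coord_compose:
  fixes c :: "'a \<Rightarrow> 'f::euclidean_space" and h :: "'f \<Rightarrow> 'g::euclidean_space"
  assumes c: "coord M U c" and h: "smooth_on (c ` U) h" "open (h ` c ` U)" "smooth_on (h ` c ` U) k" "\<And>y. y \<in> c ` U \<Longrightarrow> k (h y) = y"
  shows "coord M U (h \<circ> c)"
proof -
  have inj: "inj_on (h \<circ> c) U" by (rule comp_inj_on[OF coordD(2)[OF c] inj_on_inverseI[of "c ` U" k h, OF h(4)]])
  have inv: "inv_into U (h \<circ> c) (h (c p)) = p" if "p \<in> U" for p using inv_into_f_f[OF inj that] unfolding o_apply .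
  have im: "(h \<circ> c) ` V = h ` c ` V" for V by auto
  have hinv: "h ` T = (h ` c ` U) \<inter> k -` T" if T: "T \<subseteq> c ` U" for T
  proof (intro subset_antisym subsetI)
    fix y assume "y \<in> h ` T"
    then obtain x where x: "x \<in> T" "y = h x" by blast
    have xU: "x \<in> c ` U" using T x(1) by blast
    then have "k (h x) \<in> T" using x(1) h(4)[OF xU] by simp
    then show "y \<in> (h ` c ` U) \<inter> k -` T" unfolding x(2) using xU by simp
  next
    fix y assume "y \<in> (h ` c ` U) \<inter> k -` T"
    then obtain x where x: "x \<in> c ` U" "y = h x" "k y \<in> T" by blast
    then have "x \<in> T" using x(3) h(4)[OF x(1)] unfolding x(2) by simp
    then show "y \<in> h ` T" unfolding x(2) by (rule imageI)
  qed
  have oim: "open (h ` T)" if "open T" "T \<subseteq> c ` U" for T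
    unfolding hinv[OF that(2)] by (rule continuous_open_preimage[OF smooth_on_continuous_on[OF h(3)] h(2) that(1)])
  show ?thesis
    unfolding coord_def
  proof (intro conjI ballI, goal_cases)
    case 1 show ?case by (rule coordD(1)[OF c])
    case 2 show ?case by (rule inj)
    case 3 show ?case unfolding im by (rule h(2))
    case 4
    have "smooth_on (c ` U) ((h \<circ> c) \<circ> inv_into U c)"
    proof (rule smooth_on_cong[OF coordD(3)[OF c] _ h(1)])
      fix x assume "x \<in> c ` U"
      then show "h x = ((h \<circ> c) \<circ> inv_into U c) x" by (simp add: f_inv_into_f)
    qed
    then show ?case by (rule smooth_fun_on_push[OF c coordD(1)[OF c] subset_refl])
  next
    case (5 x)
    obtain W d where x: "x = (W, d)" and d: "(W, d) \<in> charts M" using 5 by (cases x) auto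
    have o: "open (c ` (U \<inter> W))" by (rule coordD(5)[OF c d])
    have o': "open (h ` c ` (U \<inter> W))" by (rule oim[OF o image_mono[OF Int_lower1]])
    have "smooth_on (h ` c ` (U \<inter> W)) (\<lambda>y. (d \<circ> inv_into U c) (k y))"
    proof (rule smooth_on_compose[where T="c ` (U \<inter> W)" and g="d \<circ> inv_into U c" and f=k, OF o' o _ coordD(6)[OF c d]])
      show "k ` h ` c ` (U \<inter> W) \<subseteq> c ` (U \<inter> W)"
      unfolding image_image
      proof (rule image_subsetI)
        fix q assume q: "q \<in> U \<inter> W"
        then have "c q \<in> c ` U" by simp
        from h(4)[OF this] have e: "k (h (c q)) = c q" .
        show "k (h (c q)) \<in> c ` (U \<inter> W)" unfolding e by (rule imageI[OF q])
      qed
      show "smooth_on (h ` c ` (U \<inter> W)) k" by (rule smooth_on_subset[OF h(3)]) (intro image_mono Int_lower1)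
    qed
    then have "smooth_on (h ` c ` (U \<inter> W)) (d \<circ> inv_into U (h \<circ> c))"
    proof (rule smooth_on_cong[OF o', rotated])
      fix y assume "y \<in> h ` c ` (U \<inter> W)"
      then obtain q where q: "q \<in> U" "y = h (c q)" by (elim imageE IntE) simp
      have "k y = c q" unfolding q(2) by (intro h(4) imageI q(1))
      then show "(d \<circ> inv_into U c) (k y) = (d \<circ> inv_into U (h \<circ> c)) y" using q inv[OF q(1)] coord_inv[OF c q(1)] by simp
    qed
    then show ?case unfolding x prod.case im using o' by blast
  qed
qed

lemma tv_compose:
  fixes c :: "'a \<Rightarrow> 'f::euclidean_space" and h :: "'f \<Rightarrow> 'g::euclidean_space"
  assumes c: "coord M U c" and hc: "coord M U (h \<circ> c)" and p: "p \<in> U" and h: "(h has_derivative h') (at (c p))"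
  shows "tv M U c p w = tv M U (h \<circ> c) p (h' w)"
proof -
  have "tv M U c p w = tv M U (h \<circ> c) p (frechet_derivative ((h \<circ> c) \<circ> inv_into U c) (at (c p)) w)"
    by (rule tv_change[OF hc c p p])
  also have "frechet_derivative ((h \<circ> c) \<circ> inv_into U c) (at (c p)) = h'"
    by (rule frechetI, rule has_derivative_transform_within_open[OF h coordD(3)[OF c]])
       (use p in \<open>auto simp: coord_inv[OF c]\<close>)
  finally show ?thesis .
qed

end

section \<open>Vector fields, 1-forms and diffeomorphisms in coordinates\<close>

definition coord_form :: "('a, 'e::euclidean_space, 'm) mfd_scheme \<Rightarrow> 'a set \<Rightarrow> ('a \<Rightarrow> 'f::euclidean_space) \<Rightarrow>
    ('a \<Rightarrow> 'a tvec \<Rightarrow> real) \<Rightarrow> 'f \<Rightarrow> 'f \<Rightarrow> real" where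
  "coord_form M U c \<theta> y w = \<theta> (inv_into U c y) (tv M U c (inv_into U c y) w)"

context manifold begin

lemma vector_field_subset:
  "smooth_vector_field M W X \<Longrightarrow> openin (mtop M) V \<Longrightarrow> V \<subseteq> W \<Longrightarrow> smooth_vector_field M V X"
  unfolding smooth_vector_field_def by (meson order_trans subsetD)

text \<open>The coefficients of a smooth vector field are its values on the coordinate functions, hence smooth.\<close>

lemma vector_field_rep:
  fixes c :: "'a \<Rightarrow> 'f::euclidean_space"
  assumes c: "coord M U c" and X: "smooth_vector_field M W X" and W: "W \<subseteq> U"
  obtains Y where "smooth_on (c ` W) Y" "\<And>p. p \<in> W \<Longrightarrow> X p = tv M U c p (Y (c p))"
proof -
  have oW: "openin (mtop M) W" using X unfolding smooth_vector_field_def by (elim conjE)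
  have o: "open (c ` W)" by (rule coord_open_image[OF c oW W])
  define Y where "Y y = (\<Sum>b\<in>Basis. Re (X (inv_into U c y) (\<lambda>q. complex_of_real (c q \<bullet> b))) *\<^sub>R b)" for y
  have "smooth_on (c ` W) Y"
  proof (rule smooth_on_componentwise[OF o])
    fix b :: 'f assume b: "b \<in> Basis"
    have "smooth_on (c ` W) (\<lambda>y. complex_of_real (y \<bullet> b))"
      by (rule smooth_on_linear[OF o bounded_linear_compose[OF bounded_linear_of_real bounded_linear_inner_left]])
    then have "smooth_on (c ` W) ((\<lambda>q. complex_of_real (c q \<bullet> b)) \<circ> inv_into U c)"
      by (rule smooth_on_cong[OF o, rotated]) (use W coord_inv[OF c] in auto)
    then have "smooth_fun_on M W (\<lambda>q. complex_of_real (c q \<bullet> b))" by (rule smooth_fun_on_push[OF c oW W])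
    then have "smooth_fun_on M W (\<lambda>p. X p (\<lambda>q. complex_of_real (c q \<bullet> b)))"
      using X unfolding smooth_vector_field_def by (meson subset_refl)
    then have "smooth_on (c ` W) ((\<lambda>p. X p (\<lambda>q. complex_of_real (c q \<bullet> b))) \<circ> inv_into U c)"
      by (rule smooth_fun_on_pull[OF c W])
    then have "smooth_on (c ` W) (\<lambda>y. Re (((\<lambda>p. X p (\<lambda>q. complex_of_real (c q \<bullet> b))) \<circ> inv_into U c) y))"
      by (rule smooth_on_linear_comp[where h=Re, OF o bounded_linear_Re])
    moreover have "Y y \<bullet> b = Re (X (inv_into U c y) (\<lambda>q. complex_of_real (c q \<bullet> b)))" for y
      unfolding Y_def using b by (simp add: inner_sum_left inner_Basis if_distrib[of "(*) _"] sum.delta cong: if_cong)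
    ultimately show "smooth_on (c ` W) (\<lambda>y. Y y \<bullet> b)" by simp
  qed
  moreover have "X p = tv M U c p (Y (c p))" if p: "p \<in> W" for p
  proof -
    have pU: "p \<in> U" using p W by blast
    have "X p \<in> tangent_space M p" using X p unfolding smooth_vector_field_def by blast
    then obtain w where w: "X p = tv M U c p w" using tangent_space_coord[OF c pU] by blast
    have "Re (X p (\<lambda>q. complex_of_real (c q \<bullet> b))) = w \<bullet> b" for b
      unfolding w tv_component[OF c pU] by simp
    then have "Y (c p) = w" unfolding Y_def coord_inv[OF c pU] by (simp add: euclidean_representation)
    then show ?thesis using w by simp
  qed
  ultimately show thesis by (rule that)
qed

lemma vector_field_mk:
  fixes c :: "'a \<Rightarrow> 'f::euclidean_space"
  assumes c: "coord M U c" and W: "openin (mtop M) W" "W \<subseteq> U" and Y: "smooth_on (c ` W) Y"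
  shows "smooth_vector_field M W (\<lambda>p. tv M U c p (Y (c p)))"
  unfolding smooth_vector_field_def
proof (intro conjI W(1) ballI allI impI; (elim conjE)?)
  fix p assume "p \<in> W"
  then show "tv M U c p (Y (c p)) \<in> tangent_space M p" using tangent_space_coord[OF c] W by blast
next
  fix V and g :: "'a \<Rightarrow> complex" assume V: "V \<subseteq> W" and g: "smooth_fun_on M V g"
  have oV: "openin (mtop M) V" by (rule smooth_fun_on_openin[OF g])
  have VU: "V \<subseteq> U" using V W by simp
  have o: "open (c ` V)" by (rule coord_open_image[OF c oV VU])
  show "smooth_fun_on M V (\<lambda>p. tv M U c p (Y (c p)) g)"
  proof (rule smooth_fun_on_push[OF c oV VU])
    have "smooth_on (c ` V) (\<lambda>y. frechet_derivative (g \<circ> inv_into U c) (at y) (Y y))"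
      by (rule smooth_on_frechet_field[OF o smooth_fun_on_pull[OF c VU g]], rule smooth_on_subset[OF Y image_mono[OF V]])
    then show "smooth_on (c ` V) ((\<lambda>p. tv M U c p (Y (c p)) g) \<circ> inv_into U c)"
    proof (rule smooth_on_cong[OF o, rotated])
      fix y assume "y \<in> c ` V"
      then obtain p where p: "p \<in> V" "y = c p" by blast
      have "smooth_near M p g" unfolding smooth_near_def using g p by blast
      moreover have "inv_into U c y = p" using coord_inv[OF c] p VU by auto
      ultimately show "frechet_derivative (g \<circ> inv_into U c) (at y) (Y y) = ((\<lambda>p. tv M U c p (Y (c p)) g) \<circ> inv_into U c) y"
        using p by (simp add: tv_def)
    qed
  qed
qed

lemma coord_form_at: "coord M U c \<Longrightarrow> p \<in> U \<Longrightarrow> coord_form M U c \<theta> (c p) w = \<theta> p (tv M U c p w)"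
  by (simp add: coord_form_def coord_inv)

lemma coord_form_linear:
  assumes c: "coord M U c" and \<theta>: "one_form_on M W \<theta>" "U \<subseteq> W" and y: "y \<in> c ` U"
  shows "linear (coord_form M U c \<theta> y)"
proof -
  obtain p where p: "p \<in> U" "y = c p" using y by blast
  have "coord_form M U c \<theta> y (a *\<^sub>R u + b *\<^sub>R v) = a * coord_form M U c \<theta> y u + b * coord_form M U c \<theta> y v" for a b u v
  proof -
    have "tv M U c p u \<in> tangent_space M p" "tv M U c p v \<in> tangent_space M p" using tangent_space_coord[OF c p(1)] by blast+
    then have "\<theta> p (\<lambda>g. of_real a * tv M U c p u g + of_real b * tv M U c p v g) = a * \<theta> p (tv M U c p u) + b * \<theta> p (tv M U c p v)"
      using \<theta> p(1) unfolding one_form_on_def by (meson subsetD)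
    then show ?thesis unfolding p(2) coord_form_at[OF c p(1)] tv_linear[OF c p(1)] .
  qed
  from this[of 1 _ 1] this[of _ _ 0] show ?thesis by (intro linearI) simp_all
qed

lemma coord_form_smooth:
  assumes c: "coord M U c" and \<theta>: "one_form_on M W \<theta>" "U \<subseteq> W"
  shows "smooth_on (c ` U) (\<lambda>y. coord_form M U c \<theta> y w)"
proof -
  have "smooth_vector_field M U (\<lambda>p. tv M U c p ((\<lambda>y. w) (c p)))"
    by (rule vector_field_mk[OF c coordD(1)[OF c] subset_refl smooth_on_const[OF coordD(3)[OF c]]])
  then have "smooth_fun_on M U (\<lambda>p. \<theta> p (tv M U c p w))"
    using \<theta> unfolding one_form_on_def by blast
  from smooth_fun_on_pull[OF c subset_refl this]
  show ?thesis unfolding coord_form_def[abs_def] by (simp add: o_def)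
qed

text \<open>The terms that contain derivatives of the coefficients of \<open>X\<close> and \<open>Y\<close> cancel against the value of
  the form on the bracket; what remains depends on the values of the fields at the point only. This makes the exterior
  derivative well defined and computes it.\<close>

lemma ext_deriv_fields:
  fixes c :: "'a \<Rightarrow> 'f::euclidean_space"
  assumes c: "coord M U c" and p: "p \<in> U" and \<theta>: "one_form_on M Z \<theta>" "U \<subseteq> Z"
    and W: "p \<in> W" and X: "smooth_vector_field M W X" and Y: "smooth_vector_field M W Y"
    and Xp: "X p = tv M U c p u" and Yp: "Y p = tv M U c p v"
  shows "Re (X p (\<lambda>q. of_real (\<theta> q (Y q)))) - Re (Y p (\<lambda>q. of_real (\<theta> q (X q)))) - \<theta> p (lie_bracket M X Y p)
    = frechet_derivative (\<lambda>y. coord_form M U c \<theta> y v) (at (c p)) u - frechet_derivative (\<lambda>y. coord_form M U c \<theta> y u) (at (c p)) v"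
proof -
  define V where "V = W \<inter> U"
  have oV: "openin (mtop M) V" unfolding V_def using X coordD(1)[OF c] unfolding smooth_vector_field_def by (intro openin_Int) blast+
  have V: "V \<subseteq> U" "V \<subseteq> W" "p \<in> V" using W p by (auto simp: V_def)
  have XV: "smooth_vector_field M V X" and YV: "smooth_vector_field M V Y"
    by (rule vector_field_subset[OF X oV V(2)], rule vector_field_subset[OF Y oV V(2)])
  obtain X' where X': "smooth_on (c ` V) X'" "\<And>p. p \<in> V \<Longrightarrow> X p = tv M U c p (X' (c p))" by (rule vector_field_rep[OF c XV V(1)]) (assumption | rule that)+
  obtain Y' where Y': "smooth_on (c ` V) Y'" "\<And>p. p \<in> V \<Longrightarrow> Y p = tv M U c p (Y' (c p))" by (rule vector_field_rep[OF c YV V(1)]) (assumption | rule that)+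
  have o: "open (c ` V)" by (rule coord_open_image[OF c oV V(1)])
  have cp: "c p \<in> c ` V" using V by blast
  have Xu: "X' (c p) = u" by (rule tv_inj[OF c p]) (use X'(2)[OF V(3)] Xp in simp)
  have Yv: "Y' (c p) = v" by (rule tv_inj[OF c p]) (use Y'(2)[OF V(3)] Yp in simp)
  let ?\<Theta> = "coord_form M U c \<theta>"
  let ?D = "\<lambda>f. frechet_derivative f (at (c p))"
  have \<Theta>s: "smooth_on (c ` V) (\<lambda>y. ?\<Theta> y w)" for w
    by (rule smooth_on_subset[OF coord_form_smooth[OF c \<theta>] image_mono[OF V(1)]])
  have \<Theta>lin: "linear (?\<Theta> y)" if "y \<in> c ` V" for y by (rule coord_form_linear[OF c \<theta>]) (use that V in blast)
  have \<Theta>exp: "?\<Theta> y w = (\<Sum>b\<in>Basis. (w \<bullet> b) * ?\<Theta> y b)" if "y \<in> c ` V" for y w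
  proof -
    have "?\<Theta> y (\<Sum>b\<in>Basis. (w \<bullet> b) *\<^sub>R b) = (\<Sum>b\<in>Basis. (w \<bullet> b) * ?\<Theta> y b)"
      by (simp add: linear_sum[OF \<Theta>lin[OF that]] linear_scale[OF \<Theta>lin[OF that]])
    then show ?thesis by (simp add: euclidean_representation)
  qed
  have exp_deriv: "?D (\<lambda>y. ?\<Theta> y w) h = (\<Sum>b\<in>Basis. (w \<bullet> b) * ?D (\<lambda>y. ?\<Theta> y b) h)" for w h
  proof -
    have "((\<lambda>y. \<Sum>b\<in>Basis. (w \<bullet> b) * ?\<Theta> y b) has_derivative (\<lambda>h. \<Sum>b\<in>Basis. (w \<bullet> b) * ?D (\<lambda>y. ?\<Theta> y b) h)) (at (c p))"
      by (intro has_derivative_sum has_derivative_mult_right smooth_on_has_derivative[OF \<Theta>s cp])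
    then have "((\<lambda>y. ?\<Theta> y w) has_derivative (\<lambda>h. \<Sum>b\<in>Basis. (w \<bullet> b) * ?D (\<lambda>y. ?\<Theta> y b) h)) (at (c p))"
      by (rule has_derivative_transform_within_open[OF _ o cp]) (rule \<Theta>exp[symmetric])
    then show ?thesis by (simp add: frechetI)
  qed
  \<comment> \<open>the product rule: the first summand, which involves the derivative of the coefficients of \<open>B\<close>, is the one that the bracket will cancel\<close>
  have fterm: "Re (tv M U c p a (\<lambda>q. of_real (\<theta> q (B q)))) = ?\<Theta> (c p) (?D B' a) + ?D (\<lambda>y. ?\<Theta> y (B' (c p))) a"
    if B: "smooth_vector_field M V B" "smooth_on (c ` V) B'" "\<And>p. p \<in> V \<Longrightarrow> B p = tv M U c p (B' (c p))" for B B' a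
  proof -
    have s1: "smooth_fun_on M V (\<lambda>q. \<theta> q (B q))" using \<theta> B(1) V unfolding one_form_on_def by (meson order_trans)
    have s2: "smooth_on (c ` V) ((\<lambda>q. \<theta> q (B q)) \<circ> inv_into U c)" by (rule smooth_fun_on_pull[OF c V(1) s1])
    have "smooth_on (c ` V) (\<lambda>y. complex_of_real (((\<lambda>q. \<theta> q (B q)) \<circ> inv_into U c) y))"
      by (rule smooth_on_linear_comp[where h=complex_of_real, OF o bounded_linear_of_real s2])
    then have s3: "smooth_on (c ` V) ((\<lambda>q. complex_of_real (\<theta> q (B q))) \<circ> inv_into U c)" by (simp add: o_def)
    have near: "smooth_near M p (\<lambda>q. complex_of_real (\<theta> q (B q)))"
      unfolding smooth_near_def using smooth_fun_on_push[OF c oV V(1) s3] V(3) by blast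
    have "((\<lambda>y. \<Sum>b\<in>Basis. (B' y \<bullet> b) * ?\<Theta> y b) has_derivative
       (\<lambda>h. \<Sum>b\<in>Basis. (B' (c p) \<bullet> b) * ?D (\<lambda>y. ?\<Theta> y b) h + (?D B' h \<bullet> b) * ?\<Theta> (c p) b)) (at (c p))"
      by (intro has_derivative_sum has_derivative_mult smooth_on_has_derivative[OF \<Theta>s cp]
          bounded_linear.has_derivative[OF bounded_linear_inner_left smooth_on_has_derivative[OF B(2) cp]])
    moreover have "(\<lambda>h. \<Sum>b\<in>Basis. (B' (c p) \<bullet> b) * ?D (\<lambda>y. ?\<Theta> y b) h + (?D B' h \<bullet> b) * ?\<Theta> (c p) b)
       = (\<lambda>h. ?\<Theta> (c p) (?D B' h) + ?D (\<lambda>y. ?\<Theta> y (B' (c p))) h)"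
    proof
      fix h
      show "(\<Sum>b\<in>Basis. (B' (c p) \<bullet> b) * ?D (\<lambda>y. ?\<Theta> y b) h + (?D B' h \<bullet> b) * ?\<Theta> (c p) b)
        = ?\<Theta> (c p) (?D B' h) + ?D (\<lambda>y. ?\<Theta> y (B' (c p))) h"
        unfolding sum.distrib using \<Theta>exp[OF cp, of "?D B' h"] exp_deriv[of "B' (c p)" h] by linarith
    qed
    ultimately have "((\<lambda>y. \<Sum>b\<in>Basis. (B' y \<bullet> b) * ?\<Theta> y b) has_derivative (\<lambda>h. ?\<Theta> (c p) (?D B' h) + ?D (\<lambda>y. ?\<Theta> y (B' (c p))) h)) (at (c p))"
      by (simp only:)
    then have "((\<lambda>y. complex_of_real (\<Sum>b\<in>Basis. (B' y \<bullet> b) * ?\<Theta> y b)) has_derivative (\<lambda>h. complex_of_real (?\<Theta> (c p) (?D B' h) + ?D (\<lambda>y. ?\<Theta> y (B' (c p))) h))) (at (c p))"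
      by (rule bounded_linear.has_derivative[OF bounded_linear_of_real])
    then have "(((\<lambda>q. complex_of_real (\<theta> q (B q))) \<circ> inv_into U c) has_derivative (\<lambda>h. complex_of_real (?\<Theta> (c p) (?D B' h) + ?D (\<lambda>y. ?\<Theta> y (B' (c p))) h))) (at (c p))"
    proof (rule has_derivative_transform_within_open[OF _ o cp])
      fix y assume y: "y \<in> c ` V"
      then obtain q where q: "q \<in> V" "y = c q" by blast
      have qU: "q \<in> U" using q V by blast
      have "(\<Sum>b\<in>Basis. (B' y \<bullet> b) * ?\<Theta> y b) = ?\<Theta> y (B' y)" by (rule \<Theta>exp[OF y, symmetric])
      also have "\<dots> = \<theta> q (B q)" unfolding q(2) coord_form_at[OF c qU] B(3)[OF q(1)] ..
      finally show "complex_of_real (\<Sum>b\<in>Basis. (B' y \<bullet> b) * ?\<Theta> y b) = ((\<lambda>q. complex_of_real (\<theta> q (B q))) \<circ> inv_into U c) y"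
        unfolding q(2) o_apply coord_inv[OF c qU] by simp
    qed
    then show ?thesis unfolding tv_def using near by (simp add: frechetI)
  qed
  \<comment> \<open>in the bracket the second derivatives of \<open>g\<close> cancel by symmetry, leaving the derivatives of the coefficients\<close>
  have half: "tv M U c p a (\<lambda>q. B q g) = ?D (\<lambda>y. frechet_derivative (g \<circ> inv_into U c) (at y) (B' (c p))) a + ?D (g \<circ> inv_into U c) (?D B' a)"
    if B: "smooth_vector_field M V B" "smooth_on (c ` V) B'" "\<And>p. p \<in> V \<Longrightarrow> B p = tv M U c p (B' (c p))" and g: "smooth_near M p g" for B B' a g
  proof -
    obtain W0 where W0: "p \<in> W0" "smooth_fun_on M W0 g" using g unfolding smooth_near_def by blast
    define V0 where "V0 = W0 \<inter> V"
    have oV0: "openin (mtop M) V0" unfolding V0_def using smooth_fun_on_openin[OF W0(2)] oV by blast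
    have V0: "V0 \<subseteq> U" "V0 \<subseteq> V" "p \<in> V0" "V0 \<subseteq> W0" using V W0 by (auto simp: V0_def)
    have gV0: "smooth_fun_on M V0 g" by (rule smooth_fun_on_subset[OF W0(2) oV0 V0(4)])
    let ?g = "g \<circ> inv_into U c"
    have gs: "smooth_on (c ` V0) ?g" by (rule smooth_fun_on_pull[OF c V0(1) gV0])
    have o0: "open (c ` V0)" by (rule coord_open_image[OF c oV0 V0(1)])
    have cp0: "c p \<in> c ` V0" using V0 by blast
    have near: "smooth_near M p (\<lambda>q. B q g)"
      unfolding smooth_near_def using B(1) gV0 V0 unfolding smooth_vector_field_def by blast
    have gexp: "frechet_derivative ?g (at y) w = (\<Sum>b\<in>Basis. (w \<bullet> b) *\<^sub>R frechet_derivative ?g (at y) b)" if "y \<in> c ` V0" for y w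
      by (rule frechet_basis_sum[OF smooth_on_differentiable[OF gs that]])
    have "((\<lambda>y. \<Sum>b\<in>Basis. (w \<bullet> b) *\<^sub>R frechet_derivative ?g (at y) b) has_derivative
        (\<lambda>h. \<Sum>b\<in>Basis. (w \<bullet> b) *\<^sub>R ?D (\<lambda>y. frechet_derivative ?g (at y) b) h)) (at (c p))" for w
      by (intro has_derivative_sum has_derivative_scaleR_right smooth_on_has_derivative[OF smooth_on_frechet[OF gs] cp0])
    then have hd: "((\<lambda>y. frechet_derivative ?g (at y) w) has_derivative
        (\<lambda>h. \<Sum>b\<in>Basis. (w \<bullet> b) *\<^sub>R ?D (\<lambda>y. frechet_derivative ?g (at y) b) h)) (at (c p))" for w
      by (rule has_derivative_transform_within_open[OF _ o0 cp0]) (rule gexp[symmetric])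
    have e1: "?D (\<lambda>y. frechet_derivative ?g (at y) w) h = (\<Sum>b\<in>Basis. (w \<bullet> b) *\<^sub>R ?D (\<lambda>y. frechet_derivative ?g (at y) b) h)" for w h
      by (rule fun_cong[OF frechetI[OF hd]])
    have "((\<lambda>y. \<Sum>b\<in>Basis. (B' y \<bullet> b) *\<^sub>R frechet_derivative ?g (at y) b) has_derivative
        (\<lambda>h. \<Sum>b\<in>Basis. (B' (c p) \<bullet> b) *\<^sub>R ?D (\<lambda>y. frechet_derivative ?g (at y) b) h + (?D B' h \<bullet> b) *\<^sub>R frechet_derivative ?g (at (c p)) b)) (at (c p))"
      by (intro has_derivative_sum has_derivative_scaleR smooth_on_has_derivative[OF smooth_on_frechet[OF gs] cp0]
          bounded_linear.has_derivative[OF bounded_linear_inner_left smooth_on_has_derivative[OF B(2) cp]])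
    then have "(((\<lambda>q. B q g) \<circ> inv_into U c) has_derivative
        (\<lambda>h. \<Sum>b\<in>Basis. (B' (c p) \<bullet> b) *\<^sub>R ?D (\<lambda>y. frechet_derivative ?g (at y) b) h + (?D B' h \<bullet> b) *\<^sub>R frechet_derivative ?g (at (c p)) b)) (at (c p))"
    proof (rule has_derivative_transform_within_open[OF _ o0 cp0])
      fix y assume y: "y \<in> c ` V0"
      then obtain q where q: "q \<in> V0" "y = c q" by blast
      have qU: "q \<in> U" and qV: "q \<in> V" using q V0 by blast+
      have "smooth_near M q g" unfolding smooth_near_def using q gV0 by blast
      then show "(\<Sum>b\<in>Basis. (B' y \<bullet> b) *\<^sub>R frechet_derivative ?g (at y) b) = ((\<lambda>q. B q g) \<circ> inv_into U c) y"
        unfolding gexp[OF y, symmetric] unfolding q(2) o_apply coord_inv[OF c qU] B(3)[OF qV] tv_def by simp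
    qed
    then have "?D ((\<lambda>q. B q g) \<circ> inv_into U c) a =
        (\<Sum>b\<in>Basis. (B' (c p) \<bullet> b) *\<^sub>R ?D (\<lambda>y. frechet_derivative ?g (at y) b) a + (?D B' a \<bullet> b) *\<^sub>R frechet_derivative ?g (at (c p)) b)"
      by (simp only: frechetI)
    also have "\<dots> = ?D (\<lambda>y. frechet_derivative ?g (at y) (B' (c p))) a + ?D ?g (?D B' a)"
      unfolding e1[of "B' (c p)"] gexp[OF cp0, of "?D B' a"] by (rule sum.distrib)
    finally show ?thesis unfolding tv_def using near by simp
  qed
  have "lie_bracket M X Y p = tv M U c p (?D Y' u - ?D X' v)"
  proof
    fix g
    show "lie_bracket M X Y p g = tv M U c p (?D Y' u - ?D X' v) g"
    proof (cases "smooth_near M p g")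
      case True
      obtain S where S: "open S" "c p \<in> S" "smooth_on S (g \<circ> inv_into U c)" using True smooth_near_iff[OF c p] by blast
      have "?D (\<lambda>y. frechet_derivative (g \<circ> inv_into U c) (at y) v) u = ?D (\<lambda>y. frechet_derivative (g \<circ> inv_into U c) (at y) u) v"
        by (rule second_derivative_symmetric[OF S])
      then have "lie_bracket M X Y p g = ?D (g \<circ> inv_into U c) (?D Y' u) - ?D (g \<circ> inv_into U c) (?D X' v)"
        using half[OF YV Y' True, of u] half[OF XV X' True, of v] True unfolding lie_bracket_def Xp Yp Xu Yv by simp
      also have "\<dots> = ?D (g \<circ> inv_into U c) (?D Y' u - ?D X' v)"
        by (rule linear_diff[OF frechet_linear[OF tv_near_differentiable[OF c p True]], symmetric])
      finally show ?thesis unfolding tv_def using True by simp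
    qed (simp add: lie_bracket_def tv_def)
  qed
  then have "\<theta> p (lie_bracket M X Y p) = ?\<Theta> (c p) (?D Y' u) - ?\<Theta> (c p) (?D X' v)"
    using coord_form_at[OF c p, of \<theta> "?D Y' u - ?D X' v"] linear_diff[OF \<Theta>lin[OF cp]] by simp
  then show ?thesis using fterm[OF YV Y', of u] fterm[OF XV X', of v] unfolding Xp Yp Xu Yv by linarith
qed

lemma ext_deriv_coord:
  fixes c :: "'a \<Rightarrow> 'f::euclidean_space"
  assumes c: "coord M U c" and p: "p \<in> U" and \<theta>: "one_form_on M Z \<theta>" "U \<subseteq> Z"
  shows "ext_deriv M \<theta> p (tv M U c p u) (tv M U c p v)
    = frechet_derivative (\<lambda>y. coord_form M U c \<theta> y v) (at (c p)) u - frechet_derivative (\<lambda>y. coord_form M U c \<theta> y u) (at (c p)) v"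
  unfolding ext_deriv_def
proof (rule the_equality)
  have const: "smooth_vector_field M U (\<lambda>p. tv M U c p w)" for w
    using vector_field_mk[OF c coordD(1)[OF c] subset_refl smooth_on_const[OF coordD(3)[OF c]]] by simp
  show "\<exists>W X Y. p \<in> W \<and> smooth_vector_field M W X \<and> smooth_vector_field M W Y \<and> X p = tv M U c p u \<and> Y p = tv M U c p v \<and>
      frechet_derivative (\<lambda>y. coord_form M U c \<theta> y v) (at (c p)) u - frechet_derivative (\<lambda>y. coord_form M U c \<theta> y u) (at (c p)) v
       = Re (X p (\<lambda>q. of_real (\<theta> q (Y q)))) - Re (Y p (\<lambda>q. of_real (\<theta> q (X q)))) - \<theta> p (lie_bracket M X Y p)"
    by (rule exI[of _ U], rule exI[of _ "\<lambda>p. tv M U c p u"], rule exI[of _ "\<lambda>p. tv M U c p v"])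
       (intro conjI p const refl ext_deriv_fields[OF c p \<theta> p const const refl refl, symmetric])
next
  fix r assume "\<exists>W X Y. p \<in> W \<and> smooth_vector_field M W X \<and> smooth_vector_field M W Y \<and> X p = tv M U c p u \<and> Y p = tv M U c p v \<and>
       r = Re (X p (\<lambda>q. of_real (\<theta> q (Y q)))) - Re (Y p (\<lambda>q. of_real (\<theta> q (X q)))) - \<theta> p (lie_bracket M X Y p)"
  then obtain W X Y where W: "p \<in> W" "smooth_vector_field M W X" "smooth_vector_field M W Y" "X p = tv M U c p u" "Y p = tv M U c p v"
    and r: "r = Re (X p (\<lambda>q. of_real (\<theta> q (Y q)))) - Re (Y p (\<lambda>q. of_real (\<theta> q (X q)))) - \<theta> p (lie_bracket M X Y p)"
    by (elim exE conjE)
  show "r = frechet_derivative (\<lambda>y. coord_form M U c \<theta> y v) (at (c p)) u - frechet_derivative (\<lambda>y. coord_form M U c \<theta> y u) (at (c p)) v"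
    unfolding r by (rule ext_deriv_fields[OF c p \<theta> W])
qed

end

subsection \<open>Self-diffeomorphisms\<close>

context manifold begin

lemma smooth_mapD:
  assumes "smooth_map M M f"
  shows "continuous_map (mtop M) (mtop M) f"
    "\<And>U c V d. (U, c) \<in> charts M \<Longrightarrow> (V, d) \<in> charts M \<Longrightarrow> smooth_on (c ` (U \<inter> f -` V)) (d \<circ> f \<circ> inv_into U c)"
  using assms unfolding smooth_map_def by fast+

lemma diffeomorphismD:
  assumes "diffeomorphism M M f"
  shows "bij_betw f (topspace (mtop M)) (topspace (mtop M))" "smooth_map M M f"
    "smooth_map M M (inv_into (topspace (mtop M)) f)"
  using assms unfolding diffeomorphism_def by fast+

lemma diffeomorphism_inv:
  assumes f: "diffeomorphism M M f" and p: "p \<in> topspace (mtop M)"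
  shows "f p \<in> topspace (mtop M)" "inv_into (topspace (mtop M)) f (f p) = p"
    "inv_into (topspace (mtop M)) f p \<in> topspace (mtop M)" "f (inv_into (topspace (mtop M)) f p) = p"
  using diffeomorphismD(1)[OF f] p
  by (auto simp: bij_betw_def inv_into_f_f f_inv_into_f inv_into_into)

lemma openin_pre: "continuous_map (mtop M) (mtop M) f \<Longrightarrow> openin (mtop M) V \<Longrightarrow> openin (mtop M) {p \<in> topspace (mtop M). f p \<in> V}"
  by (simp add: openin_continuous_map_preimage)

lemma smooth_map_coord:
  fixes c :: "'a \<Rightarrow> 'f::euclidean_space" and d :: "'a \<Rightarrow> 'g::euclidean_space"
  assumes f: "smooth_map M M f" and c: "coord M U c" and d: "coord M V d"
  shows "smooth_on (c ` {p \<in> U. f p \<in> V}) (d \<circ> f \<circ> inv_into U c)"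
proof (rule smooth_on_local)
  have ft: "f q \<in> topspace (mtop M)" if "q \<in> topspace (mtop M)" for q
    using continuous_map_image_subset_topspace[OF smooth_mapD(1)[OF f]] that by blast
  fix y assume "y \<in> c ` {p \<in> U. f p \<in> V}"
  then obtain p where p: "p \<in> U" "f p \<in> V" "y = c p" by blast
  have pt: "p \<in> topspace (mtop M)" using coord_topspace[OF c] p by blast
  obtain A a where a: "(A, a) \<in> charts M" "p \<in> A" using chart_at[OF pt] .
  obtain B b where b: "(B, b) \<in> charts M" "f p \<in> B" using chart_at[OF ft[OF pt]] .
  define Q where "Q = (U \<inter> A) \<inter> {q \<in> topspace (mtop M). f q \<in> V \<inter> B}"
  have oQ: "openin (mtop M) Q" unfolding Q_def
    by (intro openin_Int openin_pre[OF smooth_mapD(1)[OF f]] coordD(1)[OF c] coordD(1)[OF d] chart(1)[OF a(1)] chart(1)[OF b(1)])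
  have Q: "Q \<subseteq> U" "Q \<subseteq> A" "\<And>q. q \<in> Q \<Longrightarrow> f q \<in> V" "\<And>q. q \<in> Q \<Longrightarrow> f q \<in> B" by (auto simp: Q_def)
  have pQ: "p \<in> Q" using p a b pt by (simp add: Q_def)
  have o: "open (c ` Q)" by (rule coord_open_image[OF c oQ Q(1)])
  have oa: "open (a ` Q)" by (rule chart(4)[OF a(1) oQ Q(2)])
  have oVB: "openin (mtop M) (B \<inter> V)" by (intro openin_Int coordD(1)[OF d] chart(1)[OF b(1)])
  have ob: "open (b ` (B \<inter> V))" by (rule chart(4)[OF b(1) oVB]) simp
  have ia: "inv_into A a (a q) = q" if "q \<in> Q" for q using chart(3)[OF a(1)] Q(2) that by (simp add: subsetD)
  have ib: "inv_into B b (b q) = q" if "q \<in> B" for q using chart(3)[OF b(1)] that by simp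
  have ic: "inv_into U c (c q) = q" if "q \<in> Q" for q using coord_inv[OF c] Q(1) that by blast
  have s1: "smooth_on (c ` Q) (a \<circ> inv_into U c)"
    by (rule smooth_on_subset[OF coordD(6)[OF c a(1)]]) (use Q in blast)
  have s2: "smooth_on (a ` Q) (b \<circ> f \<circ> inv_into A a)"
    by (rule smooth_on_subset[OF smooth_mapD(2)[OF f a(1) b(1)]]) (use Q in blast)
  have s3: "smooth_on (b ` (B \<inter> V)) (d \<circ> inv_into B b)" by (rule smooth_fun_onD[OF coordD(4)[OF d] b(1)])
  have im1: "(a \<circ> inv_into U c) ` c ` Q \<subseteq> a ` Q" unfolding image_image by (rule image_subsetI) (simp add: ic)
  have im2: "(b \<circ> f \<circ> inv_into A a) ` a ` Q \<subseteq> b ` (B \<inter> V)" unfolding image_image by (rule image_subsetI) (simp add: ia Q)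
  have "smooth_on (a ` Q) (\<lambda>y. (d \<circ> inv_into B b) ((b \<circ> f \<circ> inv_into A a) y))"
    by (rule smooth_on_compose[where g="d \<circ> inv_into B b" and f="b \<circ> f \<circ> inv_into A a", OF oa ob im2 s3 s2])
  from smooth_on_compose[where f="a \<circ> inv_into U c", OF o oa im1 this s1]
  have "smooth_on (c ` Q) (\<lambda>y. (d \<circ> inv_into B b) ((b \<circ> f \<circ> inv_into A a) ((a \<circ> inv_into U c) y)))" .
  then have "smooth_on (c ` Q) (d \<circ> f \<circ> inv_into U c)"
  proof (rule smooth_on_cong[OF o, rotated])
    fix y assume "y \<in> c ` Q"
    then obtain q where q: "q \<in> Q" "y = c q" by blast
    show "(d \<circ> inv_into B b) ((b \<circ> f \<circ> inv_into A a) ((a \<circ> inv_into U c) y)) = (d \<circ> f \<circ> inv_into U c) y"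
      unfolding q(2) o_apply ic[OF q(1)] ia[OF q(1)] ib[OF Q(4)[OF q(1)]] ..
  qed
  moreover have "y \<in> c ` Q" unfolding p(3) by (rule imageI[OF pQ])
  ultimately show "\<exists>T. open T \<and> y \<in> T \<and> smooth_on T (d \<circ> f \<circ> inv_into U c)" using o by (intro exI[of _ "c ` Q"] conjI)
qed

lemma coord_pullback:
  fixes c :: "'a \<Rightarrow> 'f::euclidean_space"
  assumes f: "diffeomorphism M M f" and c: "coord M U c"
  shows "coord M {p \<in> topspace (mtop M). f p \<in> U} (c \<circ> f)"
proof -
  let ?T = "topspace (mtop M)" and ?h = "inv_into (topspace (mtop M)) f"
  define U' where "U' = {p \<in> ?T. f p \<in> U}"
  have sf: "smooth_map M M f" and sh: "smooth_map M M ?h" by (rule diffeomorphismD[OF f])+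
  have oU': "openin (mtop M) U'" unfolding U'_def by (rule openin_pre[OF smooth_mapD(1)[OF sf] coordD(1)[OF c]])
  have UT: "U \<subseteq> ?T" by (rule coord_topspace[OF c])
  have injf: "inj_on f U'"
    by (rule inj_on_subset[OF bij_betw_imp_inj_on[OF diffeomorphismD(1)[OF f]]]) (simp add: U'_def)
  have inj: "inj_on (c \<circ> f) U'"
    by (rule comp_inj_on[OF injf inj_on_subset[OF coordD(2)[OF c]]]) (auto simp: U'_def)
  have inv: "inv_into U' (c \<circ> f) (c q) = ?h q" if "q \<in> U" for q
  proof -
    have "?h q \<in> U'" "f (?h q) = q" using diffeomorphism_inv[OF f] that UT by (auto simp: U'_def)
    then show ?thesis using inv_into_f_f[OF inj, of "?h q"] by simp
  qed
  have im: "(c \<circ> f) ` {p \<in> U'. P p} = c ` {q \<in> U. P (?h q)}" for P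
  proof (intro subset_antisym image_subsetI)
    fix p assume "p \<in> {p \<in> U'. P p}"
    then have "f p \<in> {q \<in> U. P (?h q)}" using diffeomorphism_inv(2)[OF f] by (simp add: U'_def)
    then show "(c \<circ> f) p \<in> c ` {q \<in> U. P (?h q)}" by simp
  next
    fix q assume q: "q \<in> {q \<in> U. P (?h q)}"
    then have "?h q \<in> {p \<in> U'. P p}" "f (?h q) = q" using diffeomorphism_inv[OF f] UT by (auto simp: U'_def)
    then show "c q \<in> (c \<circ> f) ` {p \<in> U'. P p}" by (metis (no_types, lifting) comp_apply image_eqI)
  qed
  have oim: "open (c ` {q \<in> U. ?h q \<in> V})" if "openin (mtop M) V" for V
  proof (rule coord_open_image[OF c])
    have "{q \<in> U. ?h q \<in> V} = U \<inter> {q \<in> ?T. ?h q \<in> V}" using UT by auto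
    then show "openin (mtop M) {q \<in> U. ?h q \<in> V}"
      using openin_Int[OF coordD(1)[OF c] openin_pre[OF smooth_mapD(1)[OF sh] that]] by simp
  qed blast
  have "coord M U' (c \<circ> f)" unfolding coord_def
  proof (intro conjI ballI, goal_cases)
    case 1 show ?case by (rule oU')
  next case 2 show ?case by (rule inj)
  next case 3
    have "(c \<circ> f) ` U' = c ` U" using im[of "\<lambda>_. True"] by simp
    then show ?case using coordD(3)[OF c] by simp
  next case 4
    show ?case unfolding smooth_fun_on_def
    proof (intro conjI oU' ballI, clarify)
      fix V d assume d: "(V, d) \<in> charts M"
      have "{p \<in> V. f p \<in> U} = V \<inter> U'" using openin_subset[OF chart(1)[OF d]] by (auto simp: U'_def)
      then show "smooth_on (d ` (V \<inter> U')) (c \<circ> f \<circ> inv_into V d)" using smooth_map_coord[OF sf chart_coord[OF d] c] by simp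
    qed
  next case (5 x)
    obtain V d where x: "x = (V, d)" and d: "(V, d) \<in> charts M" using 5 by (cases x) simp
    have e: "(c \<circ> f) ` (U' \<inter> V) = c ` {q \<in> U. ?h q \<in> V}" unfolding im[of "\<lambda>p. p \<in> V", symmetric] by (simp only: Int_def)
    have "smooth_on (c ` {q \<in> U. ?h q \<in> V}) (d \<circ> ?h \<circ> inv_into U c)" by (rule smooth_map_coord[OF sh c chart_coord[OF d]])
    then have "smooth_on (c ` {q \<in> U. ?h q \<in> V}) (d \<circ> inv_into U' (c \<circ> f))"
    proof (rule smooth_on_cong[OF oim[OF chart(1)[OF d]], rotated])
      fix y assume "y \<in> c ` {q \<in> U. ?h q \<in> V}"
      then obtain q where q: "q \<in> U" "y = c q" by blast
      show "(d \<circ> ?h \<circ> inv_into U c) y = (d \<circ> inv_into U' (c \<circ> f)) y"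
        unfolding q(2) o_apply coord_inv[OF c q(1)] using inv[OF q(1)] by (simp add: o_def)
    qed
    then show ?case unfolding x prod.case e using oim[OF chart(1)[OF d]] by simp
  qed
  then show ?thesis unfolding U'_def .
qed

lemma pullback_inv:
  assumes f: "diffeomorphism M M f" and c: "coord M U c" and p: "p \<in> topspace (mtop M)" "f p \<in> U"
  shows "y \<in> c ` U \<Longrightarrow> f (inv_into {p \<in> topspace (mtop M). f p \<in> U} (c \<circ> f) y) = inv_into U c y"
proof -
  assume "y \<in> c ` U"
  then obtain q where q: "q \<in> U" "y = c q" by blast
  let ?h = "inv_into (topspace (mtop M)) f" and ?U' = "{p \<in> topspace (mtop M). f p \<in> U}"
  have qt: "q \<in> topspace (mtop M)" using coord_topspace[OF c] q by blast
  have hq: "?h q \<in> ?U'" "f (?h q) = q" using diffeomorphism_inv(3,4)[OF f qt] q by auto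
  then have "inv_into ?U' (c \<circ> f) ((c \<circ> f) (?h q)) = ?h q" by (intro coord_inv[OF coord_pullback[OF f c]])
  then show ?thesis unfolding q(2) coord_inv[OF c q(1)] using hq by simp
qed

lemma smooth_near_pullback:
  assumes f: "diffeomorphism M M f" and p: "p \<in> topspace (mtop M)" and g: "smooth_near M (f p) g"
  shows "smooth_near M p (g \<circ> f)"
proof -
  obtain U c where c: "(U, c) \<in> charts M" "f p \<in> U" using chart_at diffeomorphism_inv(1)[OF f p] by blast
  have cc: "coord M U c" by (rule chart_coord[OF c(1)])
  let ?U' = "{p \<in> topspace (mtop M). f p \<in> U}"
  have pU: "p \<in> ?U'" using p c by simp
  obtain S where S: "open S" "c (f p) \<in> S" "S \<subseteq> c ` U" "smooth_on S (g \<circ> inv_into U c)" using g smooth_near_iff[OF cc c(2)] by blast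
  have "smooth_on S (g \<circ> f \<circ> inv_into ?U' (c \<circ> f))"
    by (rule smooth_on_cong[OF S(1) _ S(4)]) (use pullback_inv[OF f cc p c(2)] S(3) in \<open>auto simp: o_def\<close>)
  moreover have "S \<subseteq> (c \<circ> f) ` ?U'"
  proof
    fix y assume "y \<in> S"
    then obtain q where q: "q \<in> U" "y = c q" using S(3) by blast
    then have "inv_into (topspace (mtop M)) f q \<in> ?U'" "f (inv_into (topspace (mtop M)) f q) = q"
      using diffeomorphism_inv(3,4)[OF f, of q] coord_topspace[OF cc] by auto
    then show "y \<in> (c \<circ> f) ` ?U'" unfolding q(2) by (metis (no_types, lifting) comp_apply image_eqI)
  qed
  ultimately show ?thesis unfolding smooth_near_iff[OF coord_pullback[OF f cc] pU] using S by (intro exI[of _ S]) simp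
qed

lemma pushforward_pullback:
  fixes c :: "'a \<Rightarrow> 'f::euclidean_space"
  assumes f: "diffeomorphism M M f" and c: "coord M U c" and p: "p \<in> topspace (mtop M)" "f p \<in> U"
  shows "pushforward M f p (tv M {p \<in> topspace (mtop M). f p \<in> U} (c \<circ> f) p w) = tv M U c (f p) w"
proof
  fix g
  let ?U' = "{p \<in> topspace (mtop M). f p \<in> U}"
  show "pushforward M f p (tv M ?U' (c \<circ> f) p w) g = tv M U c (f p) w g"
  proof (cases "smooth_near M (f p) g")
    case True
    have "frechet_derivative (g \<circ> inv_into U c) (at (c (f p))) = frechet_derivative (g \<circ> f \<circ> inv_into ?U' (c \<circ> f)) (at (c (f p)))"
      by (rule frechet_derivative_transform_within_open[OF tv_near_differentiable[OF c p(2) True] coordD(3)[OF c]])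
         (use p pullback_inv[OF f c p] in \<open>auto simp: o_def\<close>)
    then show ?thesis unfolding pushforward_def tv_def using True smooth_near_pullback[OF f p(1) True] by simp
  qed (simp add: pushforward_def tv_def)
qed

lemma pushforward_compose:
  assumes f: "diffeomorphism M M f" and p: "g p \<in> topspace (mtop M)"
  shows "pushforward M (f \<circ> g) p X = pushforward M f (g p) (pushforward M g p X)"
proof
  fix h
  show "pushforward M (f \<circ> g) p X h = pushforward M f (g p) (pushforward M g p X) h"
    unfolding pushforward_def using smooth_near_pullback[OF f p, of h] by (simp add: o_assoc)
qed

lemma pushforward_tangent:
  assumes f: "diffeomorphism M M f" and p: "p \<in> topspace (mtop M)" and X: "X \<in> tangent_space M p"
  shows "pushforward M f p X \<in> tangent_space M (f p)"
proof -
  obtain U c where c: "(U, c) \<in> charts M" "f p \<in> U" using chart_at diffeomorphism_inv(1)[OF f p] by blast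
  have cc: "coord M U c" by (rule chart_coord[OF c(1)])
  have pU: "p \<in> {p \<in> topspace (mtop M). f p \<in> U}" using p c by simp
  obtain w where "X = tv M {p \<in> topspace (mtop M). f p \<in> U} (c \<circ> f) p w"
    using X tangent_space_coord[OF coord_pullback[OF f cc] pU] by blast
  then show ?thesis using pushforward_pullback[OF f cc p c(2)] tangent_space_coord[OF cc c(2)] by simp
qed

lemma pushforward_inj:
  assumes f: "diffeomorphism M M f" and p: "p \<in> topspace (mtop M)" and X: "X \<in> tangent_space M p" "Y \<in> tangent_space M p"
    and eq: "pushforward M f p X = pushforward M f p Y"
  shows "X = Y"
proof -
  obtain U c where c: "(U, c) \<in> charts M" "f p \<in> U" using chart_at diffeomorphism_inv(1)[OF f p] by blast
  have cc: "coord M U c" by (rule chart_coord[OF c(1)])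
  have pU: "p \<in> {p \<in> topspace (mtop M). f p \<in> U}" using p c by simp
  obtain w v where "X = tv M {p \<in> topspace (mtop M). f p \<in> U} (c \<circ> f) p w" "Y = tv M {p \<in> topspace (mtop M). f p \<in> U} (c \<circ> f) p v"
    using X tangent_space_coord[OF coord_pullback[OF f cc] pU] by blast
  moreover from this have "tv M U c (f p) w = tv M U c (f p) v" using eq pushforward_pullback[OF f cc p c(2)] by simp
  ultimately show ?thesis using tv_inj[OF cc c(2)] by blast
qed

lemma pushforward_coord:
  fixes c :: "'a \<Rightarrow> 'f::euclidean_space"
  assumes f: "diffeomorphism M M f" and c: "coord M U c" and p: "p \<in> U" "f p \<in> U"
  shows "pushforward M f p (tv M U c p w) = tv M U c (f p) (frechet_derivative (c \<circ> f \<circ> inv_into U c) (at (c p)) w)"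
proof -
  have pt: "p \<in> topspace (mtop M)" using coord_topspace[OF c] p by blast
  have pU: "p \<in> {p \<in> topspace (mtop M). f p \<in> U}" using p pt by simp
  show ?thesis
    unfolding tv_change[OF coord_pullback[OF f c] c pU p(1), of w] pushforward_pullback[OF f c pt p(2)] ..
qed

text \<open>Real tangent vectors have real values on coordinate functions, so a complex tangent vector splits
  uniquely into its real and imaginary parts.\<close>

lemma real_imaginary_unique:
  assumes p: "p \<in> topspace (mtop M)"
    and X: "X \<in> tangent_space M p" "Y \<in> tangent_space M p" "X' \<in> tangent_space M p" "Y' \<in> tangent_space M p"
    and eq: "(\<lambda>g. X g - \<i> * Y g) = (\<lambda>g. X' g - \<i> * Y' g)"
  shows "X = X'" "Y = Y'"
proof -
  obtain U c where c: "(U, c) \<in> charts M" "p \<in> U" using chart_at p by blast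
  have cc: "coord M U c" by (rule chart_coord[OF c(1)])
  obtain x y x' y' where e: "X = tv M U c p x" "Y = tv M U c p y" "X' = tv M U c p x'" "Y' = tv M U c p y'"
    using X unfolding tangent_space_coord[OF cc c(2)] by (elim rangeE) (rule that)
  have "x \<bullet> b = x' \<bullet> b \<and> y \<bullet> b = y' \<bullet> b" for b
    using fun_cong[OF eq, of "\<lambda>q. complex_of_real (c q \<bullet> b)"] unfolding e tv_component[OF cc c(2)]
    by (simp add: complex_eq_iff)
  then have "x = x'" "y = y'" by (auto intro: euclidean_eqI)
  then show "X = X'" "Y = Y'" unfolding e by simp_all
qed

lemma smooth_map_compose:
  assumes f: "smooth_map M M f" and g: "smooth_map M M g"
  shows "smooth_map M M (f \<circ> g)"
  unfolding smooth_map_def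
proof (intro conjI ballI; clarify?)
  show cm: "continuous_map (mtop M) (mtop M) (f \<circ> g)" by (rule continuous_map_compose[OF smooth_mapD(1)[OF g] smooth_mapD(1)[OF f]])
  have gt: "g q \<in> topspace (mtop M)" if "q \<in> topspace (mtop M)" for q
    using continuous_map_image_subset_topspace[OF smooth_mapD(1)[OF g]] that by blast
  fix U c V d assume c: "(U, c) \<in> charts M" and d: "(V, d) \<in> charts M"
  have UT: "U \<subseteq> topspace (mtop M)" by (rule openin_subset[OF chart(1)[OF c]])
  show "smooth_on (c ` (U \<inter> (f \<circ> g) -` V)) (d \<circ> (f \<circ> g) \<circ> inv_into U c)"
  proof (rule smooth_on_local)
    fix y assume "y \<in> c ` (U \<inter> (f \<circ> g) -` V)"
    then obtain p where p: "p \<in> U" "f (g p) \<in> V" "y = c p" by auto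
    obtain B b where b: "(B, b) \<in> charts M" "g p \<in> B" using chart_at gt UT p(1) by blast
    define Q where "Q = U \<inter> ({q \<in> topspace (mtop M). g q \<in> B} \<inter> {q \<in> topspace (mtop M). (f \<circ> g) q \<in> V})"
    have oQ: "openin (mtop M) Q" unfolding Q_def
      by (intro openin_Int openin_pre[OF smooth_mapD(1)[OF g]] openin_pre[OF cm] chart(1)[OF c] chart(1)[OF b(1)] chart(1)[OF d])
    have QU: "Q \<subseteq> U" and Qg: "\<And>q. q \<in> Q \<Longrightarrow> g q \<in> B" "\<And>q. q \<in> Q \<Longrightarrow> f (g q) \<in> V" by (auto simp: Q_def)
    have o: "open (c ` Q)" by (rule chart(4)[OF c oQ QU])
    have ob: "open (b ` {q \<in> B. f q \<in> V})"
    proof (rule chart(4)[OF b(1)])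
      have "{q \<in> B. f q \<in> V} = B \<inter> {q \<in> topspace (mtop M). f q \<in> V}" using openin_subset[OF chart(1)[OF b(1)]] by auto
      then show "openin (mtop M) {q \<in> B. f q \<in> V}"
        using openin_Int[OF chart(1)[OF b(1)] openin_pre[OF smooth_mapD(1)[OF f] chart(1)[OF d]]] by simp
    qed blast
    have ic: "inv_into U c (c q) = q" if "q \<in> Q" for q using chart(3)[OF c] QU that by (simp add: subsetD)
    have ib: "inv_into B b (b q) = q" if "q \<in> B" for q using chart(3)[OF b(1)] that by simp
    have s1: "smooth_on (c ` Q) (b \<circ> g \<circ> inv_into U c)"
      by (rule smooth_on_subset[OF smooth_mapD(2)[OF g c b(1)]]) (use QU Qg in blast)
    have s2: "smooth_on (b ` {q \<in> B. f q \<in> V}) (d \<circ> f \<circ> inv_into B b)"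
      by (rule smooth_map_coord[OF f chart_coord[OF b(1)] chart_coord[OF d]])
    have im: "(b \<circ> g \<circ> inv_into U c) ` c ` Q \<subseteq> b ` {q \<in> B. f q \<in> V}"
      unfolding image_image by (rule image_subsetI) (simp add: ic Qg)
    have "smooth_on (c ` Q) (\<lambda>y. (d \<circ> f \<circ> inv_into B b) ((b \<circ> g \<circ> inv_into U c) y))"
      by (rule smooth_on_compose[where g="d \<circ> f \<circ> inv_into B b" and f="b \<circ> g \<circ> inv_into U c", OF o ob im s2 s1])
    then have "smooth_on (c ` Q) (d \<circ> (f \<circ> g) \<circ> inv_into U c)"
    proof (rule smooth_on_cong[OF o, rotated])
      fix y assume "y \<in> c ` Q"
      then obtain q where q: "q \<in> Q" "y = c q" by blast
      show "(d \<circ> f \<circ> inv_into B b) ((b \<circ> g \<circ> inv_into U c) y) = (d \<circ> (f \<circ> g) \<circ> inv_into U c) y"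
        unfolding q(2) o_apply ic[OF q(1)] ib[OF Qg(1)[OF q(1)]] ..
    qed
    moreover have "y \<in> c ` Q" unfolding p(3) Q_def using p b UT by (intro imageI) auto
    ultimately show "\<exists>T. open T \<and> y \<in> T \<and> smooth_on T (d \<circ> (f \<circ> g) \<circ> inv_into U c)" using o by (intro exI[of _ "c ` Q"] conjI)
  qed
qed

lemma smooth_map_cong:
  assumes f: "smooth_map M M f" and eq: "\<And>q. q \<in> topspace (mtop M) \<Longrightarrow> f q = g q"
  shows "smooth_map M M g"
  unfolding smooth_map_def
proof (intro conjI ballI; clarify?)
  show "continuous_map (mtop M) (mtop M) g" using smooth_mapD(1)[OF f] continuous_map_eq eq by blast
  fix U c V d assume c: "(U, c) \<in> charts M" and d: "(V, d) \<in> charts M"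
  have UT: "U \<subseteq> topspace (mtop M)" by (rule openin_subset[OF chart(1)[OF c]])
  have e: "U \<inter> g -` V = U \<inter> f -` V" using UT eq by auto
  have "U \<inter> f -` V = U \<inter> {q \<in> topspace (mtop M). f q \<in> V}" using UT by auto
  then have "openin (mtop M) (U \<inter> f -` V)"
    using openin_Int[OF chart(1)[OF c] openin_pre[OF smooth_mapD(1)[OF f] chart(1)[OF d]]] by simp
  then have o: "open (c ` (U \<inter> f -` V))" by (rule chart(4)[OF c]) simp
  show "smooth_on (c ` (U \<inter> g -` V)) (d \<circ> g \<circ> inv_into U c)"
    unfolding e
    by (rule smooth_on_cong[OF o _ smooth_mapD(2)[OF f c d]]) (use chart(3)[OF c] UT eq in auto)
qed

lemma diffeomorphism_compose:
  assumes f: "diffeomorphism M M f" and g: "diffeomorphism M M g"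
  shows "diffeomorphism M M (f \<circ> g)"
  unfolding diffeomorphism_def
proof (intro conjI)
  let ?T = "topspace (mtop M)"
  show bij: "bij_betw (f \<circ> g) ?T ?T" by (rule bij_betw_trans[OF diffeomorphismD(1)[OF g] diffeomorphismD(1)[OF f]])
  show "smooth_map M M (f \<circ> g)" by (rule smooth_map_compose[OF diffeomorphismD(2)[OF f] diffeomorphismD(2)[OF g]])
  show "smooth_map M M (inv_into ?T (f \<circ> g))"
  proof (rule smooth_map_cong[OF smooth_map_compose[OF diffeomorphismD(3)[OF g] diffeomorphismD(3)[OF f]]])
    fix q assume q: "q \<in> ?T"
    let ?x = "inv_into ?T g (inv_into ?T f q)"
    have "?x \<in> ?T" "(f \<circ> g) ?x = q" using diffeomorphism_inv[OF f q] diffeomorphism_inv(3,4)[OF g, of "inv_into ?T f q"] by auto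
    then show "(inv_into ?T g \<circ> inv_into ?T f) q = inv_into ?T (f \<circ> g) q"
      using inv_into_f_f[OF bij_betw_imp_inj_on[OF bij], of ?x] by simp
  qed
qed

end

section \<open>Almost CR manifolds and their automorphisms in coordinates\<close>

locale cr_contact =
  fixes M :: "('a, 'e::euclidean_space) cr_mfd" and n :: nat and \<theta> :: "'a \<Rightarrow> 'a tvec \<Rightarrow> real"
  assumes acr: "almost_cr_manifold n M" and contact: "contact_form M \<theta>"

sublocale cr_contact \<subseteq> manifold M
  using acr by unfold_locales (simp add: almost_cr_manifold_def)

context cr_contact begin

abbreviation "T \<equiv> topspace (mtop M)"

lemma theta:
  shows "one_form_on M T \<theta>"
    "\<And>p. p \<in> T \<Longrightarrow> \<exists>X\<in>tangent_space M p. \<theta> p X \<noteq> 0"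
    "\<And>p X. p \<in> T \<Longrightarrow> X \<in> tangent_space M p \<Longrightarrow> X \<in> cr_H M p \<longleftrightarrow> \<theta> p X = 0"
    "\<And>p X. p \<in> T \<Longrightarrow> X \<in> cr_H M p \<Longrightarrow> X \<in> tangent_space M p"
    "\<And>p X. p \<in> T \<Longrightarrow> X \<in> cr_H M p \<Longrightarrow> X \<noteq> (\<lambda>g. 0) \<Longrightarrow> ext_deriv M \<theta> p X (cr_J M p X) > 0"
proof -
  have d: "one_form_on M T \<theta>" "\<And>p. p \<in> T \<Longrightarrow> (\<exists>X\<in>tangent_space M p. \<theta> p X \<noteq> 0) \<and> {X \<in> tangent_space M p. \<theta> p X = 0} = cr_H M p"
    using contact unfolding contact_form_def defining_form_on_def by blast+
  show "one_form_on M T \<theta>" by (rule d(1))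
  show "\<exists>X\<in>tangent_space M p. \<theta> p X \<noteq> 0" if "p \<in> T" for p using d(2)[OF that] by (elim conjE)
  have e: "{X \<in> tangent_space M p. \<theta> p X = 0} = cr_H M p" if "p \<in> T" for p using d(2)[OF that] by (elim conjE)
  show "X \<in> cr_H M p \<longleftrightarrow> \<theta> p X = 0" if "p \<in> T" "X \<in> tangent_space M p" for p X using e[OF that(1)] that(2) by auto
  show "X \<in> tangent_space M p" if "p \<in> T" "X \<in> cr_H M p" for p X using e[OF that(1)] that(2) by auto
  show "ext_deriv M \<theta> p X (cr_J M p X) > 0" if "p \<in> T" "X \<in> cr_H M p" "X \<noteq> (\<lambda>g. 0)" for p X
    using contact that unfolding contact_form_def by blast
qed

lemma J:
  assumes "p \<in> T" "X \<in> cr_H M p"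
  shows "cr_J M p X \<in> cr_H M p" "cr_J M p (cr_J M p X) = (\<lambda>g. - X g)"
    "\<And>Y a b. Y \<in> cr_H M p \<Longrightarrow> cr_J M p (\<lambda>g. of_real a * X g + of_real b * Y g) =
             (\<lambda>g. of_real a * cr_J M p X g + of_real b * cr_J M p Y g)"
  using acr assms unfolding almost_cr_manifold_def by blast+

lemma J_vector_field:
  assumes "smooth_vector_field M W X" "\<And>p. p \<in> W \<Longrightarrow> X p \<in> cr_H M p"
  shows "smooth_vector_field M W (\<lambda>p. cr_J M p (X p))"
  using acr assms unfolding almost_cr_manifold_def by blast

lemma H_coord:
  assumes c: "coord M U c" and p: "p \<in> U"
  shows "tv M U c p w \<in> cr_H M p \<longleftrightarrow> coord_form M U c \<theta> (c p) w = 0"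
  unfolding coord_form_at[OF c p]
  by (rule theta(3)) (use coord_topspace[OF c] p tangent_space_coord[OF c p] in auto)

lemma form_coord:
  assumes c: "coord M U c"
  shows "\<And>y. y \<in> c ` U \<Longrightarrow> linear (coord_form M U c \<theta> y)" "\<And>w. smooth_on (c ` U) (\<lambda>y. coord_form M U c \<theta> y w)"
  by (rule coord_form_linear[OF c theta(1) coord_topspace[OF c]], assumption)
     (rule coord_form_smooth[OF c theta(1) coord_topspace[OF c]])

lemma J_coord_field:
  fixes c :: "'a \<Rightarrow> 'f::euclidean_space"
  assumes c: "coord M U c" and Y: "smooth_on (c ` U) Y" "\<And>p. p \<in> U \<Longrightarrow> tv M U c p (Y (c p)) \<in> cr_H M p"
  obtains Z where "smooth_on (c ` U) Z" "\<And>p. p \<in> U \<Longrightarrow> cr_J M p (tv M U c p (Y (c p))) = tv M U c p (Z (c p))"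
proof -
  have "smooth_vector_field M U (\<lambda>p. cr_J M p (tv M U c p (Y (c p))))"
    by (rule J_vector_field[OF vector_field_mk[OF c coordD(1)[OF c] subset_refl Y(1)] Y(2)])
  from vector_field_rep[OF c this subset_refl] show thesis using that by blast
qed

lemma J_coord:
  fixes c :: "'a \<Rightarrow> 'f::euclidean_space"
  assumes c: "coord M U c" and p: "p \<in> U"
  obtains j where "\<And>w. tv M U c p w \<in> cr_H M p \<Longrightarrow> cr_J M p (tv M U c p w) = tv M U c p (j w)"
    "\<And>w. tv M U c p w \<in> cr_H M p \<Longrightarrow> tv M U c p (j w) \<in> cr_H M p"
    "\<And>w. tv M U c p w \<in> cr_H M p \<Longrightarrow> j (j w) = - w"
    "\<And>w v a b. tv M U c p w \<in> cr_H M p \<Longrightarrow> tv M U c p v \<in> cr_H M p \<Longrightarrow> j (a *\<^sub>R w + b *\<^sub>R v) = a *\<^sub>R j w + b *\<^sub>R j v"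
proof -
  have pT: "p \<in> T" using coord_topspace[OF c] p by blast
  define j where "j w = (SOME v. cr_J M p (tv M U c p w) = tv M U c p v)" for w
  have j: "cr_J M p (tv M U c p w) = tv M U c p (j w)" if "tv M U c p w \<in> cr_H M p" for w
  proof -
    have "cr_J M p (tv M U c p w) \<in> range (tv M U c p)" using theta(4)[OF pT J(1)[OF pT that]] tangent_space_coord[OF c p] by simp
    then have "\<exists>v. cr_J M p (tv M U c p w) = tv M U c p v" by blast
    then show ?thesis unfolding j_def by (rule someI_ex)
  qed
  have jH: "tv M U c p (j w) \<in> cr_H M p" if "tv M U c p w \<in> cr_H M p" for w using J(1)[OF pT that] j[OF that] by simp
  have jj: "j (j w) = - w" if "tv M U c p w \<in> cr_H M p" for w
  proof (rule tv_inj[OF c p])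
    have "tv M U c p (j (j w)) = (\<lambda>g. - tv M U c p w g)" using J(2)[OF pT that] j[OF that] j[OF jH[OF that]] by simp
    also have "\<dots> = tv M U c p (- w)" using tv_linear[OF c p, of "-1" w 0 0] by simp
    finally show "tv M U c p (j (j w)) = tv M U c p (- w)" .
  qed
  have jl: "j (a *\<^sub>R w + b *\<^sub>R v) = a *\<^sub>R j w + b *\<^sub>R j v" if w: "tv M U c p w \<in> cr_H M p" and v: "tv M U c p v \<in> cr_H M p" for w v a b
  proof (rule tv_inj[OF c p])
    have lin: "linear (coord_form M U c \<theta> (c p))" by (rule form_coord(1)[OF c]) (use p in blast)
    have H: "tv M U c p (a *\<^sub>R w + b *\<^sub>R v) \<in> cr_H M p"
      using w v unfolding H_coord[OF c p] by (simp add: linear_add[OF lin] linear_scale[OF lin])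
    have "tv M U c p (j (a *\<^sub>R w + b *\<^sub>R v)) = cr_J M p (\<lambda>g. of_real a * tv M U c p w g + of_real b * tv M U c p v g)"
      by (simp only: j[OF H] tv_linear[OF c p])
    also have "\<dots> = (\<lambda>g. of_real a * cr_J M p (tv M U c p w) g + of_real b * cr_J M p (tv M U c p v) g)" by (rule J(3)[OF pT w v])
    also have "\<dots> = tv M U c p (a *\<^sub>R j w + b *\<^sub>R j v)" by (simp only: j[OF w] j[OF v] tv_linear[OF c p])
    finally show "tv M U c p (j (a *\<^sub>R w + b *\<^sub>R v)) = tv M U c p (a *\<^sub>R j w + b *\<^sub>R j v)" .
  qed
  show thesis by (rule that[OF j jH jj jl])
qed

text \<open>The bundle of \<open>(1, 0)\<close>-vectors determines the contact distribution and the complex structure as the real and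
  imaginary parts of its elements.\<close>

lemma automorphism:
  assumes \<phi>: "cr_automorphism M \<phi>" and p: "p \<in> T" and X: "X \<in> tangent_space M p"
  shows "pushforward M \<phi> p X \<in> cr_H M (\<phi> p) \<longleftrightarrow> X \<in> cr_H M p"
    "X \<in> cr_H M p \<Longrightarrow> cr_J M (\<phi> p) (pushforward M \<phi> p X) = pushforward M \<phi> p (cr_J M p X)"
proof -
  have d: "diffeomorphism M M \<phi>" and H10: "pushforward M \<phi> p ` H10 M p = H10 M (\<phi> p)"
    using \<phi> p unfolding cr_equivalence_def by blast+
  have \<phi>p: "\<phi> p \<in> T" by (rule diffeomorphism_inv(1)[OF d p])
  have lin: "pushforward M \<phi> p (\<lambda>g. X g - \<i> * Y g) = (\<lambda>g. pushforward M \<phi> p X g - \<i> * pushforward M \<phi> p Y g)" for X Y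
    by (auto simp: pushforward_def)
  have fwd: "pushforward M \<phi> p X \<in> cr_H M (\<phi> p) \<and> cr_J M (\<phi> p) (pushforward M \<phi> p X) = pushforward M \<phi> p (cr_J M p X)"
    if X: "X \<in> cr_H M p" for X
  proof -
    have "(\<lambda>g. X g - \<i> * cr_J M p X g) \<in> H10 M p" using X unfolding H10_def by blast
    then have "pushforward M \<phi> p (\<lambda>g. X g - \<i> * cr_J M p X g) \<in> H10 M (\<phi> p)" unfolding H10[symmetric] by (rule imageI)
    then obtain X' where X': "X' \<in> cr_H M (\<phi> p)" "(\<lambda>g. pushforward M \<phi> p X g - \<i> * pushforward M \<phi> p (cr_J M p X) g) = (\<lambda>g. X' g - \<i> * cr_J M (\<phi> p) X' g)"
      unfolding lin H10_def by blast
    have "pushforward M \<phi> p X = X'" "pushforward M \<phi> p (cr_J M p X) = cr_J M (\<phi> p) X'"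
      by (rule real_imaginary_unique[OF \<phi>p _ _ _ _ X'(2)];
          use X X'(1) theta(4) J(1) p \<phi>p pushforward_tangent[OF d p] in blast)+
    then show ?thesis using X' by simp
  qed
  show "cr_J M (\<phi> p) (pushforward M \<phi> p X) = pushforward M \<phi> p (cr_J M p X)" if "X \<in> cr_H M p" using fwd[OF that] by blast
  show "pushforward M \<phi> p X \<in> cr_H M (\<phi> p) \<longleftrightarrow> X \<in> cr_H M p"
  proof
    assume Y: "pushforward M \<phi> p X \<in> cr_H M (\<phi> p)"
    have "(\<lambda>g. pushforward M \<phi> p X g - \<i> * cr_J M (\<phi> p) (pushforward M \<phi> p X) g) \<in> H10 M (\<phi> p)" using Y unfolding H10_def by blast
    then have "(\<lambda>g. pushforward M \<phi> p X g - \<i> * cr_J M (\<phi> p) (pushforward M \<phi> p X) g) \<in> pushforward M \<phi> p ` H10 M p" unfolding H10 .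
    then obtain X1 where X1: "X1 \<in> cr_H M p" "(\<lambda>g. pushforward M \<phi> p X g - \<i> * cr_J M (\<phi> p) (pushforward M \<phi> p X) g) =
        (\<lambda>g. pushforward M \<phi> p X1 g - \<i> * pushforward M \<phi> p (cr_J M p X1) g)" unfolding H10_def lin[symmetric] by blast
    have "pushforward M \<phi> p X = pushforward M \<phi> p X1"
      by (rule real_imaginary_unique(1)[OF \<phi>p _ _ _ _ X1(2)];
          use X Y X1(1) theta(4) J(1) p \<phi>p pushforward_tangent[OF d p] in blast)
    then have "X = X1" by (rule pushforward_inj[OF d p X theta(4)[OF p X1(1)]])
    then show "X \<in> cr_H M p" using X1(1) by simp
  next
    assume "X \<in> cr_H M p" then show "pushforward M \<phi> p X \<in> cr_H M (\<phi> p)" using fwd by blast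
  qed
qed

subsection \<open>Iterates\<close>

lemma automorphism_compose:
  assumes f: "cr_automorphism M f" and g: "cr_automorphism M g"
  shows "cr_automorphism M (f \<circ> g)"
proof -
  have df: "diffeomorphism M M f" and dg: "diffeomorphism M M g"
    and Hf: "\<And>p. p \<in> T \<Longrightarrow> pushforward M f p ` H10 M p = H10 M (f p)" and Hg: "\<And>p. p \<in> T \<Longrightarrow> pushforward M g p ` H10 M p = H10 M (g p)"
    using f g unfolding cr_equivalence_def by blast+
  have "pushforward M (f \<circ> g) p ` H10 M p = H10 M ((f \<circ> g) p)" if p: "p \<in> T" for p
  proof -
    have gp: "g p \<in> T" by (rule diffeomorphism_inv(1)[OF dg p])
    have "pushforward M (f \<circ> g) p = pushforward M f (g p) \<circ> pushforward M g p"       using pushforward_compose[where f=f and g=g and p=p, OF df gp] by (intro ext) (simp only: o_apply)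
    then show ?thesis by (simp only: image_comp[symmetric] Hg[OF p] Hf[OF gp] o_apply)
  qed
  then show ?thesis unfolding cr_equivalence_def using diffeomorphism_compose[OF df dg] by blast
qed

lemma automorphism_iterate:
  assumes \<phi>: "cr_automorphism M \<phi>" shows "cr_automorphism M (\<phi> ^^ Suc m)"
proof (induction m)
  case 0 then show ?case using \<phi> by (simp add: id_def[symmetric] del: id_apply)
next
  case (Suc m)
  have "\<phi> ^^ Suc (Suc m) = \<phi> \<circ> (\<phi> ^^ Suc m)" by (rule funpow.simps(2))
  then show ?case using automorphism_compose[OF \<phi> Suc] by (simp only:)
qed

lemma contracting_iterate:
  assumes \<phi>: "cr_automorphism M \<phi>" and pt: "pt \<in> T" "\<phi> pt = pt"
    and \<mu>: "\<And>X. X \<in> tangent_space M pt \<Longrightarrow> \<theta> pt (pushforward M \<phi> pt X) = \<mu> * \<theta> pt X"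
  shows "(\<phi> ^^ Suc m) pt = pt"
    "X \<in> tangent_space M pt \<Longrightarrow> \<theta> pt (pushforward M (\<phi> ^^ Suc m) pt X) = \<mu> ^ Suc m * \<theta> pt X"
proof -
  have fixm: "(\<phi> ^^ k) pt = pt" for k using pt(2) by (induction k) auto
  show "(\<phi> ^^ Suc m) pt = pt" by (rule fixm)
  have d: "diffeomorphism M M \<phi>" "diffeomorphism M M (\<phi> ^^ Suc k)" for k
    using \<phi> automorphism_iterate[OF \<phi>, of k] unfolding cr_equivalence_def by blast+
  show "\<theta> pt (pushforward M (\<phi> ^^ Suc m) pt X) = \<mu> ^ Suc m * \<theta> pt X" if X: "X \<in> tangent_space M pt"
  proof (induction m)
    case 0 then show ?case using \<mu>[OF X] by (simp add: id_def[symmetric] del: id_apply)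
  next
    case (Suc m)
    have Y: "pushforward M (\<phi> ^^ Suc m) pt X \<in> tangent_space M pt" using pushforward_tangent[OF d(2) pt(1) X, of m] unfolding fixm .
    have "pushforward M (\<phi> \<circ> (\<phi> ^^ Suc m)) pt X = pushforward M \<phi> pt (pushforward M (\<phi> ^^ Suc m) pt X)"
      using pushforward_compose[OF d(1), of "\<phi> ^^ Suc m" pt X] pt(1) unfolding fixm by blast
    then have "\<theta> pt (pushforward M (\<phi> ^^ Suc (Suc m)) pt X) = \<mu> * \<theta> pt (pushforward M (\<phi> ^^ Suc m) pt X)"
      using \<mu>[OF Y] by (simp only: funpow.simps(2))
    then show ?case unfolding Suc by (simp only: power_Suc mult.assoc)
  qed
qed

text \<open>An iterate of \<open>\<phi>\<close> is a power of \<open>\<phi>\<^sup>m\<^sup>+\<^sup>1\<close> followed by at most \<open>m\<close> applications of \<open>\<phi>\<close>, and the latter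
  keep a sufficiently small neighbourhood of the fixed point inside a given one.\<close>

lemma stable_manifold_iterate:
  assumes cont: "continuous_map (mtop M) (mtop M) \<phi>" and pt: "\<phi> pt = pt"
  shows "stable_manifold M (\<phi> ^^ Suc m) pt = stable_manifold M \<phi> pt"
proof -
  have contk: "continuous_map (mtop M) (mtop M) (\<phi> ^^ k)" for k
  proof (induction k)
    case 0 show ?case by (simp add: id_def)
  next
    case (Suc k) then show ?case unfolding funpow.simps(2) by (rule continuous_map_compose[OF _ cont])
  qed
  have fixk: "(\<phi> ^^ k) pt = pt" for k using pt by (induction k) auto
  have pow: "((\<phi> ^^ Suc m) ^^ k) = \<phi> ^^ (Suc m * k)" for k by (rule funpow_mult)
  have "(\<forall>N. openin (mtop M) N \<and> pt \<in> N \<longrightarrow> (\<forall>\<^sub>F k in sequentially. ((\<phi> ^^ Suc m) ^^ k) ` V \<subseteq> N)) \<longleftrightarrow>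
        (\<forall>N. openin (mtop M) N \<and> pt \<in> N \<longrightarrow> (\<forall>\<^sub>F k in sequentially. (\<phi> ^^ k) ` V \<subseteq> N))" (is "?L \<longleftrightarrow> ?R") if V: "openin (mtop M) V" for V
  proof
    assume R: ?R
    show ?L
    proof (intro allI impI)
      fix N assume "openin (mtop M) N \<and> pt \<in> N"
      then obtain K where K: "\<And>k. k \<ge> K \<Longrightarrow> (\<phi> ^^ k) ` V \<subseteq> N" using R unfolding eventually_sequentially by blast
      have "((\<phi> ^^ Suc m) ^^ k) ` V \<subseteq> N" if "k \<ge> K" for k unfolding pow by (rule K) (use that in simp)
      then show "\<forall>\<^sub>F k in sequentially. ((\<phi> ^^ Suc m) ^^ k) ` V \<subseteq> N" unfolding eventually_sequentially by blast
    qed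
  next
    assume L: ?L
    show ?R
    proof (intro allI impI)
      fix N assume N: "openin (mtop M) N \<and> pt \<in> N"
      define N' where "N' = (\<Inter>j\<in>{..m}. {q \<in> T. (\<phi> ^^ j) q \<in> N})"
      have "openin (mtop M) N'" unfolding N'_def
      proof (rule openin_INT2)
        show "openin (mtop M) {q \<in> T. (\<phi> ^^ j) q \<in> N}" for j by (rule openin_pre[OF contk]) (use N in blast)
      qed auto
      moreover have "pt \<in> N'" unfolding N'_def using N fixk openin_subset by fastforce
      ultimately obtain K where K: "\<And>k. k \<ge> K \<Longrightarrow> ((\<phi> ^^ Suc m) ^^ k) ` V \<subseteq> N'" using L unfolding eventually_sequentially by blast
      have "(\<phi> ^^ i) ` V \<subseteq> N" if i: "i \<ge> Suc m * K" for i
      proof (rule image_subsetI)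
        fix q assume q: "q \<in> V"
        define k j where "k = i div Suc m" and "j = i mod Suc m"
        have "k \<ge> K" using i unfolding k_def by (metis div_le_mono nonzero_mult_div_cancel_left nat.distinct(1))
        then have "((\<phi> ^^ Suc m) ^^ k) q \<in> N'" using K q by blast
        moreover have "j \<le> m" unfolding j_def by (meson less_Suc_eq_le mod_less_divisor zero_less_Suc)
        ultimately have "(\<phi> ^^ j) (((\<phi> ^^ Suc m) ^^ k) q) \<in> N" unfolding N'_def by blast
        moreover have "(\<phi> ^^ i) q = (\<phi> ^^ j) ((\<phi> ^^ (Suc m * k)) q)"
        proof -
          have "i = j + Suc m * k" unfolding k_def j_def by (rule mod_mult_div_eq[symmetric])
          then show ?thesis by (simp only: funpow_add o_apply)
        qed
        ultimately show "(\<phi> ^^ i) q \<in> N" unfolding pow by simp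
      qed
      then show "\<forall>\<^sub>F k in sequentially. (\<phi> ^^ k) ` V \<subseteq> N" unfolding eventually_sequentially by blast
    qed
  qed
  then show ?thesis unfolding stable_manifold_def by blast
qed

end

section \<open>The differential of the automorphism at the fixed point\<close>

lemma linear_basis_expansion:
  fixes L :: "'e::euclidean_space \<Rightarrow> 'b::real_vector"
  assumes "linear L" shows "L w = (\<Sum>b\<in>Basis. (w \<bullet> b) *\<^sub>R L b)"
proof -
  have "L (\<Sum>b\<in>Basis. (w \<bullet> b) *\<^sub>R b) = (\<Sum>b\<in>Basis. (w \<bullet> b) *\<^sub>R L b)"
    by (simp add: linear_sum[OF assms] linear_scale[OF assms])
  then show ?thesis by (simp add: euclidean_representation)
qed

lemma form_derivative_linear:
  fixes \<Theta> :: "'e::euclidean_space \<Rightarrow> 'v::real_vector \<Rightarrow> real"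
  assumes S: "open S" "a \<in> S" and \<Theta>: "\<And>y. y \<in> S \<Longrightarrow> linear (\<Theta> y)" "\<And>w. smooth_on S (\<lambda>y. \<Theta> y w)"
  shows "bilinear (\<lambda>u v. frechet_derivative (\<lambda>y. \<Theta> y v) (at a) u)"
proof -
  have d: "((\<lambda>y. \<Theta> y w) has_derivative frechet_derivative (\<lambda>y. \<Theta> y w) (at a)) (at a)" for w
    by (rule smooth_on_has_derivative[OF \<Theta>(2) S(2)])
  have "frechet_derivative (\<lambda>y. \<Theta> y (r *\<^sub>R v + s *\<^sub>R w)) (at a) = (\<lambda>u. r * frechet_derivative (\<lambda>y. \<Theta> y v) (at a) u + s * frechet_derivative (\<lambda>y. \<Theta> y w) (at a) u)" for r s v w
  proof (rule frechetI, rule has_derivative_transform_within_open[OF _ S])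
    show "((\<lambda>y. r * \<Theta> y v + s * \<Theta> y w) has_derivative (\<lambda>u. r * frechet_derivative (\<lambda>y. \<Theta> y v) (at a) u + s * frechet_derivative (\<lambda>y. \<Theta> y w) (at a) u)) (at a)"
      by (intro has_derivative_add has_derivative_mult_right d)
    show "r * \<Theta> y v + s * \<Theta> y w = \<Theta> y (r *\<^sub>R v + s *\<^sub>R w)" if "y \<in> S" for y
      by (simp add: linear_add[OF \<Theta>(1)[OF that]] linear_scale[OF \<Theta>(1)[OF that]])
  qed
  from this[of 1 _ 1] this[of _ _ 0] have "linear (\<lambda>v. frechet_derivative (\<lambda>y. \<Theta> y v) (at a) u)" for u
    by (intro linearI) simp_all
  moreover have "linear (\<lambda>u. frechet_derivative (\<lambda>y. \<Theta> y v) (at a) u)" for v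
    using has_derivative_linear[OF d] .
  ultimately show ?thesis unfolding bilinear_def by blast
qed

text \<open>Differentiating \<open>f\<^sup>*\<Theta> = h \<Theta>\<close> at a fixed point, where \<open>h\<close> is an unspecified function: on the
  kernel of \<open>\<Theta>\<close> at that point the derivative of \<open>h\<close> drops out. The antisymmetric part of this
  identity is the scaling of the Levi form, its symmetric part the relation that makes the resonant
  quadratic terms of \<open>f\<close> removable.\<close>

lemma form_pullback_derivative:
  fixes f :: "'e::euclidean_space \<Rightarrow> 'e" and \<Theta> :: "'e \<Rightarrow> 'e \<Rightarrow> real"
  assumes S: "open S" "0 \<in> S" and f: "smooth_on S f" "f 0 = 0" and S': "open S'" "f ` S \<subseteq> S'" "S \<subseteq> S'"
    and \<Theta>: "\<And>y. y \<in> S' \<Longrightarrow> linear (\<Theta> y)" "\<And>w. smooth_on S' (\<lambda>y. \<Theta> y w)"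
    and ker: "\<And>x w. x \<in> S \<Longrightarrow> \<Theta> x w = 0 \<Longrightarrow> \<Theta> (f x) (frechet_derivative f (at x) w) = 0"
    and \<xi>: "\<Theta> 0 \<xi> \<noteq> 0" and \<mu>: "\<And>w. \<Theta> 0 (frechet_derivative f (at 0) w) = \<mu> * \<Theta> 0 w"
    and v: "\<Theta> 0 v = 0"
  shows "frechet_derivative (\<lambda>y. \<Theta> y (frechet_derivative f (at 0) v)) (at 0) (frechet_derivative f (at 0) u)
      + \<Theta> 0 (frechet_derivative (\<lambda>x. frechet_derivative f (at x) v) (at 0) u)
      = \<mu> * frechet_derivative (\<lambda>y. \<Theta> y v) (at 0) u"
proof -
  have 0: "0 \<in> S'" using S S' by blast
  let ?D = "\<lambda>g. frechet_derivative g (at 0)"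
  define G where "G w u = ?D (\<lambda>y. \<Theta> y w) u" for w u
  have Gbil: "linear (\<lambda>w. G w u)" for u
    using form_derivative_linear[OF S'(1) 0 \<Theta>] unfolding bilinear_def G_def by blast
  have fd: "(f has_derivative ?D f) (at 0)" by (rule smooth_on_has_derivative[OF f(1) S(2)])
  have \<Theta>d: "((\<lambda>y. \<Theta> y w) has_derivative G w) (at (f 0))" for w
    unfolding f(2) G_def by (rule smooth_on_has_derivative[OF \<Theta>(2) 0])
  have \<Theta>fd: "((\<lambda>x. \<Theta> (f x) w) has_derivative (\<lambda>u. G w (?D f u))) (at 0)" for w
    using diff_chain_at[OF fd \<Theta>d] by (simp add: o_def)
  have f2d: "((\<lambda>x. frechet_derivative f (at x) v \<bullet> b) has_derivative (\<lambda>u. ?D (\<lambda>x. frechet_derivative f (at x) v) u \<bullet> b)) (at 0)" for b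
    by (rule bounded_linear.has_derivative[OF bounded_linear_inner_left smooth_on_has_derivative[OF smooth_on_frechet[OF f(1)] S(2)]])
  have lhs: "((\<lambda>x. \<Theta> (f x) (frechet_derivative f (at x) v)) has_derivative (\<lambda>u. G (?D f v) (?D f u) + \<Theta> 0 (?D (\<lambda>x. frechet_derivative f (at x) v) u))) (at 0)"
  proof (rule has_derivative_transform_within_open[OF _ S])
    have "((\<lambda>x. \<Sum>b\<in>Basis. (frechet_derivative f (at x) v \<bullet> b) * \<Theta> (f x) b) has_derivative
      (\<lambda>u. \<Sum>b\<in>Basis. (?D f v \<bullet> b) * G b (?D f u) + (?D (\<lambda>x. frechet_derivative f (at x) v) u \<bullet> b) * \<Theta> (f 0) b)) (at 0)"
      by (intro has_derivative_sum has_derivative_mult f2d \<Theta>fd)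
    moreover have "(\<Sum>b\<in>Basis. (?D f v \<bullet> b) * G b (?D f u) + (?D (\<lambda>x. frechet_derivative f (at x) v) u \<bullet> b) * \<Theta> (f 0) b)
      = G (?D f v) (?D f u) + \<Theta> 0 (?D (\<lambda>x. frechet_derivative f (at x) v) u)" for u
      unfolding sum.distrib f(2)
      using linear_basis_expansion[OF Gbil, of "?D f v" "?D f u"] linear_basis_expansion[OF \<Theta>(1)[OF 0], of "?D (\<lambda>x. frechet_derivative f (at x) v) u"]
      by simp
    ultimately show "((\<lambda>x. \<Sum>b\<in>Basis. (frechet_derivative f (at x) v \<bullet> b) * \<Theta> (f x) b) has_derivative
      (\<lambda>u. G (?D f v) (?D f u) + \<Theta> 0 (?D (\<lambda>x. frechet_derivative f (at x) v) u))) (at 0)" by simp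
    fix x assume "x \<in> S"
    then have "f x \<in> S'" using S' by blast
    from linear_basis_expansion[OF \<Theta>(1)[OF this], of "frechet_derivative f (at x) v"]
    show "(\<Sum>b\<in>Basis. (frechet_derivative f (at x) v \<bullet> b) * \<Theta> (f x) b) = \<Theta> (f x) (frechet_derivative f (at x) v)" by simp
  qed
  \<comment> \<open>the conformal factor, found by correcting \<open>v\<close> near \<open>0\<close> by a multiple of \<open>\<xi>\<close> so that it lies in the kernel\<close>
  define m where "m x = \<Theta> (f x) (frechet_derivative f (at x) \<xi>) / \<Theta> x \<xi>" for x
  have cont\<xi>: "continuous_on S (\<lambda>x. \<Theta> x \<xi>)" by (rule continuous_on_subset[OF smooth_on_continuous_on[OF \<Theta>(2)] S'(3)])
  have "open (S \<inter> (\<lambda>x. \<Theta> x \<xi>) -` (- {0}))" by (rule continuous_open_preimage[OF cont\<xi> S(1)]) auto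
  then obtain S1 where S1: "S1 = S \<inter> (\<lambda>x. \<Theta> x \<xi>) -` (- {0})" "open S1" by blast
  have 01: "0 \<in> S1" using S1(1) S \<xi> by simp
  have mcont: "isCont m 0"
  proof -
    have a: "isCont (\<lambda>x. \<Theta> (f x) b) 0" for b by (rule has_derivative_continuous[OF \<Theta>fd])
    have b: "isCont (\<lambda>x. frechet_derivative f (at x) \<xi> \<bullet> b) 0" for b
      by (rule has_derivative_continuous[OF bounded_linear.has_derivative[OF bounded_linear_inner_left smooth_on_has_derivative[OF smooth_on_frechet[OF f(1)] S(2)]]])
    have c: "isCont (\<lambda>x. \<Theta> x \<xi>) 0" using cont\<xi> S by (simp add: continuous_on_eq_continuous_at)
    have "isCont (\<lambda>x. (\<Sum>b\<in>Basis. (frechet_derivative f (at x) \<xi> \<bullet> b) * \<Theta> (f x) b) / \<Theta> x \<xi>) 0"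
      by (intro isCont_divide isCont_sum isCont_mult a b c \<xi> ballI)
    moreover have "\<forall>\<^sub>F x in nhds 0. (\<Sum>b\<in>Basis. (frechet_derivative f (at x) \<xi> \<bullet> b) * \<Theta> (f x) b) / \<Theta> x \<xi> = m x"
      unfolding eventually_nhds
    proof (intro exI[of _ S] conjI S ballI)
      fix x assume "x \<in> S"
      then have "f x \<in> S'" using S' by blast
      from linear_basis_expansion[OF \<Theta>(1)[OF this], of "frechet_derivative f (at x) \<xi>"]
      show "(\<Sum>b\<in>Basis. (frechet_derivative f (at x) \<xi> \<bullet> b) * \<Theta> (f x) b) / \<Theta> x \<xi> = m x" by (simp add: m_def)
    qed
    ultimately show ?thesis by (simp only: isCont_cong)
  qed
  have "((\<lambda>x. \<Theta> x v *\<^sub>R m x) has_derivative (\<lambda>u. G v u *\<^sub>R m 0)) (at 0)"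
    by (rule has_derivative_scaleR_vanishing[OF \<Theta>d[unfolded f(2)] v mcont])
  then have "((\<lambda>x. \<Theta> (f x) (frechet_derivative f (at x) v)) has_derivative (\<lambda>u. G v u *\<^sub>R m 0)) (at 0)"
  proof (rule has_derivative_transform_within_open[OF _ S1(2) 01])
    fix x assume x: "x \<in> S1"
    then have xS: "x \<in> S" "x \<in> S'" "f x \<in> S'" and nz: "\<Theta> x \<xi> \<noteq> 0" using S1(1) S' by auto
    note lx = \<Theta>(1)[OF xS(2)] and lfx = \<Theta>(1)[OF xS(3)] and lD = frechet_linear[OF smooth_on_differentiable[OF f(1) xS(1)]]
    have "\<Theta> x (v - (\<Theta> x v / \<Theta> x \<xi>) *\<^sub>R \<xi>) = 0" using nz by (simp add: linear_diff[OF lx] linear_scale[OF lx])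
    from ker[OF xS(1) this]
    have "\<Theta> (f x) (frechet_derivative f (at x) v) = (\<Theta> x v / \<Theta> x \<xi>) * \<Theta> (f x) (frechet_derivative f (at x) \<xi>)"
      by (simp add: linear_diff[OF lfx] linear_scale[OF lfx] linear_diff[OF lD] linear_scale[OF lD])
    then show "\<Theta> x v *\<^sub>R m x = \<Theta> (f x) (frechet_derivative f (at x) v)" by (simp add: m_def)
  qed
  moreover have "m 0 = \<mu>" using \<mu>[of \<xi>] \<xi> f(2) by (simp add: m_def)
  ultimately have "(\<lambda>u. G v u * \<mu>) = (\<lambda>u. G (?D f v) (?D f u) + \<Theta> 0 (?D (\<lambda>x. frechet_derivative f (at x) v) u))"
    using has_derivative_unique[OF _ lhs] by simp
  from fun_cong[OF this, of u] show ?thesis by (simp add: G_def mult.commute)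
qed

subsection \<open>A unitary frame adapted to the differential\<close>

text \<open>The hypotheses describe the contact form, Levi form, complex structure and differential of a
  contracting automorphism at its fixed point. The conditions on \<open>j\<close> concern the contact hyperplane,
  where the complex structure lives; a complement adapted to the differential is yet to be found.\<close>

locale contact_differential =
  fixes \<theta>0 :: "'e::euclidean_space \<Rightarrow> real" and \<omega> :: "'e \<Rightarrow> 'e \<Rightarrow> real" and j D :: "'e \<Rightarrow> 'e" and \<mu> :: real
  assumes \<theta>0: "linear \<theta>0" "\<exists>v. \<theta>0 v \<noteq> 0" and \<omega>: "bilinear \<omega>" "\<And>u v. \<omega> u v = - \<omega> v u"
    and j: "\<And>u. \<theta>0 u = 0 \<Longrightarrow> \<theta>0 (j u) = 0" "\<And>u. \<theta>0 u = 0 \<Longrightarrow> j (j u) = - u"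
      "\<And>u v a b. \<theta>0 u = 0 \<Longrightarrow> \<theta>0 v = 0 \<Longrightarrow> j (a *\<^sub>R u + b *\<^sub>R v) = a *\<^sub>R j u + b *\<^sub>R j v"
    and pos: "\<And>u. \<theta>0 u = 0 \<Longrightarrow> u \<noteq> 0 \<Longrightarrow> 0 < \<omega> u (j u)"
    and D: "linear D" "\<And>u. \<theta>0 (D u) = \<mu> * \<theta>0 u" "\<And>u. \<theta>0 u = 0 \<Longrightarrow> j (D u) = D (j u)"
      "\<And>u v. \<theta>0 u = 0 \<Longrightarrow> \<theta>0 v = 0 \<Longrightarrow> \<omega> (D u) (D v) = \<mu> * \<omega> u v"
    and \<mu>: "0 < \<mu>" "\<mu> < 1"
begin

lemma \<omega>_lin: "linear (\<omega> u)" "linear (\<lambda>u. \<omega> u v)"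
  using \<omega>(1) by (auto simp: bilinear_def)

text \<open>The image of the differential minus \<open>\<mu>\<close> lies in the contact hyperplane, so its kernel is not \<open>0\<close>. A kernel vector in
  that hyperplane would have its Levi length multiplied by \<open>\<mu>\<^sup>2\<close> instead of \<open>\<mu>\<close>.\<close>

lemma eigenvector: "\<exists>\<xi>. \<theta>0 \<xi> = 1 \<and> D \<xi> = \<mu> *\<^sub>R \<xi>"
proof -
  have lin: "linear (\<lambda>x. D x - \<mu> *\<^sub>R x)" by (intro linear_compose_sub D(1) linear_compose_scale_right linear_ident)
  have "\<theta>0 (D x - \<mu> *\<^sub>R x) = 0" for x by (simp add: linear_diff[OF \<theta>0(1)] linear_scale[OF \<theta>0(1)] D(2))
  moreover obtain v where "\<theta>0 v \<noteq> 0" using \<theta>0(2) by blast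
  ultimately have "v \<notin> range (\<lambda>x. D x - \<mu> *\<^sub>R x)" by auto
  then have "\<not> surj (\<lambda>x. D x - \<mu> *\<^sub>R x)" by blast
  then have "\<not> inj (\<lambda>x. D x - \<mu> *\<^sub>R x)" using linear_injective_imp_surjective[OF lin] by blast
  then obtain x where x: "x \<noteq> 0" "D x = \<mu> *\<^sub>R x" using linear_injective_0[OF lin] by auto
  have "\<theta>0 x \<noteq> 0"
  proof
    assume E: "\<theta>0 x = 0"
    have "j (\<mu> *\<^sub>R x + 0 *\<^sub>R x) = \<mu> *\<^sub>R j x + 0 *\<^sub>R j x" by (rule j(3)[OF E E])
    then have "D (j x) = \<mu> *\<^sub>R j x" using D(3)[OF E] x(2) by simp
    then have "\<mu> * (\<mu> * \<omega> x (j x)) = \<mu> * \<omega> x (j x)"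
      using D(4)[OF E j(1)[OF E]] x(2) by (simp add: linear_scale[OF \<omega>_lin(1)] linear_scale[OF \<omega>_lin(2)])
    then show False using pos[OF E x(1)] \<mu> by simp
  qed
  then show ?thesis using x by (intro exI[of _ "(1 / \<theta>0 x) *\<^sub>R x"]) (simp add: linear_scale[OF \<theta>0(1)] linear_scale[OF D(1)])
qed

definition "\<xi> = (SOME \<xi>. \<theta>0 \<xi> = 1 \<and> D \<xi> = \<mu> *\<^sub>R \<xi>)"

lemma \<xi>: "\<theta>0 \<xi> = 1" "D \<xi> = \<mu> *\<^sub>R \<xi>"
  using someI_ex[OF eigenvector] unfolding \<xi>_def by blast+

text \<open>The complex structure, extended by \<open>0\<close> on the eigenvector.\<close>

definition "K v = j (v - \<theta>0 v *\<^sub>R \<xi>)"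

lemma K: "linear K" "\<And>u. \<theta>0 u = 0 \<Longrightarrow> K u = j u" "\<And>u. \<theta>0 (K u) = 0" "\<And>u. \<theta>0 u = 0 \<Longrightarrow> K (K u) = - u"
proof -
  have p: "\<theta>0 (v - \<theta>0 v *\<^sub>R \<xi>) = 0" for v by (simp add: linear_diff[OF \<theta>0(1)] linear_scale[OF \<theta>0(1)] \<xi>)
  have "K (a *\<^sub>R u + b *\<^sub>R v) = a *\<^sub>R K u + b *\<^sub>R K v" for a b u v
  proof -
    have "a *\<^sub>R u + b *\<^sub>R v - \<theta>0 (a *\<^sub>R u + b *\<^sub>R v) *\<^sub>R \<xi> = a *\<^sub>R (u - \<theta>0 u *\<^sub>R \<xi>) + b *\<^sub>R (v - \<theta>0 v *\<^sub>R \<xi>)"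
      by (simp add: linear_add[OF \<theta>0(1)] linear_scale[OF \<theta>0(1)] algebra_simps)
    then show ?thesis unfolding K_def using j(3)[OF p p] by simp
  qed
  from this[of 1 _ 1] this[of _ _ 0] show "linear K" by (intro linearI) simp_all
  show e: "K u = j u" if "\<theta>0 u = 0" for u using that by (simp add: K_def)
  show k: "\<theta>0 (K u) = 0" for u unfolding K_def by (rule j(1)[OF p])
  show "K (K u) = - u" if "\<theta>0 u = 0" for u using that by (simp add: e k j)
qed

text \<open>The Levi form need not be invariant under the complex structure, so its associated bilinear form is
  symmetrised to give an inner product. The factor makes \<open>\<omega> u (j u) = 4 g(u, u)\<close>, which is the normalisation of the
  model group.\<close>

definition "g u v = (\<omega> u (K v) + \<omega> v (K u)) / 8"

lemma g: "linear (g u)" "g u v = g v u" "\<theta>0 u = 0 \<Longrightarrow> \<theta>0 v = 0 \<Longrightarrow> g (K u) (K v) = g u v" "\<theta>0 u = 0 \<Longrightarrow> g u (K u) = 0"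
  "\<theta>0 u = 0 \<Longrightarrow> u \<noteq> 0 \<Longrightarrow> 0 < g u u"
proof -
  have l1: "linear (\<lambda>v. \<omega> u (K v))" using linear_compose[OF K(1) \<omega>_lin(1)] by (simp add: o_def)
  show "linear (g u)" unfolding g_def[abs_def]
    using linear_compose_scale_right[OF linear_compose_add[OF l1 \<omega>_lin(2)[of "K u"]], of "1/8"] by simp
  show "g u v = g v u" by (simp add: g_def)
  show "g (K u) (K v) = g u v" if "\<theta>0 u = 0" "\<theta>0 v = 0"
    using that \<omega>(2)[of "K u" v] \<omega>(2)[of "K v" u] by (simp add: g_def K(4) linear_neg[OF \<omega>_lin(1)])
  show "g u (K u) = 0" if "\<theta>0 u = 0"
    using that \<omega>(2)[of u u] \<omega>(2)[of "K u" "K u"] by (simp add: g_def K(4) linear_neg[OF \<omega>_lin(1)])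
  show "0 < g u u" if "\<theta>0 u = 0" "u \<noteq> 0" using pos[OF that] that by (simp add: g_def K)
qed

lemma g_lin2: "linear (\<lambda>u. g u v)"
proof -
  have "(\<lambda>u. g u v) = g v" by (rule ext) (rule g(2))
  then show ?thesis using g(1) by simp
qed

text \<open>Gram-Schmidt orthogonalisation over the complex numbers, each step adding a vector together with its image under
  the complex structure; as long as these do not span the contact hyperplane there is room for another one.\<close>

lemma unitary_frame:
  assumes "finite A" "2 * card A < DIM('e)"
  shows "\<exists>e :: 'i \<Rightarrow> 'e. \<forall>\<alpha>\<in>A. \<theta>0 (e \<alpha>) = 0 \<and> (\<forall>\<beta>\<in>A. g (e \<alpha>) (e \<beta>) = (if \<alpha> = \<beta> then 1 else 0) \<and> g (e \<alpha>) (K (e \<beta>)) = 0)"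
  using assms
proof (induction A)
  case empty then show ?case by simp
next
  case (insert \<alpha> A)
  then obtain e where e: "\<And>\<beta>. \<beta> \<in> A \<Longrightarrow> \<theta>0 (e \<beta>) = 0"
    "\<And>\<beta> \<gamma>. \<beta> \<in> A \<Longrightarrow> \<gamma> \<in> A \<Longrightarrow> g (e \<beta>) (e \<gamma>) = (if \<beta> = \<gamma> then 1 else 0)"
    "\<And>\<beta> \<gamma>. \<beta> \<in> A \<Longrightarrow> \<gamma> \<in> A \<Longrightarrow> g (e \<beta>) (K (e \<gamma>)) = 0" by fastforce
  define B where "B = e ` A \<union> (K \<circ> e) ` A"
  have "card B \<le> card (e ` A) + card ((K \<circ> e) ` A)" unfolding B_def by (rule card_Un_le)
  also have "\<dots> \<le> 2 * card A" using card_image_le[OF insert(1), of e] card_image_le[OF insert(1), of "K \<circ> e"] by simp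
  finally have cB: "card B \<le> 2 * card A" .
  define a where "a = (\<Sum>b\<in>Basis. \<theta>0 b *\<^sub>R b)"
  have a: "\<theta>0 x = a \<bullet> x" for x
  proof -
    have "\<theta>0 x = (\<Sum>b\<in>Basis. (x \<bullet> b) *\<^sub>R \<theta>0 b)" by (rule linear_basis_expansion[OF \<theta>0(1)])
    also have "\<dots> = a \<bullet> x" unfolding a_def inner_sum_left by (rule sum.cong) (simp_all add: inner_commute)
    finally show ?thesis .
  qed
  have "a \<noteq> 0" using \<theta>0(2) a by auto
  then have dE: "dim {x. \<theta>0 x = 0} = DIM('e) - 1" unfolding a by (rule dim_hyperplane)
  have "\<not> {x. \<theta>0 x = 0} \<subseteq> span B"
  proof
    assume "{x. \<theta>0 x = 0} \<subseteq> span B"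
    then have "dim {x. \<theta>0 x = 0} \<le> card B"
      using insert(1) by (intro dim_le_card) (auto simp: B_def)
    then show False using dE cB insert by simp
  qed
  then obtain v where v: "\<theta>0 v = 0" "v \<notin> span B" by blast
  define w where "w = v - (\<Sum>\<beta>\<in>A. g v (e \<beta>) *\<^sub>R e \<beta> + g v (K (e \<beta>)) *\<^sub>R K (e \<beta>))"
  have "(\<Sum>\<beta>\<in>A. g v (e \<beta>) *\<^sub>R e \<beta> + g v (K (e \<beta>)) *\<^sub>R K (e \<beta>)) \<in> span B"
    by (intro span_sum span_add span_scale span_base) (auto simp: B_def)
  then have w0: "w \<noteq> 0" using v(2) unfolding w_def by auto
  have wE: "\<theta>0 w = 0" unfolding w_def
    by (simp add: linear_diff[OF \<theta>0(1)] linear_sum[OF \<theta>0(1)] linear_add[OF \<theta>0(1)] linear_scale[OF \<theta>0(1)] v e K(3))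
  have gw: "g w x = g v x - (\<Sum>\<beta>\<in>A. g v (e \<beta>) * g (e \<beta>) x + g v (K (e \<beta>)) * g (K (e \<beta>)) x)" for x
    unfolding w_def by (simp add: linear_diff[OF g_lin2] linear_sum[OF g_lin2] linear_add[OF g_lin2] linear_scale[OF g_lin2])
  have w1: "g w (e \<gamma>) = 0" if "\<gamma> \<in> A" for \<gamma>
  proof -
    have "(\<Sum>\<beta>\<in>A. g v (e \<beta>) * g (e \<beta>) (e \<gamma>) + g v (K (e \<beta>)) * g (K (e \<beta>)) (e \<gamma>)) = (\<Sum>\<beta>\<in>A. if \<beta> = \<gamma> then g v (e \<gamma>) else 0)"
      by (rule sum.cong) (use that e g(2)[of "K (e _)" "e \<gamma>"] in auto)
    then show ?thesis unfolding gw using that insert(1) by simp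
  qed
  have w2: "g w (K (e \<gamma>)) = 0" if "\<gamma> \<in> A" for \<gamma>
  proof -
    have "(\<Sum>\<beta>\<in>A. g v (e \<beta>) * g (e \<beta>) (K (e \<gamma>)) + g v (K (e \<beta>)) * g (K (e \<beta>)) (K (e \<gamma>))) = (\<Sum>\<beta>\<in>A. if \<beta> = \<gamma> then g v (K (e \<gamma>)) else 0)"
      by (rule sum.cong) (use that e g(3)[OF e(1) e(1)] in auto)
    then show ?thesis unfolding gw using that insert(1) by simp
  qed
  define N where "N = sqrt (g w w)"
  have N: "N > 0" "N * N = g w w" using g(5)[OF wE w0] by (auto simp: N_def)
  define e' where "e' = e(\<alpha> := (1/N) *\<^sub>R w)"
  have new: "e' \<alpha> = (1/N) *\<^sub>R w" and old: "\<And>\<beta>. \<beta> \<in> A \<Longrightarrow> e' \<beta> = e \<beta>" using insert(2) by (auto simp: e'_def)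
  have n1: "g (e' \<alpha>) x = g w x / N" for x unfolding new by (simp add: linear_scale[OF g_lin2])
  have Kn: "K (e' \<alpha>) = (1/N) *\<^sub>R K w" unfolding new by (rule linear_scale[OF K(1)])
  have wK: "g (e \<gamma>) (K w) = 0" if "\<gamma> \<in> A" for \<gamma>
  proof -
    have "g (e \<gamma>) (K w) = g (K (e \<gamma>)) (K (K w))" by (rule g(3)[OF e(1)[OF that] K(3), symmetric])
    also have "\<dots> = - g (K (e \<gamma>)) w" using K(4)[OF wE] by (simp add: linear_neg[OF g(1)])
    finally show ?thesis using w2[OF that] g(2)[of w] by simp
  qed
  have N0: "N \<noteq> 0" using N by simp
  show ?case
  proof (intro exI[of _ e'] ballI conjI)
    fix \<beta> assume \<beta>: "\<beta> \<in> insert \<alpha> A"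
    show "\<theta>0 (e' \<beta>) = 0" using \<beta> old e(1) new wE by (cases "\<beta> = \<alpha>") (auto simp: linear_scale[OF \<theta>0(1)])
    fix \<gamma> assume \<gamma>: "\<gamma> \<in> insert \<alpha> A"
    consider "\<beta> = \<alpha>" "\<gamma> = \<alpha>" | "\<beta> = \<alpha>" "\<gamma> \<in> A" "\<gamma> \<noteq> \<alpha>" | "\<beta> \<in> A" "\<gamma> = \<alpha>" "\<beta> \<noteq> \<alpha>" | "\<beta> \<in> A" "\<gamma> \<in> A"
      using \<beta> \<gamma> insert(2) by blast
    then show "g (e' \<beta>) (e' \<gamma>) = (if \<beta> = \<gamma> then 1 else 0)"
    proof cases
      case 1
      have "g (e' \<alpha>) (e' \<alpha>) = (g w w / N) / N" unfolding n1 unfolding new by (simp add: linear_scale[OF g(1)])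
      then show ?thesis using 1 N0 unfolding N(2)[symmetric] by simp
    next case 2 then show ?thesis using n1 w1 old by simp
    next case 3 then show ?thesis using n1[of "e \<beta>"] w1 old g(2)[of "e \<beta>" "e' \<alpha>"] by simp
    next case 4 then show ?thesis using e(2) old by simp
    qed
    from \<open>\<beta> \<in> insert \<alpha> A\<close> consider "\<beta> = \<alpha>" "\<gamma> = \<alpha>" | "\<beta> = \<alpha>" "\<gamma> \<in> A" "\<gamma> \<noteq> \<alpha>" | "\<beta> \<in> A" "\<gamma> = \<alpha>" "\<beta> \<noteq> \<alpha>" | "\<beta> \<in> A" "\<gamma> \<in> A"
      using \<gamma> insert(2) by blast
    then show "g (e' \<beta>) (K (e' \<gamma>)) = 0"
    proof cases
      case 1
      have "g (e' \<alpha>) (K (e' \<alpha>)) = (g w (K w) / N) / N" unfolding n1 Kn by (simp add: linear_scale[OF g(1)])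
      then show ?thesis using 1 g(4)[OF wE] by simp
    next case 2 then show ?thesis using n1 w2 old by simp
    next case 3 then show ?thesis using wK old unfolding 3 Kn by (simp add: linear_scale[OF g(1)])
    next case 4 then show ?thesis using e(3) old by simp
    qed
  qed
qed

text \<open>A unitary frame maps the first factor to the contact hyperplane, and the last coordinate runs along the eigenvector
  instead of an arbitrary complement, which makes the differential block diagonal.\<close>

theorem normal_frame:
  assumes dim: "DIM('e) = 2 * CARD('n::finite) + 1"
  obtains T :: "'n::finite heis \<Rightarrow> 'e" and T' where "linear T" "linear T'" "\<And>x. T' (T x) = x" "\<And>y. T (T' y) = y"
    "\<And>z t. \<theta>0 (T (z, t)) = t" "\<And>z. j (T (z, 0)) = T (\<i> *s z, 0)" "\<And>z. \<omega> (T (z, 0)) (T (\<i> *s z, 0)) = 4 * (norm z)\<^sup>2"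
    "\<And>t. D (T (0, t)) = T (0, \<mu> * t)"
proof -
  obtain e :: "'n \<Rightarrow> 'e" where e: "\<And>\<alpha>. \<theta>0 (e \<alpha>) = 0" "\<And>\<alpha> \<beta>. g (e \<alpha>) (e \<beta>) = (if \<alpha> = \<beta> then 1 else 0)"
    "\<And>\<alpha> \<beta>. g (e \<alpha>) (K (e \<beta>)) = 0"
    using unitary_frame[of "UNIV :: 'n set"] dim by auto
  define T where "T x = (\<Sum>\<alpha>\<in>UNIV. Re (fst x $ \<alpha>) *\<^sub>R e \<alpha> + Im (fst x $ \<alpha>) *\<^sub>R K (e \<alpha>)) + snd x *\<^sub>R \<xi>" for x :: "'n heis"
  have Tl: "linear T" by (rule linearI) (simp_all add: T_def algebra_simps sum.distrib scaleR_sum_right)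
  have T\<theta>: "\<theta>0 (T (z, t)) = t" for z t
    by (simp add: T_def linear_add[OF \<theta>0(1)] linear_sum[OF \<theta>0(1)] linear_scale[OF \<theta>0(1)] e K(3) \<xi>)
  have KT: "K (T (z, 0)) = T (\<i> *s z, 0)" for z
    by (simp add: T_def linear_add[OF K(1)] linear_sum[OF K(1)] linear_scale[OF K(1)] K(4)[OF e(1)] vector_scalar_mult_def add.commute)
  have gT: "g (T (z, 0)) (T (z, 0)) = (norm z)\<^sup>2" for z
  proof -
    have ge: "g (e \<beta>) (T (z, 0)) = Re (z $ \<beta>)" for \<beta>
      by (simp add: T_def linear_add[OF g(1)] linear_sum[OF g(1)] linear_scale[OF g(1)] e if_distrib[of "(*) _"] cong: if_cong)
    have gK: "g (K (e \<beta>)) (T (z, 0)) = Im (z $ \<beta>)" for \<beta>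
      using g(2)[of "K (e \<beta>)" "e _"]
      by (simp add: T_def linear_add[OF g(1)] linear_sum[OF g(1)] linear_scale[OF g(1)] e g(3)[OF e(1) e(1)] if_distrib[of "(*) _"] cong: if_cong)
    have "g (T (z, 0)) (T (z, 0)) = (\<Sum>\<alpha>\<in>UNIV. Re (z $ \<alpha>) * g (e \<alpha>) (T (z, 0)) + Im (z $ \<alpha>) * g (K (e \<alpha>)) (T (z, 0)))"
      by (subst (1) T_def) (simp add: linear_add[OF g_lin2] linear_sum[OF g_lin2] linear_scale[OF g_lin2])
    also have "\<dots> = (\<Sum>\<alpha>\<in>UNIV. (norm (z $ \<alpha>))\<^sup>2)" unfolding ge gK cmod_power2 by (simp add: power2_eq_square)
    also have "\<dots> = (norm z)\<^sup>2" by (simp add: norm_vec_def L2_set_def sum_nonneg)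
    finally show ?thesis .
  qed
  have inj: "inj T"
  proof (rule linear_injective_0[OF Tl, THEN iffD2], intro allI impI)
    fix x :: "'n heis" assume x: "T x = 0"
    obtain z t where zt: "x = (z, t)" by (cases x)
    have t: "t = 0" using T\<theta>[of z t] x zt linear_0[OF \<theta>0(1)] by simp
    then have "(norm z)\<^sup>2 = 0" using gT[of z] x zt linear_0[OF g(1)] by simp
    then show "x = 0" using zt t by (simp add: zero_prod_def)
  qed
  have "dim (range T) = dim (UNIV :: 'n heis set)" by (rule dim_image_eq[OF Tl]) (use inj in simp)
  also have "\<dots> = DIM('e)" using dim by simp
  finally have "span (range T) = UNIV" using dim_eq_full by blast
  then have surj: "surj T" using linear_subspace_image[OF Tl subspace_UNIV] span_eq_iff by blast
  define T' where "T' = inv T"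
  have T'1: "T' (T x) = x" for x using inj by (simp add: T'_def)
  have T'2: "T (T' y) = y" for y using surj by (simp add: T'_def surj_f_inv_f)
  have T'l: "linear T'"
    by (rule linearI; rule injD[OF inj]) (simp_all add: linear_add[OF Tl] linear_scale[OF Tl] T'2)
  have "j (T (z, 0)) = T (\<i> *s z, 0)" for z using KT[of z] K(2)[OF T\<theta>[of z 0]] by simp
  moreover have "\<omega> (T (z, 0)) (T (\<i> *s z, 0)) = 4 * (norm z)\<^sup>2" for z
    using gT[of z] unfolding KT[symmetric] by (simp add: g_def)
  moreover have "D (T (0, t)) = T (0, \<mu> * t)" for t
    by (simp add: T_def linear_scale[OF D(1)] \<xi>)
  ultimately show thesis using that[OF Tl T'l T'1 T'2 T\<theta>] by blast
qed

end

section \<open>Invariance under the linear contraction forces the model structure\<close>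

text \<open>The dilation of the model group: the last coordinate has twice the weight of the others, because \<open>A\<close>
  will scale lengths by \<open>\<surd>\<mu>\<close>.\<close>

definition Lam :: "(complex^'n \<Rightarrow> complex^'n) \<Rightarrow> real \<Rightarrow> 'n::finite heis \<Rightarrow> 'n heis" where
  "Lam A \<mu> x = (A (fst x), \<mu> * snd x)"

locale heis_dilation =
  fixes A :: "complex^'n \<Rightarrow> complex^'n::finite" and \<mu> :: real
  assumes A: "linear A" "\<And>z. norm (A z) = sqrt \<mu> * norm z" "\<And>z. A (\<i> *s z) = \<i> *s A z" and \<mu>: "0 < \<mu>" "\<mu> < 1"
begin

abbreviation "\<Lambda> \<equiv> Lam A \<mu>"

lemma sqrt_mu: "0 < sqrt \<mu>" "sqrt \<mu> < 1" "sqrt \<mu> * sqrt \<mu> = \<mu>" using \<mu> by auto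

lemma Lam_linear: "linear \<Lambda>"
  by (rule linearI) (simp_all add: Lam_def linear_add[OF A(1)] linear_scale[OF A(1)] algebra_simps)

lemma Lam_bounded_linear: "bounded_linear \<Lambda>"
  using Lam_linear by (simp add: linear_conv_bounded_linear)

lemma Lam_norm: "norm (\<Lambda> x) \<le> sqrt \<mu> * norm x"
proof -
  have "(\<mu> * snd x)\<^sup>2 \<le> (sqrt \<mu> * snd x)\<^sup>2"
  proof -
    have "\<mu>\<^sup>2 \<le> (sqrt \<mu>)\<^sup>2" using \<mu> mult_left_le[of \<mu> \<mu>] by (simp add: power2_eq_square)
    then have "\<mu>\<^sup>2 * (snd x)\<^sup>2 \<le> (sqrt \<mu>)\<^sup>2 * (snd x)\<^sup>2" by (rule mult_right_mono) simp
    then show ?thesis by (simp only: power_mult_distrib)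
  qed
  then have "sqrt ((sqrt \<mu> * norm (fst x))\<^sup>2 + (\<mu> * snd x)\<^sup>2) \<le> sqrt ((sqrt \<mu> * norm (fst x))\<^sup>2 + (sqrt \<mu> * snd x)\<^sup>2)" by simp
  also have "\<dots> = sqrt \<mu> * norm x"
    using \<mu> by (cases x) (simp add: norm_Pair power_mult_distrib real_sqrt_mult distrib_left[symmetric])
  finally show ?thesis by (simp add: Lam_def norm_Pair A(2))
qed

lemma A_pow_norm: "norm ((A ^^ k) z) = sqrt \<mu> ^ k * norm z"
  by (induction k) (simp_all add: A(2) mult_ac)

lemma A_pow_linear: "linear (A ^^ k)"
proof (induction k)
  case 0 show ?case by (simp add: linear_id id_def[symmetric])
next
  case (Suc k) then show ?case unfolding funpow.simps(2) by (rule linear_compose[OF _ A(1)])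
qed

lemma A_pow_i: "(A ^^ k) (\<i> *s z) = \<i> *s (A ^^ k) z"
  by (induction k) (simp_all add: A(3))

lemma Lam_pow_norm: "norm ((\<Lambda> ^^ k) x) \<le> sqrt \<mu> ^ k * norm x"
proof (induction k)
  case (Suc k)
  have "norm ((\<Lambda> ^^ Suc k) x) \<le> sqrt \<mu> * norm ((\<Lambda> ^^ k) x)" using Lam_norm by simp
  also have "\<dots> \<le> sqrt \<mu> * (sqrt \<mu> ^ k * norm x)" by (rule mult_left_mono[OF Suc]) (use \<mu> in simp)
  finally show ?case by (simp add: mult.assoc)
qed simp

lemma Lam_pow_le: "norm ((\<Lambda> ^^ k) x) \<le> norm x"
proof -
  have "sqrt \<mu> ^ k * norm x \<le> 1 * norm x" using \<mu> by (intro mult_right_mono power_le_one) auto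
  then show ?thesis using Lam_pow_norm[of k x] by linarith
qed

lemma Lam_pow_tendsto: "(\<lambda>k. (\<Lambda> ^^ k) x) \<longlonglongrightarrow> 0"
proof (rule Lim_null_comparison)
  show "\<forall>\<^sub>F k in sequentially. norm ((\<Lambda> ^^ k) x) \<le> sqrt \<mu> ^ k * norm x" using Lam_pow_norm by simp
  show "(\<lambda>k. sqrt \<mu> ^ k * norm x) \<longlonglongrightarrow> 0" using sqrt_mu by (intro tendsto_mult_left_zero LIMSEQ_realpow_zero) auto
qed

text \<open>Under \<open>\<Lambda>\<^sup>k\<close> the argument \<open>v\<close> alone contributes a factor \<open>\<surd>\<mu>\<^sup>k\<close>. Taylor terms of order at least two
  in \<open>y\<close>, and linear terms in the last coordinate, contribute another factor of order \<open>\<mu>\<^sup>k\<close>, so that they decay faster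
  than the weight \<open>\<mu>\<close> allows. Only terms linear in the first component of \<open>y\<close> remain.\<close>

lemma invariant_form_linear:
  fixes \<alpha> :: "'n heis \<Rightarrow> complex^'n \<Rightarrow> real"
  assumes r: "0 < r" and \<alpha>: "\<And>y. y \<in> ball 0 r \<Longrightarrow> linear (\<alpha> y)" "\<And>v. smooth_on (ball 0 r) (\<lambda>y. \<alpha> y v)" "\<And>v. \<alpha> 0 v = 0"
    and inv: "\<And>y v. y \<in> ball 0 r \<Longrightarrow> \<alpha> (\<Lambda> y) (A v) = \<mu> * \<alpha> y v"
  obtains \<beta> where "bilinear \<beta>" "\<And>u v. \<beta> (A u) (A v) = \<mu> * \<beta> u v" "\<And>y v. y \<in> ball 0 (r/2) \<Longrightarrow> \<alpha> y v = \<beta> (fst y) v"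
    "\<And>v. ((\<lambda>y. \<alpha> y v) has_derivative (\<lambda>y. \<beta> (fst y) v)) (at 0)"
proof -
  have 0: "0 \<in> ball (0::'n heis) r" using r by simp
  define B where "B y v = frechet_derivative (\<lambda>y. \<alpha> y v) (at 0) y" for y v
  have Bd: "((\<lambda>y. \<alpha> y v) has_derivative (\<lambda>y. B y v)) (at 0)" for v
    unfolding B_def by (rule smooth_on_has_derivative[OF \<alpha>(2) 0])
  have Bbil: "bilinear B" unfolding B_def[abs_def] by (rule form_derivative_linear[OF open_ball 0 \<alpha>(1,2)])
  have Bl1: "linear (\<lambda>y. B y v)" and Bl2: "linear (B y)" for y v using Bbil unfolding bilinear_def by blast+
  have \<Lambda>0: "\<Lambda> 0 = 0" by (rule linear_0[OF Lam_linear])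
  have Binv: "B (\<Lambda> y) (A v) = \<mu> * B y v" for y v
  proof -
    have "((\<lambda>y. \<alpha> (\<Lambda> y) (A v)) has_derivative (\<lambda>y. B (\<Lambda> y) (A v))) (at 0)"
      using diff_chain_at[OF bounded_linear_imp_has_derivative[OF Lam_bounded_linear], of "\<lambda>y. \<alpha> y (A v)" _ 0] Bd[of "A v"] \<Lambda>0 by (simp add: o_def)
    then have "((\<lambda>y. \<mu> * \<alpha> y v) has_derivative (\<lambda>y. B (\<Lambda> y) (A v))) (at 0)"
      by (rule has_derivative_transform_within_open[OF _ open_ball 0]) (rule inv)
    from has_derivative_unique[OF this has_derivative_mult_right[OF Bd[of v]]] show ?thesis by metis
  qed
  define \<delta> where "\<delta> y v = \<alpha> y v - B y v" for y v
  have \<delta>lin: "linear (\<delta> y)" if "y \<in> ball 0 r" for y unfolding \<delta>_def[abs_def] by (rule linear_compose_sub[OF \<alpha>(1)[OF that] Bl2])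
  have "\<exists>C\<ge>0. \<forall>y\<in>cball 0 (r/2). \<bar>\<delta> y v\<bar> \<le> C * norm y ^ 2" for v
  proof (rule bound_nonneg, rule vanish_bound)
    show "cball 0 (r/2) \<subseteq> ball 0 r" using r by auto
    show "smooth_on (ball 0 r) (\<lambda>y. \<delta> y v)" unfolding \<delta>_def
      by (rule smooth_on_diff[OF open_ball \<alpha>(2) smooth_on_linear[where h="\<lambda>y. B y v", OF open_ball]]) (use Bl1 in \<open>simp add: linear_conv_bounded_linear\<close>)
    show "vanish 2 (\<lambda>y. \<delta> y v)"
    proof (rule first_order_vanish)
      show "\<delta> 0 v = 0" by (simp add: \<delta>_def \<alpha>(3) linear_0[OF Bl1])
      have "((\<lambda>y. \<alpha> y v - B y v) has_derivative (\<lambda>y. B y v - B y v)) (at 0)"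
        by (rule has_derivative_diff[OF Bd bounded_linear_imp_has_derivative]) (use Bl1 in \<open>simp add: linear_conv_bounded_linear\<close>)
      then show "((\<lambda>y. \<delta> y v) has_derivative (\<lambda>v. 0)) (at 0)" by (simp add: \<delta>_def)
    qed
  qed
  then obtain Cb where Cb: "\<And>v. Cb v \<ge> 0" "\<And>v y. y \<in> cball 0 (r/2) \<Longrightarrow> \<bar>\<delta> y v\<bar> \<le> Cb v * norm y ^ 2" by metis
  define C where "C = (\<Sum>b\<in>Basis. Cb b)"
  have \<delta>b: "\<bar>\<delta> y v\<bar> \<le> C * norm y ^ 2 * norm v" if y: "y \<in> cball 0 (r/2)" for y v
  proof -
    have "y \<in> ball 0 r" using y r by auto
    then have "\<delta> y v = (\<Sum>b\<in>Basis. (v \<bullet> b) *\<^sub>R \<delta> y b)" by (rule linear_basis_expansion[OF \<delta>lin])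
    then have "\<bar>\<delta> y v\<bar> \<le> (\<Sum>b\<in>Basis. \<bar>(v \<bullet> b) * \<delta> y b\<bar>)" using sum_abs[of "\<lambda>b. (v \<bullet> b) * \<delta> y b" Basis] by simp
    also have "\<dots> \<le> (\<Sum>b\<in>Basis. norm v * (Cb b * norm y ^ 2))"
      unfolding abs_mult by (intro sum_mono mult_mono Cb(2)[OF y] Basis_le_norm) auto
    also have "\<dots> = C * norm y ^ 2 * norm v" unfolding C_def sum_distrib_right by (rule sum.cong) simp_all
    finally show ?thesis .
  qed
  have \<delta>inv: "\<delta> ((\<Lambda> ^^ k) y) ((A ^^ k) v) = \<mu> ^ k * \<delta> y v" if y: "y \<in> ball 0 r" for y v k
  proof (induction k)
    case (Suc k)
    have "(\<Lambda> ^^ k) y \<in> ball 0 r" using y Lam_pow_le[of k y] by simp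
    then have "\<delta> (\<Lambda> ((\<Lambda> ^^ k) y)) (A ((A ^^ k) v)) = \<mu> * \<delta> ((\<Lambda> ^^ k) y) ((A ^^ k) v)"
      unfolding \<delta>_def Binv by (simp add: inv right_diff_distrib)
    then show ?case using Suc by simp
  qed simp
  have \<delta>0: "\<delta> y v = 0" if y: "y \<in> ball 0 (r/2)" for y v
  proof -
    have "\<bar>\<delta> y v\<bar> \<le> sqrt \<mu> ^ k * (C * norm y ^ 2 * norm v)" for k
    proof -
      have C0: "C \<ge> 0" unfolding C_def using Cb(1) by (simp add: sum_nonneg)
      have yr: "y \<in> ball 0 r" using y r by auto
      have "(\<Lambda> ^^ k) y \<in> cball 0 (r/2)" using y Lam_pow_le[of k y] by simp
      from \<delta>b[OF this, of "(A ^^ k) v"]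
      have "\<mu> ^ k * \<bar>\<delta> y v\<bar> \<le> C * norm ((\<Lambda> ^^ k) y) ^ 2 * (sqrt \<mu> ^ k * norm v)"
        unfolding \<delta>inv[OF yr] A_pow_norm using \<mu> by (simp add: abs_mult)
      also have "\<dots> \<le> C * (sqrt \<mu> ^ k * norm y) ^ 2 * (sqrt \<mu> ^ k * norm v)"
        using C0 \<mu> by (intro mult_right_mono mult_left_mono power_mono Lam_pow_norm) auto
      also have "\<dots> = \<mu> ^ k * (sqrt \<mu> ^ k * (C * norm y ^ 2 * norm v))"
      proof -
        have "(sqrt \<mu> ^ k) ^ 2 = \<mu> ^ k" using \<mu> by (simp add: power_mult[symmetric] mult.commute[of k] power_mult)
        then show ?thesis by (simp add: power_mult_distrib)
      qed
      finally show ?thesis using \<mu> by simp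
    qed
    moreover have "(\<lambda>k. sqrt \<mu> ^ k * (C * norm y ^ 2 * norm v)) \<longlonglongrightarrow> 0"
      using sqrt_mu by (intro tendsto_mult_left_zero LIMSEQ_realpow_zero) auto
    ultimately have "\<bar>\<delta> y v\<bar> \<le> 0" by (intro LIMSEQ_le_const[of _ 0]) auto
    then show ?thesis by simp
  qed
  have Bt: "B (0, t) v = 0" for t v
  proof -
    have step: "B (0, t) (A v) = B (0, t) v" for v
    proof -
      have "\<Lambda> (0, t) = \<mu> *\<^sub>R (0, t)" by (simp add: Lam_def linear_0[OF A(1)])
      then have "\<mu> * B (0, t) (A v) = \<mu> * B (0, t) v" using Binv[of "(0, t)" v] linear_scale[OF Bl1, of \<mu> "(0,t)"] by simp
      then show ?thesis using \<mu> by simp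
    qed
    have k: "B (0, t) ((A ^^ k) v) = B (0, t) v" for k by (induction k) (simp_all add: step)
    obtain K where K: "\<And>v. \<bar>B (0, t) v\<bar> \<le> norm v * K"
      using bounded_linear.bounded[of "B (0, t)"] Bl2 unfolding linear_conv_bounded_linear by (metis real_norm_def)
    have "\<bar>B (0, t) v\<bar> \<le> sqrt \<mu> ^ k * (norm v * K)" for k using K[of "(A ^^ k) v"] unfolding k A_pow_norm by (simp add: mult.assoc)
    moreover have "(\<lambda>k. sqrt \<mu> ^ k * (norm v * K)) \<longlonglongrightarrow> 0"
      using sqrt_mu by (intro tendsto_mult_left_zero LIMSEQ_realpow_zero) auto
    ultimately have "\<bar>B (0, t) v\<bar> \<le> 0" by (intro LIMSEQ_le_const[of _ 0]) auto
    then show ?thesis by simp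
  qed
  define \<beta> where "\<beta> u v = B (u, 0) v" for u v
  have B\<beta>: "B y v = \<beta> (fst y) v" for y v
  proof -
    have "y = (fst y, 0) + (0, snd y)" by simp
    then have "B y v = B (fst y, 0) v + B (0, snd y) v" using linear_add[OF Bl1] by metis
    then show ?thesis by (simp add: Bt \<beta>_def)
  qed
  show thesis
  proof (rule that[of \<beta>])
    have "linear (\<lambda>u. (u, 0::real))" by (rule linearI) simp_all
    then have "linear (\<lambda>u. \<beta> u v)" for v unfolding \<beta>_def using linear_compose[OF _ Bl1] by (simp add: o_def)
    moreover have "linear (\<beta> u)" for u
    proof -
      have "\<beta> u = B (u, 0)" by (rule ext) (simp add: \<beta>_def)
      then show ?thesis using Bl2 by simp
    qed
    ultimately show "bilinear \<beta>" unfolding bilinear_def by blast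
    show "\<beta> (A u) (A v) = \<mu> * \<beta> u v" for u v using Binv[of "(u, 0)" v] by (simp add: B\<beta> Lam_def)
    show "\<alpha> y v = \<beta> (fst y) v" if "y \<in> ball 0 (r/2)" for y v using \<delta>0[OF that, of v] by (simp add: \<delta>_def B\<beta>)
    show "((\<lambda>y. \<alpha> y v) has_derivative (\<lambda>y. \<beta> (fst y) v)) (at 0)" for v using Bd[of v] unfolding B\<beta> .
  qed
qed

text \<open>A complex structure has weight \<open>0\<close>, so its continuity at the fixed point already makes it
  constant.\<close>

lemma invariant_structure_constant:
  fixes J :: "'n heis \<Rightarrow> complex^'n \<Rightarrow> complex^'n"
  assumes r: "0 < r" and J: "\<And>y. y \<in> ball 0 r \<Longrightarrow> linear (J y)" "\<And>v. isCont (\<lambda>y. J y v) 0" "\<And>v. J 0 v = \<i> *s v"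
    and inv: "\<And>y v. y \<in> ball 0 r \<Longrightarrow> J (\<Lambda> y) (A v) = A (J y v)" and y: "y \<in> ball 0 r"
  shows "J y v = \<i> *s v"
proof -
  define \<epsilon> where "\<epsilon> y = (\<Sum>b\<in>Basis. norm (J y b - \<i> *s b))" for y
  have il: "linear (\<lambda>v::complex^'n. \<i> *s v)" by (rule linearI) (simp_all add: vec_eq_iff algebra_simps)
  have b: "norm (J y v - \<i> *s v) \<le> norm v * \<epsilon> y" if "y \<in> ball 0 r" for y v
  proof -
    have "linear (\<lambda>v. J y v - \<i> *s v)" by (rule linear_compose_sub[OF J(1)[OF that] il])
    then have "J y v - \<i> *s v = (\<Sum>b\<in>Basis. (v \<bullet> b) *\<^sub>R (J y b - \<i> *s b))" by (rule linear_basis_expansion)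
    also have "norm \<dots> \<le> (\<Sum>b\<in>Basis. norm ((v \<bullet> b) *\<^sub>R (J y b - \<i> *s b)))" by (rule norm_sum)
    also have "\<dots> \<le> (\<Sum>b\<in>Basis. norm v * norm (J y b - \<i> *s b))"
      unfolding norm_scaleR by (intro sum_mono mult_right_mono Basis_le_norm) auto
    also have "\<dots> = norm v * \<epsilon> y" by (simp add: \<epsilon>_def sum_distrib_left)
    finally show ?thesis .
  qed
  have kball: "(\<Lambda> ^^ k) y \<in> ball 0 r" for k using y Lam_pow_le[of k y] by simp
  have invk: "J ((\<Lambda> ^^ k) y) ((A ^^ k) v) = (A ^^ k) (J y v)" for k
    by (induction k) (simp_all add: inv[OF kball])
  have "norm (J y v - \<i> *s v) \<le> norm v * \<epsilon> ((\<Lambda> ^^ k) y)" for k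
  proof -
    have "sqrt \<mu> ^ k * norm (J y v - \<i> *s v) = norm (J ((\<Lambda> ^^ k) y) ((A ^^ k) v) - \<i> *s (A ^^ k) v)"
      unfolding A_pow_norm[symmetric] invk by (simp add: linear_diff[OF A_pow_linear] A_pow_i)
    also have "\<dots> \<le> (sqrt \<mu> ^ k * norm v) * \<epsilon> ((\<Lambda> ^^ k) y)" unfolding A_pow_norm[symmetric] by (rule b[OF kball])
    finally show ?thesis using sqrt_mu by (simp add: mult.assoc)
  qed
  moreover have "(\<lambda>k. norm v * \<epsilon> ((\<Lambda> ^^ k) y)) \<longlonglongrightarrow> 0"
  proof -
    have "isCont \<epsilon> 0" unfolding \<epsilon>_def by (intro isCont_sum ballI isCont_norm isCont_diff J(2)) simp
    then have "(\<lambda>k. \<epsilon> ((\<Lambda> ^^ k) y)) \<longlonglongrightarrow> \<epsilon> 0" by (rule isCont_tendsto_compose[OF _ Lam_pow_tendsto])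
    then have "(\<lambda>k. norm v * \<epsilon> ((\<Lambda> ^^ k) y)) \<longlonglongrightarrow> norm v * \<epsilon> 0" by (rule tendsto_mult_left)
    moreover have "\<epsilon> 0 = 0" by (simp add: \<epsilon>_def J(3))
    ultimately show ?thesis by simp
  qed
  ultimately have "norm (J y v - \<i> *s v) \<le> 0" by (intro LIMSEQ_le_const[of _ 0]) auto
  then show ?thesis by simp
qed

end

section \<open>Normal coordinates at the fixed point\<close>

locale cr_contracting = cr_contact M n \<theta>
  for M :: "('a, 'e::euclidean_space) cr_mfd" and n \<theta> +
  fixes \<phi> :: "'a \<Rightarrow> 'a" and pt :: 'a and \<mu> :: real
  assumes aut: "cr_automorphism M \<phi>" and pt: "pt \<in> T" "\<phi> pt = pt" and \<mu>: "0 < \<mu>" "\<mu> < 1"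
    and scale: "\<And>X. X \<in> tangent_space M pt \<Longrightarrow> \<theta> pt (pushforward M \<phi> pt X) = \<mu> * \<theta> pt X"
begin

lemma diffeo: "diffeomorphism M M \<phi>"
  using aut unfolding cr_equivalence_def by blast

lemma phi_T: "p \<in> T \<Longrightarrow> \<phi> p \<in> T"
  by (rule diffeomorphism_inv(1)[OF diffeo])

context
  fixes U and c :: "'a \<Rightarrow> 'f::euclidean_space"
  assumes c: "coord M U c" and ptU: "pt \<in> U" and c0: "c pt = 0"
begin

abbreviation "f \<equiv> c \<circ> \<phi> \<circ> inv_into U c"
abbreviation "S \<equiv> c ` {p \<in> U. \<phi> p \<in> U}"
abbreviation "\<Theta> \<equiv> coord_form M U c \<theta>"

lemma local_map:
  shows "open S" "0 \<in> S" "smooth_on S f" "f 0 = 0" "f ` S \<subseteq> c ` U" "S \<subseteq> c ` U" "0 \<in> c ` U"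
proof -
  have UT: "U \<subseteq> T" by (rule coord_topspace[OF c])
  have "{p \<in> U. \<phi> p \<in> U} = U \<inter> {p \<in> T. \<phi> p \<in> U}" using UT by auto
  then have "openin (mtop M) {p \<in> U. \<phi> p \<in> U}"
    using openin_Int[OF coordD(1)[OF c] openin_pre[OF smooth_mapD(1)[OF diffeomorphismD(2)[OF diffeo]] coordD(1)[OF c]]] by simp
  then show "open S" by (rule coord_open_image[OF c]) blast
  show "smooth_on S f" by (rule smooth_map_coord[OF diffeomorphismD(2)[OF diffeo] c c])
  show "0 \<in> S" using ptU pt(2) c0 by (intro image_eqI[of _ _ pt]) auto
  show "0 \<in> c ` U" using ptU c0 by (intro image_eqI[of _ _ pt]) auto
  show "f 0 = 0" using coord_inv[OF c ptU] c0 pt(2) by simp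
  show "f ` S \<subseteq> c ` U" unfolding image_image by (rule image_subsetI) (auto simp: coord_inv[OF c])
  show "S \<subseteq> c ` U" by blast
qed

lemma local_push:
  assumes "p \<in> U" "\<phi> p \<in> U"
  shows "pushforward M \<phi> p (tv M U c p w) = tv M U c (\<phi> p) (frechet_derivative f (at (c p)) w)"
  by (rule pushforward_coord[OF diffeo c assms])

lemma local_push0: "pushforward M \<phi> pt (tv M U c pt w) = tv M U c pt (frechet_derivative f (at 0) w)"
  using local_push[OF ptU] pt(2) ptU c0 by simp

lemma tv_tangent: "p \<in> U \<Longrightarrow> tv M U c p w \<in> tangent_space M p"
  using tangent_space_coord[OF c] by blast

text \<open>The automorphism preserves the contact distribution.\<close>

lemma local_kernel:
  assumes x: "x \<in> S" and w: "\<Theta> x w = 0"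
  shows "\<Theta> (f x) (frechet_derivative f (at x) w) = 0"
proof -
  obtain p where p: "p \<in> U" "\<phi> p \<in> U" "x = c p" using x by blast
  have "tv M U c p w \<in> cr_H M p" using w unfolding p(3) H_coord[OF c p(1)] .
  then have "pushforward M \<phi> p (tv M U c p w) \<in> cr_H M (\<phi> p)"
    using automorphism(1)[OF aut _ tv_tangent[OF p(1)]] coord_topspace[OF c] p(1) by blast
  then have "tv M U c (\<phi> p) (frechet_derivative f (at x) w) \<in> cr_H M (\<phi> p)" unfolding local_push[OF p(1,2)] p(3) .
  then have "\<Theta> (c (\<phi> p)) (frechet_derivative f (at x) w) = 0" unfolding H_coord[OF c p(2)] .
  moreover have "f x = c (\<phi> p)" using coord_inv[OF c p(1)] p(3) by simp
  ultimately show ?thesis by simp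
qed

lemma local_scale: "\<Theta> 0 (frechet_derivative f (at 0) w) = \<mu> * \<Theta> 0 w"
  using scale[OF tv_tangent[OF ptU], of w] coord_form_at[OF c ptU] c0 unfolding local_push0 by simp

lemma local_form:
  shows "\<And>y. y \<in> c ` U \<Longrightarrow> linear (\<Theta> y)" "\<And>w. smooth_on (c ` U) (\<lambda>y. \<Theta> y w)"
  by (rule form_coord(1)[OF c], assumption) (rule form_coord(2)[OF c])

lemma local_form_nonzero: "\<exists>w. \<Theta> 0 w \<noteq> 0"
proof -
  obtain X where "X \<in> tangent_space M pt" "\<theta> pt X \<noteq> 0" using theta(2)[OF pt(1)] by blast
  then obtain w where "\<theta> pt (tv M U c pt w) \<noteq> 0" unfolding tangent_space_coord[OF c ptU] by blast
  then show ?thesis using coord_form_at[OF c ptU] c0 by metis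
qed

lemma local_identity:
  assumes "\<Theta> 0 v = 0"
  shows "frechet_derivative (\<lambda>y. \<Theta> y (frechet_derivative f (at 0) v)) (at 0) (frechet_derivative f (at 0) u)
      + \<Theta> 0 (frechet_derivative (\<lambda>x. frechet_derivative f (at x) v) (at 0) u)
      = \<mu> * frechet_derivative (\<lambda>y. \<Theta> y v) (at 0) u"
proof -
  obtain \<xi> where "\<Theta> 0 \<xi> \<noteq> 0" using local_form_nonzero by blast
  from form_pullback_derivative[where f=f and \<Theta>=\<Theta> and S'="c ` U" and \<mu>=\<mu> and \<xi>=\<xi>,
    OF local_map(1,2,3,4) coordD(3)[OF c] local_map(5,6) local_form local_kernel this local_scale assms]
  show ?thesis .
qed

end

text \<open>An affine change of an arbitrary chart normalises contact form, complex structure, Levi form and the differential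
  of the automorphism at the fixed point.\<close>

lemma adapted_coordinates:
  assumes n: "n = CARD('n::finite)"
  obtains U and c :: "'a \<Rightarrow> 'n::finite heis" and A where "coord M U c" "pt \<in> U" "c pt = 0" "heis_dilation A \<mu>"
    "\<And>x. frechet_derivative (c \<circ> \<phi> \<circ> inv_into U c) (at 0) x = Lam A \<mu> x"
    "\<And>z t. coord_form M U c \<theta> 0 (z, t) = t"
    "\<And>v. cr_J M pt (tv M U c pt (v, 0)) = tv M U c pt (\<i> *s v, 0)"
    "\<And>v. ext_deriv M \<theta> pt (tv M U c pt (v, 0)) (tv M U c pt (\<i> *s v, 0)) = 4 * (norm v)\<^sup>2"
proof -
  have dim: "DIM('e) = 2 * CARD('n) + 1" using acr n unfolding almost_cr_manifold_def by blast
  obtain U d where d: "(U, d) \<in> charts M" "pt \<in> U" using chart_at[OF pt(1)] .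
  have cd: "coord M U d" by (rule chart_coord[OF d(1)])
  define h where "h y = y - d pt" for y
  have oh: "open (h ` d ` U)"
    using open_translation[OF coordD(3)[OF cd], of "- d pt"] by (simp add: h_def[abs_def] image_image add.commute)
  have sh: "smooth_on S h" if "open S" for S unfolding h_def
    by (rule smooth_on_diff[OF that smooth_on_linear[OF that bounded_linear_ident] smooth_on_const[OF that]])
  have sh': "smooth_on S (\<lambda>y. y + d pt)" if "open S" for S
    by (rule smooth_on_add[OF that smooth_on_linear[OF that bounded_linear_ident] smooth_on_const[OF that]])
  define k where "k = h \<circ> d"
  have ck: "coord M U k" unfolding k_def
    by (rule coord_compose[where k="\<lambda>y. y + d pt", OF cd sh[OF coordD(3)[OF cd]] oh sh'[OF oh]]) (simp add: h_def)
  have k0: "k pt = 0" by (simp add: k_def h_def)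
  note K = ck d(2) k0
  let ?f = "k \<circ> \<phi> \<circ> inv_into U k" and ?\<Theta> = "coord_form M U k \<theta>"
  define D where "D = frechet_derivative ?f (at 0)"
  define G where "G u v = frechet_derivative (\<lambda>y. ?\<Theta> y v) (at 0) u" for u v
  have Gbil: "bilinear G" unfolding G_def[abs_def]
    by (rule form_derivative_linear[OF coordD(3)[OF ck] local_map(7)[OF K] local_form[OF K]])
  have Gl: "linear (\<lambda>u. G u v)" "linear (G u)" for u v using Gbil unfolding bilinear_def by blast+
  define \<omega> where "\<omega> u v = G u v - G v u" for u v
  have \<omega>bil: "bilinear \<omega>" unfolding bilinear_def \<omega>_def[abs_def]
    by (intro conjI allI linear_compose_sub Gl)
  have Df: "(?f has_derivative D) (at 0)" unfolding D_def by (rule smooth_on_has_derivative[OF local_map(3,2)[OF K]])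
  have ext: "ext_deriv M \<theta> pt (tv M U k pt u) (tv M U k pt v) = \<omega> u v" for u v
    unfolding ext_deriv_coord[OF ck d(2) theta(1) coord_topspace[OF ck]] k0 \<omega>_def G_def ..
  have H: "tv M U k pt w \<in> cr_H M pt \<longleftrightarrow> ?\<Theta> 0 w = 0" for w using H_coord[OF ck d(2)] k0 by simp
  obtain j where j: "\<And>w. tv M U k pt w \<in> cr_H M pt \<Longrightarrow> cr_J M pt (tv M U k pt w) = tv M U k pt (j w)"
    "\<And>w. tv M U k pt w \<in> cr_H M pt \<Longrightarrow> tv M U k pt (j w) \<in> cr_H M pt"
    "\<And>w. tv M U k pt w \<in> cr_H M pt \<Longrightarrow> j (j w) = - w"
    "\<And>w v a b. tv M U k pt w \<in> cr_H M pt \<Longrightarrow> tv M U k pt v \<in> cr_H M pt \<Longrightarrow> j (a *\<^sub>R w + b *\<^sub>R v) = a *\<^sub>R j w + b *\<^sub>R j v"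
    by (rule J_coord[OF ck d(2)]) (rule that)
  have push: "pushforward M \<phi> pt (tv M U k pt w) = tv M U k pt (D w)" for w unfolding D_def by (rule local_push0[OF K])
  have zero: "tv M U k pt 0 = (\<lambda>g. 0)" using tv_linear[OF ck d(2), of 0 0 0 0] by simp
  interpret cd: contact_differential "?\<Theta> 0" \<omega> j D \<mu>
  proof (rule contact_differential.intro)
    show "linear (?\<Theta> 0)" by (rule local_form(1)[OF K local_map(7)[OF K]])
    show "\<exists>v. ?\<Theta> 0 v \<noteq> 0" by (rule local_form_nonzero[OF K])
    show "bilinear \<omega>" by (rule \<omega>bil)
    show "\<omega> u v = - \<omega> v u" for u v by (simp add: \<omega>_def)
    show "?\<Theta> 0 (j u) = 0" if "?\<Theta> 0 u = 0" for u using j(2)[of u] that unfolding H .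
    show "j (j u) = - u" if "?\<Theta> 0 u = 0" for u using j(3)[of u] that unfolding H .
    show "j (a *\<^sub>R u + b *\<^sub>R v) = a *\<^sub>R j u + b *\<^sub>R j v" if "?\<Theta> 0 u = 0" "?\<Theta> 0 v = 0" for u v a b using j(4)[of u v] that unfolding H .
    show "0 < \<omega> u (j u)" if u: "?\<Theta> 0 u = 0" "u \<noteq> 0" for u
    proof -
      have "tv M U k pt u \<noteq> (\<lambda>g. 0)" using tv_inj[OF ck d(2), of u 0] u(2) unfolding zero by blast
      then have "ext_deriv M \<theta> pt (tv M U k pt u) (cr_J M pt (tv M U k pt u)) > 0" using theta(5)[OF pt(1)] u(1) H by blast
      then show ?thesis using j(1)[of u] u(1) unfolding H ext[symmetric] by simp
    qed
    show "linear D" by (rule has_derivative_linear[OF Df])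
    show "?\<Theta> 0 (D u) = \<mu> * ?\<Theta> 0 u" for u unfolding D_def by (rule local_scale[OF K])
    show "j (D u) = D (j u)" if u: "?\<Theta> 0 u = 0" for u
    proof (rule tv_inj[OF ck d(2)])
      have uH: "tv M U k pt u \<in> cr_H M pt" using u unfolding H .
      have DuH: "tv M U k pt (D u) \<in> cr_H M pt" using u unfolding H D_def local_scale[OF K] by simp
      have "tv M U k pt (j (D u)) = cr_J M pt (pushforward M \<phi> pt (tv M U k pt u))" unfolding push j(1)[OF DuH] ..
      also have "\<dots> = pushforward M \<phi> pt (cr_J M pt (tv M U k pt u))"
        using automorphism(2)[OF aut pt(1) tv_tangent[OF K d(2)] uH] pt(2) by simp
      also have "\<dots> = tv M U k pt (D (j u))" unfolding j(1)[OF uH] push ..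
      finally show "tv M U k pt (j (D u)) = tv M U k pt (D (j u))" .
    qed
    show "\<omega> (D u) (D v) = \<mu> * \<omega> u v" if u: "?\<Theta> 0 u = 0" and v: "?\<Theta> 0 v = 0" for u v
    proof -
      have e1: "frechet_derivative (\<lambda>x. frechet_derivative ?f (at x) v) (at 0) u = frechet_derivative (\<lambda>x. frechet_derivative ?f (at x) u) (at 0) v"
        by (rule second_derivative_symmetric[OF local_map(1,2,3)[OF K]])
      have e2: "G (D u) (D v) + ?\<Theta> 0 (frechet_derivative (\<lambda>x. frechet_derivative ?f (at x) v) (at 0) u) = \<mu> * G u v"
        unfolding G_def D_def by (rule local_identity[OF K v])
      have e3: "G (D v) (D u) + ?\<Theta> 0 (frechet_derivative (\<lambda>x. frechet_derivative ?f (at x) u) (at 0) v) = \<mu> * G v u"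
        unfolding G_def D_def by (rule local_identity[OF K u])
      show ?thesis using e2 e3 unfolding e1 \<omega>_def right_diff_distrib by linarith
    qed
  qed (rule \<mu>)+
  obtain L :: "'n heis \<Rightarrow> 'e" and L' where L: "linear L" "linear L'" "\<And>x. L' (L x) = x" "\<And>y. L (L' y) = y"
    "\<And>z t. ?\<Theta> 0 (L (z, t)) = t" "\<And>z. j (L (z, 0)) = L (\<i> *s z, 0)" "\<And>z. \<omega> (L (z, 0)) (L (\<i> *s z, 0)) = 4 * (norm z)\<^sup>2"
    "\<And>t. D (L (0, t)) = L (0, \<mu> * t)"
    by (rule cd.normal_frame[OF dim]) (rule that)
  have bL: "bounded_linear L" "bounded_linear L'" using L(1,2) by (simp_all add: linear_conv_bounded_linear)
  have im: "L' ` k ` U = L -` (k ` U)"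
  proof (intro subset_antisym subsetI)
    fix x assume "x \<in> L' ` k ` U" then show "x \<in> L -` (k ` U)" using L(4) by auto
  next
    fix x assume "x \<in> L -` (k ` U)"
    then have "L' (L x) \<in> L' ` k ` U" by (intro imageI) simp
    then show "x \<in> L' ` k ` U" unfolding L(3) .
  qed
  have oL: "open (L' ` k ` U)" unfolding im
    by (rule open_vimage[OF coordD(3)[OF ck]]) (use bL(1) linear_continuous_on in blast)
  define c where "c = L' \<circ> k"
  have cc: "coord M U c" unfolding c_def
    by (rule coord_compose[where k=L, OF ck smooth_on_linear[OF coordD(3)[OF ck] bL(2)] oL smooth_on_linear[OF oL bL(1)]]) (rule L(4))
  have c0: "c pt = 0" by (simp add: c_def k0 linear_0[OF L(2)])
  note C = cc d(2) c0
  have tvc: "tv M U k p w = tv M U c p (L' w)" if "p \<in> U" for p w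
    unfolding c_def by (rule tv_compose[OF ck _ that bounded_linear_imp_has_derivative[OF bL(2)]]) (use cc c_def in simp)
  have tvc': "tv M U c p x = tv M U k p (L x)" if "p \<in> U" for p x unfolding tvc[OF that] L(3) ..
  define A where "A z = fst (L' (D (L (z, 0))))" for z
  have Al: "linear A"
  proof -
    have "linear (\<lambda>z. (z, 0::real))" by (rule linearI) simp_all
    from linear_compose[OF this linear_compose[OF L(1) linear_compose[OF cd.D(1) linear_compose[OF L(2) linear_fst]]]]
    show ?thesis by (simp add: A_def[abs_def] o_def)
  qed
  have sndL: "snd (L' y) = ?\<Theta> 0 y" for y using L(5)[of "fst (L' y)" "snd (L' y)"] L(4) by simp
  have DL0: "L' (D (L (z, 0))) = (A z, 0)" for z
    unfolding A_def by (rule prod_eqI) (simp_all add: sndL cd.D(2) L(5))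
  have DL: "L' (D (L x)) = Lam A \<mu> x" for x
  proof -
    have "x = (fst x, 0) + (0, snd x)" by simp
    then have "L' (D (L x)) = L' (D (L (fst x, 0))) + L' (D (L (0, snd x)))"
      by (metis linear_add[OF L(1)] linear_add[OF cd.D(1)] linear_add[OF L(2)])
    then show ?thesis by (simp add: DL0 L(8) L(3) Lam_def)
  qed
  have DL0': "D (L (z, 0)) = L (A z, 0)" for z using arg_cong[OF DL0[of z], of L] by (simp add: L(4))
  have E0: "?\<Theta> 0 (L (z, 0)) = 0" for z by (rule L(5))
  have Ai: "A (\<i> *s z) = \<i> *s A z" for z
  proof -
    have "L (A (\<i> *s z), 0) = D (j (L (z, 0)))" unfolding L(6) DL0' ..
    also have "\<dots> = j (D (L (z, 0)))" by (rule cd.D(3)[OF E0, symmetric])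
    also have "\<dots> = L (\<i> *s A z, 0)" unfolding DL0' L(6) ..
    finally have "L' (L (A (\<i> *s z), 0)) = L' (L (\<i> *s A z, 0))" by simp
    then show ?thesis unfolding L(3) by simp
  qed
  have An: "norm (A z) = sqrt \<mu> * norm z" for z
  proof -
    have "4 * (norm (A z))\<^sup>2 = \<omega> (L (A z, 0)) (L (\<i> *s A z, 0))" by (rule L(7)[symmetric])
    also have "\<dots> = \<omega> (D (L (z, 0))) (D (L (\<i> *s z, 0)))" unfolding DL0' Ai ..
    also have "\<dots> = \<mu> * (4 * (norm z)\<^sup>2)" unfolding cd.D(4)[OF E0 E0] L(7) ..
    finally have "(norm (A z))\<^sup>2 = (sqrt \<mu> * norm z)\<^sup>2" using \<mu> by (simp add: power_mult_distrib)
    then show ?thesis using \<mu> by (simp add: power2_eq_iff_nonneg)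
  qed
  show thesis
  proof (rule that[OF C])
    show "heis_dilation A \<mu>" by (rule heis_dilation.intro[OF Al An Ai \<mu>])
    show "frechet_derivative (c \<circ> \<phi> \<circ> inv_into U c) (at 0) x = Lam A \<mu> x" for x
    proof (rule tv_inj[OF cc d(2)])
      have "tv M U c pt (frechet_derivative (c \<circ> \<phi> \<circ> inv_into U c) (at 0) x) = pushforward M \<phi> pt (tv M U c pt x)"
        by (rule local_push0[OF C, symmetric])
      also have "\<dots> = tv M U c pt (L' (D (L x)))" unfolding tvc'[OF d(2)] push unfolding L(4) ..
      finally show "tv M U c pt (frechet_derivative (c \<circ> \<phi> \<circ> inv_into U c) (at 0) x) = tv M U c pt (Lam A \<mu> x)" unfolding DL .
    qed
    show "coord_form M U c \<theta> 0 (z, t) = t" for z t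
      using coord_form_at[OF cc d(2), of \<theta> "(z,t)"] coord_form_at[OF ck d(2), of \<theta> "L (z,t)"] L(5)[of z t] unfolding tvc'[OF d(2)] c0 k0 by simp
    show "cr_J M pt (tv M U c pt (v, 0)) = tv M U c pt (\<i> *s v, 0)" for v
      unfolding tvc'[OF d(2)] L(6)[symmetric] by (rule j(1)) (simp add: H E0)
    show "ext_deriv M \<theta> pt (tv M U c pt (v, 0)) (tv M U c pt (\<i> *s v, 0)) = 4 * (norm v)\<^sup>2" for v
      unfolding tvc'[OF d(2)] ext by (rule L(7))
  qed
qed

end

text \<open>Coordinates in which the contact hyperplanes are the kernels of \<open>dt + \<beta>(z, dz)\<close> and the complex structure on them
  corresponds to \<open>\<i>\<close> under projection to the first factor.\<close>

definition heis_coord :: "('a, 'e::euclidean_space) cr_mfd \<Rightarrow> 'a set \<Rightarrow> ('a \<Rightarrow> 'n::finite heis) \<Rightarrow>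
    (complex^'n \<Rightarrow> complex^'n \<Rightarrow> real) \<Rightarrow> bool" where
  "heis_coord M U c \<beta> \<longleftrightarrow> coord M U c \<and>
     (\<forall>p\<in>U. (\<forall>v s. tv M U c p (v, s) \<in> cr_H M p \<longleftrightarrow> s = - \<beta> (fst (c p)) v) \<and>
       (\<forall>v. cr_J M p (tv M U c p (v, - \<beta> (fst (c p)) v)) = tv M U c p (\<i> *s v, - \<beta> (fst (c p)) (\<i> *s v))))"

context cr_contracting begin

text \<open>Let \<open>G\<close> be the differential at \<open>0\<close> of the coefficients of the contact form. Its symmetric part on the contact
  hyperplane is the form whose coboundary equals the resonant terms of the automorphism, by the symmetric part of
  \<open>form_pullback_derivative\<close>; so the automorphism can be linearised. The ball is shrunk until it lies in
  all domains involved, and it stays invariant since the dilation does not increase norms.\<close>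

lemma linearised_coordinates:
  assumes n: "n = CARD('n::finite)" and small: "8 * real DIM('n heis) ^ 3 * sqrt \<mu> < 1"
  obtains U and c :: "'a \<Rightarrow> 'n::finite heis" and A r where "coord M U c" "pt \<in> U" "c pt = 0" "0 < r" "c ` U = ball 0 r" "heis_dilation A \<mu>"
    "\<And>p. p \<in> U \<Longrightarrow> \<phi> p \<in> U \<and> c (\<phi> p) = Lam A \<mu> (c p)"
    "\<And>z t. coord_form M U c \<theta> 0 (z, t) = t"
    "\<And>v. cr_J M pt (tv M U c pt (v, 0)) = tv M U c pt (\<i> *s v, 0)"
    "\<And>v. ext_deriv M \<theta> pt (tv M U c pt (v, 0)) (tv M U c pt (\<i> *s v, 0)) = 4 * (norm v)\<^sup>2"
proof -
  obtain U0 and c1 :: "'a \<Rightarrow> 'n heis" and A where C: "coord M U0 c1" "pt \<in> U0" "c1 pt = 0" and hd: "heis_dilation A \<mu>"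
    and Df: "\<And>x. frechet_derivative (c1 \<circ> \<phi> \<circ> inv_into U0 c1) (at 0) x = Lam A \<mu> x"
    and \<Theta>0: "\<And>z t. coord_form M U0 c1 \<theta> 0 (z, t) = t"
    and J0: "\<And>v. cr_J M pt (tv M U0 c1 pt (v, 0)) = tv M U0 c1 pt (\<i> *s v, 0)"
    and E0: "\<And>v. ext_deriv M \<theta> pt (tv M U0 c1 pt (v, 0)) (tv M U0 c1 pt (\<i> *s v, 0)) = 4 * (norm v)\<^sup>2"
    by (rule adapted_coordinates[OF n]) (rule that)
  interpret heis_dilation A \<mu> by (rule hd)
  let ?f = "c1 \<circ> \<phi> \<circ> inv_into U0 c1" and ?\<Theta> = "coord_form M U0 c1 \<theta>" and ?S = "c1 ` {p \<in> U0. \<phi> p \<in> U0}"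
  note L = local_map[OF C]
  define G where "G u v = frechet_derivative (\<lambda>y. ?\<Theta> y v) (at 0) u" for u v
  have Gbil: "bilinear G" unfolding G_def[abs_def]
    by (rule form_derivative_linear[OF coordD(3)[OF C(1)] L(7) local_form[OF C]])
  have Gl: "linear (\<lambda>u. G u v)" "linear (G u)" for u v using Gbil unfolding bilinear_def by blast+
  define S\<^sub>H where "S\<^sub>H u v = (G (u, 0) (v, 0) + G (v, 0) (u, 0)) / 2" for u v :: "complex^'n"
  have emb: "linear (\<lambda>u::complex^'n. (u, 0::real))" by (rule linearI) simp_all
  have SHl: "linear (S\<^sub>H u)" for u
  proof -
    have "linear (\<lambda>v. (1/2) *\<^sub>R (G (u, 0) (v, 0) + G (v, 0) (u, 0)))"
      by (intro linear_compose_scale_right linear_compose_add linear_compose[OF emb Gl(2), unfolded o_def] linear_compose[OF emb Gl(1), unfolded o_def])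
    then show ?thesis by (simp add: S\<^sub>H_def[abs_def])
  qed
  have SHs: "S\<^sub>H u v = S\<^sub>H v u" for u v by (simp add: S\<^sub>H_def)
  have SHb: "bilinear S\<^sub>H"
  proof -
    have "(\<lambda>u. S\<^sub>H u v) = S\<^sub>H v" for v by (rule ext) (rule SHs)
    then show ?thesis unfolding bilinear_def using SHl by simp
  qed
  have snd\<Theta>: "?\<Theta> 0 x = snd x" for x using \<Theta>0[of "fst x" "snd x"] by simp
  have res: "snd (frechet_derivative (\<lambda>x. frechet_derivative ?f (at x) (v, 0)) (at 0) (u, 0)) = \<mu> * S\<^sub>H u v - S\<^sub>H (A u) (A v)" for u v
  proof -
    have id: "G (A u, 0) (A v, 0) + snd (frechet_derivative (\<lambda>x. frechet_derivative ?f (at x) (v, 0)) (at 0) (u, 0)) = \<mu> * G (u, 0) (v, 0)" for u v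
    proof -
      have "?\<Theta> 0 (v, 0) = 0" by (rule \<Theta>0)
      from local_identity[OF C this, of "(u, 0)"] show ?thesis unfolding Df snd\<Theta> G_def by (simp add: Lam_def)
    qed
    have sym: "frechet_derivative (\<lambda>x. frechet_derivative ?f (at x) (v, 0)) (at 0) (u, 0) = frechet_derivative (\<lambda>x. frechet_derivative ?f (at x) (u, 0)) (at 0) (v, 0)"
      by (rule second_derivative_symmetric[OF L(1,2,3)])
    show ?thesis using id[of u v] id[of v u] unfolding sym S\<^sub>H_def by (simp add: field_simps)
  qed
  obtain F \<rho> where \<rho>: "0 < \<rho>" "ball 0 \<rho> \<subseteq> ?S" and F: "smooth_on (ball 0 \<rho>) F" "F 0 = 0" "(F has_derivative id) (at 0)"
    and Ff: "\<And>x. x \<in> ball 0 \<rho> \<Longrightarrow> ?f x \<in> ball 0 \<rho> \<and> F (?f x) = (A (fst (F x)), \<mu> * snd (F x))"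
  proof (rule linearisation[OF L(1,2,3,4) _ A(1,2) \<mu> small SHb SHs res])
    show "frechet_derivative ?f (at 0) (z, t) = (A z, \<mu> * t)" for z t by (simp add: Df Lam_def)
  qed (rule that)
  have 0: "0 \<in> ball (0::'n heis) \<rho>" using \<rho> by simp
  obtain U' V g where U': "open U'" "U' \<subseteq> ball 0 \<rho>" "0 \<in> U'" and V: "open V" "V = F ` U'" and inj: "inj_on F U'"
    and g: "\<And>x. x \<in> U' \<Longrightarrow> g (F x) = x" "g ` V \<subseteq> U'" "\<And>y. y \<in> V \<Longrightarrow> F (g y) = y" "smooth_on V g"
    by (rule smooth_local_inverse[OF open_ball 0 F(1,3)]) (rule that)
  define U2 where "U2 = {p \<in> U0. c1 p \<in> U'}"
  have oU2: "openin (mtop M) U2" unfolding U2_def by (rule coord_openin[OF C(1) U'(1)])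
  have U2: "U2 \<subseteq> U0" by (auto simp: U2_def)
  have c2: "coord M U2 c1" by (rule coord_subset[OF C(1) oU2 U2])
  have imU2: "c1 ` U2 = U'"
  proof
    show "c1 ` U2 \<subseteq> U'" by (auto simp: U2_def)
    show "U' \<subseteq> c1 ` U2"
    proof
      fix x assume x: "x \<in> U'"
      then have "x \<in> c1 ` U0" using U'(2) \<rho>(2) L(6) by blast
      then obtain p where "p \<in> U0" "x = c1 p" by blast
      then show "x \<in> c1 ` U2" using x by (auto simp: U2_def)
    qed
  qed
  have cF: "coord M U2 (F \<circ> c1)"
  proof (rule coord_compose[where k=g, OF c2])
    show "smooth_on (c1 ` U2) F" unfolding imU2 by (rule smooth_on_subset[OF F(1) U'(2)])
    show "open (F ` c1 ` U2)" unfolding imU2 V(2)[symmetric] by (rule V(1))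
    show "smooth_on (F ` c1 ` U2) g" unfolding imU2 V(2)[symmetric] by (rule g(4))
    show "g (F y) = y" if "y \<in> c1 ` U2" for y using that unfolding imU2 by (rule g(1))
  qed
  define W where "W = ?S \<inter> ?f -` U'"
  have oW: "open W" unfolding W_def by (rule continuous_open_preimage[OF smooth_on_continuous_on[OF L(3)] L(1) U'(1)])
  have zW: "0 \<in> W" unfolding W_def using L(2,4) U'(3) by simp
  have zV: "0 \<in> V" unfolding V(2) using U'(3) F(2) by (metis image_eqI)
  have g0: "g 0 = 0" using g(1)[OF U'(3)] F(2) by simp
  have "open (V \<inter> g -` W)" by (rule continuous_open_preimage[OF smooth_on_continuous_on[OF g(4)] V(1) oW])
  moreover have "0 \<in> V \<inter> g -` W" using zV zW g0 by simp
  ultimately obtain r where r: "0 < r" "ball 0 r \<subseteq> V \<inter> g -` W" using open_contains_ball by blast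
  define c where "c = F \<circ> c1"
  define B where "B = {p \<in> U2. c p \<in> ball 0 r}"
  have cc: "coord M U2 c" unfolding c_def by (rule cF)
  have oB: "openin (mtop M) B" unfolding B_def by (rule coord_openin[OF cc open_ball])
  have BU: "B \<subseteq> U2" by (auto simp: B_def)
  have cB: "coord M B c" by (rule coord_subset[OF cc oB BU])
  have c0: "c pt = 0" by (simp add: c_def C(3) F(2))
  have ptU2: "pt \<in> U2" using C U'(3) by (simp add: U2_def)
  have ptB: "pt \<in> B" using ptU2 c0 r(1) by (simp add: B_def)
  have imB: "c ` B = ball 0 r"
  proof
    show "c ` B \<subseteq> ball 0 r" unfolding B_def by blast
    show "ball 0 r \<subseteq> c ` B"
    proof
      fix y :: "'n heis" assume y: "y \<in> ball 0 r"
      then have yV: "y \<in> V" using r by blast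
      then have "g y \<in> c1 ` U2" unfolding imU2 using g(2) by blast
      then obtain p where p: "p \<in> U2" "c1 p = g y" by force
      have "c p = y" using g(3)[OF yV] p(2) by (simp add: c_def)
      then show "y \<in> c ` B" using p(1) y unfolding B_def by blast
    qed
  qed
  have step: "\<phi> p \<in> B \<and> c (\<phi> p) = Lam A \<mu> (c p)" if p: "p \<in> B" for p
  proof -
    have pU: "p \<in> U2" "p \<in> U0" "c1 p \<in> U'" and cr: "c p \<in> ball 0 r" using p by (auto simp: B_def U2_def)
    have "g (c p) \<in> W" using cr r by blast
    then have cW: "c1 p \<in> W" using g(1)[OF pU(3)] by (simp add: c_def)
    then obtain q where q: "q \<in> U0" "\<phi> q \<in> U0" "c1 p = c1 q" unfolding W_def by blast
    have "p = q" using inj_onD[OF coordD(2)[OF C(1)] q(3) pU(2) q(1)] .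
    then have \<phi>p: "\<phi> p \<in> U0" using q(2) by simp
    have fx: "?f (c1 p) = c1 (\<phi> p)" using coord_inv[OF C(1) pU(2)] by simp
    then have "c1 (\<phi> p) \<in> U'" using cW unfolding W_def by simp
    then have \<phi>pU: "\<phi> p \<in> U2" using \<phi>p by (simp add: U2_def)
    have "c (\<phi> p) = Lam A \<mu> (c p)" using Ff[of "c1 p"] U'(2) pU(3) fx by (auto simp: c_def Lam_def)
    moreover from this have "c (\<phi> p) \<in> ball 0 r" using Lam_pow_le[of 1 "c p"] cr by simp
    ultimately show ?thesis using \<phi>pU by (simp add: B_def)
  qed
  have tvB: "tv M B c pt w = tv M U0 c1 pt w" for w
  proof -
    have "tv M B c pt w = tv M U2 c pt w" by (rule tv_subset[OF cc oB BU ptB])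
    also have "\<dots> = tv M U2 c1 pt w"
      unfolding c_def using tv_compose[OF c2 cF ptU2, of id w] F(3) C(3) by simp
    also have "\<dots> = tv M U0 c1 pt w" by (rule tv_subset[OF C(1) oU2 U2 ptU2])
    finally show ?thesis .
  qed
  show thesis
  proof (rule that[OF cB ptB c0 r(1) imB hd step])
    show "coord_form M B c \<theta> 0 (z, t) = t" for z t
      using coord_form_at[OF cB ptB, of \<theta> "(z,t)"] coord_form_at[OF C(1,2), of \<theta> "(z,t)"] \<Theta>0[of z t] unfolding tvB c0 C(3) by simp
  qed (simp_all add: tvB J0 E0)
qed

text \<open>Both structures are invariant under the dilation, which forces the contact form and the complex structure to be of
  model type; symmetric and alternating parts of the resulting bilinear form are then separated.\<close>

lemma heis_coordinates:
  assumes n: "n = CARD('n::finite)" and small: "8 * real DIM('n heis) ^ 3 * sqrt \<mu> < 1"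
  obtains U and c :: "'a \<Rightarrow> 'n::finite heis" and A \<beta> where "heis_coord M U c \<beta>" "pt \<in> U" "c pt = 0" "heis_dilation A \<mu>"
    "\<And>p. p \<in> U \<Longrightarrow> \<phi> p \<in> U \<and> c (\<phi> p) = Lam A \<mu> (c p)"
    "bilinear \<beta>" "\<And>u v. \<beta> (A u) (A v) = \<mu> * \<beta> u v" "\<And>u v. \<beta> u v = - \<beta> v u" "\<And>v. \<beta> v (\<i> *s v) = 2 * (norm v)\<^sup>2"
proof -
  obtain U1 and c :: "'a \<Rightarrow> 'n heis" and A r1 where c: "coord M U1 c" and ptU: "pt \<in> U1" and c0: "c pt = 0" and r1: "0 < r1" "c ` U1 = ball 0 r1" and hd: "heis_dilation A \<mu>"
    and \<phi>1: "\<And>p. p \<in> U1 \<Longrightarrow> \<phi> p \<in> U1 \<and> c (\<phi> p) = Lam A \<mu> (c p)"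
    and \<Theta>0: "\<And>z t. coord_form M U1 c \<theta> 0 (z, t) = t"
    and J0: "\<And>v. cr_J M pt (tv M U1 c pt (v, 0)) = tv M U1 c pt (\<i> *s v, 0)"
    and E0: "\<And>v. ext_deriv M \<theta> pt (tv M U1 c pt (v, 0)) (tv M U1 c pt (\<i> *s v, 0)) = 4 * (norm v)\<^sup>2"
    by (rule linearised_coordinates[OF n small]) (rule that)
  interpret heis_dilation A \<mu> by (rule hd)
  note C = c ptU c0
  let ?\<Theta> = "coord_form M U1 c \<theta>"
  have \<Theta>l: "linear (?\<Theta> y)" if "y \<in> ball 0 r1" for y by (rule local_form(1)[OF C]) (use that r1 in simp)
  have \<Theta>s: "smooth_on (ball 0 r1) (\<lambda>y. ?\<Theta> y w)" for w using local_form(2)[OF C] unfolding r1(2) .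
  have 01: "0 \<in> ball (0::'n heis) r1" using r1 by simp
  obtain r where r: "0 < r" "r \<le> r1" and nz: "\<And>y. y \<in> ball 0 r \<Longrightarrow> ?\<Theta> y (0, 1) \<noteq> 0"
  proof -
    have "open (ball 0 r1 \<inter> (\<lambda>y. ?\<Theta> y (0, 1)) -` (- {0}))"
      by (rule continuous_open_preimage[OF smooth_on_continuous_on[OF \<Theta>s]]) auto
    moreover have "0 \<in> ball 0 r1 \<inter> (\<lambda>y. ?\<Theta> y (0, 1)) -` (- {0})" using r1(1) \<Theta>0 by simp
    ultimately obtain r where "0 < r" "ball 0 r \<subseteq> ball 0 r1 \<inter> (\<lambda>y. ?\<Theta> y (0, 1)) -` (- {0})" using open_contains_ball by blast
    then show thesis using that[of "min r r1"] r1(1) by (auto simp: subset_eq)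
  qed
  have br: "ball 0 r \<subseteq> ball (0::'n heis) r1" using r by auto
  have 0: "0 \<in> ball (0::'n heis) r" using r by simp
  have push: "pushforward M \<phi> p (tv M U1 c p w) = tv M U1 c (\<phi> p) (\<Lambda> w)" if p: "p \<in> U1" for p w
  proof -
    have "(c \<circ> \<phi> \<circ> inv_into U1 c has_derivative \<Lambda>) (at (c p))"
    proof (rule has_derivative_transform_within_open[OF bounded_linear_imp_has_derivative[OF Lam_bounded_linear] coordD(3)[OF c]])
      show "c p \<in> c ` U1" using p by blast
      fix y assume "y \<in> c ` U1"
      then obtain q where q: "q \<in> U1" "y = c q" by blast
      show "\<Lambda> y = (c \<circ> \<phi> \<circ> inv_into U1 c) y" using \<phi>1[OF q(1)] coord_inv[OF c q(1)] by (simp add: q(2))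
    qed
    then show ?thesis using local_push[OF C p] \<phi>1[OF p] by (simp add: frechetI)
  qed
  \<comment> \<open>dividing by the coefficient of \<open>dt\<close> removes the ambiguity of the contact form, so that \<open>\<alpha>\<close> is exactly homogeneous under the dilation\<close>
  define \<alpha> where "\<alpha> y v = ?\<Theta> y (v, 0) * inverse (?\<Theta> y (0, 1))" for y and v :: "complex^'n"
  have emb: "linear (\<lambda>u::complex^'n. (u, 0::real))" by (rule linearI) simp_all
  have \<alpha>l: "linear (\<alpha> y)" if "y \<in> ball 0 r" for y
  proof -
    have "y \<in> ball 0 r1" using that br by blast
    from linear_compose_scale_right[OF linear_compose[OF emb \<Theta>l[OF this]], of "inverse (?\<Theta> y (0, 1))"]
    show ?thesis by (simp add: \<alpha>_def[abs_def] o_def mult.commute)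
  qed
  have \<alpha>s: "smooth_on (ball 0 r) (\<lambda>y. \<alpha> y v)" for v unfolding \<alpha>_def
    by (rule smooth_on_bilinear[where mul="(*)", OF open_ball bounded_bilinear_mult smooth_on_subset[OF \<Theta>s br]
          smooth_on_inverse_real[OF open_ball nz smooth_on_subset[OF \<Theta>s br]]])
  have \<alpha>0: "\<alpha> 0 v = 0" for v by (simp add: \<alpha>_def \<Theta>0)
  have H: "tv M U1 c p (v, s) \<in> cr_H M p \<longleftrightarrow> s = - \<alpha> (c p) v" if p: "p \<in> U1" "c p \<in> ball 0 r" for p v s
  proof -
    have "c p \<in> ball 0 r1" using p br by blast
    note l = \<Theta>l[OF this]
    have "(v, s) = (v, 0) + s *\<^sub>R (0, 1)" by simp
    then have "?\<Theta> (c p) (v, s) = ?\<Theta> (c p) (v, 0) + s * ?\<Theta> (c p) (0, 1)" by (metis linear_add[OF l] linear_scale[OF l] real_scaleR_def)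
    then show ?thesis unfolding H_coord[OF c p(1)] \<alpha>_def using nz[OF p(2)] by (simp add: field_simps eq_neg_iff_add_eq_0)
  qed
  have preim: "\<exists>p. p \<in> U1 \<and> c p = y" if "y \<in> ball 0 r" for y
  proof -
    have "y \<in> c ` U1" using that br r1(2) by blast
    then show ?thesis by blast
  qed
  have \<Lambda>r: "\<Lambda> y \<in> ball 0 r" if "y \<in> ball 0 r" for y using Lam_pow_le[of 1 y] that by simp
  have \<alpha>inv: "\<alpha> (\<Lambda> y) (A v) = \<mu> * \<alpha> y v" if y: "y \<in> ball 0 r" for y v
  proof -
    obtain p where p: "p \<in> U1" "c p = y" using preim[OF y] by blast
    have "tv M U1 c p (v, - \<alpha> y v) \<in> cr_H M p" using H[OF p(1)] p y by simp
    then have "pushforward M \<phi> p (tv M U1 c p (v, - \<alpha> y v)) \<in> cr_H M (\<phi> p)"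
      using automorphism(1)[OF aut _ tv_tangent[OF C p(1)]] coord_topspace[OF c] p(1) by blast
    then have "tv M U1 c (\<phi> p) (A v, - (\<mu> * \<alpha> y v)) \<in> cr_H M (\<phi> p)" unfolding push[OF p(1)] by (simp add: Lam_def)
    then have "- (\<mu> * \<alpha> y v) = - \<alpha> (c (\<phi> p)) (A v)" using H[of "\<phi> p" "A v"] \<phi>1[OF p(1)] p(2) \<Lambda>r[OF y] by simp
    then show ?thesis using \<phi>1[OF p(1)] p(2) by simp
  qed
  obtain \<beta>0 where \<beta>0: "bilinear \<beta>0" "\<And>u v. \<beta>0 (A u) (A v) = \<mu> * \<beta>0 u v" "\<And>y v. y \<in> ball 0 (r/2) \<Longrightarrow> \<alpha> y v = \<beta>0 (fst y) v"
    and \<alpha>d: "\<And>v. ((\<lambda>y. \<alpha> y v) has_derivative (\<lambda>y. \<beta>0 (fst y) v)) (at 0)"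
    by (rule invariant_form_linear[OF r(1) \<alpha>l \<alpha>s \<alpha>0 \<alpha>inv]) (assumption | rule that)+
  \<comment> \<open>a vector of a contact hyperplane is determined by its first component, and \<open>J'\<close> is the complex structure in terms of it\<close>
  define U3 where "U3 = {p \<in> U1. c p \<in> ball 0 r}"
  have oU3: "openin (mtop M) U3" unfolding U3_def by (rule coord_openin[OF c open_ball])
  have U3: "U3 \<subseteq> U1" by (auto simp: U3_def)
  have c3: "coord M U3 c" by (rule coord_subset[OF c oU3 U3])
  have im3: "c ` U3 = ball 0 r"
  proof (intro subset_antisym subsetI)
    fix y assume "y \<in> c ` U3" then show "y \<in> ball 0 r" unfolding U3_def by blast
  next
    fix y :: "'n heis" assume y: "y \<in> ball 0 r"
    then obtain p where "p \<in> U1" "c p = y" using preim by blast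
    then show "y \<in> c ` U3" using y unfolding U3_def by blast
  qed
  have "\<exists>Z. smooth_on (ball 0 r) Z \<and> (\<forall>p\<in>U3. cr_J M p (tv M U1 c p (v, - \<alpha> (c p) v)) = tv M U1 c p (Z (c p)))" for v
  proof -
    have s: "smooth_on (c ` U3) (\<lambda>y. (v, - \<alpha> y v))" unfolding im3
    proof (rule smooth_on_componentwise[OF open_ball])
      fix b :: "'n heis" assume "b \<in> Basis"
      have "smooth_on (ball 0 r) (\<lambda>y. v \<bullet> fst b + (- snd b) * \<alpha> y v)"
        by (rule smooth_on_add[OF open_ball smooth_on_const[OF open_ball] smooth_on_linear_comp[where h="\<lambda>t. (- snd b) * t", OF open_ball bounded_linear_mult_right \<alpha>s]])
      then show "smooth_on (ball 0 r) (\<lambda>y. (v, - \<alpha> y v) \<bullet> b)" by (simp add: inner_prod_def mult.commute)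
    qed
    have h: "tv M U3 c p (v, - \<alpha> (c p) v) \<in> cr_H M p" if "p \<in> U3" for p
      unfolding tv_subset[OF c oU3 U3 that] using that H[of p v] by (simp add: U3_def)
    obtain Z where "smooth_on (c ` U3) Z" "\<And>p. p \<in> U3 \<Longrightarrow> cr_J M p (tv M U3 c p (v, - \<alpha> (c p) v)) = tv M U3 c p (Z (c p))"
      by (rule J_coord_field[where c=c and U=U3 and Y="\<lambda>y. (v, - \<alpha> y v)", OF c3 s h]) (assumption | rule that)+
    then show ?thesis unfolding im3 using tv_subset[OF c oU3 U3] by (intro exI[of _ Z]) simp
  qed
  then obtain Z where Z: "\<And>v. smooth_on (ball 0 r) (Z v)"
    "\<And>v p. p \<in> U3 \<Longrightarrow> cr_J M p (tv M U1 c p (v, - \<alpha> (c p) v)) = tv M U1 c p (Z v (c p))" by metis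
  define J' where "J' y v = fst (Z v y)" for y v
  have U3T: "p \<in> T" "p \<in> U1" "c p \<in> ball 0 r" if "p \<in> U3" for p using that coord_topspace[OF c] by (auto simp: U3_def)
  have HZ: "tv M U1 c p (v, - \<alpha> (c p) v) \<in> cr_H M p" if "p \<in> U3" for p v using H[OF U3T(2,3)[OF that], of v] by simp
  have Zeq: "Z v (c p) = (J' (c p) v, - \<alpha> (c p) (J' (c p) v))" if p: "p \<in> U3" for p v
  proof -
    have "tv M U1 c p (Z v (c p)) \<in> cr_H M p" using J(1)[OF U3T(1)[OF p] HZ[OF p]] unfolding Z(2)[OF p] .
    then show ?thesis using H[OF U3T(2,3)[OF p], of "fst (Z v (c p))" "snd (Z v (c p))"] by (simp add: J'_def prod_eq_iff)
  qed
  have pre3: "\<exists>p. p \<in> U3 \<and> c p = y" if "y \<in> ball 0 r" for y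
  proof -
    have "y \<in> c ` U3" using that im3 by blast
    then show ?thesis by blast
  qed
  have J'lin: "linear (J' y)" if y: "y \<in> ball 0 r" for y
  proof -
    obtain p where p: "p \<in> U3" "c p = y" using pre3[OF y] by blast
    have "J' y (a *\<^sub>R v + b *\<^sub>R w) = a *\<^sub>R J' y v + b *\<^sub>R J' y w" for a b v w
    proof -
      have e: "(a *\<^sub>R v + b *\<^sub>R w, - \<alpha> y (a *\<^sub>R v + b *\<^sub>R w)) = a *\<^sub>R (v, - \<alpha> y v) + b *\<^sub>R (w, - \<alpha> y w)"
        by (simp add: linear_add[OF \<alpha>l[OF y]] linear_scale[OF \<alpha>l[OF y]])
      have "tv M U1 c p (Z (a *\<^sub>R v + b *\<^sub>R w) y) = cr_J M p (tv M U1 c p (a *\<^sub>R (v, - \<alpha> y v) + b *\<^sub>R (w, - \<alpha> y w)))"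
        using Z(2)[OF p(1), of "a *\<^sub>R v + b *\<^sub>R w"] unfolding p(2) e by simp
      also have "\<dots> = cr_J M p (\<lambda>g. of_real a * tv M U1 c p (v, - \<alpha> y v) g + of_real b * tv M U1 c p (w, - \<alpha> y w) g)"
        by (simp only: tv_linear[OF c U3T(2)[OF p(1)]])
      also have "\<dots> = (\<lambda>g. of_real a * cr_J M p (tv M U1 c p (v, - \<alpha> y v)) g + of_real b * cr_J M p (tv M U1 c p (w, - \<alpha> y w)) g)"
        by (rule J(3)[OF U3T(1)[OF p(1)]]) (use HZ[OF p(1)] p(2) in auto)
      also have "\<dots> = tv M U1 c p (a *\<^sub>R Z v y + b *\<^sub>R Z w y)"
        using Z(2)[OF p(1)] unfolding p(2) by (simp only: tv_linear[OF c U3T(2)[OF p(1)]])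
      finally have "Z (a *\<^sub>R v + b *\<^sub>R w) y = a *\<^sub>R Z v y + b *\<^sub>R Z w y" by (rule tv_inj[OF c U3T(2)[OF p(1)]])
      then show ?thesis by (simp add: J'_def)
    qed
    from this[of 1 _ 1] this[of _ _ 0] show ?thesis by (intro linearI) simp_all
  qed
  have J'cont: "isCont (\<lambda>y. J' y v) 0" for v
  proof -
    have "isCont (Z v) 0" using smooth_on_continuous_on[OF Z(1)] 0 by (simp add: continuous_on_eq_continuous_at)
    then show ?thesis unfolding J'_def by (rule isCont_fst)
  qed
  have pt3: "pt \<in> U3" using ptU c0 0 by (simp add: U3_def)
  have J'0: "J' 0 v = \<i> *s v" for v
  proof -
    have "tv M U1 c pt (Z v 0) = tv M U1 c pt (\<i> *s v, 0)" using Z(2)[OF pt3, of v] J0[of v] unfolding c0 \<alpha>0 by simp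
    then have "Z v 0 = (\<i> *s v, 0)" by (rule tv_inj[OF c ptU])
    then show ?thesis by (simp add: J'_def)
  qed
  have J'inv: "J' (\<Lambda> y) (A v) = A (J' y v)" if y: "y \<in> ball 0 r" for y v
  proof -
    obtain p where p: "p \<in> U3" "c p = y" using pre3[OF y] by blast
    have \<phi>p: "\<phi> p \<in> U1" "c (\<phi> p) = \<Lambda> y" using \<phi>1[OF U3T(2)[OF p(1)]] p(2) by auto
    have \<phi>p3: "\<phi> p \<in> U3" using \<phi>p \<Lambda>r[OF y] by (simp add: U3_def)
    have "tv M U1 c (\<phi> p) (Z (A v) (\<Lambda> y)) = cr_J M (\<phi> p) (tv M U1 c (\<phi> p) (A v, - \<alpha> (\<Lambda> y) (A v)))"
      using Z(2)[OF \<phi>p3] unfolding \<phi>p(2) by simp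
    also have "\<dots> = cr_J M (\<phi> p) (pushforward M \<phi> p (tv M U1 c p (v, - \<alpha> y v)))"
      unfolding push[OF U3T(2)[OF p(1)]] \<alpha>inv[OF y] by (simp add: Lam_def)
    also have "\<dots> = pushforward M \<phi> p (cr_J M p (tv M U1 c p (v, - \<alpha> y v)))"
      by (rule automorphism(2)[OF aut U3T(1)[OF p(1)] tv_tangent[OF C U3T(2)[OF p(1)]]]) (use HZ[OF p(1), of v] p(2) in simp)
    also have "\<dots> = tv M U1 c (\<phi> p) (\<Lambda> (Z v y))" using Z(2)[OF p(1), of v] unfolding p(2) push[OF U3T(2)[OF p(1)], symmetric] by simp
    finally have "Z (A v) (\<Lambda> y) = \<Lambda> (Z v y)" by (rule tv_inj[OF c \<phi>p(1)])
    then show ?thesis by (simp add: J'_def Lam_def)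
  qed
  have J'i: "J' y v = \<i> *s v" if "y \<in> ball 0 r" for y v
    by (rule invariant_structure_constant[OF r(1) J'lin J'cont J'0 J'inv that])
  define U where "U = {p \<in> U1. c p \<in> ball 0 (r/2)}"
  have oU: "openin (mtop M) U" unfolding U_def by (rule coord_openin[OF c open_ball])
  have UU: "U \<subseteq> U1" by (auto simp: U_def)
  have cU: "coord M U c" by (rule coord_subset[OF c oU UU])
  have Ur: "c p \<in> ball 0 (r/2)" "p \<in> U3" "p \<in> U1" if "p \<in> U" for p
  proof -
    have "norm (c p) < r / 2" "p \<in> U1" using that by (auto simp: U_def)
    then show "c p \<in> ball 0 (r/2)" "p \<in> U3" "p \<in> U1" using r(1) by (auto simp: U3_def)
  qed
  have H1: "tv M U c p (v, s) \<in> cr_H M p \<longleftrightarrow> s = - \<beta>0 (fst (c p)) v" if p: "p \<in> U" for p v s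
    unfolding tv_subset[OF c oU UU p] H[OF U3T(2,3)[OF Ur(2)[OF p]]] \<beta>0(3)[OF Ur(1)[OF p]] ..
  have J1: "cr_J M p (tv M U c p (v, - \<beta>0 (fst (c p)) v)) = tv M U c p (\<i> *s v, - \<beta>0 (fst (c p)) (\<i> *s v))" if p: "p \<in> U" for p v
    using Z(2)[OF Ur(2)[OF p], of v] unfolding tv_subset[OF c oU UU p] Zeq[OF Ur(2)[OF p]] J'i[OF U3T(3)[OF Ur(2)[OF p]]] \<beta>0(3)[OF Ur(1)[OF p]] .
  have \<beta>l: "linear (\<beta>0 u)" "linear (\<lambda>u. \<beta>0 u v)" for u v using \<beta>0(1) unfolding bilinear_def by blast+
  \<comment> \<open>the Levi form at the fixed point is twice the alternating part of \<open>\<beta>0\<close>\<close>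
  have lev: "\<beta>0 v (\<i> *s v) - \<beta>0 (\<i> *s v) v = 4 * (norm v)\<^sup>2" for v
  proof -
    have d: "frechet_derivative (\<lambda>y. ?\<Theta> y (w, 0)) (at 0) (u, 0) = \<beta>0 u w" for u w
    proof -
      have \<Theta>d: "((\<lambda>y. ?\<Theta> y (0, 1)) has_derivative frechet_derivative (\<lambda>y. ?\<Theta> y (0, 1)) (at 0)) (at 0)"
        by (rule smooth_on_has_derivative[OF \<Theta>s 01])
      have "((\<lambda>y. \<alpha> y w * ?\<Theta> y (0, 1)) has_derivative (\<lambda>h. \<alpha> 0 w * frechet_derivative (\<lambda>y. ?\<Theta> y (0, 1)) (at 0) h + \<beta>0 (fst h) w * ?\<Theta> 0 (0, 1))) (at 0)"
        by (rule has_derivative_mult[OF \<alpha>d \<Theta>d])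
      then have "((\<lambda>y. \<alpha> y w * ?\<Theta> y (0, 1)) has_derivative (\<lambda>h. \<beta>0 (fst h) w)) (at 0)" by (simp add: \<alpha>0 \<Theta>0)
      then have "((\<lambda>y. ?\<Theta> y (w, 0)) has_derivative (\<lambda>h. \<beta>0 (fst h) w)) (at 0)"
        by (rule has_derivative_transform_within_open[OF _ open_ball 0]) (use nz in \<open>simp add: \<alpha>_def\<close>)
      then show ?thesis by (simp add: frechetI)
    qed
    show ?thesis
      using E0[of v] unfolding ext_deriv_coord[OF c ptU theta(1) coord_topspace[OF c]] c0 d by simp
  qed
  \<comment> \<open>the symmetric part is removed by a quadratic change of the last coordinate\<close>
  define Q where "Q x = (fst x, snd x + \<beta>0 (fst x) (fst x) / 2)" for x :: "'n heis"
  define Q' where "Q' x = (fst x, snd x - \<beta>0 (fst x) (fst x) / 2)" for x :: "'n heis"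
  define \<beta> where "\<beta> u v = (\<beta>0 u v - \<beta>0 v u) / 2" for u v
  have bb: "bounded_bilinear \<beta>0" using \<beta>0(1) by (simp add: bilinear_conv_bounded_bilinear)
  have sq: "smooth_on X (\<lambda>x. (fst x, snd x + \<kappa> * \<beta>0 (fst x) (fst x)))" if "open X" for X :: "'n heis set" and \<kappa>
  proof (rule smooth_on_componentwise[OF that])
    fix b :: "'n heis" assume "b \<in> Basis"
    have f: "smooth_on X (\<lambda>x. fst x)" by (rule smooth_on_linear[OF that bounded_linear_fst])
    have q: "smooth_on X (\<lambda>x. \<beta>0 (fst x) (fst x))" by (rule smooth_on_bilinear[where mul=\<beta>0, OF that bb f f])
    have "smooth_on X (\<lambda>x. fst x \<bullet> fst b + (snd x * snd b + (\<kappa> * snd b) * \<beta>0 (fst x) (fst x)))"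
      by (rule smooth_on_add[OF that smooth_on_linear_comp[where h="\<lambda>y. y \<bullet> fst b", OF that bounded_linear_inner_left f]],
          rule smooth_on_add[OF that smooth_on_linear_comp[where h="\<lambda>y. y * snd b", OF that bounded_linear_mult_left smooth_on_linear[OF that bounded_linear_snd]]],
          rule smooth_on_linear_comp[where h="\<lambda>y. (\<kappa> * snd b) * y", OF that bounded_linear_mult_right q])
    then show "smooth_on X (\<lambda>x. (fst x, snd x + \<kappa> * \<beta>0 (fst x) (fst x)) \<bullet> b)" by (simp add: inner_prod_def algebra_simps)
  qed
  have Qs: "smooth_on X Q" if "open X" for X using sq[OF that, of "1/2"] by (simp add: Q_def[abs_def])
  have Q's: "smooth_on X Q'" if "open X" for X using sq[OF that, of "-1/2"] by (simp add: Q'_def[abs_def])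
  have QQ: "Q' (Q x) = x" "Q (Q' x) = x" for x by (simp_all add: Q_def Q'_def)
  have oQ: "open (Q ` X)" if "open X" for X
  proof -
    have "Q ` X = Q' -` X"
    proof (intro subset_antisym subsetI)
      fix x assume "x \<in> Q ` X" then show "x \<in> Q' -` X" using QQ(1) by force
    next
      fix x assume "x \<in> Q' -` X"
      then have "Q (Q' x) \<in> Q ` X" by simp
      then show "x \<in> Q ` X" unfolding QQ(2) .
    qed
    then show ?thesis using open_vimage[OF that smooth_on_continuous_on[OF Q's[OF open_UNIV]]] by simp
  qed
  have Qd: "(Q has_derivative (\<lambda>w. (fst w, snd w + (\<beta>0 (fst x) (fst w) + \<beta>0 (fst w) (fst x)) / 2))) (at x)" for x
  proof -
    have "((\<lambda>x. (fst x, snd x + (1/2) * \<beta>0 (fst x) (fst x))) has_derivative (\<lambda>w. (fst w, snd w + (1/2) * (\<beta>0 (fst x) (fst w) + \<beta>0 (fst w) (fst x))))) (at x)"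
      by (intro has_derivative_Pair has_derivative_add has_derivative_mult_right bounded_bilinear.FDERIV[OF bb]
          bounded_linear.has_derivative[OF bounded_linear_fst] bounded_linear.has_derivative[OF bounded_linear_snd] has_derivative_ident)
    then show ?thesis by (simp add: Q_def[abs_def])
  qed
  define c' where "c' = Q \<circ> c"
  have cQ: "coord M U c'" unfolding c'_def
    by (rule coord_compose[where k=Q', OF cU Qs[OF coordD(3)[OF cU]] oQ[OF coordD(3)[OF cU]] Q's[OF oQ[OF coordD(3)[OF cU]]]]) (rule QQ(1))
  have fstc': "fst (c' p) = fst (c p)" for p by (simp add: c'_def Q_def)
  have tvQ: "tv M U c p (v, s) = tv M U c' p (v, s + (\<beta>0 (fst (c p)) v + \<beta>0 v (fst (c p))) / 2)" if "p \<in> U" for p v s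
    using tv_compose[OF cU _ that Qd, of "(v, s)"] cQ unfolding c'_def by simp
  have tvQ': "tv M U c' p (v, s) = tv M U c p (v, s - (\<beta>0 (fst (c p)) v + \<beta>0 v (fst (c p))) / 2)" if "p \<in> U" for p v s
    unfolding tvQ[OF that] by simp
  have \<beta>Q: "- \<beta> z v - (\<beta>0 z v + \<beta>0 v z) / 2 = - \<beta>0 z v" for z v by (simp add: \<beta>_def field_simps)
  show thesis
  proof (rule that[of U c' \<beta> A])
    show "heis_coord M U c' \<beta>" unfolding heis_coord_def
    proof (intro conjI cQ ballI allI)
      fix p v s assume p: "p \<in> U"
      show "tv M U c' p (v, s) \<in> cr_H M p \<longleftrightarrow> s = - \<beta> (fst (c' p)) v"
        unfolding tvQ'[OF p] H1[OF p] fstc' \<beta>Q[symmetric] by linarith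
      show "cr_J M p (tv M U c' p (v, - \<beta> (fst (c' p)) v)) = tv M U c' p (\<i> *s v, - \<beta> (fst (c' p)) (\<i> *s v))"
        unfolding tvQ'[OF p] fstc' \<beta>Q by (rule J1[OF p])
    qed
    show "pt \<in> U" using ptU c0 r(1) by (simp add: U_def)
    show "c' pt = 0" by (simp add: c'_def c0 Q_def linear_0[OF \<beta>l(1)] zero_prod_def)
    show "heis_dilation A \<mu>" by (rule hd)
    show "\<phi> p \<in> U \<and> c' (\<phi> p) = \<Lambda> (c' p)" if p: "p \<in> U" for p
    proof -
      have a: "\<phi> p \<in> U1" "c (\<phi> p) = \<Lambda> (c p)" using \<phi>1[OF Ur(3)[OF p]] by auto
      have "\<Lambda> (c p) \<in> ball 0 (r/2)" using Lam_pow_le[of 1 "c p"] Ur(1)[OF p] by simp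
      then have "\<phi> p \<in> U" using a by (simp add: U_def)
      moreover have "c' (\<phi> p) = \<Lambda> (c' p)" by (simp add: c'_def a(2) Q_def Lam_def \<beta>0(2) algebra_simps)
      ultimately show ?thesis by blast
    qed
    have "linear (\<beta> u)" for u unfolding \<beta>_def[abs_def]
      using linear_compose_scale_right[OF linear_compose_sub[OF \<beta>l(1)[of u] \<beta>l(2)[of u]], of "1/2"] by simp
    moreover have "linear (\<lambda>u. \<beta> u v)" for v unfolding \<beta>_def[abs_def]
      using linear_compose_scale_right[OF linear_compose_sub[OF \<beta>l(2)[of v] \<beta>l(1)[of v]], of "1/2"] by simp
    ultimately show "bilinear \<beta>" unfolding bilinear_def by blast
    show "\<beta> (A u) (A v) = \<mu> * \<beta> u v" for u v by (simp add: \<beta>_def \<beta>0(2) field_simps)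
    show "\<beta> u v = - \<beta> v u" for u v by (simp add: \<beta>_def field_simps)
    show "\<beta> v (\<i> *s v) = 2 * (norm v)\<^sup>2" for v using lev[of v] by (simp add: \<beta>_def)
  qed
qed

end

section \<open>The generalized Heisenberg group of an alternating form\<close>

lemma euclidean_manifold: "manifold (euclidean_mfd :: ('e::euclidean_space, 'e) mfd)"
proof
  let ?E = "euclidean_mfd :: ('e, 'e) mfd"
  have "smooth_on UNIV (\<lambda>x::'e. x)" by (rule smooth_on_linear[OF open_UNIV bounded_linear_ident])
  moreover have "id \<circ> inv_into UNIV id = (\<lambda>x::'e. x)" by (rule ext) (simp add: inv_id)
  ultimately have s: "smooth_on UNIV (id \<circ> inv_into UNIV id :: 'e \<Rightarrow> 'e)" by simp
  have h: "Hausdorff_space (euclidean :: 'e topology)" by (rule Hausdorff_space_euclidean)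
  obtain B :: "'e set set" where B: "countable B" "\<And>C. C \<in> B \<Longrightarrow> open C" "\<And>S. open S \<Longrightarrow> \<exists>U. U \<subseteq> B \<and> S = \<Union>U"
    by (rule univ_second_countable) (rule that)
  have c: "second_countable (euclidean :: 'e topology)"
    unfolding second_countable_def open_openin[symmetric]
  proof (intro exI conjI allI impI ballI)
    show "countable B" by (rule B)
    show "open V" if "V \<in> B" for V by (rule B(2)[OF that])
    fix S :: "'e set" and x assume "open S \<and> x \<in> S"
    then show "\<exists>V\<in>B. x \<in> V \<and> V \<subseteq> S" using B(3)[of S] by blast
  qed
  show "smooth_manifold ?E" unfolding smooth_manifold_def
    using s h c by (simp add: euclidean_mfd_def homeomorphic_map_id)
qed

interpretation E: manifold "euclidean_mfd :: ('e::euclidean_space, 'e) mfd" by (rule euclidean_manifold)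

abbreviation etv :: "'e::euclidean_space \<Rightarrow> 'e \<Rightarrow> 'e tvec" where
  "etv \<equiv> tv euclidean_mfd UNIV id"

lemma euclidean_chart: "coord euclidean_mfd UNIV id"
  by (rule E.chart_coord) (simp add: euclidean_mfd_def)

lemma etv_tangent: "etv q w \<in> tangent_space euclidean_mfd q"
  unfolding E.tangent_space_coord[OF euclidean_chart UNIV_I] by simp

lemma etv_linear: "linear (\<lambda>w. etv q w g)"
proof (rule linearI)
  note l = fun_cong[OF E.tv_linear[OF euclidean_chart UNIV_I]]
  show "etv q (x + y) g = etv q x g + etv q y g" for x y using l[of 1 q x g 1 y] by simp
  show "etv q (r *\<^sub>R x) g = r *\<^sub>R etv q x g" for r x using l[of r q x g 0 x] by (simp add: scaleR_conv_of_real)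
qed

text \<open>The complex-linear part of a real-linear map is determined by its values on the complex
  standard basis, exactly as \<open>\<partial>/\<partial>z\<close> is built from \<open>\<partial>/\<partial>x\<close> and \<open>\<partial>/\<partial>y\<close>.\<close>

lemma complex_linear_part_expansion:
  fixes L :: "complex^'n::finite \<Rightarrow> complex"
  assumes L: "linear L"
  shows "L v - \<i> * L (\<i> *s v) = (\<Sum>\<alpha>\<in>UNIV. v $ \<alpha> * (L (axis \<alpha> 1) - \<i> * L (axis \<alpha> \<i>)))"
proof -
  have ex: "L w = (\<Sum>\<alpha>\<in>UNIV. of_real (Re (w $ \<alpha>)) * L (axis \<alpha> 1) + of_real (Im (w $ \<alpha>)) * L (axis \<alpha> \<i>))" for w
  proof -
    have "w = (\<Sum>\<alpha>\<in>UNIV. Re (w $ \<alpha>) *\<^sub>R axis \<alpha> 1 + Im (w $ \<alpha>) *\<^sub>R axis \<alpha> \<i>)"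
    proof (rule vec_eq_iff[THEN iffD2], rule allI)
      fix i
      have "(\<Sum>\<alpha>\<in>UNIV. Re (w $ \<alpha>) *\<^sub>R axis \<alpha> 1 + Im (w $ \<alpha>) *\<^sub>R axis \<alpha> \<i>) $ i
          = (\<Sum>\<alpha>\<in>UNIV. if \<alpha> = i then Re (w $ \<alpha>) *\<^sub>R 1 + Im (w $ \<alpha>) *\<^sub>R \<i> else 0)"
        unfolding sum_component by (rule sum.cong) (auto simp: axis_def)
      also have "\<dots> = w $ i" by (simp add: complex_eq_iff)
      finally show "w $ i = (\<Sum>\<alpha>\<in>UNIV. Re (w $ \<alpha>) *\<^sub>R axis \<alpha> 1 + Im (w $ \<alpha>) *\<^sub>R axis \<alpha> \<i>) $ i" ..
    qed
    then have "L w = L (\<Sum>\<alpha>\<in>UNIV. Re (w $ \<alpha>) *\<^sub>R axis \<alpha> 1 + Im (w $ \<alpha>) *\<^sub>R axis \<alpha> \<i>)" by (rule arg_cong)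
    also have "\<dots> = (\<Sum>\<alpha>\<in>UNIV. Re (w $ \<alpha>) *\<^sub>R L (axis \<alpha> 1) + Im (w $ \<alpha>) *\<^sub>R L (axis \<alpha> \<i>))"
      by (simp only: linear_sum[OF L] linear_add[OF L] linear_scale[OF L])
    finally show ?thesis by (simp only: scaleR_conv_of_real)
  qed
  show ?thesis unfolding ex[of v] ex[of "\<i> *s v"] sum_distrib_left sum_subtractf[symmetric]
  proof (rule sum.cong[OF refl])
    fix \<alpha>
    have "(of_real (Re (v $ \<alpha>)) + \<i> * of_real (Im (v $ \<alpha>))) * (L (axis \<alpha> 1) - \<i> * L (axis \<alpha> \<i>))
        = v $ \<alpha> * (L (axis \<alpha> 1) - \<i> * L (axis \<alpha> \<i>))" by (simp only: complex_eq[symmetric])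
    then show "of_real (Re (v $ \<alpha>)) * L (axis \<alpha> 1) + of_real (Im (v $ \<alpha>)) * L (axis \<alpha> \<i>)
        - \<i> * (of_real (Re ((\<i> *s v) $ \<alpha>)) * L (axis \<alpha> 1) + of_real (Im ((\<i> *s v) $ \<alpha>)) * L (axis \<alpha> \<i>))
        = v $ \<alpha> * (L (axis \<alpha> 1) - \<i> * L (axis \<alpha> \<i>))"
      by (simp add: algebra_simps)
  qed
qed

text \<open>The forms that arise from normal coordinates. They need not be invariant under \<open>\<i>\<close>, and their failure to be so is
  the matrix of the generalized Heisenberg group.\<close>

locale heisenberg_form =
  fixes \<beta> :: "complex^'n::finite \<Rightarrow> complex^'n \<Rightarrow> real"
  assumes bil: "bilinear \<beta>" and alt: "\<beta> u v = - \<beta> v u" and quad: "\<beta> v (\<i> *s v) = 2 * (norm v)\<^sup>2"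
begin

lemma bil_linear: "linear (\<beta> u)" "linear (\<lambda>u. \<beta> u v)"
  using bil by (auto simp: bilinear_def)

lemma i_i: "\<i> *s (\<i> *s v) = - (v :: complex^'n)" by (simp add: vec_eq_iff)

lemma i_linear: "linear (\<lambda>v::complex^'n. \<i> *s v)"
  by (rule linearI) (simp_all add: vec_eq_iff algebra_simps)

text \<open>Only the restriction of the form to the pairs \<open>v\<close>, \<open>\<i>v\<close> is prescribed; polarising this
  quadratic form gives the part of the form that is invariant under \<open>\<i>\<close>.\<close>

lemma polarised: "\<beta> u (\<i> *s v) - \<beta> (\<i> *s u) v = 4 * (u \<bullet> v)"
proof -
  have "\<beta> (u + v) (\<i> *s (u + v)) = \<beta> u (\<i> *s u) + \<beta> u (\<i> *s v) + (\<beta> v (\<i> *s u) + \<beta> v (\<i> *s v))"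
    by (simp add: linear_add[OF i_linear] linear_add[OF bil_linear(1)] linear_add[OF bil_linear(2)])
  moreover have "(norm (u + v))\<^sup>2 = (norm u)\<^sup>2 + (norm v)\<^sup>2 + 2 * (u \<bullet> v)"
    by (simp add: power2_norm_eq_inner inner_add_left inner_add_right inner_commute)
  ultimately show ?thesis unfolding quad using alt[of v "\<i> *s u"] by simp
qed

lemma polarised_i: "\<beta> u v + \<beta> (\<i> *s u) (\<i> *s v) = 4 * ((\<i> *s u) \<bullet> v)"
  using polarised[of "\<i> *s u" v] by (simp add: i_i linear_neg[OF bil_linear(2)])

text \<open>Minus one half of the complex bilinear part of \<open>\<beta>(z, v) - \<i> \<beta>(z, \<i>v)\<close>; that this part is skew-symmetric
  is inherited from \<open>\<beta>\<close>.\<close>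

definition matrix :: "complex^'n^'n" where
  "matrix = (\<chi> a b. - (1/4) *
     (\<beta> (axis b 1) (axis a 1) - \<i> * \<beta> (axis b 1) (axis a \<i>) - \<i> * \<beta> (axis b \<i>) (axis a 1) - \<beta> (axis b \<i>) (axis a \<i>)))"

lemma matrix_skew: "transpose matrix = - matrix"
proof -
  have "matrix $ b $ a = - (matrix $ a $ b)" for a b
    unfolding matrix_def
    using alt[of "axis a 1" "axis b 1"] alt[of "axis a 1" "axis b \<i>"] alt[of "axis a \<i>" "axis b 1"] alt[of "axis a \<i>" "axis b \<i>"]
    by (simp add: algebra_simps)
  moreover have "transpose matrix $ a $ b = matrix $ b $ a" for a b by (simp add: transpose_def)
  moreover have "- (matrix $ a $ b) = (- matrix) $ a $ b" for a b by simp
  ultimately have "transpose matrix $ a $ b = (- matrix) $ a $ b" for a b by (metis (no_types))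
  then show ?thesis unfolding vec_eq_iff by blast
qed

text \<open>The coefficient of \<open>\<partial>/\<partial>t\<close> in \<open>Z\<^sub>\<alpha>\<close>. Splitting it into its complex-linear and antilinear
  parts in \<open>z\<close>, the former is given by the matrix and the latter by the polarised form.\<close>

lemma coefficient: "\<i> * cnj (z $ a) + (\<Sum>b\<in>UNIV. matrix $ a $ b * z $ b)
  = - (1/2) * (\<beta> z (axis a 1) - \<i> * \<beta> z (axis a \<i>))"
proof -
  define L where "L z = complex_of_real (\<beta> z (axis a 1)) - \<i> * of_real (\<beta> z (axis a \<i>))" for z
  have Ll: "linear L"
  proof (rule linearI)
    show "L (x + y) = L x + L y" for x y by (simp add: L_def linear_add[OF bil_linear(2)] algebra_simps)
    show "L (r *\<^sub>R x) = r *\<^sub>R L x" for r x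
      unfolding L_def linear_scale[OF bil_linear(2)] scaleR_conv_of_real[of r "_ :: complex"] by (simp add: algebra_simps)
  qed
  have "L z - \<i> * L (\<i> *s z) = (\<Sum>b\<in>UNIV. z $ b * (L (axis b 1) - \<i> * L (axis b \<i>)))"
    by (rule complex_linear_part_expansion[OF Ll])
  also have "\<dots> = - 4 * (\<Sum>b\<in>UNIV. matrix $ a $ b * z $ b)"
    unfolding sum_distrib_left by (rule sum.cong[OF refl]) (simp add: matrix_def L_def algebra_simps)
  finally have lin: "L z - \<i> * L (\<i> *s z) = - 4 * (\<Sum>b\<in>UNIV. matrix $ a $ b * z $ b)" .
  have ia: "\<i> *s axis a 1 = (axis a \<i> :: complex^'n)" by (simp add: vec_eq_iff axis_def)
  have "L z + \<i> * L (\<i> *s z) = of_real (\<beta> z (axis a 1) + \<beta> (\<i> *s z) (axis a \<i>)) - \<i> * of_real (\<beta> z (axis a \<i>) - \<beta> (\<i> *s z) (axis a 1))"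
    by (simp add: L_def algebra_simps)
  also have "\<dots> = of_real (4 * ((\<i> *s z) \<bullet> axis a 1)) - \<i> * of_real (4 * (z \<bullet> axis a 1))"
    unfolding polarised_i[of z "axis a 1", unfolded ia] polarised[of z "axis a 1", unfolded ia] ..
  also have "\<dots> = - 4 * \<i> * cnj (z $ a)"
    by (simp add: inner_axis complex_eq_iff inner_complex_def)
  finally have anti: "L z + \<i> * L (\<i> *s z) = - 4 * \<i> * cnj (z $ a)" .
  have "2 * L z = - 4 * (\<i> * cnj (z $ a) + (\<Sum>b\<in>UNIV. matrix $ a $ b * z $ b))"
    using arg_cong2[where f="(+)", OF lin anti] by (simp add: algebra_simps)
  moreover have "x = - (1/2) * y" if "2 * y = - 4 * x" for x y :: complex
  proof -
    have "- (1/2) * y = - (1/4) * (2 * y)" by simp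
    then show ?thesis unfolding that by simp
  qed
  ultimately show ?thesis unfolding L_def by blast
qed

text \<open>The element on the right-hand side with parameter \<open>v\<close> is the combination of the frame with
  coefficients \<open>2 v\<^sub>\<alpha>\<close>; the factor comes from \<open>\<partial>/\<partial>z = (\<partial>/\<partial>x - \<i> \<partial>/\<partial>y) / 2\<close>.\<close>

lemma heis_H10_eq:
  "heis_H10 matrix q = {\<lambda>g. etv q (v, - \<beta> (fst q) v) g - \<i> * etv q (\<i> *s v, - \<beta> (fst q) (\<i> *s v)) g | v. True}"
proof -
  have sum: "etv q (v, - \<beta> (fst q) v) g - \<i> * etv q (\<i> *s v, - \<beta> (fst q) (\<i> *s v)) g
      = (\<Sum>a\<in>UNIV. (2 * v $ a) * heis_Z matrix a q g)" for v g
  proof -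
    define L where "L v = etv q (v, - \<beta> (fst q) v) g" for v
    have Ll: "linear L" unfolding L_def
    proof (rule linear_compose[OF _ etv_linear, unfolded o_def])
      show "linear (\<lambda>v. (v, - \<beta> (fst q) v))"
        by (rule linearI) (simp_all add: linear_add[OF bil_linear(1)] linear_scale[OF bil_linear(1)])
    qed
    have split: "L v = etv q (v, 0) g - of_real (\<beta> (fst q) v) * etv q (0, 1) g" for v
    proof -
      have "(v, - \<beta> (fst q) v) = (v, 0) + (- \<beta> (fst q) v) *\<^sub>R (0, 1)" by simp
      then have "L v = etv q ((v, 0) + (- \<beta> (fst q) v) *\<^sub>R (0, 1)) g" unfolding L_def by simp
      then show ?thesis unfolding linear_add[OF etv_linear] linear_scale[OF etv_linear] by (simp add: scaleR_conv_of_real)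
    qed
    have "L v - \<i> * L (\<i> *s v) = (\<Sum>a\<in>UNIV. v $ a * (L (axis a 1) - \<i> * L (axis a \<i>)))"
      by (rule complex_linear_part_expansion[OF Ll])
    also have "\<dots> = (\<Sum>a\<in>UNIV. (2 * v $ a) * heis_Z matrix a q g)"
    proof (rule sum.cong[OF refl])
      fix a
      have "heis_Z matrix a q g = (etv q (axis a 1, 0) g - \<i> * etv q (axis a \<i>, 0) g) / 2
          + - (1/2) * (\<beta> (fst q) (axis a 1) - \<i> * \<beta> (fst q) (axis a \<i>)) * etv q (0, 1) g"
        unfolding heis_Z_def coefficient d_dz_def d_dt_def dir_deriv_eq_tv ..
      then have "2 * heis_Z matrix a q g = 2 * ((etv q (axis a 1, 0) g - \<i> * etv q (axis a \<i>, 0) g) / 2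
          + - (1/2) * (\<beta> (fst q) (axis a 1) - \<i> * \<beta> (fst q) (axis a \<i>)) * etv q (0, 1) g)" by (rule arg_cong)
      then have "L (axis a 1) - \<i> * L (axis a \<i>) = 2 * heis_Z matrix a q g"
        unfolding split by (simp add: algebra_simps diff_divide_distrib)
      then show "v $ a * (L (axis a 1) - \<i> * L (axis a \<i>)) = (2 * v $ a) * heis_Z matrix a q g" by simp
    qed
    finally show ?thesis unfolding L_def .
  qed
  show ?thesis unfolding sum heis_H10_def
  proof (intro subset_antisym subsetI; clarify)
    fix a :: "'n \<Rightarrow> complex"
    show "\<exists>v. (\<lambda>g. \<Sum>\<alpha>\<in>UNIV. a \<alpha> * heis_Z matrix \<alpha> q g) = (\<lambda>g. \<Sum>\<alpha>\<in>UNIV. (2 * v $ \<alpha>) * heis_Z matrix \<alpha> q g) \<and> True"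
      by (rule exI[of _ "\<chi> \<alpha>. a \<alpha> / 2"]) simp
  next
    fix v :: "complex^'n"
    show "\<exists>a. (\<lambda>g. \<Sum>\<alpha>\<in>UNIV. (2 * v $ \<alpha>) * heis_Z matrix \<alpha> q g) = (\<lambda>g. \<Sum>\<alpha>\<in>UNIV. a \<alpha> * heis_Z matrix \<alpha> q g) \<and> True"
      by (rule exI[of _ "\<lambda>\<alpha>. 2 * v $ \<alpha>"]) simp
  qed
qed

lemma H10_heisenberg:
  "H10 (heisenberg matrix) q = {\<lambda>g. etv q (v, - \<beta> (fst q) v) g - \<i> * etv q (\<i> *s v, - \<beta> (fst q) (\<i> *s v)) g | v. True}"
proof -
  let ?T = "tangent_space euclidean_mfd q"
  have T: "q \<in> topspace (mtop euclidean_mfd)" by (simp add: euclidean_mfd_def)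
  have J: "cr_J (heisenberg matrix) q X = Y" if "X \<in> ?T" "Y \<in> ?T" "(\<lambda>g. X g - \<i> * Y g) \<in> heis_H10 matrix q"
    "\<And>Y'. Y' \<in> ?T \<Longrightarrow> (\<lambda>g. X g - \<i> * Y' g) \<in> heis_H10 matrix q \<Longrightarrow> Y' = Y" for X Y
  proof -
    have "(THE Y. Y \<in> ?T \<and> (\<lambda>g. X g - \<i> * Y g) \<in> heis_H10 matrix q) = Y"
    proof (rule the_equality)
      show "Y \<in> ?T \<and> (\<lambda>g. X g - \<i> * Y g) \<in> heis_H10 matrix q" using that(2,3) by (rule conjI)
      show "Y' = Y" if "Y' \<in> ?T \<and> (\<lambda>g. X g - \<i> * Y' g) \<in> heis_H10 matrix q" for Y'
        using \<open>\<And>Y'. Y' \<in> ?T \<Longrightarrow> (\<lambda>g. X g - \<i> * Y' g) \<in> heis_H10 matrix q \<Longrightarrow> Y' = Y\<close> that by blast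
    qed
    then show ?thesis by (simp add: heisenberg_def)
  qed
  have uniq: "Y' = etv q (\<i> *s v, - \<beta> (fst q) (\<i> *s v))" 
    if X: "X \<in> ?T" "Y' \<in> ?T" "(\<lambda>g. X g - \<i> * Y' g) \<in> heis_H10 matrix q" and v: "X = etv q (v, - \<beta> (fst q) v)" for X Y' v
  proof -
    obtain w where w: "(\<lambda>g. X g - \<i> * Y' g) = (\<lambda>g. etv q (w, - \<beta> (fst q) w) g - \<i> * etv q (\<i> *s w, - \<beta> (fst q) (\<i> *s w)) g)"
      using X(3) unfolding heis_H10_eq by blast
    note u = E.real_imaginary_unique[OF T X(1,2) etv_tangent etv_tangent w]
    have "(v, - \<beta> (fst q) v) = (w, - \<beta> (fst q) w)" using u(1) unfolding v by (rule E.tv_inj[OF euclidean_chart UNIV_I])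
    then show ?thesis using u(2) by simp
  qed
  have H: "X \<in> cr_H (heisenberg matrix) q \<longleftrightarrow> (\<exists>v. X = etv q (v, - \<beta> (fst q) v))" for X
  proof
    assume "X \<in> cr_H (heisenberg matrix) q"
    then obtain Y where XY: "X \<in> ?T" "Y \<in> ?T" "(\<lambda>g. X g - \<i> * Y g) \<in> heis_H10 matrix q" by (auto simp: heisenberg_def)
    obtain w where w: "(\<lambda>g. X g - \<i> * Y g) = (\<lambda>g. etv q (w, - \<beta> (fst q) w) g - \<i> * etv q (\<i> *s w, - \<beta> (fst q) (\<i> *s w)) g)"
      using XY(3) unfolding heis_H10_eq by blast
    show "\<exists>v. X = etv q (v, - \<beta> (fst q) v)" by (rule exI, rule E.real_imaginary_unique(1)[OF T XY(1,2) etv_tangent etv_tangent w])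
  next
    assume "\<exists>v. X = etv q (v, - \<beta> (fst q) v)"
    then obtain v where v: "X = etv q (v, - \<beta> (fst q) v)" ..
    have "(\<lambda>g. X g - \<i> * etv q (\<i> *s v, - \<beta> (fst q) (\<i> *s v)) g) \<in> heis_H10 matrix q" unfolding heis_H10_eq v by blast
    then show "X \<in> cr_H (heisenberg matrix) q" unfolding heisenberg_def using etv_tangent v by auto
  qed
  have JX: "cr_J (heisenberg matrix) q (etv q (v, - \<beta> (fst q) v)) = etv q (\<i> *s v, - \<beta> (fst q) (\<i> *s v))" for v
  proof (rule J[OF etv_tangent etv_tangent])
    show "(\<lambda>g. etv q (v, - \<beta> (fst q) v) g - \<i> * etv q (\<i> *s v, - \<beta> (fst q) (\<i> *s v)) g) \<in> heis_H10 matrix q"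
      unfolding heis_H10_eq by blast
    show "Y' = etv q (\<i> *s v, - \<beta> (fst q) (\<i> *s v))" if "Y' \<in> ?T" "(\<lambda>g. etv q (v, - \<beta> (fst q) v) g - \<i> * Y' g) \<in> heis_H10 matrix q" for Y'
      by (rule uniq[OF etv_tangent that refl])
  qed
  show ?thesis unfolding H10_def
  proof (intro subset_antisym subsetI)
    fix Z assume "Z \<in> {\<lambda>g. X g - \<i> * cr_J (heisenberg matrix) q X g | X. X \<in> cr_H (heisenberg matrix) q}"
    then obtain X v where "Z = (\<lambda>g. X g - \<i> * cr_J (heisenberg matrix) q X g)" "X = etv q (v, - \<beta> (fst q) v)" using H by blast
    then have "Z = (\<lambda>g. etv q (v, - \<beta> (fst q) v) g - \<i> * etv q (\<i> *s v, - \<beta> (fst q) (\<i> *s v)) g)" by (simp add: JX)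
    then show "Z \<in> {\<lambda>g. etv q (v, - \<beta> (fst q) v) g - \<i> * etv q (\<i> *s v, - \<beta> (fst q) (\<i> *s v)) g | v. True}" by blast
  next
    fix Z assume "Z \<in> {\<lambda>g. etv q (v, - \<beta> (fst q) v) g - \<i> * etv q (\<i> *s v, - \<beta> (fst q) (\<i> *s v)) g | v. True}"
    then obtain v where "Z = (\<lambda>g. etv q (v, - \<beta> (fst q) v) g - \<i> * etv q (\<i> *s v, - \<beta> (fst q) (\<i> *s v)) g)" by blast
    then have "Z = (\<lambda>g. etv q (v, - \<beta> (fst q) v) g - \<i> * cr_J (heisenberg matrix) q (etv q (v, - \<beta> (fst q) v)) g)" by (simp add: JX)
    then show "Z \<in> {\<lambda>g. X g - \<i> * cr_J (heisenberg matrix) q X g | X. X \<in> cr_H (heisenberg matrix) q}" using H by blast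
  qed
qed

end

section \<open>Extension to the stable manifold\<close>

context cr_contracting begin

context
  fixes U0 and c0 :: "'a \<Rightarrow> 'n::finite heis" and A \<beta>
  assumes hc: "heis_coord M U0 c0 \<beta>" and ptU: "pt \<in> U0" and c00: "c0 pt = 0" and hd: "heis_dilation A \<mu>"
    and step: "\<And>p. p \<in> U0 \<Longrightarrow> \<phi> p \<in> U0 \<and> c0 (\<phi> p) = Lam A \<mu> (c0 p)"
    and \<beta>l: "bilinear \<beta>" and \<beta>A: "\<And>u v. \<beta> (A u) (A v) = \<mu> * \<beta> u v"
begin

interpretation hd: heis_dilation A \<mu> by (rule hd)

abbreviation "\<Lambda> \<equiv> Lam A \<mu>"
abbreviation "\<Lambda>' \<equiv> inv \<Lambda>"

lemma Lam_bij: "\<Lambda>' (\<Lambda> x) = x" "\<Lambda> (\<Lambda>' x) = x" "linear \<Lambda>'"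
proof -
  have inj: "inj \<Lambda>"
  proof (rule linear_injective_0[OF hd.Lam_linear, THEN iffD2], intro allI impI)
    fix x assume x: "\<Lambda> x = 0"
    then have "A (fst x) = 0" "\<mu> * snd x = 0" by (simp_all add: Lam_def prod_eq_iff)
    then show "x = 0" using hd.A(2)[of "fst x"] hd.\<mu> by (simp add: prod_eq_iff)
  qed
  obtain g where g: "linear g" "\<And>x. g (\<Lambda> x) = x" "\<And>x. \<Lambda> (g x) = x"
    using linear_injective_isomorphism[OF hd.Lam_linear inj] by blast
  have "\<Lambda>' = g" by (rule inv_equality) (rule g)+
  then show "\<Lambda>' (\<Lambda> x) = x" "\<Lambda> (\<Lambda>' x) = x" "linear \<Lambda>'" using g by simp_all
qed

text \<open>The dilation is an automorphism of the model structure, so pulling a model chart back by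
  \<open>\<phi>\<close> and rescaling gives a model chart again.\<close>

lemma heis_coord_pullback:
  assumes h: "heis_coord M V C \<beta>"
  shows "heis_coord M {p \<in> T. \<phi> p \<in> V} (\<Lambda>' \<circ> (C \<circ> \<phi>)) \<beta>"
proof -
  let ?V = "{p \<in> T. \<phi> p \<in> V}" and ?C = "\<Lambda>' \<circ> (C \<circ> \<phi>)"
  have C: "coord M V C" and H: "\<And>p v s. p \<in> V \<Longrightarrow> tv M V C p (v, s) \<in> cr_H M p \<longleftrightarrow> s = - \<beta> (fst (C p)) v"
    and JV: "\<And>p v. p \<in> V \<Longrightarrow> cr_J M p (tv M V C p (v, - \<beta> (fst (C p)) v)) = tv M V C p (\<i> *s v, - \<beta> (fst (C p)) (\<i> *s v))"
    using h unfolding heis_coord_def by blast+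
  have C1: "coord M ?V (C \<circ> \<phi>)" by (rule coord_pullback[OF diffeo C])
  have o: "open ((C \<circ> \<phi>) ` ?V)" by (rule coordD(3)[OF C1])
  have bl: "bounded_linear \<Lambda>'" using Lam_bij(3) by (simp add: linear_conv_bounded_linear)
  have C2: "coord M ?V ?C"
  proof (rule coord_compose[where k=\<Lambda>, OF C1 smooth_on_linear[OF o bl]])
    have "\<Lambda>' ` (C \<circ> \<phi>) ` ?V = \<Lambda> -` ((C \<circ> \<phi>) ` ?V)"
    proof (intro subset_antisym subsetI)
      fix y assume "y \<in> \<Lambda>' ` (C \<circ> \<phi>) ` ?V"
      then obtain x where "x \<in> (C \<circ> \<phi>) ` ?V" "y = \<Lambda>' x" by (rule imageE)
      then show "y \<in> \<Lambda> -` ((C \<circ> \<phi>) ` ?V)" by (simp add: Lam_bij(2))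
    next
      fix y assume "y \<in> \<Lambda> -` ((C \<circ> \<phi>) ` ?V)"
      then have "\<Lambda>' (\<Lambda> y) \<in> \<Lambda>' ` (C \<circ> \<phi>) ` ?V" by (intro imageI) (rule vimageD)
      then show "y \<in> \<Lambda>' ` (C \<circ> \<phi>) ` ?V" unfolding Lam_bij(1) .
    qed
    moreover have "open (\<Lambda> -` ((C \<circ> \<phi>) ` ?V))"
      by (rule open_vimage[OF o linear_continuous_on[OF hd.Lam_bounded_linear]])
    ultimately show o2: "open (\<Lambda>' ` (C \<circ> \<phi>) ` ?V)" by (simp only:)
    show "smooth_on (\<Lambda>' ` (C \<circ> \<phi>) ` ?V) \<Lambda>" by (rule smooth_on_linear[OF o2 hd.Lam_bounded_linear])
  qed (rule Lam_bij(2))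
  have push: "pushforward M \<phi> p (tv M ?V ?C p w) = tv M V C (\<phi> p) (\<Lambda> w)" if p: "p \<in> ?V" for p w
  proof -
    have pT: "p \<in> T" "\<phi> p \<in> V" using p by auto
    have "tv M ?V (C \<circ> \<phi>) p (\<Lambda> w) = tv M ?V ?C p (\<Lambda>' (\<Lambda> w))"
      by (rule tv_compose[OF C1 C2 p bounded_linear_imp_has_derivative[OF bl]])
    then show ?thesis using pushforward_pullback[OF diffeo C pT, of "\<Lambda> w"] unfolding Lam_bij(1) by simp
  qed
  have tan: "tv M ?V ?C p w \<in> tangent_space M p" if "p \<in> ?V" for p w
    unfolding tangent_space_coord[OF C2 that] by (rule rangeI)
  have fC: "A (fst (?C p)) = fst (C (\<phi> p))" for p
  proof -
    have "A (fst (?C p)) = fst (\<Lambda> (?C p))" by (simp add: Lam_def)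
    then show ?thesis by (simp add: Lam_bij(2))
  qed
  have \<beta>C: "\<beta> (fst (C (\<phi> p))) (A v) = \<mu> * \<beta> (fst (?C p)) v" for p v unfolding fC[symmetric] by (rule \<beta>A)
  have H2: "tv M ?V ?C p (v, s) \<in> cr_H M p \<longleftrightarrow> s = - \<beta> (fst (?C p)) v" if p: "p \<in> ?V" for p v s
  proof -
    have pT: "p \<in> T" "\<phi> p \<in> V" using p by auto
    have "tv M ?V ?C p (v, s) \<in> cr_H M p \<longleftrightarrow> pushforward M \<phi> p (tv M ?V ?C p (v, s)) \<in> cr_H M (\<phi> p)"
      by (rule automorphism(1)[OF aut pT(1) tan[OF p], symmetric])
    also have "\<dots> \<longleftrightarrow> tv M V C (\<phi> p) (A v, \<mu> * s) \<in> cr_H M (\<phi> p)" unfolding push[OF p] by (simp add: Lam_def)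
    also have "\<dots> \<longleftrightarrow> \<mu> * s = - (\<mu> * \<beta> (fst (?C p)) v)" unfolding H[OF pT(2)] \<beta>C ..
    also have "\<dots> \<longleftrightarrow> \<mu> * s = \<mu> * (- \<beta> (fst (?C p)) v)" by simp
    also have "\<dots> \<longleftrightarrow> s = - \<beta> (fst (?C p)) v"
      by (subst mult_cancel_left) (use hd.\<mu>(1) in auto)
    finally show ?thesis .
  qed
  have J2: "cr_J M p (tv M ?V ?C p (v, - \<beta> (fst (?C p)) v)) = tv M ?V ?C p (\<i> *s v, - \<beta> (fst (?C p)) (\<i> *s v))"
    if p: "p \<in> ?V" for p v
  proof -
    have pT: "p \<in> T" "\<phi> p \<in> V" using p by auto
    let ?X = "tv M ?V ?C p (v, - \<beta> (fst (?C p)) v)"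
    have X: "?X \<in> cr_H M p" unfolding H2[OF p] ..
    have "pushforward M \<phi> p (cr_J M p ?X) = cr_J M (\<phi> p) (pushforward M \<phi> p ?X)"
      by (rule automorphism(2)[OF aut pT(1) tan[OF p] X, symmetric])
    also have "pushforward M \<phi> p ?X = tv M V C (\<phi> p) (A v, - \<beta> (fst (C (\<phi> p))) (A v))"
      unfolding push[OF p] \<beta>C by (simp add: Lam_def)
    also have "cr_J M (\<phi> p) \<dots> = tv M V C (\<phi> p) (A (\<i> *s v), - \<beta> (fst (C (\<phi> p))) (A (\<i> *s v)))"
      unfolding JV[OF pT(2)] hd.A(3) ..
    also have "\<dots> = pushforward M \<phi> p (tv M ?V ?C p (\<i> *s v, - \<beta> (fst (?C p)) (\<i> *s v)))"
      unfolding push[OF p] \<beta>C by (simp add: Lam_def)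
    finally show ?thesis
      by (rule pushforward_inj[OF diffeo pT(1) theta(4)[OF pT(1) J(1)[OF pT(1) X]] tan[OF p]])
  qed
  show ?thesis unfolding heis_coord_def using C2 H2 J2 by blast
qed

text \<open>Recursive form of the coordinates \<open>\<Lambda>\<^sup>-\<^sup>k \<circ> c \<circ> \<phi>\<^sup>k\<close> and their domains.\<close>

primrec dom :: "nat \<Rightarrow> 'a set" where
  "dom 0 = U0"
| "dom (Suc k) = {p \<in> T. \<phi> p \<in> dom k}"

primrec crd :: "nat \<Rightarrow> 'a \<Rightarrow> 'n heis" where
  "crd 0 = c0"
| "crd (Suc k) = \<Lambda>' \<circ> (crd k \<circ> \<phi>)"

lemma heis_coord_dom: "heis_coord M (dom k) (crd k) \<beta>"
proof (induction k)
  case 0 show ?case using hc by simp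
next
  case (Suc k) show ?case unfolding dom.simps crd.simps by (rule heis_coord_pullback[OF Suc])
qed

lemma coord_dom: "coord M (dom k) (crd k)" using heis_coord_dom unfolding heis_coord_def by blast

lemma dom_T: "p \<in> dom k \<Longrightarrow> p \<in> T" using coord_topspace[OF coord_dom] by blast

lemma dom_step: "p \<in> dom k \<Longrightarrow> \<phi> p \<in> dom k \<and> crd k (\<phi> p) = \<Lambda> (crd k p)"
proof (induction k arbitrary: p)
  case 0 then show ?case using step by simp
next
  case (Suc k)
  then have p: "p \<in> T" "\<phi> p \<in> dom k" by auto
  from Suc.IH[OF p(2)] phi_T[OF p(1)] show ?case by (simp add: Lam_bij)
qed

text \<open>The linearisation of \<open>\<phi>\<close> holds in each of the coordinate systems, so that passing from one to the next does not
  change the coordinates of a point.\<close>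

lemma dom_Suc: "p \<in> dom k \<Longrightarrow> p \<in> dom (Suc k) \<and> crd (Suc k) p = crd k p"
  using dom_step dom_T by (simp add: Lam_bij)

lemma dom_mono: "p \<in> dom k \<Longrightarrow> p \<in> dom (k + j) \<and> crd (k + j) p = crd k p"
proof (induction j)
  case (Suc j) then show ?case using dom_Suc[of p "k + j"] unfolding add_Suc_right by metis
qed simp

lemma dom_agree: "p \<in> dom j \<Longrightarrow> p \<in> dom k \<Longrightarrow> crd j p = crd k p"
  using dom_mono[of p j k] dom_mono[of p k j] by (simp add: add.commute)

lemma dom_iterate: "p \<in> dom k \<longleftrightarrow> p \<in> T \<and> (\<phi> ^^ k) p \<in> U0"
proof (induction k arbitrary: p)
  case 0 show ?case using dom_T[of p 0] by auto
next
  case (Suc k) show ?case using Suc.IH[of "\<phi> p"] phi_T by (auto simp: funpow_swap1)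
qed

lemma dom_orbit: "p \<in> dom k \<Longrightarrow> (\<phi> ^^ m) p \<in> dom k \<and> crd k ((\<phi> ^^ m) p) = (\<Lambda> ^^ m) (crd k p)"
  by (induction m) (use dom_step in auto)

abbreviation "W \<equiv> stable_manifold M \<phi> pt"

text \<open>A point of the stable manifold eventually enters the first domain. Conversely, a point of one of the domains has a
  neighbourhood in that domain with bounded coordinates, on which \<open>\<Lambda>\<^sup>k\<close> tends to \<open>0\<close> uniformly.\<close>

lemma stable_manifold_exhausted: "W = (\<Union>k. dom k)"
proof (intro subset_antisym subsetI)
  fix x assume "x \<in> W"
  then obtain V where V: "x \<in> V" "openin (mtop M) V"
    "\<And>N. openin (mtop M) N \<and> pt \<in> N \<Longrightarrow> \<forall>\<^sub>F k in sequentially. (\<phi> ^^ k) ` V \<subseteq> N"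
    unfolding stable_manifold_def by blast
  have "openin (mtop M) U0" using coordD(1)[OF coord_dom[of 0]] by simp
  then have "\<forall>\<^sub>F k in sequentially. (\<phi> ^^ k) ` V \<subseteq> U0" using V(3) ptU by blast
  then obtain k where "(\<phi> ^^ k) ` V \<subseteq> U0" unfolding eventually_sequentially by blast
  then have "x \<in> dom k" unfolding dom_iterate using V(1) openin_subset[OF V(2)] by blast
  then show "x \<in> (\<Union>k. dom k)" by blast
next
  fix x assume "x \<in> (\<Union>k. dom k)"
  then obtain k where k: "x \<in> dom k" by blast
  have ptk: "pt \<in> dom k" "crd k pt = 0" using dom_mono[of pt 0 k] ptU c00 by auto
  define R where "R = norm (crd k x) + 1"
  have R: "0 < R" unfolding R_def using norm_ge_zero[of "crd k x"] by linarith
  define V where "V = {q \<in> dom k. crd k q \<in> ball 0 R}"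
  have oV: "openin (mtop M) V" unfolding V_def by (rule coord_openin[OF coord_dom open_ball])
  have xV: "x \<in> V" using k by (simp add: V_def R_def)
  have "\<forall>\<^sub>F m in sequentially. (\<phi> ^^ m) ` V \<subseteq> N" if N: "openin (mtop M) N" "pt \<in> N" for N
  proof -
    have oN: "openin (mtop M) (dom k \<inter> N)" by (rule openin_Int[OF coordD(1)[OF coord_dom] N(1)])
    have "open (crd k ` (dom k \<inter> N))" by (rule coord_open_image[OF coord_dom oN]) blast
    moreover have "0 \<in> crd k ` (dom k \<inter> N)" using ptk N(2) by (metis IntI image_eqI)
    ultimately obtain e where e: "0 < e" "ball 0 e \<subseteq> crd k ` (dom k \<inter> N)" using open_contains_ball by blast
    have "(\<lambda>m. sqrt \<mu> ^ m * R) \<longlonglongrightarrow> 0" using hd.sqrt_mu by (intro tendsto_mult_left_zero LIMSEQ_realpow_zero) auto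
    then have "\<forall>\<^sub>F m in sequentially. sqrt \<mu> ^ m * R < e" using e(1) by (rule order_tendstoD)
    then show ?thesis
    proof (rule eventually_mono)
      fix m assume m: "sqrt \<mu> ^ m * R < e"
      show "(\<phi> ^^ m) ` V \<subseteq> N"
      proof (rule image_subsetI)
        fix q assume "q \<in> V"
        then have q: "q \<in> dom k" "norm (crd k q) < R" by (auto simp: V_def)
        note orb = dom_orbit[OF q(1), of m]
        have "norm (crd k ((\<phi> ^^ m) q)) \<le> sqrt \<mu> ^ m * norm (crd k q)" using orb hd.Lam_pow_norm[of m "crd k q"] by simp
        also have "\<dots> \<le> sqrt \<mu> ^ m * R" by (rule mult_left_mono) (use q(2) hd.sqrt_mu in auto)
        finally have "crd k ((\<phi> ^^ m) q) \<in> ball 0 e" using m by simp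
        then obtain q' where q': "q' \<in> dom k" "q' \<in> N" "crd k ((\<phi> ^^ m) q) = crd k q'" using e(2) by blast
        have "(\<phi> ^^ m) q = q'" using inj_onD[OF coordD(2)[OF coord_dom] q'(3)] orb q'(1) by blast
        then show "(\<phi> ^^ m) q \<in> N" using q'(2) by simp
      qed
    qed
  qed
  then show "x \<in> W" unfolding stable_manifold_def using xV oV by blast
qed

lemma crd_surj: "(\<Lambda> ^^ k) y \<in> c0 ` U0 \<Longrightarrow> y \<in> crd k ` dom k"
proof (induction k arbitrary: y)
  case 0 then show ?case by simp
next
  case (Suc k)
  have "\<Lambda> y \<in> crd k ` dom k" by (rule Suc.IH) (use Suc.prems in \<open>simp add: funpow_swap1\<close>)
  then obtain q where q: "q \<in> dom k" "\<Lambda> y = crd k q" by (rule imageE)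
  let ?p = "inv_into T \<phi> q"
  have p: "?p \<in> T" "\<phi> ?p = q" using diffeomorphism_inv(3,4)[OF diffeo dom_T[OF q(1)]] by auto
  have "y = crd (Suc k) ?p" using Lam_bij(1)[of y] by (simp add: p(2) q(2))
  moreover have "?p \<in> dom (Suc k)" using p q(1) by simp
  ultimately show ?case by (rule image_eqI)
qed

text \<open>The common extension of the coordinate systems, a developing map; the least index serves merely to choose one of
  the agreeing values.\<close>

definition dev :: "'a \<Rightarrow> 'n heis" where "dev p = crd (LEAST k. p \<in> dom k) p"

lemma dev_eq: "p \<in> dom k \<Longrightarrow> dev p = crd k p"
  unfolding dev_def by (rule dom_agree[OF LeastI]) assumption+

lemma dev_bij: "bij_betw dev W UNIV"
  unfolding bij_betw_def stable_manifold_exhausted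
proof
  show "inj_on dev (\<Union>k. dom k)"
  proof (rule inj_onI)
    fix p q assume "p \<in> (\<Union>k. dom k)" "q \<in> (\<Union>k. dom k)" and eq: "dev p = dev q"
    then obtain j k where "p \<in> dom j" "q \<in> dom k" by blast
    then have pq: "p \<in> dom (j + k)" "q \<in> dom (j + k)" using dom_mono[of p j k] dom_mono[of q k j] by (auto simp: add.commute)
    show "p = q" by (rule inj_onD[OF coordD(2)[OF coord_dom] _ pq]) (use eq dev_eq pq in metis)
  qed
  have "y \<in> dev ` (\<Union>k. dom k)" for y
  proof -
    have o: "open (c0 ` U0)" using coordD(3)[OF coord_dom[of 0]] by simp
    have "0 \<in> c0 ` U0" using ptU c00 by (metis image_eqI)
    then have "\<forall>\<^sub>F k in sequentially. (\<Lambda> ^^ k) y \<in> c0 ` U0" by (rule topological_tendstoD[OF hd.Lam_pow_tendsto o])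
    then obtain k where "(\<Lambda> ^^ k) y \<in> c0 ` U0" unfolding eventually_sequentially by blast
    then obtain p where "p \<in> dom k" "y = crd k p" using crd_surj by (blast elim: imageE)
    then show ?thesis using dev_eq by (intro image_eqI[of _ _ p]) auto
  qed
  then show "dev ` (\<Union>k. dom k) = UNIV" by blast
qed

lemma W_T: "W \<subseteq> T" unfolding stable_manifold_exhausted using dom_T by blast

lemma W_openin: "openin (mtop M) W" unfolding stable_manifold_exhausted
  by (rule openin_Union) (use coordD(1)[OF coord_dom] in blast)

lemma restrict_simps:
  "mtop (cr_restrict M W) = subtopology (mtop M) W" "charts (cr_restrict M W) = {(U \<inter> W, c) | U c. (U, c) \<in> charts M}"
  "topspace (mtop (cr_restrict M W)) = W" "H10 (cr_restrict M W) p = H10 M p"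
  using W_T by (auto simp: cr_restrict_def H10_def)

lemma heisenberg_simps: "mtop (heisenberg P) = euclidean" "charts (heisenberg P) = {(UNIV, id)}"
  by (simp_all add: heisenberg_def)

lemma dev_smooth: "smooth_map (cr_restrict M W) (heisenberg P) dev"
  unfolding smooth_map_def
proof (intro conjI ballI)
  have "{x \<in> W. dev x \<in> S} = (\<Union>k. {p \<in> dom k. crd k p \<in> S})" for S
    unfolding stable_manifold_exhausted using dev_eq by auto
  then have "openin (mtop M) {x \<in> W. dev x \<in> S}" if "open S" for S
    using coord_openin[OF coord_dom that] by (auto intro: openin_Union)
  then show "continuous_map (mtop (cr_restrict M W)) (mtop (heisenberg P)) dev"
    unfolding continuous_map_def restrict_simps(3) unfolding restrict_simps heisenberg_simps
    using W_openin by (auto simp: openin_open_subtopology)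
  fix x assume x: "x \<in> charts (cr_restrict M W)"
  obtain U c where U: "x = (U \<inter> W, c)" "(U, c) \<in> charts M" using x unfolding restrict_simps by blast
  have "smooth_on (c ` (U \<inter> W)) (dev \<circ> inv_into (U \<inter> W) c)"
  proof (rule smooth_on_local)
    fix y assume "y \<in> c ` (U \<inter> W)"
    then obtain p where p: "p \<in> U" "p \<in> W" "y = c p" by blast
    obtain k where k: "p \<in> dom k" using p(2) unfolding stable_manifold_exhausted by blast
    have oi: "openin (mtop M) (U \<inter> dom k)" by (rule openin_Int[OF chart(1)[OF U(2)] coordD(1)[OF coord_dom]])
    have o: "open (c ` (U \<inter> dom k))" by (rule chart(4)[OF U(2) oi]) blast
    have s: "smooth_on (c ` (U \<inter> dom k)) (crd k \<circ> inv_into U c)" by (rule smooth_fun_onD[OF coordD(4)[OF coord_dom] U(2)])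
    have "smooth_on (c ` (U \<inter> dom k)) (dev \<circ> inv_into (U \<inter> W) c)"
    proof (rule smooth_on_cong[OF o _ s])
      fix z assume "z \<in> c ` (U \<inter> dom k)"
      then obtain q where q: "q \<in> U" "q \<in> dom k" "z = c q" by blast
      have qW: "q \<in> U \<inter> W" using q unfolding stable_manifold_exhausted by blast
      have "inv_into (U \<inter> W) c z = q" unfolding q(3) by (rule inv_into_f_f[OF inj_on_subset[OF chart(3)[OF U(2)] Int_lower1] qW])
      moreover have "inv_into U c z = q" unfolding q(3) by (rule inv_into_f_f[OF chart(3)[OF U(2)] q(1)])
      ultimately show "(crd k \<circ> inv_into U c) z = (dev \<circ> inv_into (U \<inter> W) c) z" using dev_eq[OF q(2)] by simp
    qed
    then show "\<exists>S. open S \<and> y \<in> S \<and> smooth_on S (dev \<circ> inv_into (U \<inter> W) c)"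
      using o p(1,3) k by blast
  qed
  then show "case x of (U, c) \<Rightarrow> \<forall>(V, d)\<in>charts (heisenberg P). smooth_on (c ` (U \<inter> dev -` V)) (d \<circ> dev \<circ> inv_into U c)"
    unfolding U(1) heisenberg_simps by simp
qed

lemma dev_inv: "p \<in> W \<Longrightarrow> inv_into W dev (dev p) = p"
  by (rule inv_into_f_f[OF bij_betw_imp_inj_on[OF dev_bij]])

lemma dev_surj: obtains p k where "p \<in> W" "p \<in> dom k" "y = dev p"
proof -
  have "y \<in> dev ` W" using dev_bij unfolding bij_betw_def by simp
  then obtain p where "p \<in> W" "y = dev p" by (rule imageE) 
  then show thesis using that unfolding stable_manifold_exhausted by blast
qed

lemma dev_inv_smooth: "smooth_map (heisenberg P) (cr_restrict M W) (inv_into W dev)"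
  unfolding smooth_map_def
proof (intro conjI ballI)
  let ?g = "inv_into W dev"
  have gW: "?g y \<in> W" for y using dev_surj[of y] dev_inv by metis
  have pre: "?g -` S = (\<Union>k. crd k ` (dom k \<inter> S))" if S: "S \<subseteq> W" for S
  proof (intro subset_antisym subsetI)
    fix y assume y: "y \<in> ?g -` S"
    obtain p k where p: "p \<in> W" "p \<in> dom k" "y = dev p" by (rule dev_surj)
    have "p \<in> S" using y unfolding p(3) by (simp add: dev_inv[OF p(1)])
    then show "y \<in> (\<Union>k. crd k ` (dom k \<inter> S))" unfolding p(3) dev_eq[OF p(2)] using p(2) by blast
  next
    fix y assume "y \<in> (\<Union>k. crd k ` (dom k \<inter> S))"
    then obtain p k where p: "p \<in> dom k" "p \<in> S" "y = crd k p" by blast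
    have "p \<in> W" using p(2) S by blast
    then show "y \<in> ?g -` S" using p(2) unfolding p(3) dev_eq[OF p(1), symmetric] by (simp add: dev_inv)
  qed
  have op: "open (?g -` S)" if "openin (mtop M) S" "S \<subseteq> W" for S
    unfolding pre[OF that(2)]
  proof (intro open_UN ballI)
    show "open (crd k ` (dom k \<inter> S))" for k
      by (rule coord_open_image[OF coord_dom openin_Int[OF coordD(1)[OF coord_dom] that(1)]]) blast
  qed
  show "continuous_map (mtop (heisenberg P)) (mtop (cr_restrict M W)) ?g"
    unfolding continuous_map_def restrict_simps(3) unfolding restrict_simps heisenberg_simps
  proof (intro conjI allI impI)
    show "?g \<in> topspace euclidean \<rightarrow> W" using gW by blast
    fix S assume "openin (subtopology (mtop M) W) S"
    then have "openin (mtop M) S" "S \<subseteq> W" using W_openin by (auto simp: openin_open_subtopology)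
    from op[OF this] show "openin euclidean {x \<in> topspace euclidean. ?g x \<in> S}" by (simp add: vimage_def)
  qed
  fix x assume "x \<in> charts (heisenberg P)"
  then have x: "x = (UNIV, id)" by (simp add: heisenberg_simps)
  have main: "smooth_on (?g -` (U \<inter> W)) (c \<circ> ?g)" if U: "(U, c) \<in> charts M" for U c
  proof (rule smooth_on_local)
    fix y assume y: "y \<in> ?g -` (U \<inter> W)"
    obtain p k where p: "p \<in> W" "p \<in> dom k" "y = dev p" by (rule dev_surj)
    have pU: "p \<in> U" using y unfolding p(3) by (simp add: dev_inv[OF p(1)])
    have o: "open (crd k ` (dom k \<inter> U))" by (rule coordD(5)[OF coord_dom U])
    have "smooth_on (crd k ` (dom k \<inter> U)) (c \<circ> ?g)"
    proof (rule smooth_on_cong[OF o _ coordD(6)[OF coord_dom U]])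
      fix z assume "z \<in> crd k ` (dom k \<inter> U)"
      then obtain q where q: "q \<in> dom k" "z = crd k q" by blast
      have qW: "q \<in> W" using q(1) unfolding stable_manifold_exhausted by blast
      have "inv_into (dom k) (crd k) z = q" unfolding q(2) by (rule coord_inv[OF coord_dom q(1)])
      moreover have "?g z = q" unfolding q(2) dev_eq[OF q(1), symmetric] by (rule dev_inv[OF qW])
      ultimately show "(c \<circ> inv_into (dom k) (crd k)) z = (c \<circ> ?g) z" by simp
    qed
    moreover have "y \<in> crd k ` (dom k \<inter> U)" unfolding p(3) dev_eq[OF p(2)] using p(2) pU by blast
    ultimately show "\<exists>S. open S \<and> y \<in> S \<and> smooth_on S (c \<circ> ?g)" using o by blast
  qed
  show "case x of (U, c) \<Rightarrow> \<forall>(V, d)\<in>charts (cr_restrict M W). smooth_on (c ` (U \<inter> ?g -` V)) (d \<circ> ?g \<circ> inv_into U c)"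
    unfolding x restrict_simps using main by (auto simp: inv_id)
qed

text \<open>The developing map coincides with a coordinate system near each point, and therefore identifies coordinate vectors
  with those of the model space.\<close>

lemma dev_pushforward:
  assumes p: "p \<in> dom k"
  shows "pushforward (heisenberg P) dev p (tv M (dom k) (crd k) p w) = etv (dev p) w"
proof
  fix g :: "'n heis \<Rightarrow> complex"
  have near: "smooth_near (heisenberg P) (dev p) g \<longleftrightarrow> smooth_near euclidean_mfd (dev p) g"
    unfolding smooth_near_def smooth_fun_on_def heisenberg_simps by (simp add: euclidean_mfd_def)
  show "pushforward (heisenberg P) dev p (tv M (dom k) (crd k) p w) g = etv (dev p) w g"
  proof (cases "smooth_near euclidean_mfd (dev p) g")
    case True
    have idi: "g \<circ> inv_into UNIV id = g" by (rule ext) (simp add: inv_id)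
    have cp: "dev p = crd k p" by (rule dev_eq[OF p])
    obtain S where S: "open S" "crd k p \<in> S" "smooth_on S g"
      using True unfolding E.smooth_near_iff[OF euclidean_chart UNIV_I] idi cp by auto
    have eq: "(g \<circ> dev \<circ> inv_into (dom k) (crd k)) y = g y" if y: "y \<in> crd k ` dom k" for y
    proof -
      obtain q where q: "q \<in> dom k" "y = crd k q" using y by (rule imageE)
      show ?thesis unfolding q(2) using coord_inv[OF coord_dom q(1)] dev_eq[OF q(1)] by simp
    qed
    define R where "R = S \<inter> crd k ` dom k"
    have R: "open R" "crd k p \<in> R" "R \<subseteq> crd k ` dom k" using S(1,2) coordD(3)[OF coord_dom] p by (auto simp: R_def)
    have gR: "smooth_on R g" by (rule smooth_on_subset[OF S(3)]) (simp add: R_def)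
    have "smooth_on R (g \<circ> dev \<circ> inv_into (dom k) (crd k))"
      by (rule smooth_on_cong[OF R(1) _ gR]) (rule eq[symmetric], use R(3) in blast)
    then have nM: "smooth_near M p (g \<circ> dev)" unfolding smooth_near_iff[OF coord_dom p] using R by blast
    have "frechet_derivative g (at (crd k p)) = frechet_derivative (g \<circ> dev \<circ> inv_into (dom k) (crd k)) (at (crd k p))"
      by (rule frechet_derivative_transform_within_open[OF smooth_on_differentiable[OF gR R(2)] R(1,2)]) (rule eq[symmetric], use R(3) in blast)
    then show ?thesis unfolding pushforward_def near tv_def using True nM by (simp add: cp idi)
  qed (simp add: pushforward_def near tv_def)
qed

lemma dev_H10:
  assumes \<beta>': "heisenberg_form \<beta>" and p: "p \<in> W"
  shows "pushforward (heisenberg (heisenberg_form.matrix \<beta>)) dev p ` H10 M p = H10 (heisenberg (heisenberg_form.matrix \<beta>)) (dev p)"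
proof -
  interpret heisenberg_form \<beta> by (rule \<beta>')
  obtain k where k: "p \<in> dom k" using p unfolding stable_manifold_exhausted by blast
  let ?tv = "tv M (dom k) (crd k) p" and ?z = "fst (crd k p)"
  have H: "\<And>v s. ?tv (v, s) \<in> cr_H M p \<longleftrightarrow> s = - \<beta> ?z v"
    and J: "\<And>v. cr_J M p (?tv (v, - \<beta> ?z v)) = ?tv (\<i> *s v, - \<beta> ?z (\<i> *s v))"
    using heis_coord_dom[of k] k unfolding heis_coord_def by blast+
  have HM: "H10 M p = range (\<lambda>v. \<lambda>g. ?tv (v, - \<beta> ?z v) g - \<i> * ?tv (\<i> *s v, - \<beta> ?z (\<i> *s v)) g)"
  proof (intro subset_antisym subsetI)
    fix Z assume "Z \<in> H10 M p"
    then obtain X where X: "X \<in> cr_H M p" "Z = (\<lambda>g. X g - \<i> * cr_J M p X g)" unfolding H10_def by blast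
    have "X \<in> range ?tv" using theta(4)[OF dom_T[OF k] X(1)] unfolding tangent_space_coord[OF coord_dom k] .
    then obtain v s where v: "X = ?tv (v, s)" by (metis rangeE surj_pair)
    have "s = - \<beta> ?z v" using X(1) unfolding v H .
    then have "Z = (\<lambda>g. ?tv (v, - \<beta> ?z v) g - \<i> * ?tv (\<i> *s v, - \<beta> ?z (\<i> *s v)) g)" unfolding X(2) v by (simp add: J)
    then show "Z \<in> range (\<lambda>v. \<lambda>g. ?tv (v, - \<beta> ?z v) g - \<i> * ?tv (\<i> *s v, - \<beta> ?z (\<i> *s v)) g)" by (rule range_eqI)
  next
    fix Z assume "Z \<in> range (\<lambda>v. \<lambda>g. ?tv (v, - \<beta> ?z v) g - \<i> * ?tv (\<i> *s v, - \<beta> ?z (\<i> *s v)) g)"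
    then obtain v where "Z = (\<lambda>g. ?tv (v, - \<beta> ?z v) g - \<i> * cr_J M p (?tv (v, - \<beta> ?z v)) g)" unfolding J by (rule rangeE)
    then show "Z \<in> H10 M p" unfolding H10_def using H by blast
  qed
  have push: "pushforward (heisenberg matrix) dev p (\<lambda>g. ?tv (v, - \<beta> ?z v) g - \<i> * ?tv (\<i> *s v, - \<beta> ?z (\<i> *s v)) g)
      = (\<lambda>g. etv (dev p) (v, - \<beta> ?z v) g - \<i> * etv (dev p) (\<i> *s v, - \<beta> ?z (\<i> *s v)) g)" for v
    unfolding dev_pushforward[OF k, of matrix, symmetric] pushforward_def by (rule ext) simp
  show ?thesis unfolding HM H10_heisenberg image_image push unfolding dev_eq[OF k] by blast
qed

lemma stable_manifold_equivalent:
  assumes "heisenberg_form \<beta>"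
  shows "cr_equivalence (cr_restrict M W) (heisenberg (heisenberg_form.matrix \<beta>)) dev"
  unfolding cr_equivalence_def diffeomorphism_def restrict_simps(3,4) heisenberg_simps
  using dev_bij dev_smooth dev_inv_smooth dev_H10[OF assms] by simp

end

text \<open>The smallness of \<open>\<mu>\<close> will be achieved by passing to an iterate.\<close>

lemma stable_manifold_heisenberg:
  assumes n: "n = CARD('n::finite)" and small: "8 * real DIM('n heis) ^ 3 * sqrt \<mu> < 1"
  obtains P :: "complex^'n^'n" where "transpose P = - P" "cr_equivalent (cr_restrict M (stable_manifold M \<phi> pt)) (heisenberg P)"
proof -
  obtain U and c :: "'a \<Rightarrow> 'n heis" and A \<beta> where c: "heis_coord M U c \<beta>" "pt \<in> U" "c pt = 0" "heis_dilation A \<mu>"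
    "\<And>p. p \<in> U \<Longrightarrow> \<phi> p \<in> U \<and> c (\<phi> p) = Lam A \<mu> (c p)" "bilinear \<beta>" "\<And>u v. \<beta> (A u) (A v) = \<mu> * \<beta> u v"
    and \<beta>: "\<And>u v. \<beta> u v = - \<beta> v u" "\<And>v. \<beta> v (\<i> *s v) = 2 * (norm v)\<^sup>2"
    by (rule heis_coordinates[OF n small]) (rule that)
  have hf: "heisenberg_form \<beta>" by (rule heisenberg_form.intro[OF c(6) \<beta>])
  show thesis
    by (rule that[OF heisenberg_form.matrix_skew[OF hf]])
       (use stable_manifold_equivalent[OF c hf] in \<open>auto simp: cr_equivalent_def\<close>)
qed

end

theorem theorem1p3:
  fixes M :: "('a, 'e::euclidean_space) cr_mfd"
    and \<phi> :: "'a \<Rightarrow> 'a" and pt :: 'a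
  assumes "almost_cr_manifold CARD('n::finite) M"
    and "strongly_pseudoconvex M"
    and "cr_automorphism M \<phi>"
    and "contracting_at M \<phi> pt"
  shows "\<exists>P :: complex^'n^'n. transpose P = - P \<and>
    cr_equivalent (cr_restrict M (stable_manifold M \<phi> pt)) (heisenberg P)"
proof -
  obtain \<theta> \<mu> where \<theta>: "contact_form M \<theta>" and \<mu>: "0 < \<mu>" "\<mu> < 1" and pt: "pt \<in> topspace (mtop M)" "\<phi> pt = pt"
    and scale: "\<And>X. X \<in> tangent_space M pt \<Longrightarrow> \<theta> (\<phi> pt) (pushforward M \<phi> pt X) = \<mu> * \<theta> pt X"
    using assms(4) unfolding contracting_at_def by blast
  interpret cr_contact M "CARD('n)" \<theta> by (rule cr_contact.intro[OF assms(1) \<theta>])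
  have sc: "\<theta> pt (pushforward M \<phi> pt X) = \<mu> * \<theta> pt X" if "X \<in> tangent_space M pt" for X using scale[OF that] pt(2) by simp
  obtain m where m: "8 * real DIM('n heis) ^ 3 * sqrt (\<mu> ^ Suc m) < 1"
  proof -
    have "(\<lambda>m. \<mu> ^ Suc m) \<longlonglongrightarrow> 0" by (rule LIMSEQ_Suc[OF LIMSEQ_realpow_zero]) (use \<mu> in auto)
    then have "(\<lambda>m. 8 * real DIM('n heis) ^ 3 * sqrt (\<mu> ^ Suc m)) \<longlonglongrightarrow> 8 * real DIM('n heis) ^ 3 * sqrt 0"
      by (intro tendsto_mult tendsto_const tendsto_real_sqrt)
    then have "\<forall>\<^sub>F m in sequentially. 8 * real DIM('n heis) ^ 3 * sqrt (\<mu> ^ Suc m) < 1" by (rule order_tendstoD) simp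
    then show thesis using that unfolding eventually_sequentially by blast
  qed
  have \<mu>m: "0 < \<mu> ^ Suc m" "\<mu> ^ Suc m < 1" using \<mu> by (auto intro: power_Suc_less_one simp del: power_Suc)
  interpret it: cr_contracting M "CARD('n)" \<theta> "\<phi> ^^ Suc m" pt "\<mu> ^ Suc m"
  proof
    show "cr_automorphism M (\<phi> ^^ Suc m)" by (rule automorphism_iterate[OF assms(3)])
    show "(\<phi> ^^ Suc m) pt = pt" by (rule contracting_iterate(1)[OF assms(3) pt sc])
    show "\<theta> pt (pushforward M (\<phi> ^^ Suc m) pt X) = \<mu> ^ Suc m * \<theta> pt X" if "X \<in> tangent_space M pt" for X
      by (rule contracting_iterate(2)[OF assms(3) pt sc that])
  qed (use pt \<mu>m in \<open>simp_all del: power_Suc\<close>)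
  obtain P :: "complex^'n^'n" where "transpose P = - P" "cr_equivalent (cr_restrict M (stable_manifold M (\<phi> ^^ Suc m) pt)) (heisenberg P)"
    by (rule it.stable_manifold_heisenberg[OF refl m]) (rule that)
  moreover have "continuous_map (mtop M) (mtop M) \<phi>"
    using assms(3) smooth_mapD(1) unfolding cr_equivalence_def diffeomorphism_def by blast
  ultimately show ?thesis unfolding stable_manifold_iterate[OF \<open>continuous_map (mtop M) (mtop M) \<phi>\<close> pt(2)] by blast
qed

end
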